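(* Let $G$ be a finite non-abelian group, let $m=|G|$, let $\lambda:G\to\mathcal U(\ell^2(G))$ be the left regular representation, and identify $B(\ell^2(G))\cong M_m(\mathbb C)$. Let $\alpha:G\curvearrowright M_{|G|^\infty}=\bigotimes_{n=1}^\infty M_m(\mathbb C)$ be the action $\alpha_g=\bigotimes_{n=1}^\infty\operatorname{Ad}(\lambda_g)$. Then the inclusion $M_{|G|^\infty}\subset M_{|G|^\infty}\rtimes_\alpha G$, equipped with its canonical conditional expectation $F\left(\sum_{g\in G}a_gu_g\right)=a_{1_G}$, has the weak tracial Rokhlin property and is not isomorphic to a fixed-point inclusion arising from an action of an ordinary finite group.
   Context: Here $u_g$ are the canonical unitaries of the crossed product. "Not isomorphic to a fixed-point inclusion arising from an action of an ordinary finite group" means, for the inclusion $A\subset A\rtimes_\alpha G$ with expectation $F$: there do not exist a finite group $H$, an action $\beta:H\curvearrowright D$ and a $*$-isomorphism $\Phi:A\rtimes_\alpha G\to D$ with $\Phi(A)=D^\beta$ (fixed-point algebra) and $E_\beta\circ\Phi=\Phi|_A\circ F$, where $E_\beta(d)=\frac1{|H|}\sum_{h\in H}\beta_h(d)$. Weak tracial Rokhlin property of an expectation. Fix a free ultrafilter $\omega$ on $\mathbb N$; $M_\omega=\ell^\infty(\mathbb N,M)/\{(a_n):\lim_{n\to\omega}\|a_n\|=0\}$, with $M\subset M_\omega$ as constant sequences, and a bounded linear map $F:M\to Q$ induces $F_\omega:M_\omega\to Q_\omega$. For positive $a,b$ in a $C^*$-algebra $C$, $a\lesssim b$ (in $C$)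 means that there is a sequence $(x_n)$ in $C$ with $x_nbx_n^*\to a$. For a unital inclusion $Q\subset M$, a conditional expectation $F:M\to Q$ is of index-finite type if there is a finite family $\{(u_j,v_j)\}_j\subset M\times M$ with $x=\sum_j u_jF(v_jx)=\sum_jF(xu_j)v_j$ for all $x\in M$; $\operatorname{Index}F:=\sum_ju_jv_j\in Z(M)$. Let $e_Q$ be the Jones projection, i.e. the adjointable operator extending $x\mapsto F(x)$ on the Hilbert $Q$-module completion of $M$ for $\langle x,y\rangle=F(x^*y)$, on which $M$ acts by left multiplication, and $C^*\langle M,e_Q\rangle=\operatorname{span}\{xe_Qy:x,y\in M\}$. If $M$ is simple, $F$ of index-finite type has the weak tracial Rokhlin property if for every nonzero positive $a\in M_\omega$ there is a nonzero positive contraction $e\in M_\omega\cap M'$ with $(\operatorname{Index}F)e^{1/2}e_Qe^{1/2}=e$ (in the ultrapower of $C^*\langle M,e_Q\rangle$) and $1-(\operatorname{Index}F)F_\omega(e)\lesssim a$ in $M_\omega$. *)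

theory Defs
  imports
    "HOL-Analysis.L2_Norm"
    "HOL-Algebra.Module"
    "HOL-Algebra.Subrings"
begin

section \<open>\<open>C\<^sup>*\<close>-algebras\<close>

text \<open>
  Algebras are carrier-based, extending the module records of \<open>HOL-Algebra\<close> over the field of
  complex numbers: the ultrapowers below depend on a free ultrafilter, hence on a term, and so
  cannot be types.
\<close>

definition complex_ring :: "complex ring" where
  "complex_ring = \<lparr>carrier = UNIV, monoid.mult = (*), one = 1, zero = 0, add = (+)\<rparr>"

record 'a cstar = "(complex, 'a) module" +
  adj :: "'a \<Rightarrow> 'a"
  nrm :: "'a \<Rightarrow> real"

locale cstar_algebra =
  ring A + module complex_ring A for A :: "'a cstar" (structure) +
  assumes smult_mult_left:
      "\<lbrakk>x \<in> carrier A; y \<in> carrier A\<rbrakk> \<Longrightarrow> (c \<odot> x) \<otimes> y = c \<odot> (x \<otimes> y)"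
    and smult_mult_right:
      "\<lbrakk>x \<in> carrier A; y \<in> carrier A\<rbrakk> \<Longrightarrow> x \<otimes> (c \<odot> y) = c \<odot> (x \<otimes> y)"
    and adj_closed: "x \<in> carrier A \<Longrightarrow> adj A x \<in> carrier A"
    and adj_adj: "x \<in> carrier A \<Longrightarrow> adj A (adj A x) = x"
    and adj_add:
      "\<lbrakk>x \<in> carrier A; y \<in> carrier A\<rbrakk> \<Longrightarrow> adj A (x \<oplus> y) = adj A x \<oplus> adj A y"
    and adj_smult: "x \<in> carrier A \<Longrightarrow> adj A (c \<odot> x) = cnj c \<odot> adj A x"
    and adj_mult:
      "\<lbrakk>x \<in> carrier A; y \<in> carrier A\<rbrakk> \<Longrightarrow> adj A (x \<otimes> y) = adj A y \<otimes> adj A x"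
    and nrm_eq_0: "x \<in> carrier A \<Longrightarrow> nrm A x = 0 \<longleftrightarrow> x = \<zero>"
    and nrm_smult: "x \<in> carrier A \<Longrightarrow> nrm A (c \<odot> x) = cmod c * nrm A x"
    and nrm_add: "\<lbrakk>x \<in> carrier A; y \<in> carrier A\<rbrakk> \<Longrightarrow> nrm A (x \<oplus> y) \<le> nrm A x + nrm A y"
    and nrm_mult: "\<lbrakk>x \<in> carrier A; y \<in> carrier A\<rbrakk> \<Longrightarrow> nrm A (x \<otimes> y) \<le> nrm A x * nrm A y"
    and nrm_adj_mult: "x \<in> carrier A \<Longrightarrow> nrm A (adj A x \<otimes> x) = (nrm A x)\<^sup>2"
    and complete:
      "\<lbrakk>\<And>n::nat. f n \<in> carrier A;
        \<And>\<epsilon>. \<epsilon> > 0 \<Longrightarrow> \<exists>N. \<forall>m\<ge>N. \<forall>n\<ge>N. nrm A (f m \<ominus> f n) < \<epsilon>\<rbrakk>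
       \<Longrightarrow> \<exists>x\<in>carrier A. (\<lambda>n. nrm A (f n \<ominus> x)) \<longlonglongrightarrow> 0"

definition converges_to :: "'a cstar \<Rightarrow> (nat \<Rightarrow> 'a) \<Rightarrow> 'a \<Rightarrow> bool" where
  "converges_to A f x \<longleftrightarrow> x \<in> carrier A \<and> (\<lambda>n. nrm A (f n \<ominus>\<^bsub>A\<^esub> x)) \<longlonglongrightarrow> 0"

definition norm_closed :: "'a cstar \<Rightarrow> 'a set \<Rightarrow> bool" where
  "norm_closed A S \<longleftrightarrow> (\<forall>f x. (\<forall>n. f n \<in> S) \<and> converges_to A f x \<longrightarrow> x \<in> S)"

definition positive :: "'a cstar \<Rightarrow> 'a \<Rightarrow> bool" where
  "positive A a \<longleftrightarrow> (\<exists>x\<in>carrier A. a = adj A x \<otimes>\<^bsub>A\<^esub> x)"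

definition subequivalent :: "'a cstar \<Rightarrow> 'a \<Rightarrow> 'a \<Rightarrow> bool" where
  "subequivalent A a b \<longleftrightarrow>
     (\<exists>x. (\<forall>n. x n \<in> carrier A) \<and> converges_to A (\<lambda>n. x n \<otimes>\<^bsub>A\<^esub> b \<otimes>\<^bsub>A\<^esub> adj A (x n)) a)"

definition simple_cstar :: "'a cstar \<Rightarrow> bool" where
  "simple_cstar A \<longleftrightarrow> carrier A \<noteq> {\<zero>\<^bsub>A\<^esub>} \<and>
     (\<forall>I. ideal I A \<and> norm_closed A I \<longrightarrow> I = {\<zero>\<^bsub>A\<^esub>} \<or> I = carrier A)"

definition unital_cstar_subalgebra :: "'a set \<Rightarrow> 'a cstar \<Rightarrow> bool" where
  "unital_cstar_subalgebra Q A \<longleftrightarrow> subring Q A \<and> norm_closed A Q \<and>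
     (\<forall>x\<in>Q. adj A x \<in> Q \<and> (\<forall>c. c \<odot>\<^bsub>A\<^esub> x \<in> Q))"

definition star_iso :: "'a cstar \<Rightarrow> 'b cstar \<Rightarrow> ('a \<Rightarrow> 'b) set" where
  "star_iso A B = {\<Phi> \<in> ring_hom A B. bij_betw \<Phi> (carrier A) (carrier B) \<and>
     (\<forall>x\<in>carrier A. \<Phi> (adj A x) = adj B (\<Phi> x) \<and> (\<forall>c. \<Phi> (c \<odot>\<^bsub>A\<^esub> x) = c \<odot>\<^bsub>B\<^esub> \<Phi> x))}"

definition group_action_on :: "('h, 'm) monoid_scheme \<Rightarrow> 'a cstar \<Rightarrow> ('h \<Rightarrow> 'a \<Rightarrow> 'a) \<Rightarrow> bool" where
  "group_action_on H A \<beta> \<longleftrightarrow> (\<forall>h\<in>carrier H. \<beta> h \<in> star_iso A A) \<and>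
     (\<forall>x\<in>carrier A. \<beta> \<one>\<^bsub>H\<^esub> x = x \<and>
        (\<forall>h\<in>carrier H. \<forall>k\<in>carrier H. \<beta> (h \<otimes>\<^bsub>H\<^esub> k) x = \<beta> h (\<beta> k x)))"

definition fixed_points :: "('h, 'm) monoid_scheme \<Rightarrow> 'a cstar \<Rightarrow> ('h \<Rightarrow> 'a \<Rightarrow> 'a) \<Rightarrow> 'a set" where
  "fixed_points H A \<beta> = {x \<in> carrier A. \<forall>h\<in>carrier H. \<beta> h x = x}"

definition averaging :: "('h, 'm) monoid_scheme \<Rightarrow> 'a cstar \<Rightarrow> ('h \<Rightarrow> 'a \<Rightarrow> 'a) \<Rightarrow> 'a \<Rightarrow> 'a" where
  "averaging H A \<beta> x = (1 / of_nat (card (carrier H))) \<odot>\<^bsub>A\<^esub> (\<Oplus>\<^bsub>A\<^esub>h\<in>carrier H. \<beta> h x)"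

section \<open>Algebras of sequences modulo null sequences\<close>

definition seq_rel ::
    "(nat \<Rightarrow> 'a) set \<Rightarrow> nat filter \<Rightarrow> (nat \<Rightarrow> 'a cstar) \<Rightarrow> ((nat \<Rightarrow> 'a) \<times> (nat \<Rightarrow> 'a)) set" where
  "seq_rel S \<F> A =
     {(x, y). x \<in> S \<and> y \<in> S \<and> ((\<lambda>n. nrm (A n) (x n \<ominus>\<^bsub>A n\<^esub> y n)) \<longlongrightarrow> 0) \<F>}"

text \<open>
  The operations act termwise on representatives, in the style of \<^theory>\<open>HOL.Equiv_Relations\<close>:
  each union below is over sets that all coincide.
\<close>

definition seq_quot :: "(nat \<Rightarrow> 'a) set \<Rightarrow> nat filter \<Rightarrow> (nat \<Rightarrow> 'a cstar) \<Rightarrow> (nat \<Rightarrow> 'a) set cstar" where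
  "seq_quot S \<F> A =
     \<lparr>carrier = S // seq_rel S \<F> A,
      monoid.mult = (\<lambda>X Y. \<Union>x\<in>X. \<Union>y\<in>Y. seq_rel S \<F> A `` {\<lambda>n. x n \<otimes>\<^bsub>A n\<^esub> y n}),
      one = seq_rel S \<F> A `` {\<lambda>n. \<one>\<^bsub>A n\<^esub>},
      zero = seq_rel S \<F> A `` {\<lambda>n. \<zero>\<^bsub>A n\<^esub>},
      add = (\<lambda>X Y. \<Union>x\<in>X. \<Union>y\<in>Y. seq_rel S \<F> A `` {\<lambda>n. x n \<oplus>\<^bsub>A n\<^esub> y n}),
      module.smult = (\<lambda>c X. \<Union>x\<in>X. seq_rel S \<F> A `` {\<lambda>n. c \<odot>\<^bsub>A n\<^esub> x n}),
      adj = (\<lambda>X. \<Union>x\<in>X. seq_rel S \<F> A `` {\<lambda>n. adj (A n) (x n)}),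
      nrm = (\<lambda>X. the_elem ((\<lambda>x. Lim \<F> (\<lambda>n. nrm (A n) (x n))) ` X))\<rparr>"

text \<open>The map into \<open>seq_quot S \<F> A\<close> induced by the termwise maps \<open>f n\<close>.\<close>

definition seq_map ::
    "(nat \<Rightarrow> 'a) set \<Rightarrow> nat filter \<Rightarrow> (nat \<Rightarrow> 'a cstar) \<Rightarrow> (nat \<Rightarrow> 'b \<Rightarrow> 'a)
       \<Rightarrow> (nat \<Rightarrow> 'b) set \<Rightarrow> (nat \<Rightarrow> 'a) set" where
  "seq_map S \<F> A f X = (\<Union>x\<in>X. seq_rel S \<F> A `` {\<lambda>n. f n (x n)})"

subsection \<open>Ultrapowers\<close>

definition free_ultrafilter :: "nat filter \<Rightarrow> bool" where
  "free_ultrafilter \<omega> \<longleftrightarrow> \<omega> \<noteq> bot \<and> \<omega> \<le> cofinite \<and>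
     (\<forall>P. eventually P \<omega> \<or> eventually (\<lambda>n. \<not> P n) \<omega>)"

definition bounded_seqs :: "'a cstar \<Rightarrow> (nat \<Rightarrow> 'a) set" where
  "bounded_seqs A = {x. (\<forall>n. x n \<in> carrier A) \<and> (\<exists>B. \<forall>n. nrm A (x n) \<le> B)}"

definition ultrapower :: "nat filter \<Rightarrow> 'a cstar \<Rightarrow> (nat \<Rightarrow> 'a) set cstar" where
  "ultrapower \<omega> A = seq_quot (bounded_seqs A) \<omega> (\<lambda>_. A)"

definition up_const :: "nat filter \<Rightarrow> 'a cstar \<Rightarrow> 'a \<Rightarrow> (nat \<Rightarrow> 'a) set" where
  "up_const \<omega> A a = seq_rel (bounded_seqs A) \<omega> (\<lambda>_. A) `` {\<lambda>_. a}"

text \<open>The map \<open>f\<^sub>\<omega>\<close> induced by a bounded linear map \<open>f\<close> with values in \<open>A\<close>.\<close>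

definition up_map :: "nat filter \<Rightarrow> 'a cstar \<Rightarrow> ('b \<Rightarrow> 'a) \<Rightarrow> (nat \<Rightarrow> 'b) set \<Rightarrow> (nat \<Rightarrow> 'a) set" where
  "up_map \<omega> A f = seq_map (bounded_seqs A) \<omega> (\<lambda>_. A) (\<lambda>_. f)"

definition relative_commutant :: "nat filter \<Rightarrow> 'a cstar \<Rightarrow> (nat \<Rightarrow> 'a) set set" where
  "relative_commutant \<omega> A = {x \<in> carrier (ultrapower \<omega> A). \<forall>a\<in>carrier A.
     x \<otimes>\<^bsub>ultrapower \<omega> A\<^esub> up_const \<omega> A a = up_const \<omega> A a \<otimes>\<^bsub>ultrapower \<omega> A\<^esub> x}"

subsection \<open>Inductive limits and completions\<close>

text \<open>
  For isometric connecting maps \<open>\<phi> k n : A k \<rightarrow> A n\<close> (\<open>k \<le> n\<close>) the inductive limit is realised in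
  the bounded sequences in the product of the \<open>A n\<close> modulo those tending to zero in norm, as the
  closure of the classes of the sequences that are eventually of the form \<open>n \<mapsto> \<phi> k n a\<close>.
  The elements of that closure are the classes of the following sequences.
\<close>

definition cauchy_seqs :: "(nat \<Rightarrow> 'a cstar) \<Rightarrow> (nat \<Rightarrow> nat \<Rightarrow> 'a \<Rightarrow> 'a) \<Rightarrow> (nat \<Rightarrow> 'a) set" where
  "cauchy_seqs A \<phi> = {x. (\<forall>n. x n \<in> carrier (A n)) \<and>
     (\<forall>\<epsilon>>0. \<exists>N. \<forall>n\<ge>N. nrm (A n) (x n \<ominus>\<^bsub>A n\<^esub> \<phi> N n (x N)) < \<epsilon>)}"

definition inductive_limit ::
    "(nat \<Rightarrow> 'a cstar) \<Rightarrow> (nat \<Rightarrow> nat \<Rightarrow> 'a \<Rightarrow> 'a) \<Rightarrow> (nat \<Rightarrow> 'a) set cstar" where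
  "inductive_limit A \<phi> = seq_quot (cauchy_seqs A \<phi>) sequentially A"

abbreviation self_seqs :: "'a cstar \<Rightarrow> (nat \<Rightarrow> 'a) set" where
  "self_seqs A \<equiv> cauchy_seqs (\<lambda>_. A) (\<lambda>_ _ x. x)"

abbreviation completion :: "'a cstar \<Rightarrow> (nat \<Rightarrow> 'a) set cstar" where
  "completion A \<equiv> inductive_limit (\<lambda>_. A) (\<lambda>_ _ x. x)"

section \<open>The algebras \<open>B(\<ell>\<^sup>2(I))\<close> and their infinite tensor powers\<close>

text \<open>Matrices over a finite index set \<open>J\<close>, with the operator norm on \<open>\<ell>\<^sup>2(J)\<close>.\<close>

definition matrix_algebra :: "'j set \<Rightarrow> ('j \<Rightarrow> 'j \<Rightarrow> complex) cstar" where
  "matrix_algebra J =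
     \<lparr>carrier = {x. \<forall>i j. i \<notin> J \<or> j \<notin> J \<longrightarrow> x i j = 0},
      monoid.mult = (\<lambda>x y i j. \<Sum>k\<in>J. x i k * y k j),
      one = (\<lambda>i j. if i \<in> J \<and> i = j then 1 else 0),
      zero = (\<lambda>i j. 0),
      add = (\<lambda>x y i j. x i j + y i j),
      module.smult = (\<lambda>c x i j. c * x i j),
      adj = (\<lambda>x i j. cnj (x j i)),
      nrm = (\<lambda>x. SUP v \<in> {v. L2_set (\<lambda>j. cmod (v j)) J \<le> 1}.
                    L2_set (\<lambda>i. cmod (\<Sum>j\<in>J. x i j * v j)) J)\<rparr>"

definition words :: "'i set \<Rightarrow> nat \<Rightarrow> 'i list set" where
  "words I n = {s. set s \<subseteq> I \<and> length s = n}"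

text \<open>
  The \<open>n\<close>-fold tensor power of \<open>B(\<ell>\<^sup>2(I))\<close> is \<open>B(\<ell>\<^sup>2(I\<^sup>n))\<close>, and \<open>one_ext I k n\<close> is the embedding
  \<open>x \<mapsto> x \<otimes> 1\<close> of the \<open>k\<close>-fold into the \<open>n\<close>-fold tensor power.
\<close>

definition tensor_level :: "'i set \<Rightarrow> nat \<Rightarrow> ('i list \<Rightarrow> 'i list \<Rightarrow> complex) cstar" where
  "tensor_level I n = matrix_algebra (words I n)"

definition one_ext ::
    "'i set \<Rightarrow> nat \<Rightarrow> nat \<Rightarrow> ('i list \<Rightarrow> 'i list \<Rightarrow> complex) \<Rightarrow> 'i list \<Rightarrow> 'i list \<Rightarrow> complex" where
  "one_ext I k n x = (\<lambda>s t. if s \<in> words I n \<and> t \<in> words I n \<and> drop k s = drop k t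
                            then x (take k s) (take k t) else 0)"

definition uhf :: "'i set \<Rightarrow> (nat \<Rightarrow> 'i list \<Rightarrow> 'i list \<Rightarrow> complex) set cstar" where
  "uhf I = inductive_limit (tensor_level I) (one_ext I)"

definition tensor_power ::
    "nat \<Rightarrow> ('i \<Rightarrow> 'i \<Rightarrow> complex) \<Rightarrow> 'i list \<Rightarrow> 'i list \<Rightarrow> complex" where
  "tensor_power n u = (\<lambda>s t. if length s = n \<and> length t = n then \<Prod>i<n. u (s ! i) (t ! i) else 0)"

text \<open>
  The infinite tensor product of copies of \<open>Ad(u)\<close>; on the \<open>n\<close>-fold tensor power it restricts to
  \<open>Ad\<close> of the \<open>n\<close>-fold tensor power of \<open>u\<close>.
\<close>

definition tensor_Ad ::
    "'i set \<Rightarrow> ('i \<Rightarrow> 'i \<Rightarrow> complex) \<Rightarrow> (nat \<Rightarrow> 'i list \<Rightarrow> 'i list \<Rightarrow> complex) set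
       \<Rightarrow> (nat \<Rightarrow> 'i list \<Rightarrow> 'i list \<Rightarrow> complex) set" where
  "tensor_Ad I u =
     seq_map (cauchy_seqs (tensor_level I) (one_ext I)) sequentially (tensor_level I)
       (\<lambda>n x. tensor_power n u \<otimes>\<^bsub>tensor_level I n\<^esub> x \<otimes>\<^bsub>tensor_level I n\<^esub>
                adj (tensor_level I n) (tensor_power n u))"

definition left_regular :: "('g, 'm) monoid_scheme \<Rightarrow> 'g \<Rightarrow> 'g \<Rightarrow> 'g \<Rightarrow> complex" where
  "left_regular G g = (\<lambda>s t. if s \<in> carrier G \<and> t \<in> carrier G \<and> s = g \<otimes>\<^bsub>G\<^esub> t then 1 else 0)"

definition regular_product_action ::
    "('g, 'm) monoid_scheme \<Rightarrow> 'g \<Rightarrow> (nat \<Rightarrow> 'g list \<Rightarrow> 'g list \<Rightarrow> complex) set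
       \<Rightarrow> (nat \<Rightarrow> 'g list \<Rightarrow> 'g list \<Rightarrow> complex) set" where
  "regular_product_action G g = tensor_Ad (carrier G) (left_regular G g)"

section \<open>Crossed products by finite groups\<close>

text \<open>
  The function \<open>x\<close> stands for the sum of the \<open>x g \<cdot> u\<^sub>g\<close>, where \<open>u\<^sub>g a = \<alpha>\<^sub>g(a) u\<^sub>g\<close>. The norm is that
  of the regular representation on the Hilbert \<open>A\<close>-module \<open>\<ell>\<^sup>2(G, A)\<close>, in which
  \<open>(a \<xi>)(k) = \<alpha>\<^sub>k\<^sup>-\<^sup>1(a) \<xi>(k)\<close> and \<open>(u\<^sub>g \<xi>)(k) = \<xi>(g\<^sup>-\<^sup>1 k)\<close>.
\<close>

definition l2_nrm :: "('g, 'm) monoid_scheme \<Rightarrow> 'a cstar \<Rightarrow> ('g \<Rightarrow> 'a) \<Rightarrow> real" where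
  "l2_nrm G A \<xi> = sqrt (nrm A (\<Oplus>\<^bsub>A\<^esub>k\<in>carrier G. adj A (\<xi> k) \<otimes>\<^bsub>A\<^esub> \<xi> k))"

definition regular_rep ::
    "('g, 'm) monoid_scheme \<Rightarrow> 'a cstar \<Rightarrow> ('g \<Rightarrow> 'a \<Rightarrow> 'a) \<Rightarrow> ('g \<Rightarrow> 'a) \<Rightarrow> ('g \<Rightarrow> 'a) \<Rightarrow> 'g \<Rightarrow> 'a" where
  "regular_rep G A \<alpha> x \<xi> =
     (\<lambda>k\<in>carrier G. \<Oplus>\<^bsub>A\<^esub>g\<in>carrier G. \<alpha> (inv\<^bsub>G\<^esub> k) (x g) \<otimes>\<^bsub>A\<^esub> \<xi> (inv\<^bsub>G\<^esub> g \<otimes>\<^bsub>G\<^esub> k))"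

definition crossed_product ::
    "('g, 'm) monoid_scheme \<Rightarrow> 'a cstar \<Rightarrow> ('g \<Rightarrow> 'a \<Rightarrow> 'a) \<Rightarrow> ('g \<Rightarrow> 'a) cstar" where
  "crossed_product G A \<alpha> =
     \<lparr>carrier = carrier G \<rightarrow>\<^sub>E carrier A,
      monoid.mult = (\<lambda>x y. \<lambda>k\<in>carrier G.
         \<Oplus>\<^bsub>A\<^esub>g\<in>carrier G. x g \<otimes>\<^bsub>A\<^esub> \<alpha> g (y (inv\<^bsub>G\<^esub> g \<otimes>\<^bsub>G\<^esub> k))),
      one = (\<lambda>g\<in>carrier G. if g = \<one>\<^bsub>G\<^esub> then \<one>\<^bsub>A\<^esub> else \<zero>\<^bsub>A\<^esub>),
      zero = (\<lambda>g\<in>carrier G. \<zero>\<^bsub>A\<^esub>),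
      add = (\<lambda>x y. \<lambda>g\<in>carrier G. x g \<oplus>\<^bsub>A\<^esub> y g),
      module.smult = (\<lambda>c x. \<lambda>g\<in>carrier G. c \<odot>\<^bsub>A\<^esub> x g),
      adj = (\<lambda>x. \<lambda>g\<in>carrier G. \<alpha> g (adj A (x (inv\<^bsub>G\<^esub> g)))),
      nrm = (\<lambda>x. SUP \<xi> \<in> {\<xi> \<in> carrier G \<rightarrow>\<^sub>E carrier A. l2_nrm G A \<xi> \<le> 1}.
                    l2_nrm G A (regular_rep G A \<alpha> x \<xi>))\<rparr>"

definition cp_embed :: "('g, 'm) monoid_scheme \<Rightarrow> 'a cstar \<Rightarrow> 'a \<Rightarrow> 'g \<Rightarrow> 'a" where
  "cp_embed G A a = (\<lambda>g\<in>carrier G. if g = \<one>\<^bsub>G\<^esub> then a else \<zero>\<^bsub>A\<^esub>)"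

definition cp_base :: "('g, 'm) monoid_scheme \<Rightarrow> 'a cstar \<Rightarrow> ('g \<Rightarrow> 'a) set" where
  "cp_base G A = cp_embed G A ` carrier A"

definition cp_expectation :: "('g, 'm) monoid_scheme \<Rightarrow> 'a cstar \<Rightarrow> ('g \<Rightarrow> 'a) \<Rightarrow> 'g \<Rightarrow> 'a" where
  "cp_expectation G A x = cp_embed G A (x \<one>\<^bsub>G\<^esub>)"

section \<open>Conditional expectations of index-finite type\<close>

text \<open>An inclusion is given by the subset \<open>Q\<close> of \<open>M\<close>, and the expectation is regarded as a map on \<open>M\<close>.\<close>

definition conditional_expectation :: "'a cstar \<Rightarrow> 'a set \<Rightarrow> ('a \<Rightarrow> 'a) \<Rightarrow> bool" where
  "conditional_expectation M Q F \<longleftrightarrow> unital_cstar_subalgebra Q M \<and>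
     F \<in> carrier M \<rightarrow> Q \<and> (\<forall>q\<in>Q. F q = q) \<and>
     (\<forall>x\<in>carrier M. \<forall>y\<in>carrier M. F (x \<oplus>\<^bsub>M\<^esub> y) = F x \<oplus>\<^bsub>M\<^esub> F y) \<and>
     (\<forall>x\<in>carrier M. \<forall>c. F (c \<odot>\<^bsub>M\<^esub> x) = c \<odot>\<^bsub>M\<^esub> F x) \<and>
     (\<forall>x\<in>carrier M. \<forall>q\<in>Q. F (q \<otimes>\<^bsub>M\<^esub> x) = q \<otimes>\<^bsub>M\<^esub> F x \<and> F (x \<otimes>\<^bsub>M\<^esub> q) = F x \<otimes>\<^bsub>M\<^esub> q) \<and>
     (\<forall>x\<in>carrier M. positive M x \<longrightarrow> positive M (F x))"

definition quasi_basis :: "'a cstar \<Rightarrow> ('a \<Rightarrow> 'a) \<Rightarrow> nat \<Rightarrow> (nat \<Rightarrow> 'a) \<Rightarrow> (nat \<Rightarrow> 'a) \<Rightarrow> bool" where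
  "quasi_basis M F k u v \<longleftrightarrow> (\<forall>j<k. u j \<in> carrier M \<and> v j \<in> carrier M) \<and>
     (\<forall>x\<in>carrier M. x = (\<Oplus>\<^bsub>M\<^esub>j\<in>{..<k}. u j \<otimes>\<^bsub>M\<^esub> F (v j \<otimes>\<^bsub>M\<^esub> x)) \<and>
                    x = (\<Oplus>\<^bsub>M\<^esub>j\<in>{..<k}. F (x \<otimes>\<^bsub>M\<^esub> u j) \<otimes>\<^bsub>M\<^esub> v j))"

definition index_finite :: "'a cstar \<Rightarrow> 'a set \<Rightarrow> ('a \<Rightarrow> 'a) \<Rightarrow> bool" where
  "index_finite M Q F \<longleftrightarrow> conditional_expectation M Q F \<and> (\<exists>k u v. quasi_basis M F k u v)"

definition Index :: "'a cstar \<Rightarrow> ('a \<Rightarrow> 'a) \<Rightarrow> 'a" where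
  "Index M F =
     (THE z. \<exists>k u v. quasi_basis M F k u v \<and> z = (\<Oplus>\<^bsub>M\<^esub>j\<in>{..<k}. u j \<otimes>\<^bsub>M\<^esub> v j))"

subsection \<open>The basic construction\<close>

text \<open>
  The completion of \<open>M\<close> for the norm of the inner product \<open>\<langle>x, y\<rangle> = F(x\<^sup>* y)\<close>. Only its linear
  structure, its norm and the inner product are meaningful; the fields \<open>mult\<close>, \<open>one\<close> and \<open>adj\<close>
  that the record inherits from \<open>M\<close> are not used.
\<close>

definition hilbert_pre :: "'a cstar \<Rightarrow> ('a \<Rightarrow> 'a) \<Rightarrow> 'a cstar" where
  "hilbert_pre M F = M\<lparr>nrm := \<lambda>x. sqrt (nrm M (F (adj M x \<otimes>\<^bsub>M\<^esub> x)))\<rparr>"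

definition hilbert_module :: "'a cstar \<Rightarrow> ('a \<Rightarrow> 'a) \<Rightarrow> (nat \<Rightarrow> 'a) set cstar" where
  "hilbert_module M F = completion (hilbert_pre M F)"

definition hilbert_ip :: "'a cstar \<Rightarrow> ('a \<Rightarrow> 'a) \<Rightarrow> (nat \<Rightarrow> 'a) set \<Rightarrow> (nat \<Rightarrow> 'a) set \<Rightarrow> 'a" where
  "hilbert_ip M F X Y =
     (THE z. \<forall>x\<in>X. \<forall>y\<in>Y. converges_to M (\<lambda>n. F (adj M (x n) \<otimes>\<^bsub>M\<^esub> y n)) z)"

definition hilbert_ext ::
    "'a cstar \<Rightarrow> ('a \<Rightarrow> 'a) \<Rightarrow> ('a \<Rightarrow> 'a) \<Rightarrow> (nat \<Rightarrow> 'a) set \<Rightarrow> (nat \<Rightarrow> 'a) set" where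
  "hilbert_ext M F T = (\<lambda>X\<in>carrier (hilbert_module M F).
     seq_map (self_seqs (hilbert_pre M F)) sequentially (\<lambda>_. hilbert_pre M F) (\<lambda>_. T) X)"

definition left_mult :: "'a cstar \<Rightarrow> ('a \<Rightarrow> 'a) \<Rightarrow> 'a \<Rightarrow> (nat \<Rightarrow> 'a) set \<Rightarrow> (nat \<Rightarrow> 'a) set" where
  "left_mult M F x = hilbert_ext M F (\<lambda>y. x \<otimes>\<^bsub>M\<^esub> y)"

definition jones_projection :: "'a cstar \<Rightarrow> ('a \<Rightarrow> 'a) \<Rightarrow> (nat \<Rightarrow> 'a) set \<Rightarrow> (nat \<Rightarrow> 'a) set" where
  "jones_projection M F = hilbert_ext M F F"

definition basic_span :: "'a cstar \<Rightarrow> ('a \<Rightarrow> 'a) \<Rightarrow> ((nat \<Rightarrow> 'a) set \<Rightarrow> (nat \<Rightarrow> 'a) set) set" where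
  "basic_span M F = {T. \<exists>(k::nat) x y. (\<forall>j<k. x j \<in> carrier M \<and> y j \<in> carrier M) \<and>
     T = (\<lambda>X\<in>carrier (hilbert_module M F). \<Oplus>\<^bsub>hilbert_module M F\<^esub>j\<in>{..<k}.
            left_mult M F (x j) (jones_projection M F (left_mult M F (y j) X)))}"

text \<open>
  The field \<open>one\<close> is the identity operator, which belongs to the span because \<open>F\<close> will be of
  index-finite type; for the same reason all \<open>left_mult M F x\<close> do.
\<close>

definition basic_construction ::
    "'a cstar \<Rightarrow> ('a \<Rightarrow> 'a) \<Rightarrow> ((nat \<Rightarrow> 'a) set \<Rightarrow> (nat \<Rightarrow> 'a) set) cstar" where
  "basic_construction M F = (let E = hilbert_module M F in
     \<lparr>carrier = basic_span M F,
      monoid.mult = (\<lambda>S T. \<lambda>X\<in>carrier E. S (T X)),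
      one = (\<lambda>X\<in>carrier E. X),
      zero = (\<lambda>X\<in>carrier E. \<zero>\<^bsub>E\<^esub>),
      add = (\<lambda>S T. \<lambda>X\<in>carrier E. S X \<oplus>\<^bsub>E\<^esub> T X),
      module.smult = (\<lambda>c T. \<lambda>X\<in>carrier E. c \<odot>\<^bsub>E\<^esub> T X),
      adj = (\<lambda>T. THE S. S \<in> basic_span M F \<and>
               (\<forall>X\<in>carrier E. \<forall>Y\<in>carrier E. hilbert_ip M F (T X) Y = hilbert_ip M F X (S Y))),
      nrm = (\<lambda>T. SUP X \<in> {X \<in> carrier E. nrm E X \<le> 1}. nrm E (T X))\<rparr>)"

section \<open>The weak tracial Rokhlin property\<close>

text \<open>
  Here \<open>s\<close> is the positive square root of \<open>e\<close>, and \<open>C\<^sup>*\<langle>M, e\<^sub>Q\<rangle>\<close> receives \<open>M\<close> by left multiplication,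
  whence \<open>L\<^sub>\<omega>\<close> on ultrapowers.
\<close>

definition weak_tracial_rokhlin ::
    "nat filter \<Rightarrow> 'a cstar \<Rightarrow> 'a set \<Rightarrow> ('a \<Rightarrow> 'a) \<Rightarrow> bool" where
  "weak_tracial_rokhlin \<omega> M Q F \<longleftrightarrow> simple_cstar M \<and> index_finite M Q F \<and>
     (let M\<^sub>\<omega> = ultrapower \<omega> M;
          B = basic_construction M F;
          B\<^sub>\<omega> = ultrapower \<omega> B;
          L = left_mult M F;
          L\<^sub>\<omega> = up_map \<omega> B L;
          F\<^sub>\<omega> = up_map \<omega> M F
      in \<forall>a. positive M\<^sub>\<omega> a \<and> a \<noteq> \<zero>\<^bsub>M\<^sub>\<omega>\<^esub> \<longrightarrow>
           (\<exists>e s. e \<in> relative_commutant \<omega> M \<and> positive M\<^sub>\<omega> e \<and> e \<noteq> \<zero>\<^bsub>M\<^sub>\<omega>\<^esub> \<and> nrm M\<^sub>\<omega> e \<le> 1 \<and>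
              positive M\<^sub>\<omega> s \<and> s \<otimes>\<^bsub>M\<^sub>\<omega>\<^esub> s = e \<and>
              up_const \<omega> B (L (Index M F)) \<otimes>\<^bsub>B\<^sub>\<omega>\<^esub>
                (L\<^sub>\<omega> s \<otimes>\<^bsub>B\<^sub>\<omega>\<^esub> up_const \<omega> B (jones_projection M F) \<otimes>\<^bsub>B\<^sub>\<omega>\<^esub> L\<^sub>\<omega> s) = L\<^sub>\<omega> e \<and>
              subequivalent M\<^sub>\<omega>
                (\<one>\<^bsub>M\<^sub>\<omega>\<^esub> \<ominus>\<^bsub>M\<^sub>\<omega>\<^esub> up_const \<omega> M (Index M F) \<otimes>\<^bsub>M\<^sub>\<omega>\<^esub> F\<^sub>\<omega> e) a))"

section \<open>Fixed-point inclusions\<close>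

text \<open>
  \<open>\<Phi>\<close> identifies the inclusion \<open>Q \<subseteq> M\<close> with expectation \<open>F\<close> with the fixed-point inclusion of the
  action \<open>\<beta>\<close> of the finite group \<open>H\<close> on \<open>D\<close>.
\<close>

definition iso_to_fixed_point_inclusion ::
    "'a cstar \<Rightarrow> 'a set \<Rightarrow> ('a \<Rightarrow> 'a) \<Rightarrow> 'h monoid \<Rightarrow> 'd cstar \<Rightarrow> ('h \<Rightarrow> 'd \<Rightarrow> 'd) \<Rightarrow> ('a \<Rightarrow> 'd) \<Rightarrow> bool" where
  "iso_to_fixed_point_inclusion M Q F H D \<beta> \<Phi> \<longleftrightarrow>
     group H \<and> finite (carrier H) \<and> cstar_algebra D \<and> group_action_on H D \<beta> \<and>
     \<Phi> \<in> star_iso M D \<and> \<Phi> ` Q = fixed_points H D \<beta> \<and>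
     (\<forall>x\<in>carrier M. averaging H D \<beta> (\<Phi> x) = \<Phi> (F x))"

end

theory Submission
  imports Defs "HOL-Analysis.Elementary_Topology"
begin

text \<open>
  The action is approximately inner: with \<open>v\<^sub>n(g) = \<lambda>\<^sub>g \<otimes> \<dots> \<otimes> \<lambda>\<^sub>g\<close> (\<open>n\<close> factors), the elements
  \<open>w\<^sub>n(g) = v\<^sub>n(g)\<^sup>* u\<^sub>g\<close> form a unitary representation of \<open>G\<close> in the crossed product that is permuted
  by the \<open>u\<^sub>h\<close> through conjugation and asymptotically commutes with the UHF algebra. Hence the
  projections \<open>e\<^sub>n = 1/|G| \<cdot> \<Sum>\<^sub>g w\<^sub>n(g)\<close> are asymptotically central; they satisfy \<open>|G| F(e\<^sub>n) = 1\<close> and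
  \<open>|G| e\<^sub>n e\<^sub>Q e\<^sub>n = e\<^sub>n\<close> exactly, so the remainder in the weak tracial Rokhlin property vanishes.

  The diagonal projections \<open>p\<^sub>n(t)\<close> in the \<open>n\<close>-th tensor factor are asymptotically central and are
  permuted by the action, \<open>\<alpha>\<^sub>g (p\<^sub>n(t)) = p\<^sub>n(g t)\<close>. Therefore \<open>F(x) = lim \<Sum>\<^sub>t p\<^sub>n(t) x p\<^sub>n(t)\<close>, which
  reduces simplicity of the crossed product to that of the UHF algebra, and the relative commutant
  of the UHF algebra is its centre, on which the action is trivial. An automorphism fixing the UHF
  algebra thus multiplies each \<open>u\<^sub>g\<close> by a central element \<open>z(g)\<close>, where \<open>z\<close> is a homomorphism into
  an abelian group; it fixes \<open>u\<^sub>c\<close> for every commutator \<open>c\<close>. If the UHF algebra is a fixed-point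
  algebra, then all commutators are trivial.
\<close>

section \<open>Normed rings and quotients of algebras of sequences\<close>

text \<open>The C*-algebras occur only as limits, and spectral theory is avoided. What the crossed
  product needs of its coefficients is Cauchy-Schwarz for finite columns, the bound for diagonal
  operators on them, and that a sum of elements \<open>adj x x\<close> is again of that form. These
  are proved for matrices, through their action on vectors, and carried to the UHF algebra. The
  first two are inequalities between norms and so survive limits. The third asserts the existence of
  a square root; it is obtained by an iteration whose error bounds do not depend on the level.

  Normed rings carry a constant C in the bounds for product and involution. It is 1 for matrices,
  the UHF algebra and the basic construction. For the crossed product, and for the same ring under
  the norm of the Hilbert module, it is the order m of G, because the involution of the former and
  the product of the latter are estimated through the m coefficients. Continuity of the operations
  is all that quotients and limits require, so the crude constant does no harm.\<close>

locale nring = ring A for A :: "'a cstar" (structure) +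
  fixes C :: real
  assumes smult_closed [simp, intro]: "x \<in> carrier A \<Longrightarrow> c \<odot> x \<in> carrier A"
    and smult_add: "\<lbrakk>x \<in> carrier A; y \<in> carrier A\<rbrakk> \<Longrightarrow> c \<odot> (x \<oplus> y) = c \<odot> x \<oplus> c \<odot> y"
    and add_smult: "x \<in> carrier A \<Longrightarrow> (c + d) \<odot> x = c \<odot> x \<oplus> d \<odot> x"
    and smult_smult: "x \<in> carrier A \<Longrightarrow> c \<odot> (d \<odot> x) = (c * d) \<odot> x"
    and smult_one [simp]: "x \<in> carrier A \<Longrightarrow> 1 \<odot> x = x"
    and smult_mult_left: "\<lbrakk>x \<in> carrier A; y \<in> carrier A\<rbrakk> \<Longrightarrow> (c \<odot> x) \<otimes> y = c \<odot> (x \<otimes> y)"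
    and smult_mult_right: "\<lbrakk>x \<in> carrier A; y \<in> carrier A\<rbrakk> \<Longrightarrow> x \<otimes> (c \<odot> y) = c \<odot> (x \<otimes> y)"
    and nrm_smult: "x \<in> carrier A \<Longrightarrow> nrm A (c \<odot> x) = cmod c * nrm A x"
    and nrm_add: "\<lbrakk>x \<in> carrier A; y \<in> carrier A\<rbrakk> \<Longrightarrow> nrm A (x \<oplus> y) \<le> nrm A x + nrm A y"
    and nrm_mult: "\<lbrakk>x \<in> carrier A; y \<in> carrier A\<rbrakk> \<Longrightarrow> nrm A (x \<otimes> y) \<le> C * nrm A x * nrm A y"
    and C_nonneg: "C \<ge> 0"
begin

lemma zero_smult [simp]: "x \<in> carrier A \<Longrightarrow> 0 \<odot> x = \<zero>"
  using add_smult[of x 0 0] smult_closed[of x 0] by (simp add: add.r_cancel_one')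

lemma smult_zero [simp]: "c \<odot> \<zero> = \<zero>"
  using smult_smult[of \<zero> c 0] by simp

lemma smult_minus_one: "x \<in> carrier A \<Longrightarrow> (-1) \<odot> x = \<ominus> x"
  using add_smult[of x "-1" 1] smult_closed[of x "-1"] by (intro minus_equality[symmetric]) simp_all

lemma smult_minus: "x \<in> carrier A \<Longrightarrow> c \<odot> (\<ominus> x) = \<ominus> (c \<odot> x)"
  by (simp flip: smult_minus_one add: smult_smult)

lemma smult_diff: "\<lbrakk>x \<in> carrier A; y \<in> carrier A\<rbrakk> \<Longrightarrow> c \<odot> (x \<ominus> y) = c \<odot> x \<ominus> c \<odot> y"
  by (simp add: a_minus_def smult_add smult_minus)

lemma nrm_zero [simp]: "nrm A \<zero> = 0"
  using nrm_smult[of \<zero> 0] by simp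

lemma nrm_minus [simp]: "x \<in> carrier A \<Longrightarrow> nrm A (\<ominus> x) = nrm A x"
  using nrm_smult[of x "-1"] by (simp add: smult_minus_one)

text \<open>0 = nrm (x + (-x)) is at most 2 nrm x, by the triangle inequality and invariance under
  sign.\<close>

lemma nrm_nonneg [simp]: "x \<in> carrier A \<Longrightarrow> 0 \<le> nrm A x"
  using nrm_add[of x "\<ominus> x"] by (simp add: r_neg)

lemma diff_zero_eq [simp]: "x \<in> carrier A \<Longrightarrow> x \<ominus> \<zero> = x"
  by (simp add: a_minus_def)

lemma diff_self [simp]: "x \<in> carrier A \<Longrightarrow> x \<ominus> x = \<zero>"
  by (simp add: a_minus_def r_neg)

lemma diff_closed [simp, intro]: "\<lbrakk>x \<in> carrier A; y \<in> carrier A\<rbrakk> \<Longrightarrow> x \<ominus> y \<in> carrier A"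
  by (rule minus_closed)

lemma diff_add_cancel: "\<lbrakk>x \<in> carrier A; y \<in> carrier A\<rbrakk> \<Longrightarrow> (x \<ominus> y) \<oplus> y = x"
  by (simp add: a_minus_def a_assoc l_neg)

lemma diff_eq_zero_iff: "\<lbrakk>x \<in> carrier A; y \<in> carrier A\<rbrakk> \<Longrightarrow> x \<ominus> y = \<zero> \<longleftrightarrow> x = y"
  by (metis diff_add_cancel l_zero diff_self)

lemma nrm_diff_commute: "\<lbrakk>x \<in> carrier A; y \<in> carrier A\<rbrakk> \<Longrightarrow> nrm A (x \<ominus> y) = nrm A (y \<ominus> x)"
  using nrm_minus[of "x \<ominus> y"] by (simp add: a_minus_def minus_add a_comm)

lemma nrm_triangle:
  assumes "x \<in> carrier A" "y \<in> carrier A" "z \<in> carrier A"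
  shows "nrm A (x \<ominus> z) \<le> nrm A (x \<ominus> y) + nrm A (y \<ominus> z)"
proof -
  have "(x \<ominus> y) \<oplus> (y \<ominus> z) = x \<ominus> z" using assms by (simp add: a_minus_def a_assoc r_neg1)
  then show ?thesis using nrm_add[of "x \<ominus> y" "y \<ominus> z"] assms by simp
qed

lemma abs_nrm_diff:
  assumes "x \<in> carrier A" "y \<in> carrier A"
  shows "\<bar>nrm A x - nrm A y\<bar> \<le> nrm A (x \<ominus> y)"
  using nrm_triangle[of x y \<zero>] nrm_triangle[of y x \<zero>] assms nrm_diff_commute[of x y] by simp

lemma nrm_add_diff:
  assumes "x \<in> carrier A" "y \<in> carrier A" "x' \<in> carrier A" "y' \<in> carrier A"
  shows "nrm A ((x \<oplus> y) \<ominus> (x' \<oplus> y')) \<le> nrm A (x \<ominus> x') + nrm A (y \<ominus> y')"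
proof -
  have "(x \<oplus> y) \<ominus> (x' \<oplus> y') = (x \<ominus> x') \<oplus> (y \<ominus> y')"
    using assms by (simp add: a_minus_def minus_add a_ac)
  then show ?thesis using nrm_add assms by simp
qed

text \<open>Insert the mixed product of x' and y. The identity serves both the continuity of
  products and, for squares, the increments of the square-root iteration.\<close>

lemma mult_diff_eq:
  assumes "x \<in> carrier A" "y \<in> carrier A" "x' \<in> carrier A" "y' \<in> carrier A"
  shows "(x \<otimes> y) \<ominus> (x' \<otimes> y') = ((x \<ominus> x') \<otimes> y) \<oplus> (x' \<otimes> (y \<ominus> y'))"
  using assms by (simp add: a_minus_def l_distr r_distr l_minus r_minus a_assoc r_neg1)

lemma nrm_mult_diff:
  assumes "x \<in> carrier A" "y \<in> carrier A" "x' \<in> carrier A" "y' \<in> carrier A"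
  shows "nrm A ((x \<otimes> y) \<ominus> (x' \<otimes> y')) \<le> C * nrm A (x \<ominus> x') * nrm A y + C * nrm A x' * nrm A (y \<ominus> y')"
  unfolding mult_diff_eq[OF assms]
  using nrm_add[of "(x \<ominus> x') \<otimes> y" "x' \<otimes> (y \<ominus> y')"] nrm_mult[of "x \<ominus> x'" y] nrm_mult[of x' "y \<ominus> y'"] assms
  by simp

lemma nrm_finsum:
  assumes "finite I" "f \<in> I \<rightarrow> carrier A"
  shows "nrm A (finsum A f I) \<le> (\<Sum>i\<in>I. nrm A (f i))"
  using assms
proof (induction I)
  case (insert i I)
  then have "nrm A (finsum A f (insert i I)) \<le> nrm A (f i) + nrm A (finsum A f I)"
    by (subst finsum_insert) (auto intro!: nrm_add simp: Pi_def)
  then show ?case using insert by auto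
qed simp

lemma smult_finsum:
  assumes "finite I" "f \<in> I \<rightarrow> carrier A"
  shows "c \<odot> finsum A f I = finsum A (\<lambda>i. c \<odot> f i) I"
  using assms
proof (induction I)
  case (insert i I)
  then show ?case by (subst finsum_insert; simp add: smult_add Pi_def)
qed simp

lemma finsum_const_smult: "\<lbrakk>finite I; x \<in> carrier A\<rbrakk> \<Longrightarrow> finsum A (\<lambda>_. x) I = of_nat (card I) \<odot> x"
proof (induction I rule: finite_induct)
  case (insert i I)
  then show ?case by (subst finsum_insert; simp add: add_smult a_comm)
qed simp

lemma finsum_swap:
  assumes "finite I" "finite J" "\<And>i j. i \<in> I \<Longrightarrow> j \<in> J \<Longrightarrow> f i j \<in> carrier A"
  shows "(\<Oplus>i\<in>I. \<Oplus>j\<in>J. f i j) = (\<Oplus>j\<in>J. \<Oplus>i\<in>I. f i j)"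
  using assms(1,3)
proof (induction I)
  case empty then show ?case by (simp add: finsum_zero)
next
  case (insert i I)
  have "(\<Oplus>j\<in>J. \<Oplus>i\<in>insert i I. f i j) = (\<Oplus>j\<in>J. f i j \<oplus> (\<Oplus>i\<in>I. f i j))"
    by (intro finsum_cong') (use insert in \<open>auto simp: Pi_def\<close>)
  then show ?case using insert assms(2) by (simp add: finsum_addf Pi_def)
qed

lemma finsum_single:
  assumes "finite I" "k \<in> I" "x \<in> carrier A"
  shows "(\<Oplus>i\<in>I. if i = k then x else \<zero>) = x"
  using add.finprod_singleton[of k I "\<lambda>_. x"] assms by (simp add: eq_commute[of k])

lemma finsum_minus:
  assumes "finite I" "f \<in> I \<rightarrow> carrier A"
  shows "\<ominus> finsum A f I = finsum A (\<lambda>i. \<ominus> f i) I"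
  using assms
proof (induction I)
  case (insert i I)
  then show ?case by (subst finsum_insert; simp add: minus_add Pi_def)
qed simp

lemma finsum_diff:
  assumes "finite I" "f \<in> I \<rightarrow> carrier A" "g \<in> I \<rightarrow> carrier A"
  shows "finsum A f I \<ominus> finsum A g I = finsum A (\<lambda>i. f i \<ominus> g i) I"
  using assms unfolding a_minus_def by (subst finsum_minus; simp add: finsum_addf Pi_def)

end

locale nstar = nring +
  assumes adj_closed [simp, intro]: "x \<in> carrier A \<Longrightarrow> adj A x \<in> carrier A"
    and adj_adj [simp]: "x \<in> carrier A \<Longrightarrow> adj A (adj A x) = x"
    and adj_add: "\<lbrakk>x \<in> carrier A; y \<in> carrier A\<rbrakk> \<Longrightarrow> adj A (x \<oplus> y) = adj A x \<oplus> adj A y"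
    and adj_smult: "x \<in> carrier A \<Longrightarrow> adj A (c \<odot> x) = cnj c \<odot> adj A x"
    and adj_mult: "\<lbrakk>x \<in> carrier A; y \<in> carrier A\<rbrakk> \<Longrightarrow> adj A (x \<otimes> y) = adj A y \<otimes> adj A x"
    and nrm_adj_le: "x \<in> carrier A \<Longrightarrow> nrm A (adj A x) \<le> C * nrm A x"
begin

lemma adj_zero [simp]: "adj A \<zero> = \<zero>"
  using adj_smult[of \<zero> 0] by simp

lemma adj_one [simp]: "adj A \<one> = \<one>"
  by (metis adj_adj adj_closed adj_mult l_one one_closed r_one)

lemma adj_minus: "x \<in> carrier A \<Longrightarrow> adj A (\<ominus> x) = \<ominus> adj A x"
  by (simp flip: smult_minus_one add: adj_smult)

lemma adj_diff: "\<lbrakk>x \<in> carrier A; y \<in> carrier A\<rbrakk> \<Longrightarrow> adj A (x \<ominus> y) = adj A x \<ominus> adj A y"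
  by (simp add: a_minus_def adj_add adj_minus)

lemma adj_finsum:
  assumes "finite I" "f \<in> I \<rightarrow> carrier A"
  shows "adj A (finsum A f I) = finsum A (\<lambda>i. adj A (f i)) I"
  using assms
proof (induction I)
  case (insert i I)
  then show ?case by (subst finsum_insert; simp add: adj_add Pi_def)
qed simp

end

text \<open>Common ground of the two quotients: bounded sequences along an ultrafilter, and Cauchy
  sequences of an inductive system along \<open>sequentially\<close>. \<open>S_lim\<close> gives the
  norm field of \<open>seq_quot\<close> its meaning, since that field is defined through
  \<open>Lim\<close>.\<close>

locale seq_alg =
  fixes A :: "nat \<Rightarrow> 'a cstar" and C :: real and S :: "(nat \<Rightarrow> 'a) set" and \<F> :: "nat filter"
  assumes nring: "\<And>n. nring (A n) C"
    and nontriv: "\<F> \<noteq> bot"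
    and S_carrier: "x \<in> S \<Longrightarrow> x n \<in> carrier (A n)"
    and S_bdd: "x \<in> S \<Longrightarrow> \<exists>K. \<forall>n. nrm (A n) (x n) \<le> K"
    and S_lim: "x \<in> S \<Longrightarrow> \<exists>l. ((\<lambda>n. nrm (A n) (x n)) \<longlongrightarrow> l) \<F>"
    and S_zero: "(\<lambda>n. \<zero>\<^bsub>A n\<^esub>) \<in> S"
    and S_one: "(\<lambda>n. \<one>\<^bsub>A n\<^esub>) \<in> S"
    and S_add: "\<lbrakk>x \<in> S; y \<in> S\<rbrakk> \<Longrightarrow> (\<lambda>n. x n \<oplus>\<^bsub>A n\<^esub> y n) \<in> S"
    and S_mult: "\<lbrakk>x \<in> S; y \<in> S\<rbrakk> \<Longrightarrow> (\<lambda>n. x n \<otimes>\<^bsub>A n\<^esub> y n) \<in> S"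
    and S_smult: "x \<in> S \<Longrightarrow> (\<lambda>n. c \<odot>\<^bsub>A n\<^esub> x n) \<in> S"
begin

sublocale A: nring "A n" C for n by (rule nring)

definition cls :: "(nat \<Rightarrow> 'a) \<Rightarrow> (nat \<Rightarrow> 'a) set" where
  "cls x = seq_rel S \<F> A `` {x}"

abbreviation Q where "Q \<equiv> seq_quot S \<F> A"

lemma S_minus: "x \<in> S \<Longrightarrow> (\<lambda>n. \<ominus>\<^bsub>A n\<^esub> x n) \<in> S"
  using S_smult[of x "-1"] S_carrier[of x] by (simp add: A.smult_minus_one)

lemma S_diff: "x \<in> S \<Longrightarrow> y \<in> S \<Longrightarrow> (\<lambda>n. x n \<ominus>\<^bsub>A n\<^esub> y n) \<in> S"
  unfolding a_minus_def by (intro S_add S_minus)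

lemma null_le:
  assumes "((\<lambda>n. f n) \<longlongrightarrow> 0) \<F>" "\<And>n. 0 \<le> g n" "\<And>n. g n \<le> (f n :: real)"
  shows "((\<lambda>n. g n) \<longlongrightarrow> 0) \<F>"
  by (rule tendsto_sandwich[OF _ _ tendsto_const assms(1)]) (use assms(2,3) in auto)

lemma seq_rel_iff: "(x, y) \<in> seq_rel S \<F> A \<longleftrightarrow>
    x \<in> S \<and> y \<in> S \<and> ((\<lambda>n. nrm (A n) (x n \<ominus>\<^bsub>A n\<^esub> y n)) \<longlongrightarrow> 0) \<F>"
  by (auto simp: seq_rel_def)

lemma equiv_rel: "equiv S (seq_rel S \<F> A)"
proof (rule equivI)
  show "seq_rel S \<F> A \<subseteq> S \<times> S" by (auto simp: seq_rel_def)
  show "refl_on S (seq_rel S \<F> A)"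
    by (auto simp: refl_on_def seq_rel_iff S_carrier)
  show "sym (seq_rel S \<F> A)"
    by (auto simp: sym_def seq_rel_iff A.nrm_diff_commute[OF S_carrier S_carrier])
  show "trans (seq_rel S \<F> A)"
  proof (rule transI)
    fix x y z assume *: "(x, y) \<in> seq_rel S \<F> A" "(y, z) \<in> seq_rel S \<F> A"
    have "((\<lambda>n. nrm (A n) (x n \<ominus>\<^bsub>A n\<^esub> y n) + nrm (A n) (y n \<ominus>\<^bsub>A n\<^esub> z n)) \<longlongrightarrow> 0) \<F>"
      using * by (auto simp: seq_rel_iff intro!: tendsto_eq_intros)
    from null_le[OF this, of "\<lambda>n. nrm (A n) (x n \<ominus>\<^bsub>A n\<^esub> z n)"] show "(x, z) \<in> seq_rel S \<F> A"
      using * unfolding seq_rel_iff by (auto simp: A.nrm_triangle S_carrier)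
  qed
qed

lemma cls_eq_iff: "x \<in> S \<Longrightarrow> y \<in> S \<Longrightarrow>
   cls x = cls y \<longleftrightarrow> ((\<lambda>n. nrm (A n) (x n \<ominus>\<^bsub>A n\<^esub> y n)) \<longlongrightarrow> 0) \<F>"
  unfolding cls_def using eq_equiv_class_iff[OF equiv_rel] by (simp add: seq_rel_iff)

lemma cls_self: "x \<in> S \<Longrightarrow> x \<in> cls x"
  unfolding cls_def using equiv_class_self[OF equiv_rel] by blast

lemma in_cls: "y \<in> cls x \<longleftrightarrow> (x, y) \<in> seq_rel S \<F> A"
  by (simp add: cls_def)

lemma carrier_Q: "carrier Q = cls ` S"
  by (auto simp: seq_quot_def quotient_def cls_def)

lemma cls_carrier: "x \<in> S \<Longrightarrow> cls x \<in> carrier Q" by (simp add: carrier_Q)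

lemma Q_cases: assumes "X \<in> carrier Q" obtains x where "x \<in> S" "X = cls x"
  using assms by (auto simp: carrier_Q)

lemma bdd_mult_null:
  assumes "x \<in> S" "(f \<longlongrightarrow> 0) \<F>"
  shows "((\<lambda>n. f n * nrm (A n) (x n)) \<longlongrightarrow> 0) \<F>"
proof -
  obtain l where "((\<lambda>n. nrm (A n) (x n)) \<longlongrightarrow> l) \<F>" using S_lim[OF assms(1)] by blast
  from tendsto_mult[OF assms(2) this] show ?thesis by simp
qed

text \<open>The product in \<open>seq_quot\<close> is a union over all representatives. It collapses
  to a single class once the class of the termwise product is independent of the representatives,
  which is continuity of multiplication on sequences with convergent norms.\<close>

lemma Q_mult:
  assumes "x \<in> S" "y \<in> S"
  shows "cls x \<otimes>\<^bsub>Q\<^esub> cls y = cls (\<lambda>n. x n \<otimes>\<^bsub>A n\<^esub> y n)"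
proof -
  have "congruent2 (seq_rel S \<F> A) (seq_rel S \<F> A) (\<lambda>x y. cls (\<lambda>n. x n \<otimes>\<^bsub>A n\<^esub> y n))"
  proof (rule congruent2I')
    fix x x' y y' assume *: "(x, x') \<in> seq_rel S \<F> A" "(y, y') \<in> seq_rel S \<F> A"
    then have S: "x \<in> S" "x' \<in> S" "y \<in> S" "y' \<in> S" by (auto simp: seq_rel_iff)
    have 1: "((\<lambda>n. nrm (A n) (x n \<ominus>\<^bsub>A n\<^esub> x' n)) \<longlongrightarrow> 0) \<F>" "((\<lambda>n. nrm (A n) (y n \<ominus>\<^bsub>A n\<^esub> y' n)) \<longlongrightarrow> 0) \<F>"
      using * by (auto simp: seq_rel_iff)
    have "((\<lambda>n. C * (nrm (A n) (x n \<ominus>\<^bsub>A n\<^esub> x' n) * nrm (A n) (y n)) + C * (nrm (A n) (y n \<ominus>\<^bsub>A n\<^esub> y' n) * nrm (A n) (x' n))) \<longlongrightarrow> C * 0 + C * 0) \<F>"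
      by (intro tendsto_add tendsto_mult[OF tendsto_const] bdd_mult_null S 1)
    then show "cls (\<lambda>n. x n \<otimes>\<^bsub>A n\<^esub> y n) = cls (\<lambda>n. x' n \<otimes>\<^bsub>A n\<^esub> y' n)" using S
      by (subst cls_eq_iff) (auto simp: S_mult S_carrier mult.assoc mult.commute intro!: null_le[of _ "\<lambda>n. nrm (A n) (x n \<otimes>\<^bsub>A n\<^esub> y n \<ominus>\<^bsub>A n\<^esub> x' n \<otimes>\<^bsub>A n\<^esub> y' n)"]
          order_trans[OF A.nrm_mult_diff])
  qed
  from UN_equiv_class2[OF equiv_rel equiv_rel this assms] show ?thesis
    by (simp add: seq_quot_def cls_def)
qed

lemma Q_add:
  assumes "x \<in> S" "y \<in> S"
  shows "cls x \<oplus>\<^bsub>Q\<^esub> cls y = cls (\<lambda>n. x n \<oplus>\<^bsub>A n\<^esub> y n)"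
proof -
  have "congruent2 (seq_rel S \<F> A) (seq_rel S \<F> A) (\<lambda>x y. cls (\<lambda>n. x n \<oplus>\<^bsub>A n\<^esub> y n))"
  proof (rule congruent2I')
    fix x x' y y' assume *: "(x, x') \<in> seq_rel S \<F> A" "(y, y') \<in> seq_rel S \<F> A"
    then have S: "x \<in> S" "x' \<in> S" "y \<in> S" "y' \<in> S" by (auto simp: seq_rel_iff)
    have "((\<lambda>n. nrm (A n) (x n \<ominus>\<^bsub>A n\<^esub> x' n) + nrm (A n) (y n \<ominus>\<^bsub>A n\<^esub> y' n)) \<longlongrightarrow> 0 + 0) \<F>"
      using * by (intro tendsto_add) (auto simp: seq_rel_iff)
    then show "cls (\<lambda>n. x n \<oplus>\<^bsub>A n\<^esub> y n) = cls (\<lambda>n. x' n \<oplus>\<^bsub>A n\<^esub> y' n)" using S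
      by (subst cls_eq_iff) (auto simp: S_add S_carrier intro!: null_le[of _ "\<lambda>n. nrm (A n) (x n \<oplus>\<^bsub>A n\<^esub> y n \<ominus>\<^bsub>A n\<^esub> (x' n \<oplus>\<^bsub>A n\<^esub> y' n))"]
          A.nrm_add_diff)
  qed
  from UN_equiv_class2[OF equiv_rel equiv_rel this assms] show ?thesis
    by (simp add: seq_quot_def cls_def)
qed

lemma Q_smult:
  assumes "x \<in> S"
  shows "c \<odot>\<^bsub>Q\<^esub> cls x = cls (\<lambda>n. c \<odot>\<^bsub>A n\<^esub> x n)"
proof -
  have "congruent (seq_rel S \<F> A) (\<lambda>x. cls (\<lambda>n. c \<odot>\<^bsub>A n\<^esub> x n))"
  proof (rule congruentI)
    fix x x' assume *: "(x, x') \<in> seq_rel S \<F> A"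
    then have S: "x \<in> S" "x' \<in> S" by (auto simp: seq_rel_iff)
    have "((\<lambda>n. cmod c * nrm (A n) (x n \<ominus>\<^bsub>A n\<^esub> x' n)) \<longlongrightarrow> cmod c * 0) \<F>"
      using * by (intro tendsto_mult tendsto_const) (auto simp: seq_rel_iff)
    then show "cls (\<lambda>n. c \<odot>\<^bsub>A n\<^esub> x n) = cls (\<lambda>n. c \<odot>\<^bsub>A n\<^esub> x' n)" using S
      by (subst cls_eq_iff) (auto simp: S_smult S_carrier A.nrm_smult simp flip: A.smult_diff)
  qed
  from UN_equiv_class[OF equiv_rel this assms] show ?thesis
    by (simp add: seq_quot_def cls_def)
qed

lemma Q_zero: "\<zero>\<^bsub>Q\<^esub> = cls (\<lambda>n. \<zero>\<^bsub>A n\<^esub>)" by (simp add: seq_quot_def cls_def)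
lemma Q_one: "\<one>\<^bsub>Q\<^esub> = cls (\<lambda>n. \<one>\<^bsub>A n\<^esub>)" by (simp add: seq_quot_def cls_def)

text \<open>Equivalent sequences have the same norm limit, because norms differ by at most the norm
  of the difference. So the set from which \<open>the_elem\<close> extracts the norm is a
  singleton.\<close>

lemma Q_nrm_lim:
  assumes "x \<in> S"
  shows "((\<lambda>n. nrm (A n) (x n)) \<longlongrightarrow> nrm Q (cls x)) \<F>"
proof -
  obtain l where l: "((\<lambda>n. nrm (A n) (x n)) \<longlongrightarrow> l) \<F>" using S_lim[OF assms] by blast
  have "((\<lambda>n. nrm (A n) (y n)) \<longlongrightarrow> l) \<F>" if y: "y \<in> cls x" for y
  proof -
    have abs_nrm: "\<bar>nrm (A n) (y n) - nrm (A n) (x n)\<bar> \<le> nrm (A n) (x n \<ominus>\<^bsub>A n\<^esub> y n)" for n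
      using A.abs_nrm_diff[of "x n" n "y n"] y S_carrier by (auto simp: in_cls seq_rel_iff)
    have "((\<lambda>n. nrm (A n) (y n) - nrm (A n) (x n)) \<longlongrightarrow> 0) \<F>"
      by (rule tendsto_rabs_zero_cancel, rule null_le[of "\<lambda>n. nrm (A n) (x n \<ominus>\<^bsub>A n\<^esub> y n)"])
        (use y in \<open>auto simp: in_cls seq_rel_iff S_carrier intro!: abs_nrm\<close>)
    from tendsto_add[OF this l] show ?thesis by simp
  qed
  then have "(\<lambda>y. Lim \<F> (\<lambda>n. nrm (A n) (y n))) ` cls x = {l}"
    using cls_self[OF assms] tendsto_Lim[OF nontriv] by force
  then show ?thesis using l by (simp add: seq_quot_def)
qed

lemma Q_nrm_eqI: "x \<in> S \<Longrightarrow> ((\<lambda>n. nrm (A n) (x n)) \<longlongrightarrow> l) \<F> \<Longrightarrow> nrm Q (cls x) = l"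
  using tendsto_unique[OF nontriv Q_nrm_lim] by blast

lemma Q_ring: "ring Q"
proof (rule ringI)
  show "abelian_group Q"
  proof (rule abelian_groupI)
    fix X assume "X \<in> carrier Q"
    then obtain x where x: "x \<in> S" "X = cls x" by (rule Q_cases)
    then show "\<exists>Y\<in>carrier Q. Y \<oplus>\<^bsub>Q\<^esub> X = \<zero>\<^bsub>Q\<^esub>"
      by (intro bexI[of _ "cls (\<lambda>n. \<ominus>\<^bsub>A n\<^esub> x n)"]) (auto simp: Q_add S_minus Q_zero cls_carrier A.l_neg S_carrier)
  qed (auto elim!: Q_cases simp: Q_add cls_carrier S_add S_zero Q_zero A.a_ac S_carrier)
  show "monoid Q"
    by (rule monoidI) (auto elim!: Q_cases simp: Q_mult cls_carrier S_mult S_one Q_one A.m_assoc S_carrier)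
qed (auto elim!: Q_cases simp: Q_mult Q_add cls_carrier S_mult S_add A.l_distr A.r_distr S_carrier)

sublocale Q: ring Q by (rule Q_ring)

lemma Q_nring: "nring Q C"
proof (rule nring.intro[OF Q_ring], unfold_locales)
  fix X Y assume "X \<in> carrier Q" "Y \<in> carrier Q"
  then obtain x y where x: "x \<in> S" "X = cls x" "y \<in> S" "Y = cls y" by (auto elim!: Q_cases)
  show "nrm Q (X \<oplus>\<^bsub>Q\<^esub> Y) \<le> nrm Q X + nrm Q Y"
    unfolding x Q_add[OF x(1,3)]
    by (rule tendsto_le[OF nontriv tendsto_add[OF Q_nrm_lim Q_nrm_lim] Q_nrm_lim])
      (auto simp: x S_add S_carrier intro!: always_eventually A.nrm_add)
  show "nrm Q (X \<otimes>\<^bsub>Q\<^esub> Y) \<le> C * nrm Q X * nrm Q Y"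
    unfolding x Q_mult[OF x(1,3)]
    by (rule tendsto_le[OF nontriv tendsto_mult[OF tendsto_mult[OF tendsto_const Q_nrm_lim] Q_nrm_lim] Q_nrm_lim])
      (auto simp: x S_mult S_carrier intro!: always_eventually A.nrm_mult)
next
  fix X c assume "X \<in> carrier Q"
  then obtain x where x: "x \<in> S" "X = cls x" by (auto elim!: Q_cases)
  show "nrm Q (c \<odot>\<^bsub>Q\<^esub> X) = cmod c * nrm Q X"
    unfolding x Q_smult[OF x(1)]
    by (rule Q_nrm_eqI) (auto simp: x S_smult S_carrier A.nrm_smult intro!: tendsto_mult Q_nrm_lim)
next
  fix X Y c assume "X \<in> carrier Q" "Y \<in> carrier Q"
  then obtain x y where x: "x \<in> S" "X = cls x" "y \<in> S" "Y = cls y" by (auto elim!: Q_cases)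
  show "c \<odot>\<^bsub>Q\<^esub> (X \<oplus>\<^bsub>Q\<^esub> Y) = c \<odot>\<^bsub>Q\<^esub> X \<oplus>\<^bsub>Q\<^esub> c \<odot>\<^bsub>Q\<^esub> Y"
    using x by (simp add: Q_add Q_smult S_add S_smult S_carrier A.smult_add)
  show "(c \<odot>\<^bsub>Q\<^esub> X) \<otimes>\<^bsub>Q\<^esub> Y = c \<odot>\<^bsub>Q\<^esub> (X \<otimes>\<^bsub>Q\<^esub> Y)"
    using x by (simp add: Q_mult Q_smult S_mult S_smult S_carrier A.smult_mult_left)
  show "X \<otimes>\<^bsub>Q\<^esub> (c \<odot>\<^bsub>Q\<^esub> Y) = c \<odot>\<^bsub>Q\<^esub> (X \<otimes>\<^bsub>Q\<^esub> Y)"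
    using x by (simp add: Q_mult Q_smult S_mult S_smult S_carrier A.smult_mult_right)
next
  fix X c d assume "X \<in> carrier Q"
  then obtain x where x: "x \<in> S" "X = cls x" by (auto elim!: Q_cases)
  show "c \<odot>\<^bsub>Q\<^esub> X \<in> carrier Q" "1 \<odot>\<^bsub>Q\<^esub> X = X"
    using x by (simp_all add: Q_smult S_smult S_carrier cls_carrier)
  show "(c + d) \<odot>\<^bsub>Q\<^esub> X = c \<odot>\<^bsub>Q\<^esub> X \<oplus>\<^bsub>Q\<^esub> d \<odot>\<^bsub>Q\<^esub> X"
    using x by (simp add: Q_add Q_smult S_smult S_carrier A.add_smult)
  show "c \<odot>\<^bsub>Q\<^esub> (d \<odot>\<^bsub>Q\<^esub> X) = (c * d) \<odot>\<^bsub>Q\<^esub> X"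
    using x by (simp add: Q_smult S_smult S_carrier A.smult_smult)
qed (rule A.C_nonneg)

sublocale Q: nring Q C by (rule Q_nring)

lemma Q_minus: "x \<in> S \<Longrightarrow> \<ominus>\<^bsub>Q\<^esub> cls x = cls (\<lambda>n. \<ominus>\<^bsub>A n\<^esub> x n)"
  using Q.smult_minus_one[of "cls x"] by (simp add: cls_carrier Q_smult A.smult_minus_one S_carrier)

lemma Q_diff: "x \<in> S \<Longrightarrow> y \<in> S \<Longrightarrow> cls x \<ominus>\<^bsub>Q\<^esub> cls y = cls (\<lambda>n. x n \<ominus>\<^bsub>A n\<^esub> y n)"
  by (simp add: a_minus_def Q_minus Q_add S_minus)

text \<open>Definiteness is produced by the quotient: a sequence whose norms tend to 0 is equivalent
  to the zero sequence.\<close>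

lemma Q_nrm_eq_0: "X \<in> carrier Q \<Longrightarrow> nrm Q X = 0 \<Longrightarrow> X = \<zero>\<^bsub>Q\<^esub>"
  by (elim Q_cases) (use Q_nrm_lim in \<open>force simp: Q_zero cls_eq_iff S_zero S_carrier\<close>)

lemma Q_finsum:
  assumes "finite I" "\<And>i. i \<in> I \<Longrightarrow> x i \<in> S"
  shows "(\<lambda>n. \<Oplus>\<^bsub>A n\<^esub>i\<in>I. x i n) \<in> S" "(\<Oplus>\<^bsub>Q\<^esub>i\<in>I. cls (x i)) = cls (\<lambda>n. \<Oplus>\<^bsub>A n\<^esub>i\<in>I. x i n)"
  using assms
proof (induction I)
  case empty { case 1 show ?case by (simp add: S_zero) next case 2 show ?case by (simp add: Q_zero) }
next
  case (insert i I)
  { case 1 then show ?case using insert by (simp add: S_add S_carrier) next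
    case 2 then show ?case using insert by (simp add: Q_add cls_carrier S_carrier) }
qed

end

locale seq_star = seq_alg +
  assumes nstar: "\<And>n. nstar (A n) C"
    and S_adj: "x \<in> S \<Longrightarrow> (\<lambda>n. adj (A n) (x n)) \<in> S"
begin

sublocale A: nstar "A n" C for n by (rule nstar)

lemma Q_adj:
  assumes "x \<in> S"
  shows "adj Q (cls x) = cls (\<lambda>n. adj (A n) (x n))"
proof -
  have "congruent (seq_rel S \<F> A) (\<lambda>x. cls (\<lambda>n. adj (A n) (x n)))"
  proof (rule congruentI)
    fix x x' assume *: "(x, x') \<in> seq_rel S \<F> A"
    then have S: "x \<in> S" "x' \<in> S" by (auto simp: seq_rel_iff)
    have "((\<lambda>n. C * nrm (A n) (x n \<ominus>\<^bsub>A n\<^esub> x' n)) \<longlongrightarrow> C * 0) \<F>"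
      using * by (intro tendsto_mult tendsto_const) (auto simp: seq_rel_iff)
    then show "cls (\<lambda>n. adj (A n) (x n)) = cls (\<lambda>n. adj (A n) (x' n))" using S
      by (subst cls_eq_iff) (auto simp: S_adj S_carrier intro!: null_le[of _ "\<lambda>n. nrm (A n) (adj (A n) (x n \<ominus>\<^bsub>A n\<^esub> x' n))"] A.nrm_adj_le simp flip: A.adj_diff)
  qed
  from UN_equiv_class[OF equiv_rel this assms] show ?thesis
    by (simp add: seq_quot_def cls_def)
qed

lemma Q_nstar: "nstar Q C"
proof (rule nstar.intro[OF Q_nring], unfold_locales)
  fix X assume "X \<in> carrier Q"
  then obtain x where x: "x \<in> S" "X = cls x" by (auto elim!: Q_cases)
  show "nrm Q (adj Q X) \<le> C * nrm Q X"
    unfolding x Q_adj[OF x(1)]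
    by (rule tendsto_le[OF nontriv tendsto_mult[OF tendsto_const Q_nrm_lim] Q_nrm_lim])
      (auto simp: x S_adj S_carrier intro!: always_eventually A.nrm_adj_le)
qed (elim Q_cases, simp add: Q_mult Q_add Q_adj Q_smult cls_carrier S_adj S_mult S_add S_smult S_carrier A.adj_add A.adj_smult A.adj_mult)+

sublocale Q: nstar Q C by (rule Q_nstar)

end

text \<open>A Lipschitz constant common to all n makes the termwise maps respect null sequences.
  This evaluates every induced map below: the action on the UHF algebra, the operators on the
  Hilbert module and the maps between ultrapowers.\<close>

lemma seq_map_cls:
  assumes "seq_alg A C S \<F>" "seq_alg A' C' S' \<F>"
    and x: "x \<in> S" and f: "\<And>x. x \<in> S \<Longrightarrow> (\<lambda>n. f n (x n)) \<in> S'"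
    and lip: "\<And>n x y. x \<in> carrier (A n) \<Longrightarrow> y \<in> carrier (A n) \<Longrightarrow>
       nrm (A' n) (f n x \<ominus>\<^bsub>A' n\<^esub> f n y) \<le> L * nrm (A n) (x \<ominus>\<^bsub>A n\<^esub> y)"
  shows "seq_map S' \<F> A' f (seq_alg.cls A S \<F> x) = seq_alg.cls A' S' \<F> (\<lambda>n. f n (x n))"
proof -
  interpret A: seq_alg A C S \<F> by fact
  interpret A': seq_alg A' C' S' \<F> by fact
  have "congruent (seq_rel S \<F> A) (\<lambda>x. A'.cls (\<lambda>n. f n (x n)))"
  proof (rule congruentI)
    fix x x' assume *: "(x, x') \<in> seq_rel S \<F> A"
    then have S: "x \<in> S" "x' \<in> S" by (auto simp: A.seq_rel_iff)
    have "((\<lambda>n. L * nrm (A n) (x n \<ominus>\<^bsub>A n\<^esub> x' n)) \<longlongrightarrow> L * 0) \<F>"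
      using * by (intro tendsto_mult tendsto_const) (auto simp: A.seq_rel_iff)
    then show "A'.cls (\<lambda>n. f n (x n)) = A'.cls (\<lambda>n. f n (x' n))" using S f[OF S(1)] f[OF S(2)]
      by (subst A'.cls_eq_iff) (auto intro!: A.null_le[of _ "\<lambda>n. nrm (A' n) (f n (x n) \<ominus>\<^bsub>A' n\<^esub> f n (x' n))"]
       lip A.S_carrier A'.A.nrm_nonneg A'.A.diff_closed A'.S_carrier[of "\<lambda>n. f n (x n)" for x])
  qed
  from UN_equiv_class[OF A.equiv_rel this x] show ?thesis
    by (simp add: seq_map_def A.cls_def A'.cls_def)
qed

section \<open>Ultrapowers and inductive limits\<close>

text \<open>Compactness of [-K, K] yields a cluster point l of f along the filter. If f were not
  eventually in some neighbourhood U of l, the ultrafilter property would put f eventually outside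
  U, contradicting that l is a cluster point.\<close>

lemma ultrafilter_tendsto:
  fixes f :: "nat \<Rightarrow> real"
  assumes "free_ultrafilter \<omega>" and "\<And>n. \<bar>f n\<bar> \<le> K"
  shows "\<exists>l. (f \<longlongrightarrow> l) \<omega>"
proof -
  have "compact {-K..K}" by simp
  moreover have "filtermap f \<omega> \<noteq> bot" "eventually (\<lambda>x. x \<in> {-K..K}) (filtermap f \<omega>)"
    using assms by (auto simp: filtermap_bot_iff free_ultrafilter_def eventually_filtermap abs_le_iff minus_le_iff intro!: always_eventually)
  ultimately obtain l where l: "inf (nhds l) (filtermap f \<omega>) \<noteq> bot"
    by (auto simp: compact_filter)
  have "(f \<longlongrightarrow> l) \<omega>"
  proof (rule topological_tendstoI)
    fix U assume U: "open U" "l \<in> U"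
    show "eventually (\<lambda>x. f x \<in> U) \<omega>"
    proof (rule ccontr)
      assume "\<not> eventually (\<lambda>x. f x \<in> U) \<omega>"
      then have "eventually (\<lambda>x. x \<notin> U) (filtermap f \<omega>)"
        using assms(1) by (auto simp: free_ultrafilter_def eventually_filtermap)
      moreover have "eventually (\<lambda>x. x \<in> U) (nhds l)" using U by (auto simp: eventually_nhds)
      ultimately have "eventually (\<lambda>x. False) (inf (nhds l) (filtermap f \<omega>))"
        unfolding eventually_inf by (intro exI[of _ "\<lambda>x. x \<in> U"] exI[of _ "\<lambda>x. x \<notin> U"]) auto
      then show False using l by (simp add: eventually_False)
    qed
  qed
  then show ?thesis by blast
qed

lemma (in nring) bounded_seqsI:
  "(\<And>n. x n \<in> carrier A) \<Longrightarrow> (\<And>n. nrm A (x n) \<le> B) \<Longrightarrow> x \<in> bounded_seqs A"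
  by (auto simp: bounded_seqs_def)

lemma (in nring) bounded_seqsE:
  assumes "x \<in> bounded_seqs A"
  obtains K where "K \<ge> 0" "\<And>n. nrm A (x n) \<le> K" "\<And>n. x n \<in> carrier A"
proof -
  obtain K where K: "\<And>n. nrm A (x n) \<le> K" "\<And>n. x n \<in> carrier A" using assms by (auto simp: bounded_seqs_def)
  have "0 \<le> K" using K(1)[of 0] nrm_nonneg[OF K(2)[of 0]] by linarith
  then show ?thesis using that K by blast
qed

lemma (in nring) ultrapower_seq_alg:
  assumes "free_ultrafilter \<omega>"
  shows "seq_alg (\<lambda>_. A) C (bounded_seqs A) \<omega>"
proof
  show "\<omega> \<noteq> bot" using assms by (simp add: free_ultrafilter_def)
  fix x c assume "x \<in> bounded_seqs A"
  then obtain K where K: "K \<ge> 0" "\<And>n. nrm A (x n) \<le> K" "\<And>n. x n \<in> carrier A" by (erule bounded_seqsE)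
  show "x n \<in> carrier A" for n by fact
  show "\<exists>K. \<forall>n. nrm A (x n) \<le> K" using K by blast
  show "\<exists>l. ((\<lambda>n. nrm A (x n)) \<longlongrightarrow> l) \<omega>"
    by (rule ultrafilter_tendsto[OF assms, of _ K]) (use K in auto)
  show "(\<lambda>n. c \<odot> x n) \<in> bounded_seqs A"
    by (rule bounded_seqsI[of _ "cmod c * K"]) (use K in \<open>auto simp: nrm_smult mult_left_mono\<close>)
  fix y assume "y \<in> bounded_seqs A"
  then obtain L where L: "L \<ge> 0" "\<And>n. nrm A (y n) \<le> L" "\<And>n. y n \<in> carrier A" by (erule bounded_seqsE)
  show "(\<lambda>n. x n \<oplus> y n) \<in> bounded_seqs A"
    by (rule bounded_seqsI[of _ "K + L"]) (use K L in \<open>auto intro!: order_trans[OF nrm_add] add_mono\<close>)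
  show "(\<lambda>n. x n \<otimes> y n) \<in> bounded_seqs A"
    by (rule bounded_seqsI[of _ "C * K * L"])
      (use K L C_nonneg in \<open>auto intro!: order_trans[OF nrm_mult] mult_mono mult_nonneg_nonneg\<close>)
qed (auto simp: C_nonneg nring_axioms bounded_seqs_def)

lemma (in nstar) ultrapower_seq_star:
  assumes "free_ultrafilter \<omega>"
  shows "seq_star (\<lambda>_. A) C (bounded_seqs A) \<omega>"
proof -
  interpret seq_alg "\<lambda>_. A" C "bounded_seqs A" \<omega> by (rule ultrapower_seq_alg[OF assms])
  show ?thesis
  proof unfold_locales
    fix x assume "x \<in> bounded_seqs A"
    then obtain K where K: "K \<ge> 0" "\<And>n. nrm A (x n) \<le> K" "\<And>n. x n \<in> carrier A" by (erule bounded_seqsE)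
    show "(\<lambda>n. adj A (x n)) \<in> bounded_seqs A"
      by (rule bounded_seqsI[of _ "C * K"]) (use K C_nonneg in \<open>auto intro!: order_trans[OF nrm_adj_le] mult_left_mono\<close>)
  qed
qed

text \<open>Used twice: for the tensor powers with their unital embeddings, and, with a constant
  algebra and identity maps, for the completion that becomes the Hilbert module. Isometry of the
  connecting maps is what lets a Cauchy sequence be tested against any sufficiently late
  term.\<close>

locale ind_sys =
  fixes A :: "nat \<Rightarrow> 'a cstar" and \<phi> :: "nat \<Rightarrow> nat \<Rightarrow> 'a \<Rightarrow> 'a" and C :: real
  assumes nring: "\<And>n. nring (A n) C"
    and phi_closed: "\<And>k n x. k \<le> n \<Longrightarrow> x \<in> carrier (A k) \<Longrightarrow> \<phi> k n x \<in> carrier (A n)"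
    and phi_add: "\<And>k n x y. k \<le> n \<Longrightarrow> x \<in> carrier (A k) \<Longrightarrow> y \<in> carrier (A k) \<Longrightarrow>
        \<phi> k n (x \<oplus>\<^bsub>A k\<^esub> y) = \<phi> k n x \<oplus>\<^bsub>A n\<^esub> \<phi> k n y"
    and phi_mult: "\<And>k n x y. k \<le> n \<Longrightarrow> x \<in> carrier (A k) \<Longrightarrow> y \<in> carrier (A k) \<Longrightarrow>
        \<phi> k n (x \<otimes>\<^bsub>A k\<^esub> y) = \<phi> k n x \<otimes>\<^bsub>A n\<^esub> \<phi> k n y"
    and phi_smult: "\<And>k n x c. k \<le> n \<Longrightarrow> x \<in> carrier (A k) \<Longrightarrow> \<phi> k n (c \<odot>\<^bsub>A k\<^esub> x) = c \<odot>\<^bsub>A n\<^esub> \<phi> k n x"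
    and phi_one: "\<And>k n. k \<le> n \<Longrightarrow> \<phi> k n \<one>\<^bsub>A k\<^esub> = \<one>\<^bsub>A n\<^esub>"
    and phi_nrm: "\<And>k n x. k \<le> n \<Longrightarrow> x \<in> carrier (A k) \<Longrightarrow> nrm (A n) (\<phi> k n x) = nrm (A k) x"
    and phi_phi: "\<And>k n m x. k \<le> n \<Longrightarrow> n \<le> m \<Longrightarrow> x \<in> carrier (A k) \<Longrightarrow> \<phi> n m (\<phi> k n x) = \<phi> k m x"
    and phi_id: "\<And>n x. x \<in> carrier (A n) \<Longrightarrow> \<phi> n n x = x"
begin

sublocale A: nring "A n" C for n by (rule nring)

abbreviation "S \<equiv> cauchy_seqs A \<phi>"

lemma phi_diff: "k \<le> n \<Longrightarrow> x \<in> carrier (A k) \<Longrightarrow> y \<in> carrier (A k) \<Longrightarrow>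
        \<phi> k n (x \<ominus>\<^bsub>A k\<^esub> y) = \<phi> k n x \<ominus>\<^bsub>A n\<^esub> \<phi> k n y"
  by (simp add: a_minus_def phi_add phi_smult phi_closed flip: A.smult_minus_one)

lemma phi_zero: "k \<le> n \<Longrightarrow> \<phi> k n \<zero>\<^bsub>A k\<^esub> = \<zero>\<^bsub>A n\<^esub>"
  using phi_smult[of k n "\<zero>\<^bsub>A k\<^esub>" 0] by (simp add: phi_closed)

lemma cauchy_carrier: "x \<in> S \<Longrightarrow> x n \<in> carrier (A n)" by (simp add: cauchy_seqs_def)

lemma cauchyI:
  assumes "\<And>n. x n \<in> carrier (A n)"
    "\<And>\<epsilon>. \<epsilon> > 0 \<Longrightarrow> \<exists>N. \<forall>n\<ge>N. nrm (A n) (x n \<ominus>\<^bsub>A n\<^esub> \<phi> N n (x N)) < \<epsilon>"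
  shows "x \<in> S"
  using assms by (auto simp: cauchy_seqs_def)

text \<open>\<open>cauchy_seqs\<close> tests a sequence against one term \<open>x N\<close> only.
  Halving epsilon and comparing \<open>x N\<close> with \<open>x M\<close> inside level M, where the
  isometry \<open>\<phi> M n\<close> does not change distances, moves the base point to any M >=
  N.\<close>

lemma cauchyD:
  assumes "x \<in> S" "\<epsilon> > 0"
  shows "\<exists>N. \<forall>M\<ge>N. \<forall>n\<ge>M. nrm (A n) (x n \<ominus>\<^bsub>A n\<^esub> \<phi> M n (x M)) < \<epsilon>"
proof -
  obtain N where N: "\<And>n. n \<ge> N \<Longrightarrow> nrm (A n) (x n \<ominus>\<^bsub>A n\<^esub> \<phi> N n (x N)) < \<epsilon> / 2"
    using assms(1) half_gt_zero[OF assms(2)] unfolding cauchy_seqs_def by blast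
  note c = cauchy_carrier[OF assms(1)]
  show ?thesis
  proof (intro exI allI impI)
    fix M n assume M: "N \<le> M" "M \<le> n"
    have "nrm (A n) (x n \<ominus>\<^bsub>A n\<^esub> \<phi> M n (x M)) \<le> nrm (A n) (x n \<ominus>\<^bsub>A n\<^esub> \<phi> N n (x N)) + nrm (A n) (\<phi> N n (x N) \<ominus>\<^bsub>A n\<^esub> \<phi> M n (x M))"
      using M c by (intro A.nrm_triangle) (auto simp: phi_closed)
    also have "\<phi> N n (x N) \<ominus>\<^bsub>A n\<^esub> \<phi> M n (x M) = \<phi> M n (\<phi> N M (x N) \<ominus>\<^bsub>A M\<^esub> x M)"
      using M c by (simp add: phi_diff phi_phi phi_closed)
    also have "nrm (A n) \<dots> = nrm (A M) (x M \<ominus>\<^bsub>A M\<^esub> \<phi> N M (x N))"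
      using M c by (simp add: phi_nrm phi_closed A.nrm_diff_commute[of "x M"])
    finally show "nrm (A n) (x n \<ominus>\<^bsub>A n\<^esub> \<phi> M n (x M)) < \<epsilon>" using N[of n] N[of M] M by simp
  qed
qed

lemma cauchy_bounded:
  assumes "x \<in> S"
  obtains K where "K \<ge> 0" "\<And>n. nrm (A n) (x n) \<le> K"
proof -
  obtain N where N: "\<And>n. n \<ge> N \<Longrightarrow> nrm (A n) (x n \<ominus>\<^bsub>A n\<^esub> \<phi> N n (x N)) < 1"
    using assms by (auto simp: cauchy_seqs_def) (metis zero_less_one)
  note c = cauchy_carrier[OF assms(1)]
  \<comment> \<open>The sum covers the terms up to N; beyond N the sequence stays within distance 1
    of the image of \<open>x N\<close>, whose norm is one of the summands.\<close>
  define K where "K = 1 + (\<Sum>k\<le>N. nrm (A k) (x k))"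
  have le: "nrm (A k) (x k) \<le> (\<Sum>k\<le>N. nrm (A k) (x k))" if "k \<le> N" for k
    using that c by (intro member_le_sum) auto
  have 1: "nrm (A n) (x n) \<le> K" for n
  proof (cases "n \<le> N")
    case True
    then show ?thesis using le[of n] by (simp add: K_def)
  next
    case False
    then have "\<bar>nrm (A n) (x n) - nrm (A n) (\<phi> N n (x N))\<bar> < 1" using c
      by (intro le_less_trans[OF A.abs_nrm_diff N]) (auto simp: phi_closed)
    then show ?thesis using False le[of N] c by (simp add: phi_nrm K_def)
  qed
  have "0 \<le> K" using c by (auto simp: K_def intro!: add_nonneg_nonneg sum_nonneg)
  then show ?thesis using that 1 by blast
qed

text \<open>The connecting maps preserve norms, so the norms of \<open>x m\<close> and
  \<open>x n\<close> differ by at most the distance of \<open>x n\<close> from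
  \<open>\<phi> m n (x m)\<close>.\<close>

lemma cauchy_nrm_lim:
  assumes "x \<in> S"
  shows "\<exists>l. (\<lambda>n. nrm (A n) (x n)) \<longlonglongrightarrow> l"
proof -
  note c = cauchy_carrier[OF assms(1)]
  have "Cauchy (\<lambda>n. nrm (A n) (x n))"
  proof (rule CauchyI')
    fix e :: real assume "e > 0"
    from cauchyD[OF assms this] obtain N where
      N: "\<And>M n. M \<ge> N \<Longrightarrow> n \<ge> M \<Longrightarrow> nrm (A n) (x n \<ominus>\<^bsub>A n\<^esub> \<phi> M n (x M)) < e" by blast
    show "\<exists>M. \<forall>m\<ge>M. \<forall>n>m. dist (nrm (A m) (x m)) (nrm (A n) (x n)) < e"
    proof (intro exI allI impI)
      fix m n assume m: "m \<ge> N" "n > m"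
      have "dist (nrm (A m) (x m)) (nrm (A n) (x n)) = \<bar>nrm (A n) (x n) - nrm (A n) (\<phi> m n (x m))\<bar>"
        using m c by (simp add: phi_nrm dist_real_def)
      also have "\<dots> \<le> nrm (A n) (x n \<ominus>\<^bsub>A n\<^esub> \<phi> m n (x m))"
        using m c by (intro A.abs_nrm_diff) (auto simp: phi_closed)
      also have "\<dots> < e" using N m by simp
      finally show "dist (nrm (A m) (x m)) (nrm (A n) (x n)) < e" .
    qed
  qed
  then show ?thesis using Cauchy_convergent convergent_def by blast
qed

lemma cauchy_eventually_phi:
  assumes "\<And>n. x n \<in> carrier (A n)" "\<And>n. n \<ge> N \<Longrightarrow> x n = \<phi> N n y" "y \<in> carrier (A N)"
  shows "x \<in> S"
proof (rule cauchyI)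
  fix e :: real assume "e > 0"
  then show "\<exists>N. \<forall>n\<ge>N. nrm (A n) (x n \<ominus>\<^bsub>A n\<^esub> \<phi> N n (x N)) < e"
    using assms by (intro exI[of _ N]) (auto simp: phi_id phi_closed)
qed fact

lemma cauchy_mult:
  assumes "x \<in> S" "y \<in> S"
  shows "(\<lambda>n. x n \<otimes>\<^bsub>A n\<^esub> y n) \<in> S"
proof (rule cauchyI)
  note c = cauchy_carrier[OF assms(1)] cauchy_carrier[OF assms(2)]
  show "x n \<otimes>\<^bsub>A n\<^esub> y n \<in> carrier (A n)" for n using c by simp
  obtain K where K: "K \<ge> 0" "\<And>n. nrm (A n) (x n) \<le> K" using cauchy_bounded[OF assms(1)] by blast
  obtain L where L: "L \<ge> 0" "\<And>n. nrm (A n) (y n) \<le> L" using cauchy_bounded[OF assms(2)] by blast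
  note C = A.C_nonneg
  fix e :: real assume e: "e > 0"
  \<comment> \<open>\<open>C * (K + L)\<close> is the Lipschitz constant of multiplication on the
    balls containing the two sequences. Adding 1 keeps the denominator of \<open>d\<close> positive,
    and the factor 2 there leaves room for the strict inequality.\<close>
  define P where "P = C * (K + L) + 1"
  define d where "d = e / (2 * P)"
  have pos: "P > 0" using C K L by (simp add: P_def add_nonneg_pos)
  then have d: "d > 0" using e by (simp add: d_def)
  obtain N1 where N1: "\<And>M n. M \<ge> N1 \<Longrightarrow> n \<ge> M \<Longrightarrow> nrm (A n) (x n \<ominus>\<^bsub>A n\<^esub> \<phi> M n (x M)) < d" using cauchyD[OF assms(1) d] by blast
  obtain N2 where N2: "\<And>M n. M \<ge> N2 \<Longrightarrow> n \<ge> M \<Longrightarrow> nrm (A n) (y n \<ominus>\<^bsub>A n\<^esub> \<phi> M n (y M)) < d" using cauchyD[OF assms(2) d] by blast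
  show "\<exists>N. \<forall>n\<ge>N. nrm (A n) (x n \<otimes>\<^bsub>A n\<^esub> y n \<ominus>\<^bsub>A n\<^esub> \<phi> N n (x N \<otimes>\<^bsub>A N\<^esub> y N)) < e"
  proof (intro exI[of _ "max N1 N2"] allI impI)
    fix n let ?M = "max N1 N2" assume n: "?M \<le> n"
    have "nrm (A n) (x n \<otimes>\<^bsub>A n\<^esub> y n \<ominus>\<^bsub>A n\<^esub> \<phi> ?M n (x ?M \<otimes>\<^bsub>A ?M\<^esub> y ?M)) \<le>
       C * nrm (A n) (x n \<ominus>\<^bsub>A n\<^esub> \<phi> ?M n (x ?M)) * nrm (A n) (y n) + C * nrm (A n) (\<phi> ?M n (x ?M)) * nrm (A n) (y n \<ominus>\<^bsub>A n\<^esub> \<phi> ?M n (y ?M))"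
      using c n by (subst phi_mult) (auto intro!: A.nrm_mult_diff simp: phi_closed)
    also have "\<dots> \<le> C * d * L + C * K * d"
      using c n K L C d N1[of ?M n] N2[of ?M n]
      by (intro add_mono mult_mono mult_nonneg_nonneg) (auto simp: phi_nrm phi_closed less_imp_le)
    also have "\<dots> = d * (C * (K + L))" by (simp add: algebra_simps)
    also have "\<dots> \<le> d * P" using d by (simp add: P_def)
    also have "\<dots> = e / 2" using pos by (simp add: d_def)
    also have "\<dots> < e" using e by simp
    finally show "nrm (A n) (x n \<otimes>\<^bsub>A n\<^esub> y n \<ominus>\<^bsub>A n\<^esub> \<phi> ?M n (x ?M \<otimes>\<^bsub>A ?M\<^esub> y ?M)) < e" .
  qed
qed

lemma cauchy_add:
  assumes "x \<in> S" "y \<in> S"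
  shows "(\<lambda>n. x n \<oplus>\<^bsub>A n\<^esub> y n) \<in> S"
proof (rule cauchyI)
  note c = cauchy_carrier[OF assms(1)] cauchy_carrier[OF assms(2)]
  show "x n \<oplus>\<^bsub>A n\<^esub> y n \<in> carrier (A n)" for n using c by simp
  fix e :: real assume e: "e > 0"
  obtain N1 where N1: "\<And>M n. M \<ge> N1 \<Longrightarrow> n \<ge> M \<Longrightarrow> nrm (A n) (x n \<ominus>\<^bsub>A n\<^esub> \<phi> M n (x M)) < e/2" using cauchyD[OF assms(1), of "e/2"] e by auto
  obtain N2 where N2: "\<And>M n. M \<ge> N2 \<Longrightarrow> n \<ge> M \<Longrightarrow> nrm (A n) (y n \<ominus>\<^bsub>A n\<^esub> \<phi> M n (y M)) < e/2" using cauchyD[OF assms(2), of "e/2"] e by auto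
  show "\<exists>N. \<forall>n\<ge>N. nrm (A n) (x n \<oplus>\<^bsub>A n\<^esub> y n \<ominus>\<^bsub>A n\<^esub> \<phi> N n (x N \<oplus>\<^bsub>A N\<^esub> y N)) < e"
  proof (intro exI[of _ "max N1 N2"] allI impI)
    fix n let ?M = "max N1 N2" assume n: "?M \<le> n"
    have "nrm (A n) (x n \<oplus>\<^bsub>A n\<^esub> y n \<ominus>\<^bsub>A n\<^esub> \<phi> ?M n (x ?M \<oplus>\<^bsub>A ?M\<^esub> y ?M)) \<le>
       nrm (A n) (x n \<ominus>\<^bsub>A n\<^esub> \<phi> ?M n (x ?M)) + nrm (A n) (y n \<ominus>\<^bsub>A n\<^esub> \<phi> ?M n (y ?M))"
      using c n by (subst phi_add) (auto intro!: A.nrm_add_diff simp: phi_closed)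
    also have "\<dots> < e" using N1[of ?M n] N2[of ?M n] n by simp
    finally show "nrm (A n) (x n \<oplus>\<^bsub>A n\<^esub> y n \<ominus>\<^bsub>A n\<^esub> \<phi> ?M n (x ?M \<oplus>\<^bsub>A ?M\<^esub> y ?M)) < e" .
  qed
qed

lemma cauchy_seq_alg: "seq_alg A C S sequentially"
proof
  have 1: "(\<lambda>n. \<one>\<^bsub>A n\<^esub>) \<in> S" by (rule cauchy_eventually_phi[of _ 0 "\<one>\<^bsub>A 0\<^esub>"]) (auto simp: phi_one)
  \<comment> \<open>Scalar multiples are products with a sequence of multiples of 1, so closure
    under scalars reduces to \<open>cauchy_mult\<close>.\<close>
  have const: "(\<lambda>n. c \<odot>\<^bsub>A n\<^esub> \<one>\<^bsub>A n\<^esub>) \<in> S" for c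
    by (rule cauchy_eventually_phi[of _ 0 "c \<odot>\<^bsub>A 0\<^esub> \<one>\<^bsub>A 0\<^esub>"]) (auto simp: phi_one phi_smult)
  show "(\<lambda>n. \<one>\<^bsub>A n\<^esub>) \<in> S" by fact
  show "(\<lambda>n. \<zero>\<^bsub>A n\<^esub>) \<in> S" by (rule cauchy_eventually_phi[of _ 0 "\<zero>\<^bsub>A 0\<^esub>"]) (auto simp: phi_zero)
  fix x assume x: "x \<in> S"
  show "x n \<in> carrier (A n)" for n by (rule cauchy_carrier[OF x])
  show "\<exists>K. \<forall>n. nrm (A n) (x n) \<le> K" using cauchy_bounded[OF x] by metis
  show "\<exists>l. (\<lambda>n. nrm (A n) (x n)) \<longlonglongrightarrow> l" by (rule cauchy_nrm_lim[OF x])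
  show "(\<lambda>n. c \<odot>\<^bsub>A n\<^esub> x n) \<in> S" for c
    using cauchy_mult[OF const[of c] x] cauchy_carrier[OF x] by (simp add: A.smult_mult_left)
qed (auto intro: cauchy_add cauchy_mult)

sublocale seq_alg A C S sequentially by (rule cauchy_seq_alg)

text \<open>The canonical map of \<open>A k\<close> into the limit. \<open>\<phi> k n\<close> is
  meaningful for n >= k only; the zeros in front do not affect the class.\<close>

definition level :: "nat \<Rightarrow> 'a \<Rightarrow> (nat \<Rightarrow> 'a) set" where
  "level k x = cls (\<lambda>n. if n < k then \<zero>\<^bsub>A n\<^esub> else \<phi> k n x)"

lemma level_S: "x \<in> carrier (A k) \<Longrightarrow> (\<lambda>n. if n < k then \<zero>\<^bsub>A n\<^esub> else \<phi> k n x) \<in> S"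
  by (rule cauchy_eventually_phi[of _ k x]) (auto simp: phi_closed)

lemma cls_eqI:
  assumes "x \<in> S" "y \<in> S" "\<And>n. n \<ge> N \<Longrightarrow> x n = y n"
  shows "cls x = cls y"
  using assms by (subst cls_eq_iff)
    (auto intro!: tendsto_eventually eventually_sequentiallyI[of N] simp: cauchy_carrier)

lemma level_eqI:
  assumes "x \<in> carrier (A k)" "y \<in> S" "\<And>n. n \<ge> N \<Longrightarrow> n \<ge> k \<Longrightarrow> y n = \<phi> k n x"
  shows "level k x = cls y"
  unfolding level_def by (rule cls_eqI[of _ _ "max N k"]) (use assms level_S in auto)

lemma level_closed [simp, intro]: "x \<in> carrier (A k) \<Longrightarrow> level k x \<in> carrier Q"
  by (simp add: level_def cls_carrier level_S)

lemma level_add: "x \<in> carrier (A k) \<Longrightarrow> y \<in> carrier (A k) \<Longrightarrow> level k (x \<oplus>\<^bsub>A k\<^esub> y) = level k x \<oplus>\<^bsub>Q\<^esub> level k y"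
  unfolding level_def[of k x] level_def[of k y]
  by (subst Q_add, simp_all add: level_S, rule level_eqI) (auto intro!: S_add level_S simp: phi_add)

lemma level_mult: "x \<in> carrier (A k) \<Longrightarrow> y \<in> carrier (A k) \<Longrightarrow> level k (x \<otimes>\<^bsub>A k\<^esub> y) = level k x \<otimes>\<^bsub>Q\<^esub> level k y"
  unfolding level_def[of k x] level_def[of k y]
  by (subst Q_mult, simp_all add: level_S, rule level_eqI) (auto intro!: S_mult level_S simp: phi_mult)

lemma level_smult: "x \<in> carrier (A k) \<Longrightarrow> level k (c \<odot>\<^bsub>A k\<^esub> x) = c \<odot>\<^bsub>Q\<^esub> level k x"
  unfolding level_def[of k x]
  by (subst Q_smult, simp_all add: level_S, rule level_eqI) (auto intro!: S_smult level_S simp: phi_smult)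

lemma level_one: "level k \<one>\<^bsub>A k\<^esub> = \<one>\<^bsub>Q\<^esub>"
  unfolding Q_one by (rule level_eqI) (auto intro!: S_one simp: phi_one)

lemma level_zero: "level k \<zero>\<^bsub>A k\<^esub> = \<zero>\<^bsub>Q\<^esub>"
  unfolding Q_zero by (rule level_eqI) (auto intro!: S_zero simp: phi_zero)

lemma level_minus: "x \<in> carrier (A k) \<Longrightarrow> level k (\<ominus>\<^bsub>A k\<^esub> x) = \<ominus>\<^bsub>Q\<^esub> level k x"
  using level_smult[of x k "-1"] by (simp add: A.smult_minus_one Q.smult_minus_one)

lemma level_phi: "k \<le> n \<Longrightarrow> x \<in> carrier (A k) \<Longrightarrow> level n (\<phi> k n x) = level k x"
  unfolding level_def[of k x] by (rule level_eqI) (auto simp: phi_closed level_S phi_phi)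

lemma level_nrm: "x \<in> carrier (A k) \<Longrightarrow> nrm Q (level k x) = nrm (A k) x"
  unfolding level_def by (rule Q_nrm_eqI[OF level_S])
    (auto intro!: tendsto_eventually eventually_sequentiallyI[of k] simp: phi_nrm)

lemma level_finsum:
  assumes "finite I" "\<And>i. i \<in> I \<Longrightarrow> f i \<in> carrier (A k)"
  shows "level k (\<Oplus>\<^bsub>A k\<^esub>i\<in>I. f i) = (\<Oplus>\<^bsub>Q\<^esub>i\<in>I. level k (f i))"
  using assms
proof (induction I rule: finite_induct)
  case (insert i I)
  have "level k (\<Oplus>\<^bsub>A k\<^esub>i\<in>insert i I. f i) = level k (f i \<oplus>\<^bsub>A k\<^esub> (\<Oplus>\<^bsub>A k\<^esub>i\<in>I. f i))"
    using insert by (subst A.finsum_insert) auto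
  also have "\<dots> = level k (f i) \<oplus>\<^bsub>Q\<^esub> level k (\<Oplus>\<^bsub>A k\<^esub>i\<in>I. f i)" using insert by (intro level_add A.finsum_closed) auto
  also have "\<dots> = (\<Oplus>\<^bsub>Q\<^esub>i\<in>insert i I. level k (f i))" using insert by (subst Q.finsum_insert) auto
  finally show ?case .
qed (simp add: level_zero)

text \<open>The approximant at level M is the term \<open>x M\<close> of a representative: the tail
  of x stays within epsilon of its image, and the norm of the difference is the limit of these
  distances.\<close>

lemma level_dense:
  assumes "X \<in> carrier Q" "\<epsilon> > 0"
  obtains N where "\<And>n. n \<ge> N \<Longrightarrow> \<exists>x\<in>carrier (A n). nrm Q (X \<ominus>\<^bsub>Q\<^esub> level n x) \<le> \<epsilon>"
proof -
  obtain x where x: "x \<in> S" "X = cls x" by (rule Q_cases[OF assms(1)])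
  obtain N where N: "\<And>M n. M \<ge> N \<Longrightarrow> n \<ge> M \<Longrightarrow> nrm (A n) (x n \<ominus>\<^bsub>A n\<^esub> \<phi> M n (x M)) < \<epsilon>"
    using cauchyD[OF x(1) assms(2)] by blast
  have "nrm Q (X \<ominus>\<^bsub>Q\<^esub> level M (x M)) \<le> \<epsilon>" if "M \<ge> N" for M
  proof -
    let ?y = "\<lambda>n. if n < M then \<zero>\<^bsub>A n\<^esub> else \<phi> M n (x M)"
    have y: "?y \<in> S" using x(1) by (intro level_S cauchy_carrier)
    have "nrm Q (cls (\<lambda>n. x n \<ominus>\<^bsub>A n\<^esub> ?y n)) \<le> \<epsilon>"
      by (rule tendsto_upperbound[OF Q_nrm_lim]) (use x y N that in \<open>auto intro!: S_diff eventually_sequentiallyI[of M] less_imp_le\<close>)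
    then show ?thesis unfolding x(2) level_def by (simp add: Q_diff x(1) y)
  qed
  then show ?thesis using that[of N] x(1) cauchy_carrier by blast
qed

end

locale ind_sys_star = ind_sys +
  assumes nstar: "\<And>n. nstar (A n) C"
    and phi_adj: "\<And>k n x. k \<le> n \<Longrightarrow> x \<in> carrier (A k) \<Longrightarrow> \<phi> k n (adj (A k) x) = adj (A n) (\<phi> k n x)"
begin

sublocale A: nstar "A n" C for n by (rule nstar)

lemma cauchy_adj:
  assumes "x \<in> S" shows "(\<lambda>n. adj (A n) (x n)) \<in> S"
proof (rule cauchyI)
  note c = cauchy_carrier[OF assms(1)]
  show "adj (A n) (x n) \<in> carrier (A n)" for n using c by simp
  fix e :: real assume e: "e > 0"
  define d where "d = e / (C + 1)"
  note C = A.C_nonneg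
  have d: "d > 0" using e C by (simp add: d_def)
  obtain N1 where N1: "\<And>M n. M \<ge> N1 \<Longrightarrow> n \<ge> M \<Longrightarrow> nrm (A n) (x n \<ominus>\<^bsub>A n\<^esub> \<phi> M n (x M)) < d" using cauchyD[OF assms(1) d] by auto
  show "\<exists>N. \<forall>n\<ge>N. nrm (A n) (adj (A n) (x n) \<ominus>\<^bsub>A n\<^esub> \<phi> N n (adj (A N) (x N))) < e"
  proof (intro exI[of _ N1] allI impI)
    fix n assume n: "N1 \<le> n"
    have "nrm (A n) (adj (A n) (x n) \<ominus>\<^bsub>A n\<^esub> \<phi> N1 n (adj (A N1) (x N1))) = nrm (A n) (adj (A n) (x n \<ominus>\<^bsub>A n\<^esub> \<phi> N1 n (x N1)))"
      using n c by (simp add: phi_adj phi_closed A.adj_diff)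
    also have "\<dots> \<le> C * nrm (A n) (x n \<ominus>\<^bsub>A n\<^esub> \<phi> N1 n (x N1))" using n c by (intro A.nrm_adj_le) (auto simp: phi_closed)
    also have "\<dots> \<le> C * d" using N1[of N1 n] n C by (intro mult_left_mono) auto
    also have "\<dots> < (C + 1) * d" using d by simp
    also have "\<dots> = e" using C by (simp add: d_def)
    finally show "nrm (A n) (adj (A n) (x n) \<ominus>\<^bsub>A n\<^esub> \<phi> N1 n (adj (A N1) (x N1))) < e" .
  qed
qed

sublocale seq_star A C S sequentially
  by unfold_locales (auto simp: cauchy_adj A.adj_add A.adj_smult A.adj_mult A.nrm_adj_le)

lemma level_adj: "x \<in> carrier (A k) \<Longrightarrow> level k (adj (A k) x) = adj Q (level k x)"
  unfolding level_def[of k x]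
  by (subst Q_adj, simp_all add: level_S, rule level_eqI) (auto intro!: S_adj level_S simp: phi_adj)

end

lemma (in nring) completion_ind_sys: "ind_sys (\<lambda>_. A) (\<lambda>_ _ x. x) C"
  by unfold_locales (auto simp: smult_add add_smult smult_smult smult_mult_left smult_mult_right nrm_smult nrm_add nrm_mult C_nonneg)

section \<open>Matrix algebras with the operator norm\<close>

text \<open>The Cauchy-Schwarz inequality of the Hilbert A-module of columns indexed by I, in
  squared norm form. Being an inequality between continuous functions of the entries, it passes to
  quotients of sequences.\<close>

definition cs_ineq :: "'a cstar \<Rightarrow> 'i set \<Rightarrow> bool" where
  "cs_ineq A I \<longleftrightarrow> (\<forall>x\<in>I \<rightarrow> carrier A. \<forall>y\<in>I \<rightarrow> carrier A.
     (nrm A (\<Oplus>\<^bsub>A\<^esub>i\<in>I. adj A (x i) \<otimes>\<^bsub>A\<^esub> y i))\<^sup>2 \<le>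
       nrm A (\<Oplus>\<^bsub>A\<^esub>i\<in>I. adj A (x i) \<otimes>\<^bsub>A\<^esub> x i) * nrm A (\<Oplus>\<^bsub>A\<^esub>i\<in>I. adj A (y i) \<otimes>\<^bsub>A\<^esub> y i))"

text \<open>A diagonal operator on columns is bounded by the norms of its entries. The strict bound
  \<open>< c\<close> is deliberate: it is inherited by almost all terms of representing sequences,
  which a bound \<open><= c\<close> would not be.\<close>

definition left_mult_ineq :: "'a cstar \<Rightarrow> 'i set \<Rightarrow> bool" where
  "left_mult_ineq A I \<longleftrightarrow> (\<forall>b\<in>I \<rightarrow> carrier A. \<forall>y\<in>I \<rightarrow> carrier A. \<forall>c. (\<forall>i\<in>I. nrm A (b i) < c) \<longrightarrow>
     nrm A (\<Oplus>\<^bsub>A\<^esub>i\<in>I. adj A (b i \<otimes>\<^bsub>A\<^esub> y i) \<otimes>\<^bsub>A\<^esub> (b i \<otimes>\<^bsub>A\<^esub> y i)) \<le>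
       c\<^sup>2 * nrm A (\<Oplus>\<^bsub>A\<^esub>i\<in>I. adj A (y i) \<otimes>\<^bsub>A\<^esub> y i))"

text \<open>For h the sum of the adj x_i x_i this expresses 0 <= h <= 1 through the norm of 1 - h,
  the form in which the square-root iteration can start.\<close>

definition contraction_ineq :: "'a cstar \<Rightarrow> 'i set \<Rightarrow> bool" where
  "contraction_ineq A I \<longleftrightarrow> (\<forall>x\<in>I \<rightarrow> carrier A. (\<Sum>i\<in>I. (nrm A (x i))\<^sup>2) \<le> 1 \<longrightarrow>
     nrm A (\<one>\<^bsub>A\<^esub> \<ominus>\<^bsub>A\<^esub> (\<Oplus>\<^bsub>A\<^esub>i\<in>I. adj A (x i) \<otimes>\<^bsub>A\<^esub> x i)) \<le> 1)"

definition cstar_id :: "'a cstar \<Rightarrow> bool" where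
  "cstar_id A \<longleftrightarrow> (\<forall>x\<in>carrier A. nrm A (adj A x \<otimes>\<^bsub>A\<^esub> x) = (nrm A x)\<^sup>2)"

lemma (in seq_star) Q_sum_adj_mult:
  assumes "finite I" and x: "\<forall>i\<in>I. x i \<in> S" "\<forall>i\<in>I. a i = cls (x i)"
    and y: "\<forall>i\<in>I. y i \<in> S" "\<forall>i\<in>I. b i = cls (y i)"
  shows "(\<Oplus>\<^bsub>Q\<^esub>i\<in>I. adj Q (a i) \<otimes>\<^bsub>Q\<^esub> b i) = cls (\<lambda>n. \<Oplus>\<^bsub>A n\<^esub>i\<in>I. adj (A n) (x i n) \<otimes>\<^bsub>A n\<^esub> y i n)"
    and "(\<lambda>n. \<Oplus>\<^bsub>A n\<^esub>i\<in>I. adj (A n) (x i n) \<otimes>\<^bsub>A n\<^esub> y i n) \<in> S"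
proof -
  have S: "(\<lambda>n. adj (A n) (x i n) \<otimes>\<^bsub>A n\<^esub> y i n) \<in> S" if "i \<in> I" for i
    using that x y by (intro S_mult S_adj) auto
  have "(\<Oplus>\<^bsub>Q\<^esub>i\<in>I. adj Q (a i) \<otimes>\<^bsub>Q\<^esub> b i) = (\<Oplus>\<^bsub>Q\<^esub>i\<in>I. cls (\<lambda>n. adj (A n) (x i n) \<otimes>\<^bsub>A n\<^esub> y i n))"
    using x y S by (intro Q.finsum_cong') (auto simp: Q_adj Q_mult S_adj cls_carrier)
  also have "\<dots> = cls (\<lambda>n. \<Oplus>\<^bsub>A n\<^esub>i\<in>I. adj (A n) (x i n) \<otimes>\<^bsub>A n\<^esub> y i n)"
    using S by (intro Q_finsum(2) assms) auto
  finally show "(\<Oplus>\<^bsub>Q\<^esub>i\<in>I. adj Q (a i) \<otimes>\<^bsub>Q\<^esub> b i) = cls (\<lambda>n. \<Oplus>\<^bsub>A n\<^esub>i\<in>I. adj (A n) (x i n) \<otimes>\<^bsub>A n\<^esub> y i n)" .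
  show "(\<lambda>n. \<Oplus>\<^bsub>A n\<^esub>i\<in>I. adj (A n) (x i n) \<otimes>\<^bsub>A n\<^esub> y i n) \<in> S"
    using S by (intro Q_finsum(1) assms) auto
qed

lemma (in seq_star) Q_family:
  assumes "a \<in> I \<rightarrow> carrier Q"
  obtains x where "\<forall>i\<in>I. x i \<in> S" "\<forall>i\<in>I. a i = cls (x i)"
proof -
  from assms have "\<forall>i\<in>I. \<exists>x\<in>S. a i = cls x" by (auto simp: carrier_Q)
  then show ?thesis using that by metis
qed

lemma (in seq_star) Q_cs_ineq:
  assumes "finite I" "\<And>n. cs_ineq (A n) I"
  shows "cs_ineq Q I"
  unfolding cs_ineq_def
proof (intro ballI)
  fix a b assume a: "a \<in> I \<rightarrow> carrier Q" and b: "b \<in> I \<rightarrow> carrier Q"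
  obtain x where x: "\<forall>i\<in>I. x i \<in> S" "\<forall>i\<in>I. a i = cls (x i)" using Q_family[OF a] by blast
  obtain y where y: "\<forall>i\<in>I. y i \<in> S" "\<forall>i\<in>I. b i = cls (y i)" using Q_family[OF b] by blast
  note xy = Q_sum_adj_mult[where a=a and b=b and x=x and y=y, OF assms(1) x y]
   and xx = Q_sum_adj_mult[where a=a and b=a and x=x and y=x, OF assms(1) x x]
   and yy = Q_sum_adj_mult[where a=b and b=b and x=y and y=y, OF assms(1) y y]
  have le: "(nrm (A n) (\<Oplus>\<^bsub>A n\<^esub>i\<in>I. adj (A n) (x i n) \<otimes>\<^bsub>A n\<^esub> y i n))\<^sup>2 \<le>
      nrm (A n) (\<Oplus>\<^bsub>A n\<^esub>i\<in>I. adj (A n) (x i n) \<otimes>\<^bsub>A n\<^esub> x i n) * nrm (A n) (\<Oplus>\<^bsub>A n\<^esub>i\<in>I. adj (A n) (y i n) \<otimes>\<^bsub>A n\<^esub> y i n)" for n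
    using assms(2)[of n] x(1) y(1) S_carrier unfolding cs_ineq_def
    by (elim ballE[where x="\<lambda>i. x i n"] ballE[where x="\<lambda>i. y i n"]) auto
  show "(nrm Q (\<Oplus>\<^bsub>Q\<^esub>i\<in>I. adj Q (a i) \<otimes>\<^bsub>Q\<^esub> b i))\<^sup>2
       \<le> nrm Q (\<Oplus>\<^bsub>Q\<^esub>i\<in>I. adj Q (a i) \<otimes>\<^bsub>Q\<^esub> a i) * nrm Q (\<Oplus>\<^bsub>Q\<^esub>i\<in>I. adj Q (b i) \<otimes>\<^bsub>Q\<^esub> b i)"
    unfolding xy(1) xx(1) yy(1)
    by (rule tendsto_le[OF nontriv tendsto_mult[OF Q_nrm_lim[OF xx(2)] Q_nrm_lim[OF yy(2)]] tendsto_power[OF Q_nrm_lim[OF xy(2)]]])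
      (intro always_eventually allI le)
qed

lemma (in seq_star) Q_left_mult_ineq:
  assumes I: "finite I" and lb: "\<And>n. left_mult_ineq (A n) I"
  shows "left_mult_ineq Q I"
  unfolding left_mult_ineq_def
proof (intro ballI allI impI)
  fix b a c assume b: "b \<in> I \<rightarrow> carrier Q" and a: "a \<in> I \<rightarrow> carrier Q" and c: "\<forall>i\<in>I. nrm Q (b i) < c"
  obtain x where x: "\<forall>i\<in>I. x i \<in> S" "\<forall>i\<in>I. a i = cls (x i)" using Q_family[OF a] by blast
  obtain y where y: "\<forall>i\<in>I. y i \<in> S" "\<forall>i\<in>I. b i = cls (y i)" using Q_family[OF b] by blast
  have yx: "\<forall>i\<in>I. (\<lambda>n. y i n \<otimes>\<^bsub>A n\<^esub> x i n) \<in> S" "\<forall>i\<in>I. b i \<otimes>\<^bsub>Q\<^esub> a i = cls (\<lambda>n. y i n \<otimes>\<^bsub>A n\<^esub> x i n)"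
    using x y by (auto simp: S_mult Q_mult)
  note xx = Q_sum_adj_mult[where a=a and b=a and x=x and y=x, OF I x x]
   and yy = Q_sum_adj_mult[where a="\<lambda>i. b i \<otimes>\<^bsub>Q\<^esub> a i" and b="\<lambda>i. b i \<otimes>\<^bsub>Q\<^esub> a i" and x="\<lambda>i n. y i n \<otimes>\<^bsub>A n\<^esub> x i n" and y="\<lambda>i n. y i n \<otimes>\<^bsub>A n\<^esub> x i n", OF I yx yx]
  \<comment> \<open>The strict hypothesis is open, so it passes from the classes to almost all terms
    of their representatives, for the finitely many i at once.\<close>
  have "\<forall>i\<in>I. eventually (\<lambda>n. nrm (A n) (y i n) < c) \<F>"
  proof
    fix i assume i: "i \<in> I"
    then have "((\<lambda>n. nrm (A n) (y i n)) \<longlongrightarrow> nrm Q (b i)) \<F>" using y Q_nrm_lim[of "y i"] by simp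
    then show "eventually (\<lambda>n. nrm (A n) (y i n) < c) \<F>" using c i by (intro order_tendstoD(2)) auto
  qed
  then have "eventually (\<lambda>n. \<forall>i\<in>I. nrm (A n) (y i n) < c) \<F>" using I by (simp add: eventually_ball_finite)
  moreover have "nrm (A n) (\<Oplus>\<^bsub>A n\<^esub>i\<in>I. adj (A n) (y i n \<otimes>\<^bsub>A n\<^esub> x i n) \<otimes>\<^bsub>A n\<^esub> (y i n \<otimes>\<^bsub>A n\<^esub> x i n)) \<le>
      c\<^sup>2 * nrm (A n) (\<Oplus>\<^bsub>A n\<^esub>i\<in>I. adj (A n) (x i n) \<otimes>\<^bsub>A n\<^esub> x i n)" if "\<forall>i\<in>I. nrm (A n) (y i n) < c" for n
    using lb[of n] x(1) y(1) S_carrier that unfolding left_mult_ineq_def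
    by (elim ballE[where x="\<lambda>i. y i n"] ballE[where x="\<lambda>i. x i n"]) auto
  ultimately have ev: "eventually (\<lambda>n. nrm (A n) (\<Oplus>\<^bsub>A n\<^esub>i\<in>I. adj (A n) (y i n \<otimes>\<^bsub>A n\<^esub> x i n) \<otimes>\<^bsub>A n\<^esub> (y i n \<otimes>\<^bsub>A n\<^esub> x i n)) \<le>
      c\<^sup>2 * nrm (A n) (\<Oplus>\<^bsub>A n\<^esub>i\<in>I. adj (A n) (x i n) \<otimes>\<^bsub>A n\<^esub> x i n)) \<F>" by (rule eventually_mono)
  show "nrm Q (\<Oplus>\<^bsub>Q\<^esub>i\<in>I. adj Q (b i \<otimes>\<^bsub>Q\<^esub> a i) \<otimes>\<^bsub>Q\<^esub> (b i \<otimes>\<^bsub>Q\<^esub> a i))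
       \<le> c\<^sup>2 * nrm Q (\<Oplus>\<^bsub>Q\<^esub>i\<in>I. adj Q (a i) \<otimes>\<^bsub>Q\<^esub> a i)"
    unfolding xx(1) yy(1)
    by (rule tendsto_le[OF nontriv tendsto_mult[OF tendsto_const Q_nrm_lim[OF xx(2)]] Q_nrm_lim[OF yy(2)] ev])
qed

lemma (in seq_star) Q_cstar_id:
  assumes "\<And>n. cstar_id (A n)"
  shows "cstar_id Q"
  unfolding cstar_id_def
proof
  fix a assume "a \<in> carrier Q"
  then obtain x where x: "x \<in> S" "a = cls x" by (rule Q_cases)
  show "nrm Q (adj Q a \<otimes>\<^bsub>Q\<^esub> a) = (nrm Q a)\<^sup>2"
    unfolding x(2) Q_adj[OF x(1)] Q_mult[OF S_adj[OF x(1)] x(1)]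
    by (rule Q_nrm_eqI) (use assms x S_carrier in \<open>auto simp: cstar_id_def S_mult S_adj intro!: tendsto_power Q_nrm_lim\<close>)
qed

section \<open>Matrices as operators on a finite-dimensional Hilbert space\<close>

definition mv :: "'j set \<Rightarrow> ('j \<Rightarrow> 'j \<Rightarrow> complex) \<Rightarrow> ('j \<Rightarrow> complex) \<Rightarrow> 'j \<Rightarrow> complex" where
  "mv J x v = (\<lambda>i. \<Sum>j\<in>J. x i j * v j)"

definition vnorm :: "'j set \<Rightarrow> ('j \<Rightarrow> complex) \<Rightarrow> real" where
  "vnorm J v = L2_set (\<lambda>j. cmod (v j)) J"

definition vip :: "'j set \<Rightarrow> ('j \<Rightarrow> complex) \<Rightarrow> ('j \<Rightarrow> complex) \<Rightarrow> complex" where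
  "vip J u v = (\<Sum>j\<in>J. cnj (u j) * v j)"

lemma vnorm_nonneg [simp]: "vnorm J v \<ge> 0" by (simp add: vnorm_def)

lemma vnorm_add: "vnorm J (\<lambda>i. u i + v i) \<le> vnorm J u + vnorm J v"
  unfolding vnorm_def by (rule order_trans[OF L2_set_mono L2_set_triangle_ineq]) (auto simp: norm_triangle_ineq)

lemma vnorm_scale: "vnorm J (\<lambda>i. c * v i) = cmod c * vnorm J v"
  unfolding vnorm_def by (simp add: norm_mult L2_set_right_distrib)

lemma vnorm_sum: "finite I \<Longrightarrow> vnorm J (\<lambda>j. \<Sum>i\<in>I. v i j) \<le> (\<Sum>i\<in>I. vnorm J (v i))"
proof (induction I rule: finite_induct)
  case empty then show ?case by (simp add: vnorm_def L2_set_def)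
next
  case (insert i I) then show ?case using vnorm_add[of J "v i" "\<lambda>j. \<Sum>i\<in>I. v i j"] by simp
qed

lemma vip_self: "vip J v v = of_real ((vnorm J v)\<^sup>2)"
  by (simp add: vip_def vnorm_def L2_set_def sum_nonneg complex_norm_square[symmetric] mult.commute)

lemma vip_bound: "cmod (vip J u v) \<le> vnorm J u * vnorm J v"
proof -
  have "cmod (vip J u v) \<le> (\<Sum>j\<in>J. \<bar>cmod (u j)\<bar> * \<bar>cmod (v j)\<bar>)"
    unfolding vip_def by (rule order_trans[OF norm_sum]) (simp add: norm_mult)
  then show ?thesis using L2_set_mult_ineq[of "\<lambda>j. cmod (u j)" "\<lambda>j. cmod (v j)" J] by (simp add: vnorm_def)
qed

lemma vip_sum: "vip J u (\<lambda>j. \<Sum>i\<in>I. v i j) = (\<Sum>i\<in>I. vip J u (v i))"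
  unfolding vip_def sum_distrib_left by (rule sum.swap)

lemma mv_cong: "(\<And>j. j \<in> J \<Longrightarrow> u j = v j) \<Longrightarrow> mv J x u = mv J x v"
  by (auto simp: mv_def intro!: sum.cong)

lemma vnorm_cong: "(\<And>j. j \<in> J \<Longrightarrow> u j = v j) \<Longrightarrow> vnorm J u = vnorm J v"
  by (auto simp: vnorm_def intro!: L2_set_cong)

lemma vip_adj: "vip J u (mv J x v) = vip J (mv J (\<lambda>i j. cnj (x j i)) u) v"
proof -
  have "vip J u (mv J x v) = (\<Sum>i\<in>J. \<Sum>j\<in>J. cnj (u i) * (x i j * v j))"
    by (simp add: vip_def mv_def sum_distrib_left)
  also have "\<dots> = (\<Sum>j\<in>J. \<Sum>i\<in>J. cnj (u i) * (x i j * v j))" by (rule sum.swap)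
  also have "\<dots> = vip J (mv J (\<lambda>i j. cnj (x j i)) u) v"
    by (simp add: vip_def mv_def sum_distrib_right sum_distrib_left algebra_simps)
  finally show ?thesis .
qed

context
  fixes J :: "'j set"
  assumes fin: "finite J"
begin

abbreviation "MA \<equiv> matrix_algebra J"

lemma MA_simps:
  "x \<otimes>\<^bsub>MA\<^esub> y = (\<lambda>i j. \<Sum>k\<in>J. x i k * y k j)" "\<one>\<^bsub>MA\<^esub> = (\<lambda>i j. if i \<in> J \<and> i = j then 1 else 0)"
  "\<zero>\<^bsub>MA\<^esub> = (\<lambda>i j. 0)" "x \<oplus>\<^bsub>MA\<^esub> y = (\<lambda>i j. x i j + y i j)" "c \<odot>\<^bsub>MA\<^esub> x = (\<lambda>i j. c * x i j)"
  "adj MA x = (\<lambda>i j. cnj (x j i))"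
  "x \<in> carrier MA \<longleftrightarrow> (\<forall>i j. i \<notin> J \<or> j \<notin> J \<longrightarrow> x i j = 0)"
  by (simp_all add: matrix_algebra_def)

lemma MA_nrm: "nrm MA x = (SUP v \<in> {v. vnorm J v \<le> 1}. vnorm J (mv J x v))"
  by (simp add: matrix_algebra_def vnorm_def mv_def)

text \<open>An entrywise estimate, from which the set whose supremum is the operator norm is seen to
  be bounded; the sharp estimate is \<open>vnorm_mv\<close>.\<close>

lemma vnorm_mv_crude: "vnorm J (mv J x v) \<le> (\<Sum>i\<in>J. \<Sum>j\<in>J. cmod (x i j)) * vnorm J v"
proof -
  have "vnorm J (mv J x v) \<le> (\<Sum>i\<in>J. cmod (mv J x v i))"
    unfolding vnorm_def by (rule L2_set_le_sum) auto
  also have "\<dots> \<le> (\<Sum>i\<in>J. \<Sum>j\<in>J. cmod (x i j) * vnorm J v)"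
    unfolding mv_def vnorm_def using fin
    by (intro sum_mono order_trans[OF norm_sum]) (auto simp: norm_mult intro!: mult_left_mono member_le_L2_set)
  finally show ?thesis by (simp add: sum_distrib_right)
qed

lemma MA_bdd: "bdd_above ((\<lambda>v. vnorm J (mv J x v)) ` {v. vnorm J v \<le> 1})"
proof (rule bdd_aboveI2)
  fix v assume "v \<in> {v. vnorm J v \<le> 1}"
  then show "vnorm J (mv J x v) \<le> (\<Sum>i\<in>J. \<Sum>j\<in>J. cmod (x i j)) * 1"
    by (intro order_trans[OF vnorm_mv_crude] mult_left_mono) (auto intro!: sum_nonneg)
qed

lemma vnorm_zero: "vnorm J (\<lambda>_. 0) = 0" by (simp add: vnorm_def L2_set_def)

lemma vnorm_mv: "vnorm J (mv J x v) \<le> nrm MA x * vnorm J v"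
proof (cases "vnorm J v = 0")
  case True
  then show ?thesis using vnorm_mv_crude[of x v] by simp
next
  case False
  define c where "c = complex_of_real (1 / vnorm J v)"
  have "vnorm J (\<lambda>j. c * v j) \<le> 1" using False unfolding vnorm_scale by (simp add: c_def norm_divide)
  then have "vnorm J (mv J x (\<lambda>j. c * v j)) \<le> nrm MA x"
    unfolding MA_nrm by (intro cSUP_upper MA_bdd) auto
  moreover have "mv J x (\<lambda>j. c * v j) = (\<lambda>i. c * mv J x v i)"
    by (simp add: mv_def sum_distrib_left algebra_simps)
  ultimately have "cmod c * vnorm J (mv J x v) \<le> nrm MA x" by (simp add: vnorm_scale)
  moreover have "vnorm J v > 0" using False by (simp add: less_le)
  ultimately show ?thesis by (simp add: c_def norm_divide field_simps)
qed

lemma MA_nrm_le: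
  assumes "\<And>v. vnorm J (mv J x v) \<le> c * vnorm J v" "c \<ge> 0"
  shows "nrm MA x \<le> c"
  unfolding MA_nrm
proof (rule cSUP_least)
  show "{v. vnorm J v \<le> 1} \<noteq> {}" using vnorm_zero by (auto intro!: exI[of _ "\<lambda>_. 0"])
  fix v assume "v \<in> {v. vnorm J v \<le> 1}"
  then show "vnorm J (mv J x v) \<le> c" using assms mult_left_mono[of "vnorm J v" 1 c] order_trans[of "vnorm J (mv J x v)" "c * vnorm J v" c] by auto
qed

lemma MA_nrm_nonneg: "nrm MA x \<ge> 0"
  unfolding MA_nrm by (rule order_trans[OF _ cSUP_upper[OF _ MA_bdd, of "\<lambda>_. 0"]]) (auto simp: vnorm_zero)

text \<open>Testing with u = x v turns the hypothesis into |x v|^2 <= c |x v| |v|.\<close>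

lemma MA_nrm_le_vip:
  assumes "\<And>u v. cmod (vip J u (mv J x v)) \<le> c * vnorm J u * vnorm J v" "c \<ge> 0"
  shows "nrm MA x \<le> c"
proof (rule MA_nrm_le)
  fix v
  let ?w = "mv J x v"
  have "(vnorm J ?w)\<^sup>2 \<le> c * vnorm J ?w * vnorm J v" using assms(1)[of ?w v] by (simp add: vip_self norm_power)
  then have "vnorm J ?w * vnorm J ?w \<le> vnorm J ?w * (c * vnorm J v)" by (simp add: power2_eq_square algebra_simps)
  then show "vnorm J ?w \<le> c * vnorm J v"
    using assms(2) by (cases "vnorm J ?w = 0") (auto simp: less_le)
qed fact

lemma mv_mult: "mv J (x \<otimes>\<^bsub>MA\<^esub> y) v = mv J x (mv J y v)"
proof
  fix i
  have "mv J (x \<otimes>\<^bsub>MA\<^esub> y) v i = (\<Sum>j\<in>J. \<Sum>k\<in>J. x i k * y k j * v j)"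
    by (simp add: mv_def MA_simps sum_distrib_right)
  also have "\<dots> = (\<Sum>k\<in>J. \<Sum>j\<in>J. x i k * y k j * v j)" by (rule sum.swap)
  also have "\<dots> = mv J x (mv J y v) i" by (simp add: mv_def sum_distrib_left algebra_simps)
  finally show "mv J (x \<otimes>\<^bsub>MA\<^esub> y) v i = mv J x (mv J y v) i" .
qed

lemma mv_add: "mv J (x \<oplus>\<^bsub>MA\<^esub> y) v = (\<lambda>i. mv J x v i + mv J y v i)"
  by (simp add: mv_def MA_simps algebra_simps sum.distrib)

lemma mv_smult: "mv J (c \<odot>\<^bsub>MA\<^esub> x) v = (\<lambda>i. c * mv J x v i)"
  by (simp add: mv_def MA_simps algebra_simps sum_distrib_left)

lemma MA_ring: "ring MA"
proof (rule ringI)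
  show "abelian_group MA"
  proof (rule abelian_groupI)
    fix x assume "x \<in> carrier MA"
    then show "\<exists>y\<in>carrier MA. y \<oplus>\<^bsub>MA\<^esub> x = \<zero>\<^bsub>MA\<^esub>"
      by (intro bexI[of _ "\<lambda>i j. - x i j"]) (auto simp: MA_simps)
  qed (auto simp: MA_simps algebra_simps)
  show "monoid MA"
  proof (rule monoidI)
    fix x y z
    show "x \<otimes>\<^bsub>MA\<^esub> y \<otimes>\<^bsub>MA\<^esub> z = x \<otimes>\<^bsub>MA\<^esub> (y \<otimes>\<^bsub>MA\<^esub> z)"
    proof (intro ext)
      fix i j
      have "(x \<otimes>\<^bsub>MA\<^esub> y \<otimes>\<^bsub>MA\<^esub> z) i j = (\<Sum>k\<in>J. \<Sum>l\<in>J. x i l * y l k * z k j)" by (simp add: MA_simps sum_distrib_right)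
      also have "\<dots> = (\<Sum>l\<in>J. \<Sum>k\<in>J. x i l * y l k * z k j)" by (rule sum.swap)
      finally show "(x \<otimes>\<^bsub>MA\<^esub> y \<otimes>\<^bsub>MA\<^esub> z) i j = (x \<otimes>\<^bsub>MA\<^esub> (y \<otimes>\<^bsub>MA\<^esub> z)) i j"
        by (simp add: MA_simps sum_distrib_left algebra_simps)
    qed
  next
    fix x assume x: "x \<in> carrier MA"
    show "\<one>\<^bsub>MA\<^esub> \<otimes>\<^bsub>MA\<^esub> x = x"
    proof (intro ext)
      fix i j
      have "(\<one>\<^bsub>MA\<^esub> \<otimes>\<^bsub>MA\<^esub> x) i j = (\<Sum>k\<in>J. if i = k then x k j else 0)"
        unfolding MA_simps by (rule sum.cong) auto
      then show "(\<one>\<^bsub>MA\<^esub> \<otimes>\<^bsub>MA\<^esub> x) i j = x i j" using fin x by (auto simp: MA_simps)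
    qed
    show "x \<otimes>\<^bsub>MA\<^esub> \<one>\<^bsub>MA\<^esub> = x"
    proof (intro ext)
      fix i j
      have "(x \<otimes>\<^bsub>MA\<^esub> \<one>\<^bsub>MA\<^esub>) i j = (\<Sum>k\<in>J. if k = j then x i k else 0)"
        unfolding MA_simps by (rule sum.cong) auto
      then show "(x \<otimes>\<^bsub>MA\<^esub> \<one>\<^bsub>MA\<^esub>) i j = x i j" using fin x by (auto simp: MA_simps)
    qed
  qed (auto simp: MA_simps)
qed (auto simp: MA_simps algebra_simps sum.distrib)

lemma MA_nrm_adj_le: "nrm MA (adj MA x) \<le> nrm MA x"
proof (rule MA_nrm_le_vip)
  fix u v
  have "vip J u (mv J (adj MA x) v) = vip J (mv J x u) v" by (subst vip_adj) (simp add: MA_simps)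
  also have "cmod \<dots> \<le> vnorm J (mv J x u) * vnorm J v" by (rule vip_bound)
  also have "\<dots> \<le> nrm MA x * vnorm J u * vnorm J v" by (intro mult_right_mono vnorm_mv) auto
  finally show "cmod (vip J u (mv J (adj MA x) v)) \<le> nrm MA x * vnorm J u * vnorm J v" .
qed (rule MA_nrm_nonneg)

lemma MA_nring: "nring MA 1"
proof (rule nring.intro[OF MA_ring], unfold_locales)
  fix x y c assume x: "x \<in> carrier MA"
  have le: "nrm MA (c \<odot>\<^bsub>MA\<^esub> x) \<le> cmod c * nrm MA x" for c x
    by (rule MA_nrm_le) (auto simp: mv_smult vnorm_scale MA_nrm_nonneg mult.assoc intro!: mult_left_mono vnorm_mv)
  show "nrm MA (c \<odot>\<^bsub>MA\<^esub> x) = cmod c * nrm MA x"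
  proof (cases "c = 0")
    case True then show ?thesis using le[of c x] MA_nrm_nonneg[of "c \<odot>\<^bsub>MA\<^esub> x"] by simp
  next
    case False
    \<comment> \<open>The inequality \<open>le\<close> for c and for its inverse together give
      equality.\<close>
    have "inverse c \<odot>\<^bsub>MA\<^esub> (c \<odot>\<^bsub>MA\<^esub> x) = x" using False by (simp add: MA_simps flip: mult.assoc)
    with le[of "inverse c" "c \<odot>\<^bsub>MA\<^esub> x"] have "nrm MA x \<le> nrm MA (c \<odot>\<^bsub>MA\<^esub> x) / cmod c" by (simp add: norm_inverse divide_inverse mult.commute)
    then show ?thesis using le[of c x] False by (simp add: field_simps)
  qed
  show "nrm MA (x \<oplus>\<^bsub>MA\<^esub> y) \<le> nrm MA x + nrm MA y"
    by (rule MA_nrm_le) (auto simp: mv_add algebra_simps MA_nrm_nonneg intro!: order_trans[OF vnorm_add] add_mono order_trans[OF vnorm_mv])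
  show "nrm MA (x \<otimes>\<^bsub>MA\<^esub> y) \<le> 1 * nrm MA x * nrm MA y"
    by (rule MA_nrm_le) (auto simp: mv_mult MA_nrm_nonneg mult.assoc intro!: order_trans[OF vnorm_mv] mult_left_mono vnorm_mv)
qed (auto simp: MA_simps algebra_simps sum_distrib_left)

interpretation MA: nring MA 1 by (rule MA_nring)

lemma MA_nstar: "nstar MA 1"
  by (rule nstar.intro[OF MA_nring], unfold_locales) (auto simp: MA_nrm_adj_le, auto simp: MA_simps algebra_simps)

interpretation MA: nstar MA 1 by (rule MA_nstar)

lemma mv_finsum:
  "finite I \<Longrightarrow> (\<And>i. i \<in> I \<Longrightarrow> f i \<in> carrier MA) \<Longrightarrow> mv J (\<Oplus>\<^bsub>MA\<^esub>i\<in>I. f i) v = (\<lambda>j. \<Sum>i\<in>I. mv J (f i) v j)"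
proof (induction I rule: finite_induct)
  case empty then show ?case by (simp add: MA_simps mv_def)
next
  case (insert i I) then show ?case by (subst MA.finsum_insert) (auto simp: mv_add)
qed

lemma vip_adj': "vip J u (mv J (adj MA x \<otimes>\<^bsub>MA\<^esub> y) v) = vip J (mv J x u) (mv J y v)"
  unfolding mv_mult by (subst vip_adj) (simp add: MA_simps)

lemma vip_sum_adj:
  assumes "finite I" "x \<in> I \<rightarrow> carrier MA" "y \<in> I \<rightarrow> carrier MA"
  shows "vip J u (mv J (\<Oplus>\<^bsub>MA\<^esub>i\<in>I. adj MA (x i) \<otimes>\<^bsub>MA\<^esub> y i) v) = (\<Sum>i\<in>I. vip J (mv J (x i) u) (mv J (y i) v))"
  using assms by (subst mv_finsum) (auto simp: vip_sum vip_adj' Pi_def)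

lemma col_self:
  assumes "finite I" "x \<in> I \<rightarrow> carrier MA"
  shows "vip J v (mv J (\<Oplus>\<^bsub>MA\<^esub>i\<in>I. adj MA (x i) \<otimes>\<^bsub>MA\<^esub> x i) v) = of_real (\<Sum>i\<in>I. (vnorm J (mv J (x i) v))\<^sup>2)"
  using assms by (simp add: vip_sum_adj vip_self)

text \<open>The squared length of the column of the x_i v is the inner product of v with the sum of
  the adj x_i x_i applied to v (\<open>col_self\<close>), which Cauchy-Schwarz bounds.\<close>

lemma col_bound:
  assumes "finite I" "x \<in> I \<rightarrow> carrier MA"
  shows "L2_set (\<lambda>i. vnorm J (mv J (x i) v)) I \<le> sqrt (nrm MA (\<Oplus>\<^bsub>MA\<^esub>i\<in>I. adj MA (x i) \<otimes>\<^bsub>MA\<^esub> x i)) * vnorm J v"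
proof -
  let ?h = "\<Oplus>\<^bsub>MA\<^esub>i\<in>I. adj MA (x i) \<otimes>\<^bsub>MA\<^esub> x i"
  have "(\<Sum>i\<in>I. (vnorm J (mv J (x i) v))\<^sup>2) = cmod (vip J v (mv J ?h v))"
    unfolding col_self[OF assms] norm_of_real by (simp add: sum_nonneg)
  also have "\<dots> \<le> vnorm J v * (nrm MA ?h * vnorm J v)"
    by (intro order_trans[OF vip_bound] mult_left_mono vnorm_mv) auto
  finally have "L2_set (\<lambda>i. vnorm J (mv J (x i) v)) I \<le> sqrt (nrm MA ?h * (vnorm J v)\<^sup>2)"
    unfolding L2_set_def by (intro real_sqrt_le_mono) (simp add: power2_eq_square algebra_simps)
  then show ?thesis by (simp add: real_sqrt_mult)
qed

text \<open>Cauchy-Schwarz twice: in the Hilbert space for each i, then for the sum over I;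
  \<open>col_bound\<close> estimates the two resulting lengths.\<close>

lemma MA_cs: "finite I \<Longrightarrow> cs_ineq MA I"
  unfolding cs_ineq_def
proof (intro ballI)
  fix x y assume *: "finite I" "x \<in> I \<rightarrow> carrier MA" "y \<in> I \<rightarrow> carrier MA"
  let ?x = "nrm MA (\<Oplus>\<^bsub>MA\<^esub>i\<in>I. adj MA (x i) \<otimes>\<^bsub>MA\<^esub> x i)" and ?y = "nrm MA (\<Oplus>\<^bsub>MA\<^esub>i\<in>I. adj MA (y i) \<otimes>\<^bsub>MA\<^esub> y i)"
  have "nrm MA (\<Oplus>\<^bsub>MA\<^esub>i\<in>I. adj MA (x i) \<otimes>\<^bsub>MA\<^esub> y i) \<le> sqrt ?x * sqrt ?y"
  proof (rule MA_nrm_le_vip)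
    fix u v
    have "cmod (vip J u (mv J (\<Oplus>\<^bsub>MA\<^esub>i\<in>I. adj MA (x i) \<otimes>\<^bsub>MA\<^esub> y i) v)) \<le> (\<Sum>i\<in>I. vnorm J (mv J (x i) u) * vnorm J (mv J (y i) v))"
      unfolding vip_sum_adj[OF *] by (intro order_trans[OF norm_sum] sum_mono vip_bound)
    also have "\<dots> \<le> L2_set (\<lambda>i. vnorm J (mv J (x i) u)) I * L2_set (\<lambda>i. vnorm J (mv J (y i) v)) I"
      using L2_set_mult_ineq[of "\<lambda>i. vnorm J (mv J (x i) u)" "\<lambda>i. vnorm J (mv J (y i) v)" I] by simp
    also have "\<dots> \<le> (sqrt ?x * vnorm J u) * (sqrt ?y * vnorm J v)"
      using * by (intro mult_mono col_bound) (auto simp: MA_nrm_nonneg)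
    finally show "cmod (vip J u (mv J (\<Oplus>\<^bsub>MA\<^esub>i\<in>I. adj MA (x i) \<otimes>\<^bsub>MA\<^esub> y i) v)) \<le> sqrt ?x * sqrt ?y * vnorm J u * vnorm J v"
      by (simp add: algebra_simps)
  qed (simp add: MA_nrm_nonneg)
  from power_mono[OF this MA_nrm_nonneg, of 2]
  show "(nrm MA (\<Oplus>\<^bsub>MA\<^esub>i\<in>I. adj MA (x i) \<otimes>\<^bsub>MA\<^esub> y i))\<^sup>2 \<le> ?x * ?y"
    by (simp add: power_mult_distrib MA_nrm_nonneg)
qed

text \<open>As for \<open>MA_cs\<close>, after each factor b_i has been estimated by c on
  vectors.\<close>

lemma MA_lb: "finite I \<Longrightarrow> left_mult_ineq MA I"
  unfolding left_mult_ineq_def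
proof (intro ballI allI impI)
  fix b y c assume *: "finite I" "b \<in> I \<rightarrow> carrier MA" "y \<in> I \<rightarrow> carrier MA" and c: "\<forall>i\<in>I. nrm MA (b i) < c"
  let ?y = "nrm MA (\<Oplus>\<^bsub>MA\<^esub>i\<in>I. adj MA (y i) \<otimes>\<^bsub>MA\<^esub> y i)"
  have vb: "vnorm J (mv J (b i) v) \<le> c * vnorm J v" "0 \<le> c" if "i \<in> I" for i v
  proof -
    show "vnorm J (mv J (b i) v) \<le> c * vnorm J v"
      using c that by (intro order_trans[OF vnorm_mv] mult_right_mono) (auto simp: less_imp_le)
    show "0 \<le> c" using c that MA_nrm_nonneg[of "b i"] by (meson less_imp_le order_trans)
  qed
  show "nrm MA (\<Oplus>\<^bsub>MA\<^esub>i\<in>I. adj MA (b i \<otimes>\<^bsub>MA\<^esub> y i) \<otimes>\<^bsub>MA\<^esub> (b i \<otimes>\<^bsub>MA\<^esub> y i)) \<le> c\<^sup>2 * ?y"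
  proof (rule MA_nrm_le_vip)
    fix u v
    have "cmod (vip J u (mv J (\<Oplus>\<^bsub>MA\<^esub>i\<in>I. adj MA (b i \<otimes>\<^bsub>MA\<^esub> y i) \<otimes>\<^bsub>MA\<^esub> (b i \<otimes>\<^bsub>MA\<^esub> y i)) v))
       \<le> (\<Sum>i\<in>I. vnorm J (mv J (b i \<otimes>\<^bsub>MA\<^esub> y i) u) * vnorm J (mv J (b i \<otimes>\<^bsub>MA\<^esub> y i) v))"
      using * by (subst vip_sum_adj) (auto simp: Pi_iff intro!: order_trans[OF norm_sum] sum_mono vip_bound)
    also have "\<dots> \<le> (\<Sum>i\<in>I. (c * vnorm J (mv J (y i) u)) * (c * vnorm J (mv J (y i) v)))"
      unfolding mv_mult by (intro sum_mono mult_mono vb) (auto dest: vb(2))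
    also have "\<dots> = c\<^sup>2 * (\<Sum>i\<in>I. vnorm J (mv J (y i) u) * vnorm J (mv J (y i) v))"
      by (simp add: sum_distrib_left power2_eq_square algebra_simps)
    also have "\<dots> \<le> c\<^sup>2 * (L2_set (\<lambda>i. vnorm J (mv J (y i) u)) I * L2_set (\<lambda>i. vnorm J (mv J (y i) v)) I)"
      using L2_set_mult_ineq[of "\<lambda>i. vnorm J (mv J (y i) u)" "\<lambda>i. vnorm J (mv J (y i) v)" I] by (intro mult_left_mono) simp_all
    also have "\<dots> \<le> c\<^sup>2 * ((sqrt ?y * vnorm J u) * (sqrt ?y * vnorm J v))"
      using * by (intro mult_mono mult_left_mono col_bound) (auto simp: MA_nrm_nonneg)
    also have "\<dots> = c\<^sup>2 * ((sqrt ?y * sqrt ?y) * vnorm J u * vnorm J v)" by (simp only: mult_ac)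
    also have "\<dots> = c\<^sup>2 * ?y * vnorm J u * vnorm J v" by (simp add: MA_nrm_nonneg)
    finally show "cmod (vip J u (mv J (\<Oplus>\<^bsub>MA\<^esub>i\<in>I. adj MA (b i \<otimes>\<^bsub>MA\<^esub> y i) \<otimes>\<^bsub>MA\<^esub> (b i \<otimes>\<^bsub>MA\<^esub> y i)) v)) \<le> c\<^sup>2 * ?y * vnorm J u * vnorm J v" .
  qed (simp add: MA_nrm_nonneg)
qed

text \<open>One inequality comes from the adjoint having no larger norm; the other from |x v|^2
  being the inner product of v with adj x x v.\<close>

lemma MA_cstar_id: "cstar_id MA"
  unfolding cstar_id_def
proof
  fix x assume x: "x \<in> carrier MA"
  let ?h = "nrm MA (adj MA x \<otimes>\<^bsub>MA\<^esub> x)"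
  have "?h \<le> nrm MA (adj MA x) * nrm MA x" using MA.nrm_mult[of "adj MA x" x] x by simp
  also have "\<dots> \<le> (nrm MA x)\<^sup>2" unfolding power2_eq_square by (intro mult_right_mono MA_nrm_adj_le MA_nrm_nonneg)
  finally have 1: "?h \<le> (nrm MA x)\<^sup>2" .
  have "nrm MA x \<le> sqrt ?h"
  proof (rule MA_nrm_le)
    fix v
    have "(vnorm J (mv J x v))\<^sup>2 = cmod (vip J v (mv J (adj MA x \<otimes>\<^bsub>MA\<^esub> x) v))"
      by (simp add: vip_adj' vip_self norm_power)
    also have "\<dots> \<le> vnorm J v * (?h * vnorm J v)" by (intro order_trans[OF vip_bound] mult_left_mono vnorm_mv) auto
    finally have "(vnorm J (mv J x v))\<^sup>2 \<le> (sqrt ?h * vnorm J v)\<^sup>2"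
      by (simp add: power_mult_distrib MA_nrm_nonneg) (simp add: power2_eq_square algebra_simps)
    then show "vnorm J (mv J x v) \<le> sqrt ?h * vnorm J v" by (rule power2_le_imp_le) (simp add: MA_nrm_nonneg)
  qed (simp add: MA_nrm_nonneg)
  from power_mono[OF this MA_nrm_nonneg, of 2] 1 show "?h = (nrm MA x)\<^sup>2" by (simp add: MA_nrm_nonneg)
qed

text \<open>With s the inner product of v and h v, |v - h v|^2 = |v|^2 - 2 s + |h v|^2. Since s is
  the sum of the |x_i v|^2, and h v is the sum of the adj x_i (x_i v) with square-summed norms at
  most 1, |h v|^2 <= s; so the length of v does not grow.\<close>

lemma MA_contr: "finite I \<Longrightarrow> contraction_ineq MA I"
  unfolding contraction_ineq_def
proof (intro ballI impI)
  fix x assume *: "finite I" "x \<in> I \<rightarrow> carrier MA" "(\<Sum>i\<in>I. (nrm MA (x i))\<^sup>2) \<le> 1"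
  let ?h = "\<Oplus>\<^bsub>MA\<^esub>i\<in>I. adj MA (x i) \<otimes>\<^bsub>MA\<^esub> x i"
  have h: "?h \<in> carrier MA" using * by (intro MA.finsum_closed) auto
  show "nrm MA (\<one>\<^bsub>MA\<^esub> \<ominus>\<^bsub>MA\<^esub> ?h) \<le> 1"
  proof (rule MA_nrm_le)
    fix v
    let ?w = "mv J ?h v"
    define s where "s = (\<Sum>i\<in>I. (vnorm J (mv J (x i) v))\<^sup>2)"
    have s: "s \<ge> 0" by (simp add: s_def sum_nonneg)
    have "vnorm J (mv J (\<one>\<^bsub>MA\<^esub> \<ominus>\<^bsub>MA\<^esub> ?h) v) = vnorm J (\<lambda>j. v j - ?w j)"
    proof (rule vnorm_cong)
      fix j assume j: "j \<in> J"
      have "mv J \<one>\<^bsub>MA\<^esub> v j = v j" using fin j by (simp add: mv_def MA_simps if_distrib[of "\<lambda>x. x * y" for y] sum.delta' cong: if_cong)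
      then show "mv J (\<one>\<^bsub>MA\<^esub> \<ominus>\<^bsub>MA\<^esub> ?h) v j = v j - ?w j"
        using h by (simp add: a_minus_def mv_add mv_smult flip: MA.smult_minus_one)
    qed
    moreover have "complex_of_real ((vnorm J (\<lambda>j. v j - ?w j))\<^sup>2) = vip J v v - vip J v ?w - vip J ?w v + vip J ?w ?w"
      unfolding vip_self[symmetric] by (simp add: vip_def algebra_simps sum.distrib sum_subtractf)
    moreover have "vip J v ?w = of_real s" unfolding s_def by (rule col_self[OF *(1,2)])
    moreover have "vip J ?w v = cnj (vip J v ?w)" by (simp add: vip_def mult.commute)
    ultimately have "complex_of_real ((vnorm J (mv J (\<one>\<^bsub>MA\<^esub> \<ominus>\<^bsub>MA\<^esub> ?h) v))\<^sup>2) = of_real ((vnorm J v)\<^sup>2 - 2 * s + (vnorm J ?w)\<^sup>2)"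
      by (simp add: vip_self)
    then have eq: "(vnorm J (mv J (\<one>\<^bsub>MA\<^esub> \<ominus>\<^bsub>MA\<^esub> ?h) v))\<^sup>2 = (vnorm J v)\<^sup>2 - 2 * s + (vnorm J ?w)\<^sup>2"
      by (simp only: of_real_eq_iff)
    have "?w = (\<lambda>j. \<Sum>i\<in>I. mv J (adj MA (x i)) (mv J (x i) v) j)" using * by (subst mv_finsum) (auto simp: mv_mult)
    then have "vnorm J ?w \<le> (\<Sum>i\<in>I. vnorm J (mv J (adj MA (x i)) (mv J (x i) v)))" using vnorm_sum[OF *(1)] by simp
    also have "\<dots> \<le> (\<Sum>i\<in>I. nrm MA (x i) * vnorm J (mv J (x i) v))"
      by (intro sum_mono order_trans[OF vnorm_mv] mult_right_mono MA_nrm_adj_le) simp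
    also have "\<dots> \<le> L2_set (\<lambda>i. nrm MA (x i)) I * L2_set (\<lambda>i. vnorm J (mv J (x i) v)) I"
      using L2_set_mult_ineq[of "\<lambda>i. nrm MA (x i)" "\<lambda>i. vnorm J (mv J (x i) v)" I] by (simp add: MA_nrm_nonneg)
    also have "\<dots> \<le> 1 * sqrt s" using * by (intro mult_mono) (auto simp: L2_set_def s_def sum_nonneg)
    finally have "(vnorm J ?w)\<^sup>2 \<le> s" using power_mono[of "vnorm J ?w" "sqrt s" 2] s by simp
    then have "(vnorm J (mv J (\<one>\<^bsub>MA\<^esub> \<ominus>\<^bsub>MA\<^esub> ?h) v))\<^sup>2 \<le> (vnorm J v)\<^sup>2" using eq s by simp
    then show "vnorm J (mv J (\<one>\<^bsub>MA\<^esub> \<ominus>\<^bsub>MA\<^esub> ?h) v) \<le> 1 * vnorm J v" by (auto dest: power2_le_imp_le)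
  qed simp
qed

lemma MA_finsum_entry:
  "finite I \<Longrightarrow> (\<And>i. i \<in> I \<Longrightarrow> f i \<in> carrier MA) \<Longrightarrow> (\<Oplus>\<^bsub>MA\<^esub>i\<in>I. f i) s t = (\<Sum>i\<in>I. f i s t)"
proof (induction I rule: finite_induct)
  case (insert i I) then show ?case by (subst MA.finsum_insert) (auto simp: MA_simps)
qed (simp add: MA_simps)

end

section \<open>Square roots\<close>

text \<open>A fixed point y of y = (t + y^2)/2 with t = 1 - h satisfies (1 - y)^2 = h, so 1 - y is a
  square root of h. Started at 0, the iterates are polynomials in t and commute with whatever
  commutes with t.\<close>

primrec sqrt_iter :: "'a cstar \<Rightarrow> 'a \<Rightarrow> nat \<Rightarrow> 'a" where
  "sqrt_iter A t 0 = \<zero>\<^bsub>A\<^esub>"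
| "sqrt_iter A t (Suc k) = (1/2) \<odot>\<^bsub>A\<^esub> (t \<oplus>\<^bsub>A\<^esub> sqrt_iter A t k \<otimes>\<^bsub>A\<^esub> sqrt_iter A t k)"

text \<open>The same iteration for the number t = 1, the worst case: it majorises norms and
  increments of \<open>sqrt_iter\<close>, with rates that do not depend on the algebra.\<close>

primrec sqrt_major :: "nat \<Rightarrow> real" where
  "sqrt_major 0 = 0"
| "sqrt_major (Suc k) = (1 + (sqrt_major k)\<^sup>2) / 2"

lemma sqrt_major_range: "0 \<le> sqrt_major k" "sqrt_major k \<le> 1"
proof (induction k)
  case (Suc k)
  { case 1 show ?case by simp next
    case 2 have "(sqrt_major k)\<^sup>2 \<le> 1" using Suc by (simp add: power_le_one) then show ?case by simp }
qed simp_all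

lemma sqrt_major_mono: "sqrt_major k \<le> sqrt_major (Suc k)"
proof -
  have "0 \<le> (1 - sqrt_major k)\<^sup>2" by simp
  then show ?thesis by (simp add: power2_eq_square algebra_simps)
qed

text \<open>The sequence is increasing and bounded, and its limit solves l = (1 + l^2)/2, which has
  the double root 1.\<close>

lemma sqrt_major_tendsto: "sqrt_major \<longlonglongrightarrow> 1"
proof -
  have "incseq sqrt_major" by (rule incseq_SucI) (rule sqrt_major_mono)
  moreover have "\<forall>k. sqrt_major k \<le> 1" using sqrt_major_range by blast
  ultimately obtain l where l: "sqrt_major \<longlonglongrightarrow> l"
    using incseq_convergent[of sqrt_major 1] by metis
  then have "(\<lambda>k. sqrt_major (Suc k)) \<longlonglongrightarrow> (1 + l\<^sup>2) / 2" by (auto intro!: tendsto_intros)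
  then have "(1 + l\<^sup>2) / 2 = l" using LIMSEQ_unique LIMSEQ_Suc[OF l] by blast
  then have "(l - 1)\<^sup>2 = 0" by (simp add: power2_eq_square algebra_simps)
  then show ?thesis using l by simp
qed

locale nstar1 = nstar A 1 for A :: "'a cstar" (structure)
begin

lemma sqrt_iter_closed [simp, intro]: "t \<in> carrier A \<Longrightarrow> sqrt_iter A t k \<in> carrier A"
  by (induction k) auto

lemma sqrt_iter_nrm: "t \<in> carrier A \<Longrightarrow> nrm A t \<le> 1 \<Longrightarrow> nrm A (sqrt_iter A t k) \<le> sqrt_major k"
proof (induction k)
  case (Suc k)
  let ?s = "sqrt_iter A t k"
  have "nrm A (?s \<otimes> ?s) \<le> (sqrt_major k)\<^sup>2"
    using nrm_mult[of ?s ?s] Suc mult_mono[of "nrm A ?s" "sqrt_major k" "nrm A ?s" "sqrt_major k"] sqrt_major_range[of k]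
    by (simp add: power2_eq_square)
  then show ?case using nrm_add[of t "?s \<otimes> ?s"] Suc.prems by (simp add: nrm_smult)
qed simp

lemma sqrt_iter_commutes:
  "t \<in> carrier A \<Longrightarrow> z \<in> carrier A \<Longrightarrow> z \<otimes> t = t \<otimes> z \<Longrightarrow> z \<otimes> sqrt_iter A t k = sqrt_iter A t k \<otimes> z"
proof (induction k)
  case (Suc k)
  let ?s = "sqrt_iter A t k"
  have "z \<otimes> (?s \<otimes> ?s) = (z \<otimes> ?s) \<otimes> ?s" using Suc.prems by (simp add: m_assoc)
  also have "\<dots> = ?s \<otimes> (z \<otimes> ?s)" using Suc by (simp add: m_assoc)
  also have "\<dots> = (?s \<otimes> ?s) \<otimes> z" using Suc by (simp add: m_assoc)
  finally show ?case using Suc.prems by (simp add: smult_mult_left smult_mult_right l_distr r_distr)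
qed simp

text \<open>All iterates commute, so the difference of squares factors: y_{k+2} - y_{k+1} = (y_{k+1}
  - y_k)(y_{k+1} + y_k)/2. The majorant obeys the same recursion, so the bound propagates.\<close>

lemma sqrt_iter_step:
  assumes t: "t \<in> carrier A" "nrm A t \<le> 1"
  shows "nrm A (sqrt_iter A t (Suc k) \<ominus> sqrt_iter A t k) \<le> sqrt_major (Suc k) - sqrt_major k"
proof (induction k)
  case 0 then show ?case using t by (simp add: nrm_smult)
next
  case (Suc k)
  let ?a = "sqrt_iter A t k" and ?b = "sqrt_iter A t (Suc k)"
  have c: "?a \<in> carrier A" "?b \<in> carrier A" using t by (auto simp del: sqrt_iter.simps)
  have comm: "?a \<otimes> ?b = ?b \<otimes> ?a"
    using t c by (intro sqrt_iter_commutes) (auto simp: sqrt_iter_commutes simp del: sqrt_iter.simps)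
  have "sqrt_iter A t (Suc (Suc k)) \<ominus> ?b = (1/2) \<odot> (t \<oplus> ?b \<otimes> ?b) \<ominus> (1/2) \<odot> (t \<oplus> ?a \<otimes> ?a)" by simp
  also have "\<dots> = (1/2) \<odot> ((t \<oplus> ?b \<otimes> ?b) \<ominus> (t \<oplus> ?a \<otimes> ?a))" using t c by (intro smult_diff[symmetric]) auto
  also have "(t \<oplus> ?b \<otimes> ?b) \<ominus> (t \<oplus> ?a \<otimes> ?a) = (?b \<otimes> ?b) \<ominus> (?a \<otimes> ?a)"
    using t c by (simp add: a_minus_def minus_add a_ac r_neg1 r_neg2 del: sqrt_iter.simps)
  also have "\<dots> = (?b \<ominus> ?a) \<otimes> ?b \<oplus> ?a \<otimes> (?b \<ominus> ?a)" using c by (intro mult_diff_eq)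
  also have "?a \<otimes> (?b \<ominus> ?a) = (?b \<ominus> ?a) \<otimes> ?a"
    using c comm by (simp add: a_minus_def l_distr r_distr l_minus r_minus del: sqrt_iter.simps)
  also have "(?b \<ominus> ?a) \<otimes> ?b \<oplus> (?b \<ominus> ?a) \<otimes> ?a = (?b \<ominus> ?a) \<otimes> (?b \<oplus> ?a)" using c by (intro r_distr[symmetric]) auto
  finally have "nrm A (sqrt_iter A t (Suc (Suc k)) \<ominus> ?b) = nrm A ((?b \<ominus> ?a) \<otimes> (?b \<oplus> ?a)) / 2"
    using c by (simp add: nrm_smult del: sqrt_iter.simps)
  also have "\<dots> \<le> (nrm A (?b \<ominus> ?a) * (nrm A ?b + nrm A ?a)) / 2"
    using c nrm_mult[of "?b \<ominus> ?a" "?b \<oplus> ?a"] mult_left_mono[OF nrm_add[of ?b ?a] nrm_nonneg[of "?b \<ominus> ?a"]]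
    by (simp del: sqrt_iter.simps)
  also have "\<dots> \<le> ((sqrt_major (Suc k) - sqrt_major k) * (sqrt_major (Suc k) + sqrt_major k)) / 2"
    using c Suc t sqrt_iter_nrm[OF t, of "Suc k"] sqrt_iter_nrm[OF t, of k] sqrt_major_mono[of k]
    by (intro divide_right_mono mult_mono add_mono) (auto simp del: sqrt_iter.simps)
  also have "\<dots> = sqrt_major (Suc (Suc k)) - sqrt_major (Suc k)"
    by (simp only: sqrt_major.simps(2)[of "Suc k"] sqrt_major.simps(2)[of k]) (simp add: power2_eq_square field_simps)
  finally show ?case .
qed

lemma sqrt_iter_dist:
  assumes t: "t \<in> carrier A" "nrm A t \<le> 1" and "k \<le> l"
  shows "nrm A (sqrt_iter A t l \<ominus> sqrt_iter A t k) \<le> sqrt_major l - sqrt_major k"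
  using \<open>k \<le> l\<close>
proof (induction l rule: dec_induct)
  case base then show ?case using t by simp
next
  case (step l)
  then show ?case using nrm_triangle[of "sqrt_iter A t (Suc l)" "sqrt_iter A t l" "sqrt_iter A t k"] sqrt_iter_step[OF t, of l] t
    by (simp del: sqrt_iter.simps sqrt_major.simps)
qed

text \<open>The factor k is crude; it suffices because \<open>sqrt_diag_cauchy\<close> fixes the
  number of steps before choosing the level.\<close>

lemma sqrt_iter_lipschitz:
  assumes t: "t \<in> carrier A" "nrm A t \<le> 1" and u: "u \<in> carrier A" "nrm A u \<le> 1"
  shows "nrm A (sqrt_iter A t k \<ominus> sqrt_iter A u k) \<le> k * nrm A (t \<ominus> u)"
proof (induction k)
  case (Suc k)
  let ?a = "sqrt_iter A t k" and ?b = "sqrt_iter A u k"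
  have c: "?a \<in> carrier A" "?b \<in> carrier A" using t u by auto
  have le1: "nrm A ?a \<le> 1" "nrm A ?b \<le> 1" using sqrt_iter_nrm t u sqrt_major_range order_trans by blast+
  have "nrm A ((?a \<otimes> ?a) \<ominus> (?b \<otimes> ?b)) \<le> 1 * nrm A (?a \<ominus> ?b) * nrm A ?a + 1 * nrm A ?b * nrm A (?a \<ominus> ?b)"
    using c by (intro nrm_mult_diff) auto
  also have "\<dots> \<le> 1 * nrm A (?a \<ominus> ?b) * 1 + 1 * 1 * nrm A (?a \<ominus> ?b)"
    using c le1 by (intro add_mono mult_mono) auto
  finally have 1: "nrm A ((?a \<otimes> ?a) \<ominus> (?b \<otimes> ?b)) \<le> 2 * nrm A (?a \<ominus> ?b)" by simp
  have "nrm A (sqrt_iter A t (Suc k) \<ominus> sqrt_iter A u (Suc k)) = nrm A ((t \<oplus> ?a \<otimes> ?a) \<ominus> (u \<oplus> ?b \<otimes> ?b)) / 2"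
    using t u c by (simp add: nrm_smult flip: smult_diff)
  also have "\<dots> \<le> (nrm A (t \<ominus> u) + nrm A ((?a \<otimes> ?a) \<ominus> (?b \<otimes> ?b))) / 2"
    using t u c by (intro divide_right_mono nrm_add_diff) auto
  also have "\<dots> \<le> (nrm A (t \<ominus> u) + 2 * (k * nrm A (t \<ominus> u))) / 2" using 1 Suc by (intro divide_right_mono) auto
  also have "\<dots> \<le> (2 * nrm A (t \<ominus> u) + 2 * (k * nrm A (t \<ominus> u))) / 2" using t u by (intro divide_right_mono) auto
  also have "\<dots> = Suc k * nrm A (t \<ominus> u)" by (simp add: algebra_simps)
  finally show ?case .
qed (use t u in simp)

lemma sqrt_iter_adj: "t \<in> carrier A \<Longrightarrow> adj A t = t \<Longrightarrow> adj A (sqrt_iter A t k) = sqrt_iter A t k"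
  by (induction k) (auto simp: adj_add adj_smult adj_mult)

text \<open>The defect of the k-th approximate square root is twice the next increment, which
  \<open>sqrt_iter_step\<close> controls.\<close>

lemma sqrt_iter_square:
  assumes "h \<in> carrier A" "t = \<one> \<ominus> h"
  defines "y \<equiv> sqrt_iter A t"
  shows "((\<one> \<ominus> y k) \<otimes> (\<one> \<ominus> y k)) \<ominus> h = 2 \<odot> (y (Suc k) \<ominus> y k)"
proof -
  have t: "t \<in> carrier A" using assms by auto
  then have y: "y k \<in> carrier A" "y (Suc k) \<in> carrier A" unfolding y_def by (auto simp del: sqrt_iter.simps)
  have "2 \<odot> y (Suc k) = t \<oplus> y k \<otimes> y k" using t y unfolding y_def by (simp add: smult_smult)
  then have yy: "2 \<odot> (y (Suc k) \<ominus> y k) = (t \<oplus> y k \<otimes> y k) \<ominus> (y k \<oplus> y k)"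
    using y add_smult[of "y k" 1 1] by (simp add: smult_diff)
  show ?thesis unfolding yy assms(2) using assms(1) y(1)
    by (simp add: a_minus_def l_distr r_distr l_minus r_minus minus_add a_ac)
qed

end

section \<open>Square roots in inductive limits\<close>

locale ind_sys_star1 = ind_sys_star A \<phi> 1 for A :: "nat \<Rightarrow> 'a cstar" and \<phi>
begin

sublocale A: nstar1 "A n" for n by unfold_locales

lemma phi_sqrt_iter:
  assumes "k \<le> n" "t \<in> carrier (A k)"
  shows "\<phi> k n (sqrt_iter (A k) t m) = sqrt_iter (A n) (\<phi> k n t) m"
  using assms by (induction m) (auto simp: phi_zero phi_smult phi_add phi_mult phi_closed)

text \<open>Diagonal choice: n steps at level n. The majorant makes the tail of the iteration small
  uniformly in the level, which fixes k; then k steps depend on t in a Lipschitz way, which fixes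
  the level. Each of the three pieces of the triangle inequality costs at most e/4.\<close>

lemma sqrt_diag_cauchy:
  assumes t: "t \<in> S" "\<And>n. nrm (A n) (t n) \<le> 1"
  shows "(\<lambda>n. sqrt_iter (A n) (t n) n) \<in> S"
proof (rule cauchyI)
  note c = cauchy_carrier[OF t(1)]
  show "sqrt_iter (A n) (t n) n \<in> carrier (A n)" for n using c by auto
  fix e :: real assume e: "e > 0"
  have "\<exists>k. \<forall>n\<ge>k. dist (sqrt_major n) 1 < e / 4" using sqrt_major_tendsto e unfolding lim_sequentially
    by (metis zero_less_divide_iff zero_less_numeral)
  then obtain k where "dist (sqrt_major k) 1 < e / 4" by blast
  then have k: "1 - sqrt_major k < e / 4" unfolding dist_real_def by linarith
  have "e / (4 * (k + 1)) > 0" using e by simp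
  then obtain N where N: "\<And>M n. M \<ge> N \<Longrightarrow> n \<ge> M \<Longrightarrow> nrm (A n) (t n \<ominus>\<^bsub>A n\<^esub> \<phi> M n (t M)) < e / (4 * (k + 1))"
    using cauchyD[OF t(1)] by blast
  let ?M = "max N k"
  let ?y = "\<lambda>n m. sqrt_iter (A n) (t n) m"
  have "nrm (A n) (?y n n \<ominus>\<^bsub>A n\<^esub> \<phi> ?M n (?y ?M ?M)) < e" if n: "n \<ge> ?M" for n
  proof -
    let ?u = "\<phi> ?M n (t ?M)"
    let ?z = "\<lambda>m. sqrt_iter (A n) ?u m"
    have u: "?u \<in> carrier (A n)" "nrm (A n) ?u \<le> 1" using n c t by (auto simp: phi_closed phi_nrm)
    have "nrm (A n) (?y n n \<ominus>\<^bsub>A n\<^esub> \<phi> ?M n (?y ?M ?M)) = nrm (A n) (?y n n \<ominus>\<^bsub>A n\<^esub> ?z ?M)"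
      using n c by (subst phi_sqrt_iter) auto
    also have "\<dots> \<le> nrm (A n) (?y n n \<ominus>\<^bsub>A n\<^esub> ?y n k) + (nrm (A n) (?y n k \<ominus>\<^bsub>A n\<^esub> ?z k) + nrm (A n) (?z k \<ominus>\<^bsub>A n\<^esub> ?z ?M))"
      using c u A.nrm_triangle[of "?y n n" n "?y n k" "?z ?M"] A.nrm_triangle[of "?y n k" n "?z k" "?z ?M"] by simp
    also have "nrm (A n) (?z k \<ominus>\<^bsub>A n\<^esub> ?z ?M) = nrm (A n) (?z ?M \<ominus>\<^bsub>A n\<^esub> ?z k)" using u by (intro A.nrm_diff_commute) auto
    also have "nrm (A n) (?y n n \<ominus>\<^bsub>A n\<^esub> ?y n k) + (nrm (A n) (?y n k \<ominus>\<^bsub>A n\<^esub> ?z k) + nrm (A n) (?z ?M \<ominus>\<^bsub>A n\<^esub> ?z k)) \<le>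
      (sqrt_major n - sqrt_major k) + (k * nrm (A n) (t n \<ominus>\<^bsub>A n\<^esub> ?u) + (sqrt_major ?M - sqrt_major k))"
      using n c u t by (intro add_mono A.sqrt_iter_dist A.sqrt_iter_lipschitz) auto
    also have "\<dots> \<le> e/4 + (k * (e / (4 * (k + 1))) + e/4)"
      using k sqrt_major_range[of n] sqrt_major_range[of ?M] N[of ?M n] n
      by (intro add_mono mult_left_mono) (auto simp: less_imp_le)
    also have "k * (e / (4 * (k + 1))) \<le> e / 4" using e by (simp add: field_simps)
    finally show ?thesis using e by simp
  qed
  then show "\<exists>N. \<forall>n\<ge>N. nrm (A n) (?y n n \<ominus>\<^bsub>A n\<^esub> \<phi> N n (?y N N)) < e" by blast
qed

text \<open>\<open>positive\<close> asks for a single z with adj z z equal to the sum. It is a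
  scalar multiple of the limit of self-adjoint approximate square roots of the rescaled sum at the
  finite levels.\<close>

lemma sum_adj_mult_positive:
  assumes I: "finite I" and contr: "\<And>n. contraction_ineq (A n) I" and a: "a \<in> I \<rightarrow> carrier Q"
  shows "positive Q (\<Oplus>\<^bsub>Q\<^esub>i\<in>I. adj Q (a i) \<otimes>\<^bsub>Q\<^esub> a i)"
proof -
  obtain x where x: "\<forall>i\<in>I. x i \<in> S" "\<forall>i\<in>I. a i = cls (x i)" using Q_family[OF a] by blast
  have "\<forall>i\<in>I. \<exists>K. K \<ge> 0 \<and> (\<forall>n. nrm (A n) (x i n) \<le> K)" using x cauchy_bounded by metis
  then obtain K where K: "\<And>i. i \<in> I \<Longrightarrow> K i \<ge> 0" "\<And>i n. i \<in> I \<Longrightarrow> nrm (A n) (x i n) \<le> K i" by metis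
  \<comment> \<open>B dominates the sum of the squared bounds, so dividing the \<open>x i\<close> by
    sqrt B meets the hypothesis of \<open>contraction_ineq\<close>; the 1 keeps B positive.\<close>
  define B where "B = 1 + (\<Sum>i\<in>I. (K i)\<^sup>2)"
  have B: "B > 0" by (auto simp: B_def add_pos_nonneg sum_nonneg)
  define c where "c = complex_of_real (1 / sqrt B)"
  have c: "cmod c ^ 2 = 1 / B" "cnj c = c" "c * c = of_real (1 / B)" using B
    by (auto simp: c_def norm_divide power_divide simp flip: of_real_mult)
  let ?x = "\<lambda>i n. c \<odot>\<^bsub>A n\<^esub> x i n"
  let ?h = "\<lambda>n. \<Oplus>\<^bsub>A n\<^esub>i\<in>I. adj (A n) (?x i n) \<otimes>\<^bsub>A n\<^esub> ?x i n"
  have xc: "x i n \<in> carrier (A n)" if "i \<in> I" for i n using x that by (auto intro: cauchy_carrier)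
  have xS: "\<forall>i\<in>I. ?x i \<in> S" "\<forall>i\<in>I. c \<odot>\<^bsub>Q\<^esub> a i = cls (?x i)" using x by (auto simp: S_smult Q_smult)
  have h: "(\<Oplus>\<^bsub>Q\<^esub>i\<in>I. adj Q (c \<odot>\<^bsub>Q\<^esub> a i) \<otimes>\<^bsub>Q\<^esub> (c \<odot>\<^bsub>Q\<^esub> a i)) = cls ?h" "?h \<in> S"
    using Q_sum_adj_mult[OF I xS xS] by auto
  have hc: "?h n \<in> carrier (A n)" for n by (rule cauchy_carrier[OF h(2)])
  define t where "t n = \<one>\<^bsub>A n\<^esub> \<ominus>\<^bsub>A n\<^esub> ?h n" for n
  have tS: "t \<in> S" unfolding t_def by (intro S_diff S_one h)
  have tc: "t n \<in> carrier (A n)" for n by (rule cauchy_carrier[OF tS])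
  have t1: "nrm (A n) (t n) \<le> 1" for n
  proof -
    have "(\<Sum>i\<in>I. (nrm (A n) (?x i n))\<^sup>2) = (\<Sum>i\<in>I. (nrm (A n) (x i n))\<^sup>2) / B"
      using xc by (simp add: A.nrm_smult power_mult_distrib c sum_divide_distrib)
    also have "(\<Sum>i\<in>I. (nrm (A n) (x i n))\<^sup>2) \<le> (\<Sum>i\<in>I. (K i)\<^sup>2)"
      using xc K by (intro sum_mono power_mono) auto
    also have "(\<Sum>i\<in>I. (K i)\<^sup>2) / B \<le> 1" using B by (simp add: B_def)
    finally have "(\<Sum>i\<in>I. (nrm (A n) (?x i n))\<^sup>2) \<le> 1" using B by (simp add: divide_right_mono)
    then show ?thesis using contr[of n] xc unfolding contraction_ineq_def t_def by (auto elim!: ballE[where x="\<lambda>i. ?x i n"])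
  qed
  have tadj: "adj (A n) (t n) = t n" for n
  proof -
    have "adj (A n) (?h n) = ?h n"
      using xc by (subst A.adj_finsum[OF I]) (auto simp: A.adj_mult intro!: A.finsum_cong')
    then show ?thesis using hc[of n] by (simp add: t_def A.adj_diff)
  qed
  define y where "y n = sqrt_iter (A n) (t n)" for n
  \<comment> \<open>The n-th approximate root of h at level n. It is self-adjoint because t n is, so
    adj s s is the square of s and differs from h by a null sequence.\<close>
  define s where "s n = \<one>\<^bsub>A n\<^esub> \<ominus>\<^bsub>A n\<^esub> y n n" for n
  have yc: "y n k \<in> carrier (A n)" for n k using tc by (auto simp: y_def)
  have "(\<lambda>n. y n n) \<in> S" unfolding y_def by (rule sqrt_diag_cauchy[OF tS t1])
  then have sS: "s \<in> S" unfolding s_def by (intro S_diff S_one)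
  have sadj: "adj (A n) (s n) = s n" for n using yc[of n n] A.sqrt_iter_adj[OF tc tadj, of n n] by (simp add: s_def A.adj_diff y_def)
  have null: "(\<lambda>n. nrm (A n) (s n \<otimes>\<^bsub>A n\<^esub> s n \<ominus>\<^bsub>A n\<^esub> ?h n)) \<longlonglongrightarrow> 0"
  proof (rule null_le)
    show "(\<lambda>n. 2 * (sqrt_major (Suc n) - sqrt_major n)) \<longlonglongrightarrow> 0"
      using tendsto_mult[OF tendsto_const[of 2] tendsto_diff[OF LIMSEQ_Suc[OF sqrt_major_tendsto] sqrt_major_tendsto]]
      by simp
    show "0 \<le> nrm (A n) (s n \<otimes>\<^bsub>A n\<^esub> s n \<ominus>\<^bsub>A n\<^esub> ?h n)" for n
      using hc[of n] yc[of n n] by (intro A.nrm_nonneg) (auto simp: s_def)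
    show "nrm (A n) (s n \<otimes>\<^bsub>A n\<^esub> s n \<ominus>\<^bsub>A n\<^esub> ?h n) \<le> 2 * (sqrt_major (Suc n) - sqrt_major n)" for n
      unfolding s_def y_def using A.sqrt_iter_square[OF hc[of n] t_def[of n], of n] yc[of n] A.sqrt_iter_step[OF tc[of n] t1[of n], of n]
      by (simp add: A.nrm_smult y_def del: sqrt_iter.simps sqrt_major.simps)
  qed
  have "adj Q (cls s) \<otimes>\<^bsub>Q\<^esub> cls s = cls ?h"
    using sS null h(2) by (simp add: Q_adj sadj Q_mult cls_eq_iff S_mult)
  moreover have "cls ?h = (c * c) \<odot>\<^bsub>Q\<^esub> (\<Oplus>\<^bsub>Q\<^esub>i\<in>I. adj Q (a i) \<otimes>\<^bsub>Q\<^esub> a i)"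
  proof -
    have "adj Q (c \<odot>\<^bsub>Q\<^esub> a i) \<otimes>\<^bsub>Q\<^esub> (c \<odot>\<^bsub>Q\<^esub> a i) = (c * c) \<odot>\<^bsub>Q\<^esub> (adj Q (a i) \<otimes>\<^bsub>Q\<^esub> a i)" if "i \<in> I" for i
      using a that c(2) by (simp add: Pi_iff Q.adj_smult Q.smult_mult_left Q.smult_mult_right Q.smult_smult)
    then have "cls ?h = (\<Oplus>\<^bsub>Q\<^esub>i\<in>I. (c * c) \<odot>\<^bsub>Q\<^esub> (adj Q (a i) \<otimes>\<^bsub>Q\<^esub> a i))"
      unfolding h(1)[symmetric] using a by (intro Q.finsum_cong') (auto simp: Pi_iff intro!: Q.smult_closed)
    also have "\<dots> = (c * c) \<odot>\<^bsub>Q\<^esub> (\<Oplus>\<^bsub>Q\<^esub>i\<in>I. adj Q (a i) \<otimes>\<^bsub>Q\<^esub> a i)"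
      using a by (intro Q.smult_finsum[symmetric] I) (auto simp: Pi_iff)
    finally show ?thesis .
  qed
  ultimately have eq: "adj Q (cls s) \<otimes>\<^bsub>Q\<^esub> cls s = of_real (1 / B) \<odot>\<^bsub>Q\<^esub> (\<Oplus>\<^bsub>Q\<^esub>i\<in>I. adj Q (a i) \<otimes>\<^bsub>Q\<^esub> a i)"
    by (simp add: c)
  have ac: "(\<Oplus>\<^bsub>Q\<^esub>i\<in>I. adj Q (a i) \<otimes>\<^bsub>Q\<^esub> a i) \<in> carrier Q" using a by (intro Q.finsum_closed) auto
  let ?r = "complex_of_real (sqrt B)"
  have "adj Q (?r \<odot>\<^bsub>Q\<^esub> cls s) \<otimes>\<^bsub>Q\<^esub> (?r \<odot>\<^bsub>Q\<^esub> cls s) = (?r * ?r) \<odot>\<^bsub>Q\<^esub> (adj Q (cls s) \<otimes>\<^bsub>Q\<^esub> cls s)"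
    using sS by (simp add: Q.adj_smult Q.smult_mult_left Q.smult_mult_right Q.smult_smult cls_carrier)
  also have "?r * ?r = of_real B" using B by (simp flip: of_real_mult)
  also have "of_real B \<odot>\<^bsub>Q\<^esub> (adj Q (cls s) \<otimes>\<^bsub>Q\<^esub> cls s) = (\<Oplus>\<^bsub>Q\<^esub>i\<in>I. adj Q (a i) \<otimes>\<^bsub>Q\<^esub> a i)"
    unfolding eq using ac B by (simp add: Q.smult_smult flip: of_real_mult)
  finally show ?thesis unfolding positive_def using sS by (intro bexI[of _ "?r \<odot>\<^bsub>Q\<^esub> cls s"]) (auto simp: cls_carrier)
qed

end

section \<open>Simplicity of the UHF algebra\<close>

lemma words_append: "k \<le> n \<Longrightarrow> u \<in> words I k \<Longrightarrow> w \<in> words I (n - k) \<Longrightarrow> u @ w \<in> words I n"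
  by (auto simp: words_def)

lemma words_take: "k \<le> n \<Longrightarrow> s \<in> words I n \<Longrightarrow> take k s \<in> words I k"
  by (auto simp: words_def dest: in_set_takeD)

lemma words_drop: "s \<in> words I n \<Longrightarrow> drop k s \<in> words I (n - k)"
  by (auto simp: words_def dest: in_set_dropD)

lemma finite_words: "finite I \<Longrightarrow> finite (words I n)"
  unfolding words_def by (rule finite_lists_length_eq)

lemma words_length: "s \<in> words I n \<Longrightarrow> length s = n" by (simp add: words_def)

text \<open>A word is a prefix of length k and a suffix: the index form of splitting the n-fold
  tensor power into its first k and its last n - k factors.\<close>

lemma sum_words_split:
  assumes "k \<le> n"
  shows "(\<Sum>s\<in>words I n. f s) = (\<Sum>w\<in>words I (n - k). \<Sum>u\<in>words I k. f (u @ w))"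
proof -
  have "(\<Sum>s\<in>words I n. f s) = (\<Sum>(w,u)\<in>words I (n - k) \<times> words I k. f (u @ w))"
    using assms by (intro sum.reindex_bij_witness[of _ "\<lambda>(w,u). u @ w" "\<lambda>s. (drop k s, take k s)"])
      (auto simp: words_append words_take words_drop dest: words_length)
  then show ?thesis by (simp add: sum.cartesian_product)
qed

locale uhf_setup =
  fixes G :: "'g set"
  assumes finite_G: "finite G" and nonempty_G: "G \<noteq> {}"
begin

abbreviation "W \<equiv> words G"
abbreviation "T \<equiv> tensor_level G"
abbreviation "oe \<equiv> one_ext G"

lemmas fW = finite_words[OF finite_G]

lemma T_def: "T n = matrix_algebra (W n)" by (simp add: tensor_level_def)

lemmas T_simps = MA_simps[OF fW, folded T_def]

lemma W_nonempty: "\<exists>w. w \<in> W n"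
proof -
  obtain g where "g \<in> G" using nonempty_G by blast
  then have "replicate n g \<in> W n" by (auto simp: words_def)
  then show ?thesis by blast
qed

lemma oe_closed: "oe k n x \<in> carrier (T n)"
  by (auto simp: T_simps one_ext_def)

lemma oe_entry: "k \<le> n \<Longrightarrow> w \<in> W (n - k) \<Longrightarrow> w' \<in> W (n - k) \<Longrightarrow> u \<in> W k \<Longrightarrow> u' \<in> W k \<Longrightarrow>
    oe k n x (u @ w) (u' @ w') = (if w = w' then x u u' else 0)"
  using words_length[of u G k] words_length[of u' G k] by (auto simp: one_ext_def words_append)

lemma oe_mult:
  assumes "k \<le> n"
  shows "oe k n (x \<otimes>\<^bsub>T k\<^esub> y) = oe k n x \<otimes>\<^bsub>T n\<^esub> oe k n y"
proof (intro ext)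
  fix s t
  show "oe k n (x \<otimes>\<^bsub>T k\<^esub> y) s t = (oe k n x \<otimes>\<^bsub>T n\<^esub> oe k n y) s t"
  proof (cases "s \<in> W n \<and> t \<in> W n")
    case False then show ?thesis by (auto simp: T_simps one_ext_def)
  next
    case True
    define u w u' w' where "u = take k s" "w = drop k s" "u' = take k t" "w' = drop k t"
    then have st: "s = u @ w" "t = u' @ w'" "u \<in> W k" "u' \<in> W k" "w \<in> W (n-k)" "w' \<in> W (n-k)"
      using True assms by (auto simp: words_take words_drop)
    have "(oe k n x \<otimes>\<^bsub>T n\<^esub> oe k n y) s t = (\<Sum>z\<in>W (n-k). \<Sum>r\<in>W k. oe k n x s (r @ z) * oe k n y (r @ z) t)"
      unfolding T_simps by (rule sum_words_split[OF assms])
    also have "\<dots> = (\<Sum>z\<in>W (n-k). if z = w then (\<Sum>r\<in>W k. if w = w' then x u r * y r u' else 0) else 0)"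
      unfolding st(1,2) using assms st by (intro sum.cong) (auto simp: oe_entry intro!: sum.neutral sum.cong)
    also have "\<dots> = (if w = w' then (x \<otimes>\<^bsub>T k\<^esub> y) u u' else 0)" using fW st by (simp add: T_simps)
    also have "\<dots> = oe k n (x \<otimes>\<^bsub>T k\<^esub> y) s t" unfolding st(1,2) using assms st by (simp add: oe_entry)
    finally show ?thesis by simp
  qed
qed

lemma vnorm_split:
  assumes "k \<le> n"
  shows "(vnorm (W n) v)\<^sup>2 = (\<Sum>w\<in>W (n - k). (vnorm (W k) (\<lambda>u. v (u @ w)))\<^sup>2)"
  unfolding vnorm_def L2_set_def using sum_words_split[OF assms, of "\<lambda>s. (cmod (v s))\<^sup>2" G]
  by (simp add: sum_nonneg)

text \<open>On each slice of vectors with fixed suffix w, tensoring x with 1 acts as x.\<close>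

lemma mv_oe:
  assumes "k \<le> n" "u \<in> W k" "w \<in> W (n-k)"
  shows "mv (W n) (oe k n x) v (u @ w) = mv (W k) x (\<lambda>u. v (u @ w)) u"
proof -
  have "mv (W n) (oe k n x) v (u @ w) = (\<Sum>z\<in>W (n-k). \<Sum>r\<in>W k. oe k n x (u @ w) (r @ z) * v (r @ z))"
    unfolding mv_def by (rule sum_words_split[OF assms(1)])
  also have "\<dots> = (\<Sum>z\<in>W (n-k). if z = w then (\<Sum>r\<in>W k. x u r * v (r @ w)) else 0)"
    using assms by (intro sum.cong) (auto simp: oe_entry intro!: sum.neutral sum.cong)
  also have "\<dots> = mv (W k) x (\<lambda>u. v (u @ w)) u" using fW assms by (simp add: mv_def)
  finally show ?thesis .
qed

text \<open>The space is the orthogonal sum of slices of fixed suffix, on each of which the embedded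
  matrix acts as x. This gives <=; for >= a vector is placed on a single slice.\<close>

lemma oe_nrm:
  assumes "k \<le> n"
  shows "nrm (T n) (oe k n x) = nrm (T k) x"
proof (rule antisym)
  show "nrm (T n) (oe k n x) \<le> nrm (T k) x"
    unfolding T_def
  proof (rule MA_nrm_le[OF fW])
    fix v
    have "(vnorm (W n) (mv (W n) (oe k n x) v))\<^sup>2 = (\<Sum>w\<in>W (n-k). (vnorm (W k) (mv (W k) x (\<lambda>u. v (u @ w))))\<^sup>2)"
      unfolding vnorm_split[OF assms] using assms
      by (intro sum.cong arg_cong[where f="\<lambda>x. x\<^sup>2"] vnorm_cong) (auto simp: mv_oe)
    also have "\<dots> \<le> (\<Sum>w\<in>W (n-k). (nrm (matrix_algebra (W k)) x * vnorm (W k) (\<lambda>u. v (u @ w)))\<^sup>2)"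
      by (intro sum_mono power_mono vnorm_mv[OF fW]) auto
    also have "\<dots> = (nrm (matrix_algebra (W k)) x * vnorm (W n) v)\<^sup>2"
      by (simp add: vnorm_split[OF assms] power_mult_distrib sum_distrib_left)
    finally show "vnorm (W n) (mv (W n) (oe k n x) v) \<le> nrm (matrix_algebra (W k)) x * vnorm (W n) v"
      by (rule power2_le_imp_le) (simp add: MA_nrm_nonneg[OF fW])
  qed (rule MA_nrm_nonneg[OF fW])
  show "nrm (T k) x \<le> nrm (T n) (oe k n x)"
    unfolding T_def
  proof (rule MA_nrm_le[OF fW])
    fix v
    obtain w0 where w0: "w0 \<in> W (n-k)" using W_nonempty by blast
    define v' :: "'g list \<Rightarrow> complex" where "v' s = (if drop k s = w0 then v (take k s) else 0)" for s
    have v': "(\<lambda>u. v' (u @ w)) u = (if w = w0 then v u else 0)" if "u \<in> W k" for u w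
      using words_length[OF that] by (simp add: v'_def)
    have pick: "(\<Sum>w\<in>W (n-k). (vnorm (W k) (f w))\<^sup>2) = (vnorm (W k) g)\<^sup>2"
      if "\<And>w u. u \<in> W k \<Longrightarrow> w \<in> W (n-k) \<Longrightarrow> f w u = (if w = w0 then g u else 0)" for f g
    proof -
      have "(\<Sum>w\<in>W (n-k). (vnorm (W k) (f w))\<^sup>2) = (\<Sum>w\<in>W (n-k). if w = w0 then (vnorm (W k) g)\<^sup>2 else 0)"
      proof (intro sum.cong refl)
        fix w assume w: "w \<in> W (n-k)"
        have "vnorm (W k) (f w) = vnorm (W k) (\<lambda>u. if w = w0 then g u else 0)"
          using that w by (intro vnorm_cong) auto
        then show "(vnorm (W k) (f w))\<^sup>2 = (if w = w0 then (vnorm (W k) g)\<^sup>2 else 0)"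
          by (simp add: vnorm_zero[OF fW])
      qed
      then show ?thesis using fW w0 by simp
    qed
    have "(vnorm (W n) v')\<^sup>2 = (vnorm (W k) v)\<^sup>2"
      unfolding vnorm_split[OF assms] by (rule pick) (use v' in auto)
    moreover have "(vnorm (W n) (mv (W n) (oe k n x) v'))\<^sup>2 = (vnorm (W k) (mv (W k) x v))\<^sup>2"
      unfolding vnorm_split[OF assms]
    proof (rule pick)
      fix w u assume uw: "u \<in> W k" "w \<in> W (n-k)"
      have "mv (W k) x (\<lambda>u. v' (u @ w)) = mv (W k) x (\<lambda>u. if w = w0 then v u else 0)"
        using v' by (intro mv_cong) auto
      then show "mv (W n) (oe k n x) v' (u @ w) = (if w = w0 then mv (W k) x v u else 0)"
        using uw assms by (simp add: mv_oe) (simp add: mv_def)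
    qed
    ultimately show "vnorm (W k) (mv (W k) x v) \<le> nrm (matrix_algebra (W n)) (oe k n x) * vnorm (W k) v"
      using vnorm_mv[OF fW, of n "oe k n x" v'] by simp
  qed (rule MA_nrm_nonneg[OF fW])
qed

lemma T_nstar: "nstar (T n) 1" unfolding T_def by (rule MA_nstar[OF fW])

sublocale T: nstar "T n" 1 for n by (rule T_nstar)

lemma oe_ind_sys_star: "ind_sys_star T oe 1"
proof unfold_locales
  fix k n m :: nat and x
  show "oe n n x = x" if x: "x \<in> carrier (T n)"
  proof (intro ext)
    fix s t
    show "oe n n x s t = x s t"
      using x words_length[of s G n] words_length[of t G n]
      by (cases "s \<in> W n \<and> t \<in> W n") (auto simp: one_ext_def T_simps)
  qed
  show "k \<le> n \<Longrightarrow> oe k n \<one>\<^bsub>T k\<^esub> = \<one>\<^bsub>T n\<^esub>"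
    by (intro ext) (auto simp: one_ext_def T_simps words_take, metis append_take_drop_id)
  assume "k \<le> n" "n \<le> m"
  \<comment> \<open>Agreement of two words from position k on is checked in two stages, between k
    and n and from n on; this is the composition of the two embeddings.\<close>
  then have "take k (take n s) = take k s" "drop k s = drop k t \<longleftrightarrow> drop n s = drop n t \<and> drop k (take n s) = drop k (take n t)"
    if "length s = m" "length t = m" for s t :: "'g list"
  proof -
    assume *: "k \<le> n" "n \<le> m"
    show "take k (take n s) = take k s" using * by (simp add: min_def)
    have "drop k s = take (n - k) (drop k s) @ drop (n-k) (drop k s)" for s :: "'g list"
      by (rule append_take_drop_id[symmetric])
    then have d: "drop k s = drop k (take n s) @ drop n s" for s :: "'g list" using * by (simp add: drop_take)
    show "drop k s = drop k t \<longleftrightarrow> drop n s = drop n t \<and> drop k (take n s) = drop k (take n t)"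
      unfolding d[of s] d[of t] using that * by auto
  qed
  then show "oe n m (oe k n x) = oe k m x"
    using \<open>k \<le> n\<close> \<open>n \<le> m\<close> by (intro ext) (auto simp: one_ext_def words_take dest: words_length)
qed (auto simp: oe_closed oe_mult oe_nrm, auto simp: T_simps one_ext_def fun_eq_iff)

sublocale ind_sys_star T oe 1 by (rule oe_ind_sys_star)
sublocale ind_sys_star1 T oe by unfold_locales

lemma uhf_eq: "uhf G = Q"
  by (simp add: uhf_def inductive_limit_def)

lemma Q_cs: "finite I \<Longrightarrow> cs_ineq Q I"
  by (intro Q_cs_ineq) (auto simp: T_def MA_cs[OF fW])

lemma Q_lb: "finite I \<Longrightarrow> left_mult_ineq Q I"
  by (intro Q_left_mult_ineq) (auto simp: T_def MA_lb[OF fW])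

lemma Q_cstar: "cstar_id Q"
  by (intro Q_cstar_id) (auto simp: T_def MA_cstar_id[OF fW])

lemma Q_positive: "finite I \<Longrightarrow> a \<in> I \<rightarrow> carrier Q \<Longrightarrow> positive Q (\<Oplus>\<^bsub>Q\<^esub>i\<in>I. adj Q (a i) \<otimes>\<^bsub>Q\<^esub> a i)"
  by (rule sum_adj_mult_positive) (auto simp: T_def MA_contr[OF fW])

lemma T_finsum_entry:
  "finite I \<Longrightarrow> (\<And>i. i \<in> I \<Longrightarrow> f i \<in> carrier (T n)) \<Longrightarrow> (\<Oplus>\<^bsub>T n\<^esub>i\<in>I. f i) s t = (\<Sum>i\<in>I. f i s t)"
  unfolding T_def by (rule MA_finsum_entry[OF fW])

text \<open>Simplicity of a matrix algebra with constants. For vectors u, v with z the inner product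
  of u and x v, the rank-one matrices R i = |i><u|/z and D i = |v><i| satisfy R i x D i = |i><i|,
  and these sum to 1. The sizes of the row R and the column D together are controlled by the norm of
  x alone, not by n, as an approximation argument requires.\<close>

lemma compress:
  assumes x: "x \<in> carrier (T n)" and pos: "nrm (T n) x > 0"
  obtains R D where "R \<in> W n \<rightarrow> carrier (T n)" "D \<in> W n \<rightarrow> carrier (T n)"
    "(\<Oplus>\<^bsub>T n\<^esub>i\<in>W n. R i \<otimes>\<^bsub>T n\<^esub> x \<otimes>\<^bsub>T n\<^esub> D i) = \<one>\<^bsub>T n\<^esub>"
    "nrm (T n) (\<Oplus>\<^bsub>T n\<^esub>i\<in>W n. adj (T n) (adj (T n) (R i)) \<otimes>\<^bsub>T n\<^esub> adj (T n) (R i)) * nrm (T n) (\<Oplus>\<^bsub>T n\<^esub>i\<in>W n. adj (T n) (D i) \<otimes>\<^bsub>T n\<^esub> D i) \<le> (2 / nrm (T n) x)\<^sup>2"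
proof -
  let ?J = "W n"
  let ?N = "nrm (T n) x"
  \<comment> \<open>Vectors reaching half the norm exist, otherwise \<open>MA_nrm_le_vip\<close>
    would halve it. This half is the source of the 2 in the final bound.\<close>
  have "\<exists>u v. \<not> cmod (vip ?J u (mv ?J x v)) \<le> ?N / 2 * vnorm ?J u * vnorm ?J v"
  proof (rule ccontr)
    assume "\<not> ?thesis"
    then have "?N \<le> ?N / 2" using pos unfolding T_def by (intro MA_nrm_le_vip[OF fW]) auto
    then show False using pos by simp
  qed
  then obtain u v where uv: "?N / 2 * vnorm ?J u * vnorm ?J v < cmod (vip ?J u (mv ?J x v))" by (auto simp: not_le)
  define z where "z = vip ?J u (mv ?J x v)"
  have "0 \<le> ?N / 2 * vnorm ?J u * vnorm ?J v" using pos by simp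
  then have "cmod z > 0" using uv unfolding z_def by linarith
  then have z: "z \<noteq> 0" by simp
  define R where "R i = (\<lambda>s t. if s = i \<and> s \<in> ?J \<and> t \<in> ?J then cnj (u t) / z else 0)" for i
  define D where "D i = (\<lambda>s t. if t = i \<and> s \<in> ?J \<and> t \<in> ?J then v s else 0)" for i
  have RD: "R i \<in> carrier (T n)" "D i \<in> carrier (T n)" for i by (auto simp: T_simps R_def D_def)
  \<comment> \<open>The three sums below all consist of multiples c |i><i| of diagonal matrix units,
    with the same c for every i.\<close>
  have diag: "(\<Oplus>\<^bsub>T n\<^esub>i\<in>?J. f i) = c \<odot>\<^bsub>T n\<^esub> \<one>\<^bsub>T n\<^esub>"
    if "\<And>i. i \<in> ?J \<Longrightarrow> f i = (\<lambda>s t. if s = i \<and> t = i then c else 0)" for f c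
  proof (intro ext)
    fix s t
    have f: "f i \<in> carrier (T n)" if i: "i \<in> ?J" for i using \<open>\<And>i. i \<in> ?J \<Longrightarrow> f i = _\<close>[OF i] i by (auto simp: T_simps)
    have "(\<Oplus>\<^bsub>T n\<^esub>i\<in>?J. f i) s t = (\<Sum>i\<in>?J. f i s t)" using fW f by (rule T_finsum_entry)
    also have "\<dots> = (\<Sum>i\<in>?J. if i = s then (if t = s then c else 0) else 0)"
      using that by (intro sum.cong) auto
    also have "\<dots> = (c \<odot>\<^bsub>T n\<^esub> \<one>\<^bsub>T n\<^esub>) s t" using fW by (auto simp: T_simps)
    finally show "(\<Oplus>\<^bsub>T n\<^esub>i\<in>?J. f i) s t = (c \<odot>\<^bsub>T n\<^esub> \<one>\<^bsub>T n\<^esub>) s t" .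
  qed
  have Rx: "(R i \<otimes>\<^bsub>T n\<^esub> x) = (\<lambda>s t. if s = i then (\<Sum>r\<in>?J. cnj (u r) / z * x r t) else 0)" if "i \<in> ?J" for i
    using that by (intro ext) (auto simp: T_simps R_def intro!: sum.cong)
  have RxD: "(\<Oplus>\<^bsub>T n\<^esub>i\<in>?J. R i \<otimes>\<^bsub>T n\<^esub> x \<otimes>\<^bsub>T n\<^esub> D i) = 1 \<odot>\<^bsub>T n\<^esub> \<one>\<^bsub>T n\<^esub>"
  proof (rule diag)
    fix i assume i: "i \<in> ?J"
    have "(\<Sum>q\<in>?J. (\<Sum>r\<in>?J. cnj (u r) / z * x r q) * v q) = (\<Sum>r\<in>?J. \<Sum>q\<in>?J. cnj (u r) / z * x r q * v q)"
      unfolding sum_distrib_right by (rule sum.swap)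
    also have "\<dots> = vip ?J u (mv ?J x v) / z" unfolding vip_def mv_def by (simp add: sum_distrib_left sum_divide_distrib mult.assoc)
    finally have 1: "(\<Sum>q\<in>?J. (\<Sum>r\<in>?J. cnj (u r) / z * x r q) * v q) = 1" using z by (simp flip: z_def)
    show "R i \<otimes>\<^bsub>T n\<^esub> x \<otimes>\<^bsub>T n\<^esub> D i = (\<lambda>s t. if s = i \<and> t = i then 1 else 0)"
      unfolding Rx[OF i] 1[symmetric] using i by (intro ext) (auto simp: T_simps(1) D_def intro!: sum.cong)
  qed
  have RR: "(\<Oplus>\<^bsub>T n\<^esub>i\<in>?J. adj (T n) (adj (T n) (R i)) \<otimes>\<^bsub>T n\<^esub> adj (T n) (R i)) = of_real ((vnorm ?J u)\<^sup>2 / (cmod z)\<^sup>2) \<odot>\<^bsub>T n\<^esub> \<one>\<^bsub>T n\<^esub>"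
  proof (rule diag)
    fix i assume i: "i \<in> ?J"
    have "(\<Sum>q\<in>?J. (cnj (u q) / z) * cnj (cnj (u q) / z)) = of_real ((vnorm ?J u)\<^sup>2 / (cmod z)\<^sup>2)"
      unfolding of_real_divide vip_self[symmetric] complex_norm_square
      by (simp add: vip_def sum_divide_distrib mult.commute)
    then show "adj (T n) (adj (T n) (R i)) \<otimes>\<^bsub>T n\<^esub> adj (T n) (R i) = (\<lambda>s t. if s = i \<and> t = i then of_real ((vnorm ?J u)\<^sup>2 / (cmod z)\<^sup>2) else 0)"
      using i RD by (intro ext) (auto simp: T_simps(1,6) R_def intro!: sum.neutral)
  qed
  have DD: "(\<Oplus>\<^bsub>T n\<^esub>i\<in>?J. adj (T n) (D i) \<otimes>\<^bsub>T n\<^esub> D i) = of_real ((vnorm ?J v)\<^sup>2) \<odot>\<^bsub>T n\<^esub> \<one>\<^bsub>T n\<^esub>"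
  proof (rule diag)
    fix i assume i: "i \<in> ?J"
    show "adj (T n) (D i) \<otimes>\<^bsub>T n\<^esub> D i = (\<lambda>s t. if s = i \<and> t = i then of_real ((vnorm ?J v)\<^sup>2) else 0)"
      unfolding vip_self[symmetric] vip_def
      using i by (intro ext) (auto simp: T_simps(1,6) D_def intro!: sum.cong sum.neutral)
  qed
  have one: "nrm (T n) \<one>\<^bsub>T n\<^esub> \<le> 1" using T.nrm_mult[of "\<one>\<^bsub>T n\<^esub>" n "\<one>\<^bsub>T n\<^esub>"] Q_cstar
    unfolding T_def by (intro MA_nrm_le[OF fW]) (auto simp: mv_def MA_simps[OF fW] if_distrib[of "\<lambda>x. x * y" for y] sum.delta' fW intro!: eq_refl vnorm_cong cong: if_cong)
  have "nrm (T n) (\<Oplus>\<^bsub>T n\<^esub>i\<in>?J. adj (T n) (adj (T n) (R i)) \<otimes>\<^bsub>T n\<^esub> adj (T n) (R i)) * nrm (T n) (\<Oplus>\<^bsub>T n\<^esub>i\<in>?J. adj (T n) (D i) \<otimes>\<^bsub>T n\<^esub> D i)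
     = ((vnorm ?J u)\<^sup>2 / (cmod z)\<^sup>2 * nrm (T n) \<one>\<^bsub>T n\<^esub>) * ((vnorm ?J v)\<^sup>2 * nrm (T n) \<one>\<^bsub>T n\<^esub>)"
    unfolding RR DD by (subst (1 2) T.nrm_smult) (auto simp: norm_divide norm_power norm_mult)
  also have "\<dots> \<le> ((vnorm ?J u)\<^sup>2 / (cmod z)\<^sup>2 * 1) * ((vnorm ?J v)\<^sup>2 * 1)"
    using one by (intro mult_mono) auto
  also have "\<dots> = (vnorm ?J u * vnorm ?J v)\<^sup>2 / (cmod z)\<^sup>2" by (simp add: power_mult_distrib)
  also have "\<dots> \<le> (2 / ?N)\<^sup>2"
  proof -
    have "vnorm ?J u * vnorm ?J v \<le> 2 / ?N * cmod z" using uv pos by (simp add: z_def field_simps)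
    then have "(vnorm ?J u * vnorm ?J v)\<^sup>2 \<le> (2 / ?N * cmod z)\<^sup>2" by (intro power_mono) auto
    then show ?thesis using z by (simp add: power_mult_distrib power_divide divide_le_eq)
  qed
  finally show ?thesis using that[of R D] RD RxD by simp
qed

text \<open>Approximate a by x at a finite level. The matrices that compress x to 1, applied to a
  instead, give elements of the ideal close to 1, with an error proportional to that of the
  approximation; closedness then yields 1 itself.\<close>

lemma Q_simple:
  assumes I: "I \<subseteq> carrier Q" "norm_closed Q I"
    and add: "\<And>x y. x \<in> I \<Longrightarrow> y \<in> I \<Longrightarrow> x \<oplus>\<^bsub>Q\<^esub> y \<in> I"
    and mult: "\<And>x y. x \<in> carrier Q \<Longrightarrow> y \<in> I \<Longrightarrow> x \<otimes>\<^bsub>Q\<^esub> y \<in> I" "\<And>x y. x \<in> carrier Q \<Longrightarrow> y \<in> I \<Longrightarrow> y \<otimes>\<^bsub>Q\<^esub> x \<in> I"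
    and a: "a \<in> I" "a \<noteq> \<zero>\<^bsub>Q\<^esub>"
  shows "\<one>\<^bsub>Q\<^esub> \<in> I"
proof -
  have ac: "a \<in> carrier Q" using a I by auto
  define \<delta> where "\<delta> = nrm Q a"
  have \<delta>: "\<delta> > 0" using Q.nrm_nonneg[OF ac] Q_nrm_eq_0[OF ac] a by (auto simp: \<delta>_def less_le)
  have zero: "\<zero>\<^bsub>Q\<^esub> \<in> I" using mult(1)[of "\<zero>\<^bsub>Q\<^esub>" a] a ac by simp
  have sum: "(\<Oplus>\<^bsub>Q\<^esub>i\<in>K. f i) \<in> I" if "finite K" "\<And>i. i \<in> K \<Longrightarrow> f i \<in> I" for K and f :: "'g list \<Rightarrow> _"
    using that
  proof (induction K rule: finite_induct)
    case (insert i K) then show ?case using I add by (subst Q.finsum_insert) auto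
  qed (simp add: zero)
  have approx: "\<exists>b\<in>I. nrm Q (b \<ominus>\<^bsub>Q\<^esub> \<one>\<^bsub>Q\<^esub>) \<le> e * (8 / \<delta>)" if e: "e > 0" "e \<le> \<delta> / 2" for e
  proof -
    obtain n where "\<exists>x\<in>carrier (T n). nrm Q (a \<ominus>\<^bsub>Q\<^esub> level n x) \<le> e" using level_dense[OF ac e(1)] by (metis order_refl)
    then obtain x where x: "x \<in> carrier (T n)" "nrm Q (a \<ominus>\<^bsub>Q\<^esub> level n x) \<le> e" by blast
    have "\<delta> \<le> e + nrm (T n) x"
      using Q.abs_nrm_diff[OF ac level_closed[OF x(1)]] x by (simp add: \<delta>_def level_nrm)
    then have nx: "nrm (T n) x \<ge> \<delta> / 2" "nrm (T n) x > 0" using e \<delta> by auto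
    obtain R D where RD: "R \<in> W n \<rightarrow> carrier (T n)" "D \<in> W n \<rightarrow> carrier (T n)"
      "(\<Oplus>\<^bsub>T n\<^esub>i\<in>W n. R i \<otimes>\<^bsub>T n\<^esub> x \<otimes>\<^bsub>T n\<^esub> D i) = \<one>\<^bsub>T n\<^esub>"
      "nrm (T n) (\<Oplus>\<^bsub>T n\<^esub>i\<in>W n. adj (T n) (adj (T n) (R i)) \<otimes>\<^bsub>T n\<^esub> adj (T n) (R i)) * nrm (T n) (\<Oplus>\<^bsub>T n\<^esub>i\<in>W n. adj (T n) (D i) \<otimes>\<^bsub>T n\<^esub> D i) \<le> (2 / nrm (T n) x)\<^sup>2"
      using compress[OF x(1) nx(2)] by blast
    define r d where "r i = level n (R i)" and "d i = level n (D i)" for i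
    have rd: "r i \<in> carrier Q" "d i \<in> carrier Q" if "i \<in> W n" for i using RD that by (auto simp: r_def d_def)
    define b where "b = (\<Oplus>\<^bsub>Q\<^esub>i\<in>W n. r i \<otimes>\<^bsub>Q\<^esub> a \<otimes>\<^bsub>Q\<^esub> d i)"
    define c where "c = a \<ominus>\<^bsub>Q\<^esub> level n x"
    have c: "c \<in> carrier Q" using ac x by (auto simp: c_def)
    have bI: "b \<in> I" unfolding b_def using rd a by (intro sum fW mult)
    have one: "\<one>\<^bsub>Q\<^esub> = (\<Oplus>\<^bsub>Q\<^esub>i\<in>W n. r i \<otimes>\<^bsub>Q\<^esub> level n x \<otimes>\<^bsub>Q\<^esub> d i)"
    proof -
      have "\<one>\<^bsub>Q\<^esub> = level n (\<Oplus>\<^bsub>T n\<^esub>i\<in>W n. R i \<otimes>\<^bsub>T n\<^esub> x \<otimes>\<^bsub>T n\<^esub> D i)" by (simp add: RD(3) level_one)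
      also have "\<dots> = (\<Oplus>\<^bsub>Q\<^esub>i\<in>W n. level n (R i \<otimes>\<^bsub>T n\<^esub> x \<otimes>\<^bsub>T n\<^esub> D i))" using RD x by (intro level_finsum fW) auto
      also have "\<dots> = (\<Oplus>\<^bsub>Q\<^esub>i\<in>W n. r i \<otimes>\<^bsub>Q\<^esub> level n x \<otimes>\<^bsub>Q\<^esub> d i)"
        using RD x by (intro Q.finsum_cong') (auto simp: Pi_iff level_mult r_def d_def)
      finally show ?thesis .
    qed
    have "b \<ominus>\<^bsub>Q\<^esub> \<one>\<^bsub>Q\<^esub> = (\<Oplus>\<^bsub>Q\<^esub>i\<in>W n. r i \<otimes>\<^bsub>Q\<^esub> a \<otimes>\<^bsub>Q\<^esub> d i \<ominus>\<^bsub>Q\<^esub> r i \<otimes>\<^bsub>Q\<^esub> level n x \<otimes>\<^bsub>Q\<^esub> d i)"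
      unfolding one b_def using rd ac x by (intro Q.finsum_diff fW) auto
    also have "\<dots> = (\<Oplus>\<^bsub>Q\<^esub>i\<in>W n. adj Q (adj Q (r i)) \<otimes>\<^bsub>Q\<^esub> (c \<otimes>\<^bsub>Q\<^esub> d i))"
      using rd ac x by (intro Q.finsum_cong') (auto simp: c_def a_minus_def Q.l_distr Q.r_distr Q.l_minus Q.r_minus Q.m_assoc)
    finally have eq: "b \<ominus>\<^bsub>Q\<^esub> \<one>\<^bsub>Q\<^esub> = (\<Oplus>\<^bsub>Q\<^esub>i\<in>W n. adj Q (adj Q (r i)) \<otimes>\<^bsub>Q\<^esub> (c \<otimes>\<^bsub>Q\<^esub> d i))" .
    let ?r = "nrm Q (\<Oplus>\<^bsub>Q\<^esub>i\<in>W n. adj Q (adj Q (r i)) \<otimes>\<^bsub>Q\<^esub> adj Q (r i))"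
    let ?d = "nrm Q (\<Oplus>\<^bsub>Q\<^esub>i\<in>W n. adj Q (d i) \<otimes>\<^bsub>Q\<^esub> d i)"
    let ?cd = "nrm Q (\<Oplus>\<^bsub>Q\<^esub>i\<in>W n. adj Q (c \<otimes>\<^bsub>Q\<^esub> d i) \<otimes>\<^bsub>Q\<^esub> (c \<otimes>\<^bsub>Q\<^esub> d i))"
    have rn: "?r = nrm (T n) (\<Oplus>\<^bsub>T n\<^esub>i\<in>W n. adj (T n) (adj (T n) (R i)) \<otimes>\<^bsub>T n\<^esub> adj (T n) (R i))"
      using RD by (subst level_nrm[symmetric], simp add: Pi_iff, subst level_finsum[OF fW], simp add: Pi_iff, intro arg_cong[where f="nrm Q"] Q.finsum_cong')
        (auto simp: level_mult level_adj r_def Pi_iff)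
    have dn: "?d = nrm (T n) (\<Oplus>\<^bsub>T n\<^esub>i\<in>W n. adj (T n) (D i) \<otimes>\<^bsub>T n\<^esub> D i)"
      using RD by (subst level_nrm[symmetric], simp add: Pi_iff, subst level_finsum[OF fW], simp add: Pi_iff, intro arg_cong[where f="nrm Q"] Q.finsum_cong')
        (auto simp: level_mult level_adj d_def Pi_iff)
    \<comment> \<open>Cauchy-Schwarz separates the row r from the column c d, and
      \<open>left_mult_ineq\<close> takes out c. A termwise triangle inequality would give an error
      growing with the number of words.\<close>
    have "(nrm Q (b \<ominus>\<^bsub>Q\<^esub> \<one>\<^bsub>Q\<^esub>))\<^sup>2 \<le> ?r * ?cd"
      unfolding eq using Q_cs[OF fW, of n] rd c unfolding cs_ineq_def
      by (elim ballE[where x="\<lambda>i. adj Q (r i)"] ballE[where x="\<lambda>i. c \<otimes>\<^bsub>Q\<^esub> d i"]) auto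
    also have "\<dots> \<le> ?r * ((2 * e)\<^sup>2 * ?d)"
    proof (intro mult_left_mono)
      \<comment> \<open>Doubling e turns the approximation into the strict bound demanded by
        \<open>left_mult_ineq\<close>.\<close>
      have "nrm Q c < 2 * e" using x(2) e by (simp add: c_def)
      then show "?cd \<le> (2 * e)\<^sup>2 * ?d"
        using Q_lb[OF fW, of n] rd c unfolding left_mult_ineq_def
        by (elim ballE[where x="\<lambda>i. c"] ballE[where x="d"]) auto
    qed (use rd in auto)
    also have "\<dots> = (?r * ?d) * (2 * e)\<^sup>2" by simp
    also have "\<dots> \<le> (2 / nrm (T n) x)\<^sup>2 * (2 * e)\<^sup>2"
      unfolding rn dn using RD(4) by (intro mult_right_mono) auto
    also have "\<dots> = (e * (4 / nrm (T n) x))\<^sup>2" by (simp add: power_mult_distrib power_divide)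
    finally have "nrm Q (b \<ominus>\<^bsub>Q\<^esub> \<one>\<^bsub>Q\<^esub>) \<le> e * (4 / nrm (T n) x)"
      by (rule power2_le_imp_le) (use e nx in auto)
    also have "\<dots> \<le> e * (8 / \<delta>)" using nx \<delta> e by (intro mult_left_mono) (auto simp: field_simps)
    finally show ?thesis using bI by blast
  qed
  \<comment> \<open>The choice e = \<delta>/(2(k+1)) is admissible for \<open>approx\<close> and
    makes the error 4/(k+1).\<close>
  have "\<forall>k::nat. \<exists>b\<in>I. nrm Q (b \<ominus>\<^bsub>Q\<^esub> \<one>\<^bsub>Q\<^esub>) \<le> (\<delta> / 2 / Suc k) * (8 / \<delta>)"
    using \<delta> by (intro allI approx) (auto simp: field_simps)
  then obtain b where b: "\<And>k. b k \<in> I" "\<And>k::nat. nrm Q (b k \<ominus>\<^bsub>Q\<^esub> \<one>\<^bsub>Q\<^esub>) \<le> (\<delta> / 2 / Suc k) * (8 / \<delta>)" by metis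
  have "(\<lambda>k. nrm Q (b k \<ominus>\<^bsub>Q\<^esub> \<one>\<^bsub>Q\<^esub>)) \<longlonglongrightarrow> 0"
  proof (rule null_le)
    show "(\<lambda>k. 4 * inverse (real (Suc k))) \<longlonglongrightarrow> 0" using tendsto_mult[OF tendsto_const LIMSEQ_inverse_real_of_nat, of 4] by simp
    show "0 \<le> nrm Q (b k \<ominus>\<^bsub>Q\<^esub> \<one>\<^bsub>Q\<^esub>)" for k using b(1)[of k] I by (intro Q.nrm_nonneg) auto
    show "nrm Q (b k \<ominus>\<^bsub>Q\<^esub> \<one>\<^bsub>Q\<^esub>) \<le> 4 * inverse (real (Suc k))" for k using b(2)[of k] \<delta> by (simp add: field_simps)
  qed
  then show ?thesis using I(2) b(1) unfolding norm_closed_def converges_to_def by blast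
qed

end

section \<open>The infinite tensor power of the left regular representation\<close>

locale regular_uhf = group G for G :: "'g monoid" (structure) +
  assumes fin: "finite (carrier G)"
begin

sublocale uhf_setup "carrier G"
  using fin one_closed by unfold_locales auto

definition tr :: "'g \<Rightarrow> 'g list \<Rightarrow> 'g list" where
  "tr g = map (\<lambda>t. g \<otimes> t)"

definition lam :: "nat \<Rightarrow> 'g \<Rightarrow> 'g list \<Rightarrow> 'g list \<Rightarrow> complex" where
  "lam n g = (\<lambda>s t. if s \<in> W n \<and> t \<in> W n \<and> s = tr g t then 1 else 0)"

lemma tr_words: "g \<in> carrier G \<Longrightarrow> s \<in> W n \<Longrightarrow> tr g s \<in> W n"
  by (auto simp: tr_def words_def)

lemma tr_tr: "g \<in> carrier G \<Longrightarrow> h \<in> carrier G \<Longrightarrow> s \<in> W n \<Longrightarrow> tr g (tr h s) = tr (g \<otimes> h) s"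
  by (auto simp: tr_def words_def m_assoc)

lemma tr_one: "s \<in> W n \<Longrightarrow> tr \<one> s = s"
  by (auto simp: tr_def words_def intro!: map_idI)

lemma tr_inv_eq: "g \<in> carrier G \<Longrightarrow> s \<in> W n \<Longrightarrow> t \<in> W n \<Longrightarrow> s = tr g t \<longleftrightarrow> t = tr (inv g) s"
  by (metis inv_closed l_inv r_inv tr_one tr_tr)

lemma tr_take: "take k (tr g s) = tr g (take k s)" by (simp add: tr_def take_map)
lemma tr_drop: "drop k (tr g s) = tr g (drop k s)" by (simp add: tr_def drop_map)

text \<open>A product of entries 0 and 1 is 1 exactly when every letter is matched, so the tensor
  power of a permutation matrix is the permutation matrix of the letterwise translation.\<close>

lemma tensor_power_eq:
  assumes g: "g \<in> carrier G"
  shows "tensor_power n (left_regular G g) = lam n g"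
proof (intro ext)
  fix s t
  show "tensor_power n (left_regular G g) s t = lam n g s t"
  proof (cases "length s = n \<and> length t = n")
    case False
    then show ?thesis by (auto simp: tensor_power_def lam_def words_def)
  next
    case True
    let ?P = "\<lambda>i. s ! i \<in> carrier G \<and> t ! i \<in> carrier G \<and> s ! i = g \<otimes> t ! i"
    have "s \<in> W n \<and> t \<in> W n \<and> s = tr g t \<longleftrightarrow> (\<forall>i<n. ?P i)"
      using True by (auto simp: words_def tr_def set_conv_nth list_eq_iff_nth_eq subset_iff)
    moreover have "(\<Prod>i<n. left_regular G g (s ! i) (t ! i)) = (if \<forall>i<n. ?P i then 1 else 0)"
    proof (cases "\<forall>i<n. ?P i")
      case True
      then show ?thesis by (auto simp: left_regular_def intro!: prod.neutral)
    next
      case False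
      then obtain i where "i < n" "\<not> ?P i" by blast
      then have "left_regular G g (s ! i) (t ! i) = 0" by (auto simp: left_regular_def)
      then have "(\<Prod>i<n. left_regular G g (s ! i) (t ! i)) = 0" using \<open>i < n\<close> by (intro prod_zero) auto
      then show ?thesis using False by (simp only: if_False)
    qed
    ultimately show ?thesis using True by (simp add: tensor_power_def lam_def)
  qed
qed

lemma lam_closed [simp, intro]: "lam n g \<in> carrier (T n)"
  by (auto simp: T_simps lam_def)

lemma lam_left:
  assumes "g \<in> carrier G" "x \<in> carrier (T n)"
  shows "lam n g \<otimes>\<^bsub>T n\<^esub> x = (\<lambda>s t. if s \<in> W n then x (tr (inv g) s) t else 0)"
proof (intro ext)
  fix s t
  have "(lam n g \<otimes>\<^bsub>T n\<^esub> x) s t = (\<Sum>r\<in>W n. if s \<in> W n \<and> r = tr (inv g) s then x r t else 0)"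
    unfolding T_simps
  proof (intro sum.cong refl)
    fix r assume r: "r \<in> W n"
    have "s \<in> W n \<Longrightarrow> s = tr g r \<longleftrightarrow> r = tr (inv g) s" using tr_inv_eq[OF assms(1) _ r] .
    then show "lam n g s r * x r t = (if s \<in> W n \<and> r = tr (inv g) s then x r t else 0)"
      using r by (cases "s \<in> W n") (simp_all add: lam_def)
  qed
  also have "\<dots> = (if s \<in> W n then x (tr (inv g) s) t else 0)"
    using fW assms by (cases "s \<in> W n") (auto simp: tr_words)
  finally show "(lam n g \<otimes>\<^bsub>T n\<^esub> x) s t = (if s \<in> W n then x (tr (inv g) s) t else 0)" .
qed

lemma lam_right:
  assumes "g \<in> carrier G" "x \<in> carrier (T n)"
  shows "x \<otimes>\<^bsub>T n\<^esub> lam n g = (\<lambda>s t. if t \<in> W n then x s (tr g t) else 0)"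
proof (intro ext)
  fix s t
  have "(x \<otimes>\<^bsub>T n\<^esub> lam n g) s t = (\<Sum>r\<in>W n. if r = tr g t then (if t \<in> W n then x s r else 0) else 0)"
    unfolding T_simps by (intro sum.cong) (auto simp: lam_def)
  also have "\<dots> = (if t \<in> W n then x s (tr g t) else 0)"
    using fW assms by (auto simp: tr_words)
  finally show "(x \<otimes>\<^bsub>T n\<^esub> lam n g) s t = (if t \<in> W n then x s (tr g t) else 0)" .
qed

lemma lam_mult: "g \<in> carrier G \<Longrightarrow> h \<in> carrier G \<Longrightarrow> lam n g \<otimes>\<^bsub>T n\<^esub> lam n h = lam n (g \<otimes> h)"
  by (subst lam_right, assumption, rule lam_closed) (auto simp: lam_def fun_eq_iff tr_words tr_tr)

lemma lam_one: "lam n \<one> = \<one>\<^bsub>T n\<^esub>"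
  by (auto simp: lam_def T_simps fun_eq_iff tr_one)

lemma lam_adj: "g \<in> carrier G \<Longrightarrow> adj (T n) (lam n g) = lam n (inv g)"
  unfolding T_simps
proof (intro ext)
  fix s t assume g: "g \<in> carrier G"
  have "s \<in> W n \<Longrightarrow> t \<in> W n \<Longrightarrow> t = tr g s \<longleftrightarrow> s = tr (inv g) t" using tr_inv_eq[OF g] by blast
  then have eq: "s \<in> W n \<and> t \<in> W n \<and> s = tr (inv g) t \<longleftrightarrow> t \<in> W n \<and> s \<in> W n \<and> t = tr g s" by blast
  show "cnj (lam n g t s) = lam n (inv g) s t" unfolding lam_def eq by simp
qed

lemma nrm_T_one: "nrm (T n) \<one>\<^bsub>T n\<^esub> \<le> 1"
proof -
  have "mv (W n) \<one>\<^bsub>T n\<^esub> v s = v s" if "s \<in> W n" for v s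
  proof -
    have "mv (W n) \<one>\<^bsub>T n\<^esub> v s = (\<Sum>j\<in>W n. if s = j then v j else 0)"
      unfolding mv_def T_simps using that by (intro sum.cong) auto
    then show ?thesis using that fW by simp
  qed
  then have "vnorm (W n) (mv (W n) \<one>\<^bsub>T n\<^esub> v) = vnorm (W n) v" for v by (intro vnorm_cong)
  then show ?thesis unfolding T_def by (intro MA_nrm_le[OF fW]) (auto simp: T_def)
qed

text \<open>The C*-identity, as the adjoint of this permutation matrix is its inverse.\<close>

lemma nrm_lam: assumes "g \<in> carrier G" shows "nrm (T n) (lam n g) \<le> 1"
proof -
  have "(nrm (T n) (lam n g))\<^sup>2 = nrm (T n) (adj (T n) (lam n g) \<otimes>\<^bsub>T n\<^esub> lam n g)"
    using MA_cstar_id[OF fW[of n]] by (simp add: cstar_id_def T_def[symmetric])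
  also have "\<dots> \<le> 1\<^sup>2" using assms nrm_T_one by (simp add: lam_adj lam_mult lam_one)
  finally show ?thesis by (rule power2_le_imp_le) simp
qed

section \<open>The product action on the finite levels and on their limit\<close>

definition act :: "nat \<Rightarrow> 'g \<Rightarrow> ('g list \<Rightarrow> 'g list \<Rightarrow> complex) \<Rightarrow> ('g list \<Rightarrow> 'g list \<Rightarrow> complex)" where
  "act n g x = lam n g \<otimes>\<^bsub>T n\<^esub> x \<otimes>\<^bsub>T n\<^esub> lam n (inv g)"

lemma act_closed [simp, intro]: "x \<in> carrier (T n) \<Longrightarrow> act n g x \<in> carrier (T n)"
  by (simp add: act_def)

lemma act_entry:
  assumes "g \<in> carrier G" "x \<in> carrier (T n)"
  shows "act n g x = (\<lambda>s t. if s \<in> W n \<and> t \<in> W n then x (tr (inv g) s) (tr (inv g) t) else 0)"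
proof -
  have c: "lam n g \<otimes>\<^bsub>T n\<^esub> x \<in> carrier (T n)" using assms by simp
  show ?thesis unfolding act_def lam_right[OF inv_closed[OF assms(1)] c] unfolding lam_left[OF assms]
    by (auto simp: fun_eq_iff)
qed

lemma act_add: "x \<in> carrier (T n) \<Longrightarrow> y \<in> carrier (T n) \<Longrightarrow> act n g (x \<oplus>\<^bsub>T n\<^esub> y) = act n g x \<oplus>\<^bsub>T n\<^esub> act n g y"
  by (simp add: act_def T.l_distr T.r_distr)

lemma act_smult: "x \<in> carrier (T n) \<Longrightarrow> act n g (c \<odot>\<^bsub>T n\<^esub> x) = c \<odot>\<^bsub>T n\<^esub> act n g x"
  by (simp add: act_def T.smult_mult_left T.smult_mult_right)

lemma lam_inv_cancel: "g \<in> carrier G \<Longrightarrow> x \<in> carrier (T n) \<Longrightarrow> lam n (inv g) \<otimes>\<^bsub>T n\<^esub> (lam n g \<otimes>\<^bsub>T n\<^esub> x) = x"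
  by (simp add: T.m_assoc[symmetric] lam_mult lam_one)

lemma act_mult: "g \<in> carrier G \<Longrightarrow> x \<in> carrier (T n) \<Longrightarrow> y \<in> carrier (T n) \<Longrightarrow> act n g (x \<otimes>\<^bsub>T n\<^esub> y) = act n g x \<otimes>\<^bsub>T n\<^esub> act n g y"
  by (simp add: act_def T.m_assoc lam_inv_cancel)

lemma act_adj: "g \<in> carrier G \<Longrightarrow> x \<in> carrier (T n) \<Longrightarrow> act n g (adj (T n) x) = adj (T n) (act n g x)"
  by (simp add: act_def T.adj_mult lam_adj T.m_assoc)

lemma act_act: "g \<in> carrier G \<Longrightarrow> h \<in> carrier G \<Longrightarrow> x \<in> carrier (T n) \<Longrightarrow> act n g (act n h x) = act n (g \<otimes> h) x"
  by (simp add: act_def T.m_assoc lam_mult inv_mult_group) (simp add: T.m_assoc[symmetric] lam_mult)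

lemma act_one: "x \<in> carrier (T n) \<Longrightarrow> act n \<one> x = x"
  by (simp add: act_def lam_one)

lemma act_nrm:
  assumes "g \<in> carrier G" "x \<in> carrier (T n)"
  shows "nrm (T n) (act n g x) \<le> nrm (T n) x"
proof -
  have "nrm (T n) (act n g x) \<le> (nrm (T n) (lam n g) * nrm (T n) x) * nrm (T n) (lam n (inv g))"
    unfolding act_def using assms T.nrm_mult[of "lam n g" n x]
    by (intro order_trans[OF T.nrm_mult]) (auto intro!: mult_right_mono)
  also have "\<dots> \<le> (1 * nrm (T n) x) * 1" using assms by (intro mult_mono nrm_lam) auto
  finally show ?thesis by simp
qed

text \<open>Translation by g is a bijection of words, so suffixes are equal before it exactly if
  they are equal after it. Hence conjugation preserves the tensor factor 1, and the actions on the
  levels fit together.\<close>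

lemma act_oe:
  assumes "g \<in> carrier G" "k \<le> n" "x \<in> carrier (T k)"
  shows "act n g (oe k n x) = oe k n (act k g x)"
proof (intro ext)
  fix s t
  show "act n g (oe k n x) s t = oe k n (act k g x) s t"
  proof (cases "s \<in> W n \<and> t \<in> W n")
    case False
    then show ?thesis unfolding act_entry[OF assms(1) oe_closed] by (auto simp: one_ext_def)
  next
    case True
    have "tr (inv g) (drop k s) = tr (inv g) (drop k t) \<longleftrightarrow> drop k s = drop k t"
      using True assms words_drop[of s "carrier G" n k] words_drop[of t "carrier G" n k]
      by (metis inv_closed tr_inv_eq tr_words)
    then show ?thesis using True assms unfolding act_entry[OF assms(1) oe_closed]
      by (simp add: one_ext_def act_entry tr_words words_take tr_take tr_drop)
  qed
qed

abbreviation "\<alpha> \<equiv> regular_product_action G"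

lemma act_S:
  assumes g: "g \<in> carrier G" and x: "x \<in> S"
  shows "(\<lambda>n. act n g (x n)) \<in> S"
proof (rule cauchyI)
  note c = cauchy_carrier[OF x]
  show "act n g (x n) \<in> carrier (T n)" for n using c by auto
  fix e :: real assume "e > 0"
  then obtain N where N: "\<And>n. n \<ge> N \<Longrightarrow> nrm (T n) (x n \<ominus>\<^bsub>T n\<^esub> oe N n (x N)) < e"
    using x by (auto simp: cauchy_seqs_def) metis
  have "nrm (T n) (act n g (x n) \<ominus>\<^bsub>T n\<^esub> oe N n (act N g (x N))) < e" if n: "n \<ge> N" for n
  proof -
    have "act n g (x n) \<ominus>\<^bsub>T n\<^esub> oe N n (act N g (x N)) = act n g (x n \<ominus>\<^bsub>T n\<^esub> oe N n (x N))"
      using c n g by (simp add: act_oe[symmetric] oe_closed a_minus_def act_add act_smult flip: T.smult_minus_one)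
    then show ?thesis using N[OF n] act_nrm[OF g, of "x n \<ominus>\<^bsub>T n\<^esub> oe N n (x N)" n] c oe_closed by auto
  qed
  then show "\<exists>N. \<forall>n\<ge>N. nrm (T n) (act n g (x n) \<ominus>\<^bsub>T n\<^esub> oe N n (act N g (x N))) < e" by blast
qed

text \<open>Conjugation by the tensor powers is contractive and compatible with the embeddings,
  which is what \<open>seq_map_cls\<close> requires. All properties of the action are then read off
  termwise.\<close>

lemma alpha_cls:
  assumes g: "g \<in> carrier G" and x: "x \<in> S"
  shows "\<alpha> g (cls x) = cls (\<lambda>n. act n g (x n))"
proof -
  have eq: "tensor_power n (left_regular G g) \<otimes>\<^bsub>T n\<^esub> y \<otimes>\<^bsub>T n\<^esub> adj (T n) (tensor_power n (left_regular G g)) = act n g y" for n y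
    using g by (simp add: tensor_power_eq lam_adj act_def)
  have diff: "act n g y \<ominus>\<^bsub>T n\<^esub> act n g z = act n g (y \<ominus>\<^bsub>T n\<^esub> z)" if "y \<in> carrier (T n)" "z \<in> carrier (T n)" for n y z
    using that by (simp add: a_minus_def act_add act_smult flip: T.smult_minus_one)
  show ?thesis
    unfolding regular_product_action_def tensor_Ad_def eq
    by (rule seq_map_cls[OF seq_alg_axioms seq_alg_axioms x, where L = 1])
      (use g in \<open>auto simp: act_S diff act_nrm\<close>)
qed

lemma alpha_closed [simp, intro]: "g \<in> carrier G \<Longrightarrow> a \<in> carrier Q \<Longrightarrow> \<alpha> g a \<in> carrier Q"
  by (auto elim!: Q_cases simp: alpha_cls act_S cls_carrier)

lemma alpha_add: "g \<in> carrier G \<Longrightarrow> a \<in> carrier Q \<Longrightarrow> b \<in> carrier Q \<Longrightarrow> \<alpha> g (a \<oplus>\<^bsub>Q\<^esub> b) = \<alpha> g a \<oplus>\<^bsub>Q\<^esub> \<alpha> g b"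
  by (elim Q_cases) (simp add: alpha_cls act_S Q_add S_add act_add S_carrier)

lemma alpha_mult: "g \<in> carrier G \<Longrightarrow> a \<in> carrier Q \<Longrightarrow> b \<in> carrier Q \<Longrightarrow> \<alpha> g (a \<otimes>\<^bsub>Q\<^esub> b) = \<alpha> g a \<otimes>\<^bsub>Q\<^esub> \<alpha> g b"
  by (elim Q_cases) (simp add: alpha_cls act_S Q_mult S_mult act_mult S_carrier)

lemma alpha_smult: "g \<in> carrier G \<Longrightarrow> a \<in> carrier Q \<Longrightarrow> \<alpha> g (c \<odot>\<^bsub>Q\<^esub> a) = c \<odot>\<^bsub>Q\<^esub> \<alpha> g a"
  by (elim Q_cases) (simp add: alpha_cls act_S Q_smult S_smult act_smult S_carrier)

lemma alpha_adj: "g \<in> carrier G \<Longrightarrow> a \<in> carrier Q \<Longrightarrow> \<alpha> g (adj Q a) = adj Q (\<alpha> g a)"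
  by (elim Q_cases) (simp add: alpha_cls act_S Q_adj S_adj act_adj S_carrier)

lemma alpha_alpha: "g \<in> carrier G \<Longrightarrow> h \<in> carrier G \<Longrightarrow> a \<in> carrier Q \<Longrightarrow> \<alpha> g (\<alpha> h a) = \<alpha> (g \<otimes> h) a"
  by (elim Q_cases) (simp add: alpha_cls act_S act_act S_carrier)

lemma alpha_one: "a \<in> carrier Q \<Longrightarrow> \<alpha> \<one> a = a"
  by (elim Q_cases) (simp add: alpha_cls act_one S_carrier)

lemma alpha_nrm:
  assumes "g \<in> carrier G" "a \<in> carrier Q"
  shows "nrm Q (\<alpha> g a) \<le> nrm Q a"
proof -
  obtain x where x: "x \<in> S" "a = cls x" using assms(2) by (rule Q_cases)
  show ?thesis unfolding x(2) alpha_cls[OF assms(1) x(1)]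
    by (rule tendsto_le[OF nontriv Q_nrm_lim[OF x(1)] Q_nrm_lim[OF act_S[OF assms(1) x(1)]]])
      (use assms x S_carrier in \<open>auto intro!: always_eventually act_nrm\<close>)
qed

lemma alpha_level:
  assumes "g \<in> carrier G" "x \<in> carrier (T n)"
  shows "\<alpha> g (level n x) = level n (act n g x)"
  unfolding level_def[of n x] using assms
  by (subst alpha_cls, simp_all add: level_S, intro level_eqI[symmetric])
    (auto simp: act_S[OF _ level_S] act_oe)

definition vv :: "nat \<Rightarrow> 'g \<Rightarrow> _" where "vv n g = level n (lam n g)"

text \<open>The projection onto the words whose letter at position n is t. Positions count from 0,
  so it lives at level \<open>Suc n\<close> and leaves the first n letters free; this is why it
  commutes with every level up to n.\<close>

definition pmat :: "nat \<Rightarrow> 'g \<Rightarrow> 'g list \<Rightarrow> 'g list \<Rightarrow> complex" where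
  "pmat n t = (\<lambda>s r. if s \<in> W (Suc n) \<and> s = r \<and> s ! n = t then 1 else 0)"

definition pp :: "nat \<Rightarrow> 'g \<Rightarrow> _" where "pp n t = level (Suc n) (pmat n t)"

lemma pmat_closed [simp, intro]: "pmat n t \<in> carrier (T (Suc n))"
  by (auto simp: pmat_def T_simps)

lemma pmat_left: "x \<in> carrier (T (Suc n)) \<Longrightarrow> pmat n t \<otimes>\<^bsub>T (Suc n)\<^esub> x = (\<lambda>s r. if s \<in> W (Suc n) \<and> s ! n = t then x s r else 0)"
proof (intro ext)
  fix s r assume x: "x \<in> carrier (T (Suc n))"
  have "(pmat n t \<otimes>\<^bsub>T (Suc n)\<^esub> x) s r = (\<Sum>q\<in>W (Suc n). if s = q then (if s \<in> W (Suc n) \<and> s ! n = t then x s r else 0) else 0)"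
    unfolding T_simps by (intro sum.cong) (auto simp: pmat_def)
  then show "(pmat n t \<otimes>\<^bsub>T (Suc n)\<^esub> x) s r = (if s \<in> W (Suc n) \<and> s ! n = t then x s r else 0)"
    using fW by auto
qed

lemma pmat_right: "x \<in> carrier (T (Suc n)) \<Longrightarrow> x \<otimes>\<^bsub>T (Suc n)\<^esub> pmat n t = (\<lambda>s r. if r \<in> W (Suc n) \<and> r ! n = t then x s r else 0)"
proof (intro ext)
  fix s r assume x: "x \<in> carrier (T (Suc n))"
  have "(x \<otimes>\<^bsub>T (Suc n)\<^esub> pmat n t) s r = (\<Sum>q\<in>W (Suc n). if q = r then (if r \<in> W (Suc n) \<and> r ! n = t then x s r else 0) else 0)"
    unfolding T_simps by (intro sum.cong) (auto simp: pmat_def)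
  then show "(x \<otimes>\<^bsub>T (Suc n)\<^esub> pmat n t) s r = (if r \<in> W (Suc n) \<and> r ! n = t then x s r else 0)"
    using fW by auto
qed

lemma vv_closed [simp, intro]: "vv n g \<in> carrier Q" by (simp add: vv_def level_closed)
lemma pp_closed [simp, intro]: "pp n t \<in> carrier Q" by (simp add: pp_def level_closed)

lemma vv_mult: "g \<in> carrier G \<Longrightarrow> h \<in> carrier G \<Longrightarrow> vv n g \<otimes>\<^bsub>Q\<^esub> vv n h = vv n (g \<otimes> h)"
  by (simp add: vv_def level_mult[symmetric] lam_mult)
lemma vv_one: "vv n \<one> = \<one>\<^bsub>Q\<^esub>" by (simp add: vv_def lam_one level_one)
lemma vv_adj: "g \<in> carrier G \<Longrightarrow> adj Q (vv n g) = vv n (inv g)" by (simp add: vv_def level_adj[symmetric] lam_adj)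
lemma alpha_vv: "g \<in> carrier G \<Longrightarrow> h \<in> carrier G \<Longrightarrow> \<alpha> g (vv n h) = vv n (g \<otimes> h \<otimes> inv g)"
  by (simp add: vv_def alpha_level act_def lam_mult)

lemma pp_mult: "s \<in> carrier G \<Longrightarrow> t \<in> carrier G \<Longrightarrow> pp n s \<otimes>\<^bsub>Q\<^esub> pp n t = (if s = t then pp n s else \<zero>\<^bsub>Q\<^esub>)"
proof -
  have "pmat n s \<otimes>\<^bsub>T (Suc n)\<^esub> pmat n t = (if s = t then pmat n s else \<zero>\<^bsub>T (Suc n)\<^esub>)"
    by (subst pmat_left) (auto simp: pmat_def T_simps fun_eq_iff)
  then show ?thesis by (simp add: pp_def level_mult[symmetric] level_zero)
qed

lemma pp_sum: "(\<Oplus>\<^bsub>Q\<^esub>t\<in>carrier G. pp n t) = \<one>\<^bsub>Q\<^esub>"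
proof -
  have "(\<Oplus>\<^bsub>T (Suc n)\<^esub>t\<in>carrier G. pmat n t) = \<one>\<^bsub>T (Suc n)\<^esub>"
  proof (intro ext)
    fix s r
    have nth: "s ! n \<in> carrier G" if "s \<in> W (Suc n)" using that by (auto simp: words_def subset_iff)
    have "(\<Oplus>\<^bsub>T (Suc n)\<^esub>t\<in>carrier G. pmat n t) s r = (\<Sum>t\<in>carrier G. pmat n t s r)"
      using fin by (intro T_finsum_entry) auto
    also have "\<dots> = (\<Sum>t\<in>carrier G. if t = s ! n then (if s \<in> W (Suc n) \<and> s = r then 1 else 0) else 0)"
      by (intro sum.cong) (auto simp: pmat_def)
    also have "\<dots> = \<one>\<^bsub>T (Suc n)\<^esub> s r" using fin nth by (auto simp: T_simps)
    finally show "(\<Oplus>\<^bsub>T (Suc n)\<^esub>t\<in>carrier G. pmat n t) s r = \<one>\<^bsub>T (Suc n)\<^esub> s r" .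
  qed
  then show ?thesis unfolding pp_def using fin by (subst level_finsum[symmetric]) (auto simp: level_one)
qed

lemma alpha_pp:
  assumes "g \<in> carrier G" "t \<in> carrier G"
  shows "\<alpha> g (pp n t) = pp n (g \<otimes> t)"
proof -
  have "act (Suc n) g (pmat n t) = pmat n (g \<otimes> t)"
  proof (intro ext)
    fix s r
    show "act (Suc n) g (pmat n t) s r = pmat n (g \<otimes> t) s r"
    proof (cases "s \<in> W (Suc n) \<and> r \<in> W (Suc n)")
      case False then show ?thesis unfolding act_entry[OF assms(1) pmat_closed] by (auto simp: pmat_def)
    next
      case True
      have 1: "tr (inv g) s = tr (inv g) r \<longleftrightarrow> s = r" using True assms by (metis inv_closed tr_inv_eq tr_words)
      have "s ! n \<in> carrier G" using True by (auto simp: words_def subset_iff)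
      then have 2: "tr (inv g) s ! n = t \<longleftrightarrow> s ! n = g \<otimes> t"
        using True assms by (auto simp: tr_def words_def inv_solve_left' simp del: nth_mem)
      show ?thesis unfolding act_entry[OF assms(1) pmat_closed] unfolding pmat_def using True 1 2 assms by (simp add: tr_words)
    qed
  qed
  then show ?thesis using assms by (simp add: pp_def alpha_level)
qed

text \<open>If f n vanishes on level N from n = N on, and the f n are Lipschitz with a constant
  independent of n, density of the levels makes them tend to 0 at a. Both asymptotic properties
  below have this shape; K + 1 avoids division by zero.\<close>

lemma approx_null:
  fixes f :: "nat \<Rightarrow> _ \<Rightarrow> real"
  assumes a: "a \<in> carrier Q" and nonneg: "\<And>n b. b \<in> carrier Q \<Longrightarrow> 0 \<le> f n b"
    and zero: "\<And>N n x. N \<le> n \<Longrightarrow> x \<in> carrier (T N) \<Longrightarrow> f n (level N x) = 0"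
    and lip: "\<And>n b. b \<in> carrier Q \<Longrightarrow> f n a \<le> f n b + K * nrm Q (a \<ominus>\<^bsub>Q\<^esub> b)" and K: "K \<ge> 0"
  shows "(\<lambda>n. f n a) \<longlonglongrightarrow> 0"
proof (rule LIMSEQ_I)
  fix r :: real assume r: "r > 0"
  have "r / (K + 1) > 0" using r K by simp
  from level_dense[OF a this] obtain N x where x: "x \<in> carrier (T N)" "nrm Q (a \<ominus>\<^bsub>Q\<^esub> level N x) \<le> r / (K + 1)"
    by (metis order_refl)
  have "norm (f n a - 0) < r" if "n \<ge> N" for n
  proof -
    have "f n a \<le> K * nrm Q (a \<ominus>\<^bsub>Q\<^esub> level N x)" using lip[of "level N x" n] zero[OF that x(1)] x by auto
    also have "\<dots> \<le> K * (r / (K + 1))" using x K by (intro mult_left_mono)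
    also have "\<dots> < r" using r K by (simp add: field_simps)
    finally show ?thesis using nonneg[OF a] by simp
  qed
  then show "\<exists>N. \<forall>n\<ge>N. norm (f n a - 0) < r" by blast
qed

lemma nrm_vv: "g \<in> carrier G \<Longrightarrow> nrm Q (vv n g) \<le> 1" by (simp add: vv_def level_nrm nrm_lam)

text \<open>A self-adjoint idempotent has a norm r with r = r^2.\<close>

lemma nrm_pp:
  assumes "t \<in> carrier G" shows "nrm Q (pp n t) \<le> 1"
proof -
  have "adj (T (Suc n)) (pmat n t) = pmat n t" by (auto simp: pmat_def T_simps fun_eq_iff)
  then have "adj Q (pp n t) = pp n t" by (simp add: pp_def level_adj[symmetric])
  then have "nrm Q (pp n t) = (nrm Q (pp n t))\<^sup>2"
    using Q_cstar pp_mult[OF assms assms, of n] by (auto simp: cstar_id_def dest!: bspec[of _ _ "pp n t"])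
  then show ?thesis by (auto simp: power2_eq_square)
qed

text \<open>Conjugation by \<open>vv n g\<close> agrees with the action exactly on every level N <=
  n. Both maps are contractive, whence the constant 2.\<close>

lemma Ad_vv_tendsto:
  assumes g: "g \<in> carrier G" and a: "a \<in> carrier Q"
  shows "(\<lambda>n. nrm Q (vv n g \<otimes>\<^bsub>Q\<^esub> a \<otimes>\<^bsub>Q\<^esub> vv n (inv g) \<ominus>\<^bsub>Q\<^esub> \<alpha> g a)) \<longlonglongrightarrow> 0"
proof (rule approx_null[OF a, where K = 2])
  fix n b assume b: "b \<in> carrier Q"
  let ?f = "\<lambda>a. vv n g \<otimes>\<^bsub>Q\<^esub> a \<otimes>\<^bsub>Q\<^esub> vv n (inv g)"
  show "0 \<le> nrm Q (?f b \<ominus>\<^bsub>Q\<^esub> \<alpha> g b)" using b g by simp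
  have fab: "?f a \<ominus>\<^bsub>Q\<^esub> ?f b = ?f (a \<ominus>\<^bsub>Q\<^esub> b)" using a b
    by (simp add: a_minus_def Q.l_distr Q.r_distr Q.l_minus Q.r_minus)
  have "nrm Q (?f (a \<ominus>\<^bsub>Q\<^esub> b)) \<le> (nrm Q (vv n g) * nrm Q (a \<ominus>\<^bsub>Q\<^esub> b)) * nrm Q (vv n (inv g))"
    using a b Q.nrm_mult[of "vv n g" "a \<ominus>\<^bsub>Q\<^esub> b"]
    by (intro order_trans[OF Q.nrm_mult]) (auto intro!: mult_right_mono)
  also have "\<dots> \<le> (1 * nrm Q (a \<ominus>\<^bsub>Q\<^esub> b)) * 1" using a b g by (intro mult_mono nrm_vv) auto
  finally have 1: "nrm Q (?f a \<ominus>\<^bsub>Q\<^esub> ?f b) \<le> nrm Q (a \<ominus>\<^bsub>Q\<^esub> b)" by (simp add: fab)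
  have "\<alpha> g b \<ominus>\<^bsub>Q\<^esub> \<alpha> g a = \<alpha> g (b \<ominus>\<^bsub>Q\<^esub> a)" using a b g
    by (simp add: a_minus_def alpha_add alpha_smult flip: Q.smult_minus_one)
  then have 2: "nrm Q (\<alpha> g b \<ominus>\<^bsub>Q\<^esub> \<alpha> g a) \<le> nrm Q (a \<ominus>\<^bsub>Q\<^esub> b)"
    using alpha_nrm[OF g, of "b \<ominus>\<^bsub>Q\<^esub> a"] a b by (simp add: Q.nrm_diff_commute)
  show "nrm Q (?f a \<ominus>\<^bsub>Q\<^esub> \<alpha> g a) \<le> nrm Q (?f b \<ominus>\<^bsub>Q\<^esub> \<alpha> g b) + 2 * nrm Q (a \<ominus>\<^bsub>Q\<^esub> b)"
    using 1 2 Q.nrm_triangle[of "?f a" "?f b" "\<alpha> g a"] Q.nrm_triangle[of "?f b" "\<alpha> g b" "\<alpha> g a"] a b g by auto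
next
  fix N n x assume x: "N \<le> n" "x \<in> carrier (T N)"
  let ?y = "oe N n x"
  have "level N x = level n ?y" using x by (simp add: level_phi)
  then show "nrm Q (vv n g \<otimes>\<^bsub>Q\<^esub> level N x \<otimes>\<^bsub>Q\<^esub> vv n (inv g) \<ominus>\<^bsub>Q\<^esub> \<alpha> g (level N x)) = 0"
    using g by (simp add: vv_def level_mult[symmetric] alpha_level oe_closed act_def level_closed)
qed simp

text \<open>An element of level N <= n does not touch the letter at position n, so its commutator
  with the projection is zero.\<close>

lemma pp_central:
  assumes t: "t \<in> carrier G" and a: "a \<in> carrier Q"
  shows "(\<lambda>n. nrm Q (a \<otimes>\<^bsub>Q\<^esub> pp n t \<ominus>\<^bsub>Q\<^esub> pp n t \<otimes>\<^bsub>Q\<^esub> a)) \<longlonglongrightarrow> 0"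
proof (rule approx_null[OF a, where K = 2])
  fix n b assume b: "b \<in> carrier Q"
  let ?p = "pp n t"
  show "0 \<le> nrm Q (b \<otimes>\<^bsub>Q\<^esub> ?p \<ominus>\<^bsub>Q\<^esub> ?p \<otimes>\<^bsub>Q\<^esub> b)" using b by simp
  have 1: "nrm Q (a \<otimes>\<^bsub>Q\<^esub> ?p \<ominus>\<^bsub>Q\<^esub> b \<otimes>\<^bsub>Q\<^esub> ?p) \<le> nrm Q (a \<ominus>\<^bsub>Q\<^esub> b)"
    using Q.nrm_mult_diff[of a ?p b ?p] a b nrm_pp[OF t, of n] mult_left_mono[OF nrm_pp[OF t, of n], of "nrm Q (a \<ominus>\<^bsub>Q\<^esub> b)"] by simp
  have 2: "nrm Q (?p \<otimes>\<^bsub>Q\<^esub> b \<ominus>\<^bsub>Q\<^esub> ?p \<otimes>\<^bsub>Q\<^esub> a) \<le> nrm Q (a \<ominus>\<^bsub>Q\<^esub> b)"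
    using Q.nrm_mult_diff[of ?p b ?p a] a b mult_right_mono[OF nrm_pp[OF t, of n], of "nrm Q (b \<ominus>\<^bsub>Q\<^esub> a)"] by (simp add: Q.nrm_diff_commute[of b a])
  show "nrm Q (a \<otimes>\<^bsub>Q\<^esub> ?p \<ominus>\<^bsub>Q\<^esub> ?p \<otimes>\<^bsub>Q\<^esub> a) \<le> nrm Q (b \<otimes>\<^bsub>Q\<^esub> ?p \<ominus>\<^bsub>Q\<^esub> ?p \<otimes>\<^bsub>Q\<^esub> b) + 2 * nrm Q (a \<ominus>\<^bsub>Q\<^esub> b)"
    using 1 2 Q.nrm_triangle[of "a \<otimes>\<^bsub>Q\<^esub> ?p" "b \<otimes>\<^bsub>Q\<^esub> ?p" "?p \<otimes>\<^bsub>Q\<^esub> a"] Q.nrm_triangle[of "b \<otimes>\<^bsub>Q\<^esub> ?p" "?p \<otimes>\<^bsub>Q\<^esub> b" "?p \<otimes>\<^bsub>Q\<^esub> a"] a b by auto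
next
  fix N n x assume x: "N \<le> n" "x \<in> carrier (T N)"
  let ?y = "oe N (Suc n) x"
  have "?y \<otimes>\<^bsub>T (Suc n)\<^esub> pmat n t = pmat n t \<otimes>\<^bsub>T (Suc n)\<^esub> ?y"
  proof -
    have nth: "s ! n = r ! n" if "drop N s = drop N r" "s \<in> W (Suc n)" "r \<in> W (Suc n)" for s r
      using that x(1) nth_drop[of N s "n - N"] nth_drop[of N r "n - N"] by (auto simp: words_def)
    show ?thesis unfolding pmat_left[OF oe_closed] pmat_right[OF oe_closed]
    proof (intro ext)
      fix s r
      show "(if r \<in> W (Suc n) \<and> r ! n = t then ?y s r else 0) = (if s \<in> W (Suc n) \<and> s ! n = t then ?y s r else 0)"
      proof (cases "s \<in> W (Suc n) \<and> r \<in> W (Suc n) \<and> drop N s = drop N r")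
        case True
        then have "s ! n = r ! n" using nth by blast
        then show ?thesis using True by simp
      next
        case False
        then have "?y s r = 0" by (auto simp: one_ext_def)
        then show ?thesis by simp
      qed
    qed
  qed
  moreover have "level N x = level (Suc n) ?y" using x by (simp add: level_phi)
  ultimately show "nrm Q (level N x \<otimes>\<^bsub>Q\<^esub> pp n t \<ominus>\<^bsub>Q\<^esub> pp n t \<otimes>\<^bsub>Q\<^esub> level N x) = 0"
    by (simp add: pp_def level_mult[symmetric] oe_closed level_closed)
qed simp

end

section \<open>The crossed product as a normed star-algebra\<close>

text \<open>Collects what the crossed product uses of its coefficients. The inequalities are asked
  for columns indexed by G because the regular representation acts on such columns.\<close>

locale crossed = group G + A: nstar A 1 for G :: "'g monoid" (structure) and A :: "'a cstar" +
  fixes \<alpha> :: "'g \<Rightarrow> 'a \<Rightarrow> 'a"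
  assumes fin: "finite (carrier G)"
    and cstar: "cstar_id A" and definite: "\<And>x. x \<in> carrier A \<Longrightarrow> nrm A x = 0 \<Longrightarrow> x = \<zero>\<^bsub>A\<^esub>"
    and nontrivial: "\<one>\<^bsub>A\<^esub> \<noteq> \<zero>\<^bsub>A\<^esub>"
    and cs: "cs_ineq A (carrier G)" and lb: "left_mult_ineq A (carrier G)"
    and alpha_closed [simp, intro]: "\<And>g x. g \<in> carrier G \<Longrightarrow> x \<in> carrier A \<Longrightarrow> \<alpha> g x \<in> carrier A"
    and alpha_add: "\<And>g x y. g \<in> carrier G \<Longrightarrow> x \<in> carrier A \<Longrightarrow> y \<in> carrier A \<Longrightarrow> \<alpha> g (x \<oplus>\<^bsub>A\<^esub> y) = \<alpha> g x \<oplus>\<^bsub>A\<^esub> \<alpha> g y"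
    and alpha_mult: "\<And>g x y. g \<in> carrier G \<Longrightarrow> x \<in> carrier A \<Longrightarrow> y \<in> carrier A \<Longrightarrow> \<alpha> g (x \<otimes>\<^bsub>A\<^esub> y) = \<alpha> g x \<otimes>\<^bsub>A\<^esub> \<alpha> g y"
    and alpha_smult: "\<And>g x c. g \<in> carrier G \<Longrightarrow> x \<in> carrier A \<Longrightarrow> \<alpha> g (c \<odot>\<^bsub>A\<^esub> x) = c \<odot>\<^bsub>A\<^esub> \<alpha> g x"
    and alpha_adj: "\<And>g x. g \<in> carrier G \<Longrightarrow> x \<in> carrier A \<Longrightarrow> \<alpha> g (adj A x) = adj A (\<alpha> g x)"
    and alpha_alpha: "\<And>g h x. g \<in> carrier G \<Longrightarrow> h \<in> carrier G \<Longrightarrow> x \<in> carrier A \<Longrightarrow> \<alpha> g (\<alpha> h x) = \<alpha> (g \<otimes> h) x"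
    and alpha_one [simp]: "\<And>x. x \<in> carrier A \<Longrightarrow> \<alpha> \<one> x = x"
    and alpha_nrm_le: "\<And>g x. g \<in> carrier G \<Longrightarrow> x \<in> carrier A \<Longrightarrow> nrm A (\<alpha> g x) \<le> nrm A x"
begin

abbreviation "m \<equiv> card (carrier G)"
abbreviation "M \<equiv> crossed_product G A \<alpha>"
abbreviation "F \<equiv> cp_expectation G A"
abbreviation "vec \<equiv> carrier G \<rightarrow> carrier A"
abbreviation "rr \<equiv> regular_rep G A \<alpha>"
abbreviation "l2 \<equiv> l2_nrm G A"

lemma m_pos: "m > 0" using fin one_closed by (auto simp: card_gt_0_iff)

lemma alpha_zero [simp]: "g \<in> carrier G \<Longrightarrow> \<alpha> g \<zero>\<^bsub>A\<^esub> = \<zero>\<^bsub>A\<^esub>"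
  using alpha_smult[of g "\<zero>\<^bsub>A\<^esub>" 0] by simp

lemma alpha_inv_cancel [simp]: "g \<in> carrier G \<Longrightarrow> x \<in> carrier A \<Longrightarrow> \<alpha> g (\<alpha> (inv g) x) = x" "g \<in> carrier G \<Longrightarrow> x \<in> carrier A \<Longrightarrow> \<alpha> (inv g) (\<alpha> g x) = x"
  by (auto simp: alpha_alpha)

lemma alpha_A_one [simp]: "g \<in> carrier G \<Longrightarrow> \<alpha> g \<one>\<^bsub>A\<^esub> = \<one>\<^bsub>A\<^esub>"
proof -
  assume g: "g \<in> carrier G"
  have "\<alpha> g \<one>\<^bsub>A\<^esub> \<otimes>\<^bsub>A\<^esub> \<alpha> g (\<alpha> (inv g) \<one>\<^bsub>A\<^esub>) = \<alpha> g (\<one>\<^bsub>A\<^esub> \<otimes>\<^bsub>A\<^esub> \<alpha> (inv g) \<one>\<^bsub>A\<^esub>)" using g by (intro alpha_mult[symmetric]) auto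
  then show ?thesis using g by simp
qed

lemma alpha_nrm: "g \<in> carrier G \<Longrightarrow> x \<in> carrier A \<Longrightarrow> nrm A (\<alpha> g x) = nrm A x"
  using alpha_nrm_le[of g x] alpha_nrm_le[of "inv g" "\<alpha> g x"] by simp

lemma alpha_sum:
  assumes "g \<in> carrier G" "finite I" "f \<in> I \<rightarrow> carrier A"
  shows "\<alpha> g (\<Oplus>\<^bsub>A\<^esub>i\<in>I. f i) = (\<Oplus>\<^bsub>A\<^esub>i\<in>I. \<alpha> g (f i))"
  using assms(2,3)
proof (induction I)
  case (insert i I)
  then show ?case using assms(1) by (subst A.finsum_insert; simp add: alpha_add Pi_def)
qed (simp add: assms)

lemma sum_left:
  assumes "h \<in> carrier G" "f \<in> vec"
  shows "(\<Oplus>\<^bsub>A\<^esub>g\<in>carrier G. f (h \<otimes> g)) = (\<Oplus>\<^bsub>A\<^esub>g\<in>carrier G. f g)"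
proof -
  have "(\<lambda>g. h \<otimes> g) ` carrier G = carrier G" "inj_on (\<lambda>g. h \<otimes> g) (carrier G)"
    using assms surj_const_mult inj_on_multc[of h] by (auto simp: inj_on_def)
  then show ?thesis using A.finsum_reindex[of f "\<lambda>g. h \<otimes> g" "carrier G"] assms by auto
qed

lemma sum_inv:
  assumes "f \<in> vec"
  shows "(\<Oplus>\<^bsub>A\<^esub>g\<in>carrier G. f (inv g)) = (\<Oplus>\<^bsub>A\<^esub>g\<in>carrier G. f g)"
proof -
  have "(\<lambda>g. inv g) ` carrier G = carrier G" by (auto intro!: image_eqI[of _ _ "inv x" for x])
  moreover have "inj_on (\<lambda>g. inv g) (carrier G)" by (rule inj_onI) (metis inv_inv)
  ultimately show ?thesis using A.finsum_reindex[of f "\<lambda>g. inv g" "carrier G"] assms by auto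
qed

section \<open>The Hilbert A-module of columns indexed by G\<close>

definition ip where "ip \<xi> \<eta> = (\<Oplus>\<^bsub>A\<^esub>k\<in>carrier G. adj A (\<xi> k) \<otimes>\<^bsub>A\<^esub> \<eta> k)"

lemma vecD: "\<xi> \<in> vec \<Longrightarrow> k \<in> carrier G \<Longrightarrow> \<xi> k \<in> carrier A" by auto

lemma ip_closed [simp, intro]: "\<xi> \<in> vec \<Longrightarrow> \<eta> \<in> vec \<Longrightarrow> ip \<xi> \<eta> \<in> carrier A"
  unfolding ip_def by (intro A.finsum_closed) auto

lemma l2_def: "l2 \<xi> = sqrt (nrm A (ip \<xi> \<xi>))" by (simp add: l2_nrm_def ip_def)

lemma l2_nonneg [simp]: "\<xi> \<in> vec \<Longrightarrow> 0 \<le> l2 \<xi>" by (simp add: l2_def)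

lemma l2_sq: "\<xi> \<in> vec \<Longrightarrow> (l2 \<xi>)\<^sup>2 = nrm A (ip \<xi> \<xi>)" by (simp add: l2_def)

lemma ip_cs:
  assumes "\<xi> \<in> vec" "\<eta> \<in> vec"
  shows "nrm A (ip \<xi> \<eta>) \<le> l2 \<xi> * l2 \<eta>"
proof -
  have "(nrm A (ip \<xi> \<eta>))\<^sup>2 \<le> nrm A (ip \<xi> \<xi>) * nrm A (ip \<eta> \<eta>)" using cs assms unfolding cs_ineq_def ip_def by blast
  also have "\<dots> = (l2 \<xi> * l2 \<eta>)\<^sup>2" using assms by (simp add: power_mult_distrib l2_sq)
  finally show ?thesis by (rule power2_le_imp_le) (use assms in simp)
qed

lemma ip_cong: "(\<And>k. k \<in> carrier G \<Longrightarrow> \<xi> k = \<xi>' k) \<Longrightarrow> (\<And>k. k \<in> carrier G \<Longrightarrow> \<eta> k = \<eta>' k) \<Longrightarrow> \<xi> \<in> vec \<Longrightarrow> \<eta> \<in> vec \<Longrightarrow> ip \<xi> \<eta> = ip \<xi>' \<eta>'"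
proof -
  assume *: "\<And>k. k \<in> carrier G \<Longrightarrow> \<xi> k = \<xi>' k" "\<And>k. k \<in> carrier G \<Longrightarrow> \<eta> k = \<eta>' k" "\<xi> \<in> vec" "\<eta> \<in> vec"
  then have "\<xi>' \<in> vec" "\<eta>' \<in> vec" by (metis Pi_cong)+
  then show ?thesis unfolding ip_def using * by (intro A.finsum_cong') (auto simp: vecD)
qed

lemma l2_cong: "(\<And>k. k \<in> carrier G \<Longrightarrow> \<xi> k = \<xi>' k) \<Longrightarrow> \<xi> \<in> vec \<Longrightarrow> l2 \<xi> = l2 \<xi>'"
  unfolding l2_def by (metis (no_types) ip_cong)

lemma ip_add:
  assumes "\<xi> \<in> vec" "\<eta> \<in> vec" "\<xi>' \<in> vec" "\<eta>' \<in> vec"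
  shows "ip (\<lambda>k. \<xi> k \<oplus>\<^bsub>A\<^esub> \<eta> k) (\<lambda>k. \<xi>' k \<oplus>\<^bsub>A\<^esub> \<eta>' k) = (ip \<xi> \<xi>' \<oplus>\<^bsub>A\<^esub> ip \<xi> \<eta>') \<oplus>\<^bsub>A\<^esub> (ip \<eta> \<xi>' \<oplus>\<^bsub>A\<^esub> ip \<eta> \<eta>')"
proof -
  have "ip (\<lambda>k. \<xi> k \<oplus>\<^bsub>A\<^esub> \<eta> k) (\<lambda>k. \<xi>' k \<oplus>\<^bsub>A\<^esub> \<eta>' k) = (\<Oplus>\<^bsub>A\<^esub>k\<in>carrier G.
     (adj A (\<xi> k) \<otimes>\<^bsub>A\<^esub> \<xi>' k \<oplus>\<^bsub>A\<^esub> adj A (\<xi> k) \<otimes>\<^bsub>A\<^esub> \<eta>' k) \<oplus>\<^bsub>A\<^esub> (adj A (\<eta> k) \<otimes>\<^bsub>A\<^esub> \<xi>' k \<oplus>\<^bsub>A\<^esub> adj A (\<eta> k) \<otimes>\<^bsub>A\<^esub> \<eta>' k))"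
    unfolding ip_def using assms
    by (intro A.finsum_cong') (auto simp: vecD A.adj_add A.l_distr A.r_distr A.a_ac)
  then show ?thesis unfolding ip_def using assms by (simp add: A.finsum_addf Pi_def)
qed

lemma l2_add:
  assumes "\<xi> \<in> vec" "\<eta> \<in> vec"
  shows "l2 (\<lambda>k. \<xi> k \<oplus>\<^bsub>A\<^esub> \<eta> k) \<le> l2 \<xi> + l2 \<eta>"
proof -
  have v: "(\<lambda>k. \<xi> k \<oplus>\<^bsub>A\<^esub> \<eta> k) \<in> vec" using assms by auto
  have "nrm A (ip (\<lambda>k. \<xi> k \<oplus>\<^bsub>A\<^esub> \<eta> k) (\<lambda>k. \<xi> k \<oplus>\<^bsub>A\<^esub> \<eta> k)) \<le> (nrm A (ip \<xi> \<xi>) + nrm A (ip \<xi> \<eta>)) + (nrm A (ip \<eta> \<xi>) + nrm A (ip \<eta> \<eta>))"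
    unfolding ip_add[OF assms assms] using assms
    by (intro order_trans[OF A.nrm_add] add_mono A.nrm_add) auto
  also have "\<dots> \<le> ((l2 \<xi>)\<^sup>2 + l2 \<xi> * l2 \<eta>) + (l2 \<eta> * l2 \<xi> + (l2 \<eta>)\<^sup>2)"
    using assms by (intro add_mono ip_cs) (auto simp: l2_sq)
  also have "\<dots> = (l2 \<xi> + l2 \<eta>)\<^sup>2" by (simp add: power2_eq_square algebra_simps)
  finally have "(l2 (\<lambda>k. \<xi> k \<oplus>\<^bsub>A\<^esub> \<eta> k))\<^sup>2 \<le> (l2 \<xi> + l2 \<eta>)\<^sup>2" using v by (simp add: l2_sq)
  then show ?thesis by (rule power2_le_imp_le) (use assms in auto)
qed

lemma l2_smult:
  assumes "\<xi> \<in> vec"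
  shows "l2 (\<lambda>k. c \<odot>\<^bsub>A\<^esub> \<xi> k) = cmod c * l2 \<xi>"
proof -
  have "ip (\<lambda>k. c \<odot>\<^bsub>A\<^esub> \<xi> k) (\<lambda>k. c \<odot>\<^bsub>A\<^esub> \<xi> k) = (cnj c * c) \<odot>\<^bsub>A\<^esub> ip \<xi> \<xi>"
    unfolding ip_def using assms
    by (subst A.smult_finsum[OF fin]) (auto simp: vecD A.adj_smult A.smult_mult_left A.smult_mult_right A.smult_smult mult.commute intro!: A.finsum_cong')
  then show ?thesis using assms unfolding l2_def
    by (simp add: A.nrm_smult norm_mult real_sqrt_mult)
qed

lemma nrm_A_one: "nrm A \<one>\<^bsub>A\<^esub> = 1"
proof -
  have "nrm A \<one>\<^bsub>A\<^esub> = (nrm A \<one>\<^bsub>A\<^esub>)\<^sup>2" using cstar by (auto simp: cstar_id_def dest!: bspec[of _ _ "\<one>\<^bsub>A\<^esub>"])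
  moreover have "nrm A \<one>\<^bsub>A\<^esub> \<noteq> 0" using definite nontrivial by blast
  ultimately show ?thesis by (auto simp: power2_eq_square)
qed

definition delta where "delta h a = (\<lambda>k. if k = h then a else \<zero>\<^bsub>A\<^esub>)"

lemma delta_vec [simp, intro]: "a \<in> carrier A \<Longrightarrow> delta h a \<in> vec" by (auto simp: delta_def)

lemma ip_delta: "\<xi> \<in> vec \<Longrightarrow> h \<in> carrier G \<Longrightarrow> a \<in> carrier A \<Longrightarrow> ip \<xi> (delta h a) = adj A (\<xi> h) \<otimes>\<^bsub>A\<^esub> a"
proof -
  assume *: "\<xi> \<in> vec" "h \<in> carrier G" "a \<in> carrier A"
  have "ip \<xi> (delta h a) = (\<Oplus>\<^bsub>A\<^esub>k\<in>carrier G. if k = h then adj A (\<xi> h) \<otimes>\<^bsub>A\<^esub> a else \<zero>\<^bsub>A\<^esub>)"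
    unfolding ip_def using * by (intro A.finsum_cong') (auto simp: delta_def vecD)
  also have "\<dots> = adj A (\<xi> h) \<otimes>\<^bsub>A\<^esub> a" using * by (intro A.finsum_single fin) (auto simp: vecD)
  finally show ?thesis .
qed

lemma l2_delta: "h \<in> carrier G \<Longrightarrow> a \<in> carrier A \<Longrightarrow> l2 (delta h a) = nrm A a"
  using cstar unfolding l2_def by (subst ip_delta) (auto simp: delta_def cstar_id_def)

lemma nrm_adj: "x \<in> carrier A \<Longrightarrow> nrm A (adj A x) = nrm A x"
  using A.nrm_adj_le[of x] A.nrm_adj_le[of "adj A x"] by simp

text \<open>Cauchy-Schwarz against the column whose only entry is 1, at h.\<close>

lemma l2_comp: "\<xi> \<in> vec \<Longrightarrow> h \<in> carrier G \<Longrightarrow> nrm A (\<xi> h) \<le> l2 \<xi>"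
  using ip_cs[of \<xi> "delta h \<one>\<^bsub>A\<^esub>"] by (simp add: ip_delta l2_delta nrm_A_one nrm_adj vecD)

text \<open>\<open>left_mult_ineq\<close> demands a strict bound, so it is applied with every d > c,
  and the estimate is passed to the limit d -> c.\<close>

lemma l2_mult:
  assumes "b \<in> vec" "\<xi> \<in> vec" and le: "\<And>k. k \<in> carrier G \<Longrightarrow> nrm A (b k) \<le> c"
  shows "l2 (\<lambda>k. b k \<otimes>\<^bsub>A\<^esub> \<xi> k) \<le> c * l2 \<xi>"
proof -
  have c: "c \<ge> 0" using le[of \<one>] A.nrm_nonneg[OF vecD[OF assms(1) one_closed]] by simp
  have *: "l2 (\<lambda>k. b k \<otimes>\<^bsub>A\<^esub> \<xi> k) \<le> d * l2 \<xi>" if "d > c" for d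
  proof -
    have "(l2 (\<lambda>k. b k \<otimes>\<^bsub>A\<^esub> \<xi> k))\<^sup>2 \<le> d\<^sup>2 * (l2 \<xi>)\<^sup>2"
      using lb assms that le_less_trans[OF le \<open>d > c\<close>]
      by (subst (1 2) l2_sq) (auto simp: ip_def left_mult_ineq_def)
    then have "(l2 (\<lambda>k. b k \<otimes>\<^bsub>A\<^esub> \<xi> k))\<^sup>2 \<le> (d * l2 \<xi>)\<^sup>2" by (simp add: power_mult_distrib)
    then show ?thesis by (rule power2_le_imp_le) (use c that assms in auto)
  qed
  show ?thesis
  proof (rule tendsto_lowerbound)
    show "((\<lambda>d. d * l2 \<xi>) \<longlongrightarrow> c * l2 \<xi>) (at_right c)" by (intro tendsto_intros)
    show "eventually (\<lambda>d. l2 (\<lambda>k. b k \<otimes>\<^bsub>A\<^esub> \<xi> k) \<le> d * l2 \<xi>) (at_right c)"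
      using * by (auto simp: eventually_at_filter)
  qed simp
qed

lemma l2_shift:
  assumes "\<xi> \<in> vec" "g \<in> carrier G"
  shows "l2 (\<lambda>k. \<xi> (g \<otimes> k)) = l2 \<xi>"
  unfolding l2_def ip_def using sum_left[of g "\<lambda>k. adj A (\<xi> k) \<otimes>\<^bsub>A\<^esub> \<xi> k"] assms by (auto simp: Pi_iff)

lemma l2_sum:
  assumes "finite I" "\<And>i. i \<in> I \<Longrightarrow> \<xi> i \<in> vec"
  shows "l2 (\<lambda>k. \<Oplus>\<^bsub>A\<^esub>i\<in>I. \<xi> i k) \<le> (\<Sum>i\<in>I. l2 (\<xi> i))"
  using assms
proof (induction I rule: finite_induct)
  case empty
  have "l2 (\<lambda>k. \<zero>\<^bsub>A\<^esub>) = 0" using l2_smult[of "\<lambda>k. \<zero>\<^bsub>A\<^esub>" 0] by simp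
  then show ?case by simp
next
  case (insert i I)
  have v: "(\<lambda>k. \<Oplus>\<^bsub>A\<^esub>i\<in>I. \<xi> i k) \<in> vec" using insert by (auto intro!: A.finsum_closed)
  have "l2 (\<lambda>k. \<Oplus>\<^bsub>A\<^esub>i\<in>insert i I. \<xi> i k) = l2 (\<lambda>k. \<xi> i k \<oplus>\<^bsub>A\<^esub> (\<Oplus>\<^bsub>A\<^esub>i\<in>I. \<xi> i k))"
    using insert v by (intro l2_cong[symmetric]) (auto intro!: A.finsum_insert[symmetric])
  also have "\<dots> \<le> l2 (\<xi> i) + l2 (\<lambda>k. \<Oplus>\<^bsub>A\<^esub>i\<in>I. \<xi> i k)" using insert v by (intro l2_add) auto
  finally show ?case using insert by auto
qed

section \<open>The involutive algebra structure of the crossed product\<close>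

lemma M_simps:
  "carrier M = carrier G \<rightarrow>\<^sub>E carrier A"
  "x \<otimes>\<^bsub>M\<^esub> y = (\<lambda>k\<in>carrier G. \<Oplus>\<^bsub>A\<^esub>g\<in>carrier G. x g \<otimes>\<^bsub>A\<^esub> \<alpha> g (y (inv g \<otimes> k)))"
  "\<one>\<^bsub>M\<^esub> = (\<lambda>g\<in>carrier G. if g = \<one> then \<one>\<^bsub>A\<^esub> else \<zero>\<^bsub>A\<^esub>)"
  "\<zero>\<^bsub>M\<^esub> = (\<lambda>g\<in>carrier G. \<zero>\<^bsub>A\<^esub>)"
  "x \<oplus>\<^bsub>M\<^esub> y = (\<lambda>g\<in>carrier G. x g \<oplus>\<^bsub>A\<^esub> y g)"
  "c \<odot>\<^bsub>M\<^esub> x = (\<lambda>g\<in>carrier G. c \<odot>\<^bsub>A\<^esub> x g)"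
  "adj M x = (\<lambda>g\<in>carrier G. \<alpha> g (adj A (x (inv g))))"
  "nrm M x = (SUP \<xi> \<in> {\<xi> \<in> carrier G \<rightarrow>\<^sub>E carrier A. l2 \<xi> \<le> 1}. l2 (rr x \<xi>))"
  by (simp_all add: crossed_product_def)

lemma M_vec: "x \<in> carrier M \<Longrightarrow> x \<in> vec" by (auto simp: M_simps)
lemma M_comp [simp, intro]: "x \<in> carrier M \<Longrightarrow> k \<in> carrier G \<Longrightarrow> x k \<in> carrier A" by (auto simp: M_simps)
lemma M_ext: "x \<in> carrier M \<Longrightarrow> y \<in> carrier M \<Longrightarrow> (\<And>k. k \<in> carrier G \<Longrightarrow> x k = y k) \<Longrightarrow> x = y"
  by (auto simp: M_simps intro: PiE_ext)

lemma M_mult_closed: "x \<in> carrier M \<Longrightarrow> y \<in> carrier M \<Longrightarrow> x \<otimes>\<^bsub>M\<^esub> y \<in> carrier M"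
  by (auto simp: M_simps intro!: A.finsum_closed)

lemma M_mult_comp: "k \<in> carrier G \<Longrightarrow> (x \<otimes>\<^bsub>M\<^esub> y) k = (\<Oplus>\<^bsub>A\<^esub>g\<in>carrier G. x g \<otimes>\<^bsub>A\<^esub> \<alpha> g (y (inv g \<otimes> k)))"
  by (simp add: M_simps)

lemma M_add_comp [simp]: "k \<in> carrier G \<Longrightarrow> (x \<oplus>\<^bsub>M\<^esub> y) k = x k \<oplus>\<^bsub>A\<^esub> y k" by (simp add: M_simps)
lemma M_smult_comp [simp]: "k \<in> carrier G \<Longrightarrow> (c \<odot>\<^bsub>M\<^esub> x) k = c \<odot>\<^bsub>A\<^esub> x k" by (simp add: M_simps)
lemma M_zero_comp [simp]: "k \<in> carrier G \<Longrightarrow> \<zero>\<^bsub>M\<^esub> k = \<zero>\<^bsub>A\<^esub>" by (simp add: M_simps)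
lemma M_one_comp: "k \<in> carrier G \<Longrightarrow> \<one>\<^bsub>M\<^esub> k = (if k = \<one> then \<one>\<^bsub>A\<^esub> else \<zero>\<^bsub>A\<^esub>)" by (simp add: M_simps)
lemma M_adj_comp [simp]: "k \<in> carrier G \<Longrightarrow> adj M x k = \<alpha> k (adj A (x (inv k)))" by (simp add: M_simps)

lemma M_closed: "x \<in> carrier M \<Longrightarrow> y \<in> carrier M \<Longrightarrow> x \<oplus>\<^bsub>M\<^esub> y \<in> carrier M" "x \<in> carrier M \<Longrightarrow> c \<odot>\<^bsub>M\<^esub> x \<in> carrier M"
  "\<zero>\<^bsub>M\<^esub> \<in> carrier M" "\<one>\<^bsub>M\<^esub> \<in> carrier M" "x \<in> carrier M \<Longrightarrow> adj M x \<in> carrier M"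
  by (auto simp: M_simps)

lemma sum_delta_left:
  assumes "h \<in> carrier G" "f \<in> vec" "\<And>g. g \<in> carrier G \<Longrightarrow> g \<noteq> h \<Longrightarrow> f g = \<zero>\<^bsub>A\<^esub>"
  shows "(\<Oplus>\<^bsub>A\<^esub>g\<in>carrier G. f g) = f h"
proof -
  have "(\<Oplus>\<^bsub>A\<^esub>g\<in>carrier G. f g) = (\<Oplus>\<^bsub>A\<^esub>g\<in>carrier G. if g = h then f h else \<zero>\<^bsub>A\<^esub>)"
    using assms by (intro A.finsum_cong') auto
  then show ?thesis using assms fin by (simp add: A.finsum_single vecD)
qed

lemma inv_mult_assoc: "g \<in> carrier G \<Longrightarrow> h \<in> carrier G \<Longrightarrow> k \<in> carrier G \<Longrightarrow> inv h \<otimes> (inv g \<otimes> k) = inv (g \<otimes> h) \<otimes> k"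
  by (simp add: inv_mult_group m_assoc)

lemma M_assoc:
  assumes x: "x \<in> carrier M" and y: "y \<in> carrier M" and z: "z \<in> carrier M"
  shows "x \<otimes>\<^bsub>M\<^esub> y \<otimes>\<^bsub>M\<^esub> z = x \<otimes>\<^bsub>M\<^esub> (y \<otimes>\<^bsub>M\<^esub> z)"
proof (rule M_ext)
  fix k assume k: "k \<in> carrier G"
  let ?t = "\<lambda>h g. x h \<otimes>\<^bsub>A\<^esub> (\<alpha> h (y (inv h \<otimes> g)) \<otimes>\<^bsub>A\<^esub> \<alpha> g (z (inv g \<otimes> k)))"
  have t: "?t h g \<in> carrier A" if "h \<in> carrier G" "g \<in> carrier G" for h g using that x y z k by auto
  have "(x \<otimes>\<^bsub>M\<^esub> y \<otimes>\<^bsub>M\<^esub> z) k = (\<Oplus>\<^bsub>A\<^esub>g\<in>carrier G. (\<Oplus>\<^bsub>A\<^esub>h\<in>carrier G. x h \<otimes>\<^bsub>A\<^esub> \<alpha> h (y (inv h \<otimes> g))) \<otimes>\<^bsub>A\<^esub> \<alpha> g (z (inv g \<otimes> k)))"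
    unfolding M_mult_comp[OF k, of "x \<otimes>\<^bsub>M\<^esub> y"]
    using M_comp[OF M_mult_closed[OF x y]] z k by (intro A.finsum_cong') (auto simp: M_mult_comp)
  also have "\<dots> = (\<Oplus>\<^bsub>A\<^esub>g\<in>carrier G. \<Oplus>\<^bsub>A\<^esub>h\<in>carrier G. ?t h g)"
  proof (rule A.finsum_cong')
    fix g assume g: "g \<in> carrier G"
    have "(\<Oplus>\<^bsub>A\<^esub>h\<in>carrier G. x h \<otimes>\<^bsub>A\<^esub> \<alpha> h (y (inv h \<otimes> g))) \<otimes>\<^bsub>A\<^esub> \<alpha> g (z (inv g \<otimes> k)) = (\<Oplus>\<^bsub>A\<^esub>h\<in>carrier G. x h \<otimes>\<^bsub>A\<^esub> \<alpha> h (y (inv h \<otimes> g)) \<otimes>\<^bsub>A\<^esub> \<alpha> g (z (inv g \<otimes> k)))"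
      using g x y z k by (intro A.finsum_ldistr fin) auto
    also have "\<dots> = (\<Oplus>\<^bsub>A\<^esub>h\<in>carrier G. ?t h g)"
      using g x y z k by (intro A.finsum_cong') (auto simp: A.m_assoc)
    finally show "(\<Oplus>\<^bsub>A\<^esub>h\<in>carrier G. x h \<otimes>\<^bsub>A\<^esub> \<alpha> h (y (inv h \<otimes> g))) \<otimes>\<^bsub>A\<^esub> \<alpha> g (z (inv g \<otimes> k)) = (\<Oplus>\<^bsub>A\<^esub>h\<in>carrier G. ?t h g)" .
  qed (use t in \<open>auto intro!: A.finsum_closed\<close>)
  also have "\<dots> = (\<Oplus>\<^bsub>A\<^esub>h\<in>carrier G. \<Oplus>\<^bsub>A\<^esub>g\<in>carrier G. ?t h g)" by (rule A.finsum_swap[OF fin fin]) (rule t)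
  also have "\<dots> = (\<Oplus>\<^bsub>A\<^esub>h\<in>carrier G. x h \<otimes>\<^bsub>A\<^esub> \<alpha> h ((y \<otimes>\<^bsub>M\<^esub> z) (inv h \<otimes> k)))"
  proof (rule A.finsum_cong')
    fix h assume h: "h \<in> carrier G"
    \<comment> \<open>The shift g -> h g turns the automorphism of h g into the composite of those
      of h and g, so that the one of h can be taken out of the sum.\<close>
    have "(\<Oplus>\<^bsub>A\<^esub>g\<in>carrier G. ?t h g) = (\<Oplus>\<^bsub>A\<^esub>g\<in>carrier G. ?t h (h \<otimes> g))"
      using t h by (intro sum_left[symmetric]) auto
    also have "\<dots> = (\<Oplus>\<^bsub>A\<^esub>g\<in>carrier G. x h \<otimes>\<^bsub>A\<^esub> \<alpha> h (y g \<otimes>\<^bsub>A\<^esub> \<alpha> g (z (inv g \<otimes> (inv h \<otimes> k)))))"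
    proof (rule A.finsum_cong')
      fix g assume g: "g \<in> carrier G"
      have "inv h \<otimes> (h \<otimes> g) = g" using g h by (simp flip: m_assoc)
      then show "?t h (h \<otimes> g) = x h \<otimes>\<^bsub>A\<^esub> \<alpha> h (y g \<otimes>\<^bsub>A\<^esub> \<alpha> g (z (inv g \<otimes> (inv h \<otimes> k))))"
        using g h k x y z by (simp add: alpha_mult alpha_alpha inv_mult_assoc)
    qed (use h k x y z in auto)
    also have "\<dots> = x h \<otimes>\<^bsub>A\<^esub> (\<Oplus>\<^bsub>A\<^esub>g\<in>carrier G. \<alpha> h (y g \<otimes>\<^bsub>A\<^esub> \<alpha> g (z (inv g \<otimes> (inv h \<otimes> k)))))"
      using h k x y z by (intro A.finsum_rdistr[symmetric] fin) auto
    also have "\<dots> = x h \<otimes>\<^bsub>A\<^esub> \<alpha> h ((y \<otimes>\<^bsub>M\<^esub> z) (inv h \<otimes> k))"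
      using h k x y z by (subst alpha_sum[symmetric, OF _ fin]) (auto simp: M_mult_comp)
    finally show "(\<Oplus>\<^bsub>A\<^esub>g\<in>carrier G. ?t h g) = x h \<otimes>\<^bsub>A\<^esub> \<alpha> h ((y \<otimes>\<^bsub>M\<^esub> z) (inv h \<otimes> k))" .
  qed (use k x M_mult_closed[OF y z] in auto)
  also have "\<dots> = (x \<otimes>\<^bsub>M\<^esub> (y \<otimes>\<^bsub>M\<^esub> z)) k" using k by (simp add: M_mult_comp[of k])
  finally show "(x \<otimes>\<^bsub>M\<^esub> y \<otimes>\<^bsub>M\<^esub> z) k = (x \<otimes>\<^bsub>M\<^esub> (y \<otimes>\<^bsub>M\<^esub> z)) k" .
qed (auto intro!: M_mult_closed x y z)

lemma M_one_mult: assumes x: "x \<in> carrier M" shows "\<one>\<^bsub>M\<^esub> \<otimes>\<^bsub>M\<^esub> x = x" "x \<otimes>\<^bsub>M\<^esub> \<one>\<^bsub>M\<^esub> = x"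
proof -
  show "\<one>\<^bsub>M\<^esub> \<otimes>\<^bsub>M\<^esub> x = x"
  proof (rule M_ext)
    fix k assume k: "k \<in> carrier G"
    have "(\<one>\<^bsub>M\<^esub> \<otimes>\<^bsub>M\<^esub> x) k = \<one>\<^bsub>M\<^esub> \<one> \<otimes>\<^bsub>A\<^esub> \<alpha> \<one> (x (inv \<one> \<otimes> k))"
      unfolding M_mult_comp[OF k] using x k by (intro sum_delta_left) (auto simp: M_one_comp)
    then show "(\<one>\<^bsub>M\<^esub> \<otimes>\<^bsub>M\<^esub> x) k = x k" using x k by (simp add: M_one_comp)
  qed (auto intro!: M_mult_closed M_closed x)
  show "x \<otimes>\<^bsub>M\<^esub> \<one>\<^bsub>M\<^esub> = x"
  proof (rule M_ext)
    fix k assume k: "k \<in> carrier G"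
    have *: "inv g \<otimes> k = \<one> \<longleftrightarrow> g = k" if "g \<in> carrier G" for g using that k by (metis inv_closed inv_equality inv_inv l_inv)
    have "(x \<otimes>\<^bsub>M\<^esub> \<one>\<^bsub>M\<^esub>) k = x k \<otimes>\<^bsub>A\<^esub> \<alpha> k (\<one>\<^bsub>M\<^esub> (inv k \<otimes> k))"
      unfolding M_mult_comp[OF k] using x k * by (intro sum_delta_left) (auto simp: M_one_comp)
    then show "(x \<otimes>\<^bsub>M\<^esub> \<one>\<^bsub>M\<^esub>) k = x k" using x k by (simp add: M_one_comp)
  qed (auto intro!: M_mult_closed M_closed x)
qed

lemma M_ring: "ring M"
proof (rule ringI)
  show "abelian_group M"
  proof (rule abelian_groupI)
    fix x assume x: "x \<in> carrier M"
    show "\<exists>y\<in>carrier M. y \<oplus>\<^bsub>M\<^esub> x = \<zero>\<^bsub>M\<^esub>"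
      using x by (intro bexI[of _ "(-1) \<odot>\<^bsub>M\<^esub> x"] M_ext) (auto simp: M_closed A.smult_minus_one A.l_neg)
  next
    fix x y z assume "x \<in> carrier M" "y \<in> carrier M" "z \<in> carrier M"
    then show "x \<oplus>\<^bsub>M\<^esub> y \<oplus>\<^bsub>M\<^esub> z = x \<oplus>\<^bsub>M\<^esub> (y \<oplus>\<^bsub>M\<^esub> z)"
      by (intro M_ext) (auto simp: M_closed A.a_assoc)
  next
    fix x y assume "x \<in> carrier M" "y \<in> carrier M"
    then show "x \<oplus>\<^bsub>M\<^esub> y = y \<oplus>\<^bsub>M\<^esub> x" by (intro M_ext) (auto simp: M_closed A.a_comm)
  next
    fix x assume "x \<in> carrier M"
    then show "\<zero>\<^bsub>M\<^esub> \<oplus>\<^bsub>M\<^esub> x = x" by (intro M_ext) (auto simp: M_closed)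
  qed (auto simp: M_closed)
  show "monoid M" by (rule monoidI) (auto simp: M_closed M_mult_closed M_assoc M_one_mult)
next
  fix x y z assume *: "x \<in> carrier M" "y \<in> carrier M" "z \<in> carrier M"
  show "(x \<oplus>\<^bsub>M\<^esub> y) \<otimes>\<^bsub>M\<^esub> z = x \<otimes>\<^bsub>M\<^esub> z \<oplus>\<^bsub>M\<^esub> y \<otimes>\<^bsub>M\<^esub> z"
  proof (rule M_ext)
    fix k assume k: "k \<in> carrier G"
    have "((x \<oplus>\<^bsub>M\<^esub> y) \<otimes>\<^bsub>M\<^esub> z) k = (\<Oplus>\<^bsub>A\<^esub>g\<in>carrier G. x g \<otimes>\<^bsub>A\<^esub> \<alpha> g (z (inv g \<otimes> k)) \<oplus>\<^bsub>A\<^esub> y g \<otimes>\<^bsub>A\<^esub> \<alpha> g (z (inv g \<otimes> k)))"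
      unfolding M_mult_comp[OF k] using * k by (intro A.finsum_cong') (auto simp: A.l_distr)
    then show "((x \<oplus>\<^bsub>M\<^esub> y) \<otimes>\<^bsub>M\<^esub> z) k = (x \<otimes>\<^bsub>M\<^esub> z \<oplus>\<^bsub>M\<^esub> y \<otimes>\<^bsub>M\<^esub> z) k"
      using * k by (simp add: M_mult_comp A.finsum_addf Pi_def)
  qed (use * in \<open>auto intro!: M_mult_closed M_closed\<close>)
  show "z \<otimes>\<^bsub>M\<^esub> (x \<oplus>\<^bsub>M\<^esub> y) = z \<otimes>\<^bsub>M\<^esub> x \<oplus>\<^bsub>M\<^esub> z \<otimes>\<^bsub>M\<^esub> y"
  proof (rule M_ext)
    fix k assume k: "k \<in> carrier G"
    have "(z \<otimes>\<^bsub>M\<^esub> (x \<oplus>\<^bsub>M\<^esub> y)) k = (\<Oplus>\<^bsub>A\<^esub>g\<in>carrier G. z g \<otimes>\<^bsub>A\<^esub> \<alpha> g (x (inv g \<otimes> k)) \<oplus>\<^bsub>A\<^esub> z g \<otimes>\<^bsub>A\<^esub> \<alpha> g (y (inv g \<otimes> k)))"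
      unfolding M_mult_comp[OF k] using * k by (intro A.finsum_cong') (auto simp: A.r_distr alpha_add)
    then show "(z \<otimes>\<^bsub>M\<^esub> (x \<oplus>\<^bsub>M\<^esub> y)) k = (z \<otimes>\<^bsub>M\<^esub> x \<oplus>\<^bsub>M\<^esub> z \<otimes>\<^bsub>M\<^esub> y) k"
      using * k by (simp add: M_mult_comp A.finsum_addf Pi_def)
  qed (use * in \<open>auto intro!: M_mult_closed M_closed\<close>)
qed

lemma M_adj_mult:
  assumes x: "x \<in> carrier M" and y: "y \<in> carrier M"
  shows "adj M (x \<otimes>\<^bsub>M\<^esub> y) = adj M y \<otimes>\<^bsub>M\<^esub> adj M x"
proof (rule M_ext)
  fix k assume k: "k \<in> carrier G"
  let ?t = "\<lambda>h. \<alpha> h (adj A (y (inv h))) \<otimes>\<^bsub>A\<^esub> \<alpha> k (adj A (x (inv k \<otimes> h)))"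
  have t: "?t \<in> vec" using x y k by auto
  have s: "(\<lambda>g. x g \<otimes>\<^bsub>A\<^esub> \<alpha> g (y (inv g \<otimes> inv k))) \<in> vec" using x y k by auto
  have "adj M (x \<otimes>\<^bsub>M\<^esub> y) k = \<alpha> k (adj A (\<Oplus>\<^bsub>A\<^esub>g\<in>carrier G. x g \<otimes>\<^bsub>A\<^esub> \<alpha> g (y (inv g \<otimes> inv k))))"
    using k by (simp add: M_mult_comp)
  also have "\<dots> = (\<Oplus>\<^bsub>A\<^esub>g\<in>carrier G. \<alpha> k (adj A (x g \<otimes>\<^bsub>A\<^esub> \<alpha> g (y (inv g \<otimes> inv k)))))"
    using k s by (simp add: A.adj_finsum[OF fin] alpha_sum[OF _ fin] Pi_def)
  also have "\<dots> = (\<Oplus>\<^bsub>A\<^esub>g\<in>carrier G. ?t (k \<otimes> g))"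
  proof (rule A.finsum_cong')
    fix g assume g: "g \<in> carrier G"
    have "inv k \<otimes> (k \<otimes> g) = g" using g k by (simp flip: m_assoc)
    then show "\<alpha> k (adj A (x g \<otimes>\<^bsub>A\<^esub> \<alpha> g (y (inv g \<otimes> inv k)))) = ?t (k \<otimes> g)"
      using g k x y by (simp add: A.adj_mult alpha_mult alpha_alpha inv_mult_group flip: alpha_adj)
  qed (use t k in auto)
  also have "\<dots> = (\<Oplus>\<^bsub>A\<^esub>h\<in>carrier G. ?t h)" using t k by (intro sum_left)
  also have "\<dots> = (adj M y \<otimes>\<^bsub>M\<^esub> adj M x) k"
    unfolding M_mult_comp[OF k] using x y k t
    by (intro A.finsum_cong') (auto simp: alpha_alpha inv_mult_group m_assoc[symmetric])
  finally show "adj M (x \<otimes>\<^bsub>M\<^esub> y) k = (adj M y \<otimes>\<^bsub>M\<^esub> adj M x) k" .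
qed (auto intro!: M_mult_closed M_closed x y)

section \<open>The regular representation and the norm\<close>

lemma rr_vec: "x \<in> vec \<Longrightarrow> \<xi> \<in> vec \<Longrightarrow> rr x \<xi> \<in> vec"
  by (auto simp: regular_rep_def vecD intro!: A.finsum_closed)

lemma rr_PiE: "x \<in> vec \<Longrightarrow> \<xi> \<in> vec \<Longrightarrow> rr x \<xi> \<in> carrier G \<rightarrow>\<^sub>E carrier A"
  by (auto simp: regular_rep_def vecD intro!: A.finsum_closed)

lemma rr_comp: "k \<in> carrier G \<Longrightarrow> rr x \<xi> k = (\<Oplus>\<^bsub>A\<^esub>g\<in>carrier G. \<alpha> (inv k) (x g) \<otimes>\<^bsub>A\<^esub> \<xi> (inv g \<otimes> k))"
  by (simp add: regular_rep_def)

text \<open>The same shift as in \<open>M_assoc\<close>. It is what makes the norm submultiplicative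
  and turns left multiplication in M into an operator on first columns
  (\<open>H_left_bound\<close>).\<close>

lemma rr_mult:
  assumes x: "x \<in> carrier M" and y: "y \<in> carrier M" and \<xi>: "\<xi> \<in> vec"
  shows "rr (x \<otimes>\<^bsub>M\<^esub> y) \<xi> = rr x (rr y \<xi>)"
proof (rule PiE_ext[OF rr_PiE rr_PiE])
  fix k assume k: "k \<in> carrier G"
  let ?t = "\<lambda>g l. \<alpha> (inv k) (x g) \<otimes>\<^bsub>A\<^esub> (\<alpha> (inv k \<otimes> g) (y (inv g \<otimes> l)) \<otimes>\<^bsub>A\<^esub> \<xi> (inv l \<otimes> k))"
  have t: "?t g l \<in> carrier A" if "g \<in> carrier G" "l \<in> carrier G" for g l using that k x y \<xi> by (auto simp: vecD)
  have "rr (x \<otimes>\<^bsub>M\<^esub> y) \<xi> k = (\<Oplus>\<^bsub>A\<^esub>l\<in>carrier G. \<Oplus>\<^bsub>A\<^esub>g\<in>carrier G. ?t g l)"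
    unfolding rr_comp[OF k]
  proof (rule A.finsum_cong')
    fix l assume l: "l \<in> carrier G"
    have s: "(\<lambda>g. x g \<otimes>\<^bsub>A\<^esub> \<alpha> g (y (inv g \<otimes> l))) \<in> vec" using x y l by auto
    have "\<alpha> (inv k) ((x \<otimes>\<^bsub>M\<^esub> y) l) \<otimes>\<^bsub>A\<^esub> \<xi> (inv l \<otimes> k) = (\<Oplus>\<^bsub>A\<^esub>g\<in>carrier G. \<alpha> (inv k) (x g \<otimes>\<^bsub>A\<^esub> \<alpha> g (y (inv g \<otimes> l)))) \<otimes>\<^bsub>A\<^esub> \<xi> (inv l \<otimes> k)"
      using k l s by (simp add: M_mult_comp alpha_sum[OF _ fin])
    also have "\<dots> = (\<Oplus>\<^bsub>A\<^esub>g\<in>carrier G. \<alpha> (inv k) (x g \<otimes>\<^bsub>A\<^esub> \<alpha> g (y (inv g \<otimes> l))) \<otimes>\<^bsub>A\<^esub> \<xi> (inv l \<otimes> k))"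
      using k l s \<xi> by (intro A.finsum_ldistr fin) (auto simp: vecD)
    also have "\<dots> = (\<Oplus>\<^bsub>A\<^esub>g\<in>carrier G. ?t g l)"
      using k l x y \<xi> t by (intro A.finsum_cong') (auto simp: alpha_mult alpha_alpha A.m_assoc vecD)
    finally show "\<alpha> (inv k) ((x \<otimes>\<^bsub>M\<^esub> y) l) \<otimes>\<^bsub>A\<^esub> \<xi> (inv l \<otimes> k) = (\<Oplus>\<^bsub>A\<^esub>g\<in>carrier G. ?t g l)" .
  qed (use t in \<open>auto intro!: A.finsum_closed\<close>)
  also have "\<dots> = (\<Oplus>\<^bsub>A\<^esub>g\<in>carrier G. \<Oplus>\<^bsub>A\<^esub>l\<in>carrier G. ?t g l)" by (rule A.finsum_swap[OF fin fin]) (rule t)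
  also have "\<dots> = rr x (rr y \<xi>) k"
    unfolding rr_comp[OF k, of x]
  proof (rule A.finsum_cong')
    fix g assume g: "g \<in> carrier G"
    have "(\<Oplus>\<^bsub>A\<^esub>l\<in>carrier G. ?t g l) = (\<Oplus>\<^bsub>A\<^esub>l\<in>carrier G. ?t g (g \<otimes> l))" using t g by (intro sum_left[symmetric]) auto
    also have "\<dots> = (\<Oplus>\<^bsub>A\<^esub>l\<in>carrier G. \<alpha> (inv k) (x g) \<otimes>\<^bsub>A\<^esub> (\<alpha> (inv (inv g \<otimes> k)) (y l) \<otimes>\<^bsub>A\<^esub> \<xi> (inv l \<otimes> (inv g \<otimes> k))))"
    proof (rule A.finsum_cong')
      fix l assume l: "l \<in> carrier G"
      have "inv g \<otimes> (g \<otimes> l) = l" using g l by (simp flip: m_assoc)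
      then show "?t g (g \<otimes> l) = \<alpha> (inv k) (x g) \<otimes>\<^bsub>A\<^esub> (\<alpha> (inv (inv g \<otimes> k)) (y l) \<otimes>\<^bsub>A\<^esub> \<xi> (inv l \<otimes> (inv g \<otimes> k)))"
        using g l k by (simp add: inv_mult_group m_assoc)
    qed (use g k x y \<xi> in \<open>auto simp: vecD\<close>)
    also have "\<dots> = \<alpha> (inv k) (x g) \<otimes>\<^bsub>A\<^esub> (\<Oplus>\<^bsub>A\<^esub>l\<in>carrier G. \<alpha> (inv (inv g \<otimes> k)) (y l) \<otimes>\<^bsub>A\<^esub> \<xi> (inv l \<otimes> (inv g \<otimes> k)))"
      using g k x y \<xi> by (intro A.finsum_rdistr[symmetric] fin) (auto simp: vecD)
    also have "\<dots> = \<alpha> (inv k) (x g) \<otimes>\<^bsub>A\<^esub> rr y \<xi> (inv g \<otimes> k)" using g k by (simp add: rr_comp)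
    finally show "(\<Oplus>\<^bsub>A\<^esub>l\<in>carrier G. ?t g l) = \<alpha> (inv k) (x g) \<otimes>\<^bsub>A\<^esub> rr y \<xi> (inv g \<otimes> k)" .
  qed (use k x vecD[OF rr_vec[OF M_vec[OF y] \<xi>]] in auto)
  finally show "rr (x \<otimes>\<^bsub>M\<^esub> y) \<xi> k = rr x (rr y \<xi>) k" .
qed (use M_vec[OF x] M_vec[OF y] M_vec[OF M_mult_closed[OF x y]] \<xi> rr_vec in auto)

text \<open>Each x_g u_g permutes the entries of a column and then applies a diagonal operator with
  entries of norm at most nrm x_g. Together with \<open>M_nrm_comp\<close> this makes convergence in
  M the same as convergence of all coefficients, which is how limits in M are handled below.\<close>

lemma rr_l2_le:
  assumes x: "x \<in> vec" and \<xi>: "\<xi> \<in> vec"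
  shows "l2 (rr x \<xi>) \<le> (\<Sum>g\<in>carrier G. nrm A (x g)) * l2 \<xi>"
proof -
  have v: "(\<lambda>k. \<alpha> (inv k) (x g) \<otimes>\<^bsub>A\<^esub> \<xi> (inv g \<otimes> k)) \<in> vec" if "g \<in> carrier G" for g using that x \<xi> by (auto simp: vecD)
  have "l2 (rr x \<xi>) = l2 (\<lambda>k. \<Oplus>\<^bsub>A\<^esub>g\<in>carrier G. \<alpha> (inv k) (x g) \<otimes>\<^bsub>A\<^esub> \<xi> (inv g \<otimes> k))"
    using rr_vec[OF x \<xi>] by (intro l2_cong) (auto simp: rr_comp)
  also have "\<dots> \<le> (\<Sum>g\<in>carrier G. l2 (\<lambda>k. \<alpha> (inv k) (x g) \<otimes>\<^bsub>A\<^esub> \<xi> (inv g \<otimes> k)))"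
    using v by (intro l2_sum fin)
  also have "\<dots> \<le> (\<Sum>g\<in>carrier G. nrm A (x g) * l2 (\<lambda>k. \<xi> (inv g \<otimes> k)))"
    using x \<xi> by (intro sum_mono l2_mult) (auto simp: vecD alpha_nrm_le)
  also have "\<dots> = (\<Sum>g\<in>carrier G. nrm A (x g) * l2 \<xi>)"
    using \<xi> by (intro sum.cong) (auto simp: l2_shift)
  finally show ?thesis by (simp add: sum_distrib_right)
qed

lemma M_bdd: "x \<in> vec \<Longrightarrow> bdd_above ((\<lambda>\<xi>. l2 (rr x \<xi>)) ` {\<xi> \<in> carrier G \<rightarrow>\<^sub>E carrier A. l2 \<xi> \<le> 1})"
proof (rule bdd_aboveI2)
  fix \<xi> assume x: "x \<in> vec" and "\<xi> \<in> {\<xi> \<in> carrier G \<rightarrow>\<^sub>E carrier A. l2 \<xi> \<le> 1}"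
  then have \<xi>: "\<xi> \<in> vec" "l2 \<xi> \<le> 1" by auto
  show "l2 (rr x \<xi>) \<le> (\<Sum>g\<in>carrier G. nrm A (x g)) * 1"
    using x \<xi> by (intro order_trans[OF rr_l2_le] mult_left_mono) (auto intro!: sum_nonneg simp: vecD)
qed

lemma restrict_vec: "\<xi> \<in> vec \<Longrightarrow> restrict \<xi> (carrier G) \<in> carrier G \<rightarrow>\<^sub>E carrier A" by auto

lemma rr_restrict: "rr x (restrict \<xi> (carrier G)) = rr x \<xi>" if "x \<in> vec" "\<xi> \<in> vec"
  using that by (intro PiE_ext[OF rr_PiE rr_PiE]) (auto simp: rr_comp vecD intro!: A.finsum_cong')

lemma l2_restrict: "\<xi> \<in> vec \<Longrightarrow> l2 (restrict \<xi> (carrier G)) = l2 \<xi>"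
  by (intro l2_cong) auto

lemma rr_smult_vec:
  assumes "x \<in> vec" "\<xi> \<in> vec" "k \<in> carrier G"
  shows "rr x (\<lambda>k. c \<odot>\<^bsub>A\<^esub> \<xi> k) k = c \<odot>\<^bsub>A\<^esub> rr x \<xi> k"
  unfolding rr_comp[OF assms(3)] using assms
  by (subst A.smult_finsum[OF fin]) (auto simp: vecD A.smult_mult_right intro!: A.finsum_cong')

lemma rr_l2:
  assumes x: "x \<in> vec" and \<xi>: "\<xi> \<in> vec"
  shows "l2 (rr x \<xi>) \<le> nrm M x * l2 \<xi>"
proof (cases "l2 \<xi> = 0")
  case True
  then show ?thesis using rr_l2_le[OF x \<xi>] by simp
next
  case False
  then have pos: "l2 \<xi> > 0" using \<xi> by (simp add: less_le)
  define c where "c = complex_of_real (1 / l2 \<xi>)"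
  let ?\<eta> = "\<lambda>k. c \<odot>\<^bsub>A\<^esub> \<xi> k"
  have \<eta>: "?\<eta> \<in> vec" using \<xi> by auto
  have "l2 ?\<eta> \<le> 1" using pos \<xi> unfolding l2_smult[OF \<xi>] by (simp add: c_def norm_divide)
  then have "l2 (rr x (restrict ?\<eta> (carrier G))) \<le> nrm M x"
    unfolding M_simps(8)
    by (intro cSUP_upper M_bdd x CollectI conjI restrict_vec \<eta>) (simp only: l2_restrict[OF \<eta>])
  moreover have "l2 (rr x ?\<eta>) = l2 (\<lambda>k. c \<odot>\<^bsub>A\<^esub> rr x \<xi> k)"
    using rr_vec[OF x \<eta>] x \<xi> by (intro l2_cong) (auto simp: rr_smult_vec)
  ultimately have "cmod c * l2 (rr x \<xi>) \<le> nrm M x" using x \<xi> \<eta> by (simp add: rr_restrict l2_smult rr_vec)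
  then show ?thesis using pos by (simp add: c_def norm_divide field_simps)
qed

lemma M_nrm_le:
  assumes "\<And>\<xi>. \<xi> \<in> vec \<Longrightarrow> l2 (rr x \<xi>) \<le> c * l2 \<xi>" "c \<ge> 0"
  shows "nrm M x \<le> c"
  unfolding M_simps(8)
proof (rule cSUP_least)
  have "restrict (delta \<one> \<zero>\<^bsub>A\<^esub>) (carrier G) \<in> {\<xi> \<in> carrier G \<rightarrow>\<^sub>E carrier A. l2 \<xi> \<le> 1}"
    using l2_delta[of \<one> "\<zero>\<^bsub>A\<^esub>"] by (auto simp: l2_restrict)
  then show "{\<xi> \<in> carrier G \<rightarrow>\<^sub>E carrier A. l2 \<xi> \<le> 1} \<noteq> {}" by blast
  fix \<xi> assume "\<xi> \<in> {\<xi> \<in> carrier G \<rightarrow>\<^sub>E carrier A. l2 \<xi> \<le> 1}"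
  then have \<xi>: "\<xi> \<in> vec" "l2 \<xi> \<le> 1" by auto
  then show "l2 (rr x \<xi>) \<le> c" using assms(1)[OF \<xi>(1)] mult_left_mono[OF \<xi>(2) assms(2)] by simp
qed

lemma M_nrm_sum: "x \<in> carrier M \<Longrightarrow> nrm M x \<le> (\<Sum>g\<in>carrier G. nrm A (x g))"
  using rr_l2_le[OF M_vec] by (intro M_nrm_le) (auto intro!: sum_nonneg)

text \<open>The first column of x in the regular representation, that is, x applied to the vector 1
  at the unit of G. Its entries are \<open>\<alpha> (inv k) (x k)\<close>, and its length is the
  norm of x in the Hilbert module of F (\<open>H_nrm\<close>).\<close>

definition col where "col x = rr x (delta \<one> \<one>\<^bsub>A\<^esub>)"

lemma col_vec [simp, intro]: "x \<in> carrier M \<Longrightarrow> col x \<in> vec"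
  unfolding col_def by (intro rr_vec M_vec delta_vec) auto

lemma col_comp: "x \<in> carrier M \<Longrightarrow> k \<in> carrier G \<Longrightarrow> col x k = \<alpha> (inv k) (x k)"
proof -
  assume *: "x \<in> carrier M" "k \<in> carrier G"
  have **: "inv g \<otimes> k = \<one> \<longleftrightarrow> g = k" if "g \<in> carrier G" for g using that * by (metis inv_closed inv_equality inv_inv l_inv)
  have "col x k = \<alpha> (inv k) (x k) \<otimes>\<^bsub>A\<^esub> delta \<one> \<one>\<^bsub>A\<^esub> (inv k \<otimes> k)"
    unfolding col_def rr_comp[OF *(2)] using * ** by (intro sum_delta_left) (auto simp: delta_def)
  then show ?thesis using * by (simp add: delta_def)
qed

lemma col_l2_le: "x \<in> carrier M \<Longrightarrow> l2 (col x) \<le> nrm M x"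
  unfolding col_def using rr_l2[of x "delta \<one> \<one>\<^bsub>A\<^esub>"] M_vec[of x] by (simp add: l2_delta nrm_A_one)

lemma M_nrm_comp: "x \<in> carrier M \<Longrightarrow> k \<in> carrier G \<Longrightarrow> nrm A (x k) \<le> nrm M x"
  using l2_comp[of "col x" k] col_l2_le[of x] by (simp add: col_comp alpha_nrm)

lemma M_nrm_nonneg: "x \<in> carrier M \<Longrightarrow> 0 \<le> nrm M x"
  by (rule order_trans[OF A.nrm_nonneg[OF M_comp] M_nrm_comp[of _ \<one>]]) auto

lemma rr_add:
  assumes "x \<in> carrier M" "y \<in> carrier M" "\<xi> \<in> vec" "k \<in> carrier G"
  shows "rr (x \<oplus>\<^bsub>M\<^esub> y) \<xi> k = rr x \<xi> k \<oplus>\<^bsub>A\<^esub> rr y \<xi> k"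
proof -
  have "rr (x \<oplus>\<^bsub>M\<^esub> y) \<xi> k = (\<Oplus>\<^bsub>A\<^esub>g\<in>carrier G. \<alpha> (inv k) (x g) \<otimes>\<^bsub>A\<^esub> \<xi> (inv g \<otimes> k) \<oplus>\<^bsub>A\<^esub> \<alpha> (inv k) (y g) \<otimes>\<^bsub>A\<^esub> \<xi> (inv g \<otimes> k))"
    unfolding rr_comp[OF assms(4)] using assms by (intro A.finsum_cong') (auto simp: alpha_add A.l_distr vecD)
  then show ?thesis using assms by (simp add: rr_comp A.finsum_addf Pi_def)
qed

lemma rr_smult:
  assumes "x \<in> carrier M" "\<xi> \<in> vec" "k \<in> carrier G"
  shows "rr (c \<odot>\<^bsub>M\<^esub> x) \<xi> k = c \<odot>\<^bsub>A\<^esub> rr x \<xi> k"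
  unfolding rr_comp[OF assms(3)] using assms
  by (subst A.smult_finsum[OF fin]) (auto simp: vecD alpha_smult A.smult_mult_left intro!: A.finsum_cong')

lemma M_nrm_smult_le: "x \<in> carrier M \<Longrightarrow> nrm M (c \<odot>\<^bsub>M\<^esub> x) \<le> cmod c * nrm M x"
proof (rule M_nrm_le)
  fix \<xi> assume x: "x \<in> carrier M" and \<xi>: "\<xi> \<in> vec"
  have "l2 (rr (c \<odot>\<^bsub>M\<^esub> x) \<xi>) = l2 (\<lambda>k. c \<odot>\<^bsub>A\<^esub> rr x \<xi> k)"
    using x \<xi> rr_vec[OF M_vec[OF M_closed(2)[OF x]] \<xi>] by (intro l2_cong) (auto simp: rr_smult)
  then show "l2 (rr (c \<odot>\<^bsub>M\<^esub> x) \<xi>) \<le> cmod c * nrm M x * l2 \<xi>"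
    using x \<xi> rr_l2[OF M_vec[OF x] \<xi>] by (simp add: l2_smult rr_vec M_vec mult.assoc mult_left_mono)
qed (simp add: M_nrm_nonneg)

lemma M_nrm_mult1:
  assumes "x \<in> carrier M" "y \<in> carrier M"
  shows "nrm M (x \<otimes>\<^bsub>M\<^esub> y) \<le> nrm M x * nrm M y"
proof (rule M_nrm_le)
  fix \<xi> assume \<xi>: "\<xi> \<in> vec"
  have "l2 (rr (x \<otimes>\<^bsub>M\<^esub> y) \<xi>) \<le> nrm M x * l2 (rr y \<xi>)"
    unfolding rr_mult[OF assms \<xi>] using assms \<xi> M_vec by (intro rr_l2 rr_vec) auto
  also have "\<dots> \<le> nrm M x * (nrm M y * l2 \<xi>)" using assms \<xi> M_vec by (intro mult_left_mono rr_l2 M_nrm_nonneg) auto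
  finally show "l2 (rr (x \<otimes>\<^bsub>M\<^esub> y) \<xi>) \<le> nrm M x * nrm M y * l2 \<xi>" by (simp add: mult.assoc)
qed (auto intro!: mult_nonneg_nonneg M_nrm_nonneg assms)

lemma m_ge1: "real m \<ge> 1" using m_pos by simp

text \<open>The product bound holds with constant 1 (\<open>M_nrm_mult1\<close>). It is weakened to
  m so that one constant also covers the involution, which \<open>M_nstar\<close> estimates through
  its m coefficients.\<close>

lemma M_nring: "nring M (real m)"
proof (rule nring.intro[OF M_ring], unfold_locales)
  fix x y c assume x: "x \<in> carrier M"
  show "nrm M (c \<odot>\<^bsub>M\<^esub> x) = cmod c * nrm M x"
  proof (cases "c = 0")
    case True then show ?thesis using M_nrm_smult_le[OF x, of c] M_nrm_nonneg[OF M_closed(2)[OF x], of c] by simp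
  next
    case False
    have "inverse c \<odot>\<^bsub>M\<^esub> (c \<odot>\<^bsub>M\<^esub> x) = x" using False x by (intro M_ext) (auto simp: M_closed A.smult_smult)
    with M_nrm_smult_le[OF M_closed(2)[OF x], of "inverse c" c] have "nrm M x \<le> nrm M (c \<odot>\<^bsub>M\<^esub> x) / cmod c"
      by (simp add: norm_inverse divide_inverse mult.commute)
    then show ?thesis using M_nrm_smult_le[OF x, of c] False by (simp add: field_simps)
  qed
  assume y: "y \<in> carrier M"
  show "nrm M (x \<otimes>\<^bsub>M\<^esub> y) \<le> real m * nrm M x * nrm M y"
    using M_nrm_mult1[OF x y] mult_right_mono[OF m_ge1, of "nrm M x * nrm M y"] M_nrm_nonneg x y by (simp add: mult.assoc)
  show "nrm M (x \<oplus>\<^bsub>M\<^esub> y) \<le> nrm M x + nrm M y"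
  proof (rule M_nrm_le)
    fix \<xi> assume \<xi>: "\<xi> \<in> vec"
    have "l2 (rr (x \<oplus>\<^bsub>M\<^esub> y) \<xi>) = l2 (\<lambda>k. rr x \<xi> k \<oplus>\<^bsub>A\<^esub> rr y \<xi> k)"
      using x y \<xi> rr_vec[OF M_vec[OF M_closed(1)[OF x y]] \<xi>] by (intro l2_cong) (auto simp: rr_add)
    also have "\<dots> \<le> l2 (rr x \<xi>) + l2 (rr y \<xi>)" using x y \<xi> M_vec by (intro l2_add rr_vec) auto
    also have "\<dots> \<le> nrm M x * l2 \<xi> + nrm M y * l2 \<xi>" using x y \<xi> M_vec by (intro add_mono rr_l2) auto
    finally show "l2 (rr (x \<oplus>\<^bsub>M\<^esub> y) \<xi>) \<le> (nrm M x + nrm M y) * l2 \<xi>" by (simp add: algebra_simps)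
  qed (use x y M_nrm_nonneg in auto)
  show "c \<odot>\<^bsub>M\<^esub> (x \<oplus>\<^bsub>M\<^esub> y) = c \<odot>\<^bsub>M\<^esub> x \<oplus>\<^bsub>M\<^esub> c \<odot>\<^bsub>M\<^esub> y" using x y by (intro M_ext) (auto simp: M_closed A.smult_add)
  show "(c \<odot>\<^bsub>M\<^esub> x) \<otimes>\<^bsub>M\<^esub> y = c \<odot>\<^bsub>M\<^esub> (x \<otimes>\<^bsub>M\<^esub> y)"
  proof (rule M_ext)
    fix k assume k: "k \<in> carrier G"
    show "((c \<odot>\<^bsub>M\<^esub> x) \<otimes>\<^bsub>M\<^esub> y) k = (c \<odot>\<^bsub>M\<^esub> (x \<otimes>\<^bsub>M\<^esub> y)) k"
      unfolding M_smult_comp[OF k] M_mult_comp[OF k] using x y k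
      by (subst A.smult_finsum[OF fin]) (auto simp: A.smult_mult_left intro!: A.finsum_cong')
  qed (use x y in \<open>auto intro!: M_mult_closed M_closed\<close>)
  show "x \<otimes>\<^bsub>M\<^esub> (c \<odot>\<^bsub>M\<^esub> y) = c \<odot>\<^bsub>M\<^esub> (x \<otimes>\<^bsub>M\<^esub> y)"
  proof (rule M_ext)
    fix k assume k: "k \<in> carrier G"
    show "(x \<otimes>\<^bsub>M\<^esub> (c \<odot>\<^bsub>M\<^esub> y)) k = (c \<odot>\<^bsub>M\<^esub> (x \<otimes>\<^bsub>M\<^esub> y)) k"
      unfolding M_smult_comp[OF k] M_mult_comp[OF k] using x y k
      by (subst A.smult_finsum[OF fin]) (auto simp: alpha_smult A.smult_mult_right intro!: A.finsum_cong')
  qed (use x y in \<open>auto intro!: M_mult_closed M_closed\<close>)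
next
  fix x c d assume x: "x \<in> carrier M"
  show "(c + d) \<odot>\<^bsub>M\<^esub> x = c \<odot>\<^bsub>M\<^esub> x \<oplus>\<^bsub>M\<^esub> d \<odot>\<^bsub>M\<^esub> x" using x by (intro M_ext) (auto simp: M_closed A.add_smult)
  show "c \<odot>\<^bsub>M\<^esub> (d \<odot>\<^bsub>M\<^esub> x) = (c * d) \<odot>\<^bsub>M\<^esub> x" using x by (intro M_ext) (auto simp: M_closed A.smult_smult)
  show "1 \<odot>\<^bsub>M\<^esub> x = x" using x by (intro M_ext) (auto simp: M_closed)
qed (auto simp: M_closed)

sublocale M: nring M "real m" by (rule M_nring)

lemma M_nstar: "nstar M (real m)"
proof (rule nstar.intro[OF M_nring], unfold_locales)
  fix x assume x: "x \<in> carrier M"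
  show "adj M (adj M x) = x" using x by (intro M_ext) (auto simp: M_closed alpha_adj[symmetric] alpha_alpha)
  show "nrm M (adj M x) \<le> real m * nrm M x"
  proof -
    have "nrm M (adj M x) \<le> (\<Sum>g\<in>carrier G. nrm A (adj M x g))" using x by (intro M_nrm_sum M_closed)
    also have "\<dots> \<le> (\<Sum>g\<in>carrier G. nrm M x)" using x by (intro sum_mono) (auto simp: alpha_nrm nrm_adj intro!: M_nrm_comp)
    finally show ?thesis by simp
  qed
  show "adj M (c \<odot>\<^bsub>M\<^esub> x) = cnj c \<odot>\<^bsub>M\<^esub> adj M x" for c using x by (intro M_ext) (auto simp: M_closed A.adj_smult alpha_smult)
  fix y assume y: "y \<in> carrier M"
  show "adj M (x \<oplus>\<^bsub>M\<^esub> y) = adj M x \<oplus>\<^bsub>M\<^esub> adj M y" using x y by (intro M_ext) (auto simp: M_closed A.adj_add alpha_add)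
  show "adj M (x \<otimes>\<^bsub>M\<^esub> y) = adj M y \<otimes>\<^bsub>M\<^esub> adj M x" by (rule M_adj_mult[OF x y])
qed (auto simp: M_closed)

sublocale M: nstar M "real m" by (rule M_nstar)

end

section \<open>The conditional expectation and the basic construction\<close>

locale crossed_pos = crossed G A \<alpha> for G :: "'g monoid" (structure) and A :: "'a cstar" and \<alpha> +
  assumes sum_positive: "\<And>a. a \<in> carrier G \<rightarrow> carrier A \<Longrightarrow> positive A (\<Oplus>\<^bsub>A\<^esub>k\<in>carrier G. adj A (a k) \<otimes>\<^bsub>A\<^esub> a k)"
begin

abbreviation "emb \<equiv> cp_embed G A"
abbreviation "QQ \<equiv> cp_base G A"

text \<open>The monomial a u_g; at the unit of G it is the embedding of A
  (\<open>embed_mono\<close>).\<close>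

definition mon :: "'a \<Rightarrow> 'g \<Rightarrow> 'g \<Rightarrow> 'a" where
  "mon a g = (\<lambda>k\<in>carrier G. if k = g then a else \<zero>\<^bsub>A\<^esub>)"

lemma embed_mono: "emb a = mon a \<one>" by (simp add: cp_embed_def mon_def)

lemma mon_closed [simp, intro]: "a \<in> carrier A \<Longrightarrow> mon a g \<in> carrier M"
  by (auto simp: mon_def M_simps)

lemma mon_comp: "k \<in> carrier G \<Longrightarrow> mon a g k = (if k = g then a else \<zero>\<^bsub>A\<^esub>)" by (simp add: mon_def)

lemma embed_closed [simp, intro]: "a \<in> carrier A \<Longrightarrow> emb a \<in> carrier M" by (simp add: embed_mono)

lemma mon_left:
  assumes "a \<in> carrier A" "h \<in> carrier G" "x \<in> carrier M" "k \<in> carrier G"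
  shows "(mon a h \<otimes>\<^bsub>M\<^esub> x) k = a \<otimes>\<^bsub>A\<^esub> \<alpha> h (x (inv h \<otimes> k))"
proof -
  have "(mon a h \<otimes>\<^bsub>M\<^esub> x) k = mon a h h \<otimes>\<^bsub>A\<^esub> \<alpha> h (x (inv h \<otimes> k))"
    unfolding M_mult_comp[OF assms(4)] using assms by (intro sum_delta_left) (auto simp: mon_comp)
  then show ?thesis using assms by (simp add: mon_comp)
qed

lemma inv_mult_eq_iff: "g \<in> carrier G \<Longrightarrow> h \<in> carrier G \<Longrightarrow> k \<in> carrier G \<Longrightarrow> inv g \<otimes> k = h \<longleftrightarrow> g = k \<otimes> inv h"
  by (metis inv_closed inv_solve_left inv_solve_right m_closed)

lemma mon_right:
  assumes "a \<in> carrier A" "h \<in> carrier G" "x \<in> carrier M" "k \<in> carrier G"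
  shows "(x \<otimes>\<^bsub>M\<^esub> mon a h) k = x (k \<otimes> inv h) \<otimes>\<^bsub>A\<^esub> \<alpha> (k \<otimes> inv h) a"
proof -
  have *: "inv g \<otimes> k = h \<longleftrightarrow> g = k \<otimes> inv h" if "g \<in> carrier G" for g using inv_mult_eq_iff[OF that assms(2,4)] .
  have "(x \<otimes>\<^bsub>M\<^esub> mon a h) k = x (k \<otimes> inv h) \<otimes>\<^bsub>A\<^esub> \<alpha> (k \<otimes> inv h) (mon a h (inv (k \<otimes> inv h) \<otimes> k))"
    unfolding M_mult_comp[OF assms(4)] using assms * by (intro sum_delta_left) (auto simp: mon_comp)
  moreover have "inv (k \<otimes> inv h) \<otimes> k = h" using *[of "k \<otimes> inv h"] assms by simp
  ultimately show ?thesis using assms by (simp add: mon_comp)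
qed

lemma embed_left: "a \<in> carrier A \<Longrightarrow> x \<in> carrier M \<Longrightarrow> k \<in> carrier G \<Longrightarrow> (emb a \<otimes>\<^bsub>M\<^esub> x) k = a \<otimes>\<^bsub>A\<^esub> x k"
  unfolding embed_mono by (subst mon_left) auto

lemma embed_right: "a \<in> carrier A \<Longrightarrow> x \<in> carrier M \<Longrightarrow> k \<in> carrier G \<Longrightarrow> (x \<otimes>\<^bsub>M\<^esub> emb a) k = x k \<otimes>\<^bsub>A\<^esub> \<alpha> k a"
  unfolding embed_mono by (subst mon_right) auto

lemma embed_comp: "k \<in> carrier G \<Longrightarrow> emb a k = (if k = \<one> then a else \<zero>\<^bsub>A\<^esub>)" by (simp add: cp_embed_def)

lemma embed_add: "a \<in> carrier A \<Longrightarrow> b \<in> carrier A \<Longrightarrow> emb (a \<oplus>\<^bsub>A\<^esub> b) = emb a \<oplus>\<^bsub>M\<^esub> emb b"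
  by (intro M_ext) (auto simp: embed_comp M_closed)
lemma embed_smult: "a \<in> carrier A \<Longrightarrow> emb (c \<odot>\<^bsub>A\<^esub> a) = c \<odot>\<^bsub>M\<^esub> emb a"
  by (intro M_ext) (auto simp: embed_comp)
lemma embed_mult: "a \<in> carrier A \<Longrightarrow> b \<in> carrier A \<Longrightarrow> emb (a \<otimes>\<^bsub>A\<^esub> b) = emb a \<otimes>\<^bsub>M\<^esub> emb b"
  by (intro M_ext) (auto simp: embed_left, auto simp: embed_comp)
lemma embed_one: "emb \<one>\<^bsub>A\<^esub> = \<one>\<^bsub>M\<^esub>" by (intro M_ext) (auto simp: embed_comp M_one_comp)
lemma embed_adj: "a \<in> carrier A \<Longrightarrow> emb (adj A a) = adj M (emb a)"
  by (intro M_ext) (auto simp: embed_comp)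
lemma embed_minus: "a \<in> carrier A \<Longrightarrow> emb (\<ominus>\<^bsub>A\<^esub> a) = \<ominus>\<^bsub>M\<^esub> emb a"
  by (simp add: embed_smult flip: A.smult_minus_one M.smult_minus_one)

lemma embed_nrm:
  assumes "a \<in> carrier A" shows "nrm M (emb a) = nrm A a"
proof (rule antisym)
  have "nrm M (emb a) \<le> (\<Sum>g\<in>carrier G. nrm A (emb a g))" using assms by (intro M_nrm_sum) auto
  also have "\<dots> = (\<Sum>g\<in>carrier G. if g = \<one> then nrm A a else 0)" by (intro sum.cong) (auto simp: embed_comp)
  finally show "nrm M (emb a) \<le> nrm A a" using fin by simp
  show "nrm A a \<le> nrm M (emb a)" using M_nrm_comp[of "emb a" \<one>] assms by (simp add: embed_comp)
qed

lemma F_def: "F x = emb (x \<one>)" by (simp add: cp_expectation_def)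

lemma F_closed [simp, intro]: "x \<in> carrier M \<Longrightarrow> F x \<in> carrier M" by (auto simp: F_def)

lemma M_finsum_comp:
  assumes "finite I" "\<And>i. i \<in> I \<Longrightarrow> f i \<in> carrier M" "k \<in> carrier G"
  shows "(\<Oplus>\<^bsub>M\<^esub>i\<in>I. f i) k = (\<Oplus>\<^bsub>A\<^esub>i\<in>I. f i k)"
  using assms(1,2)
proof (induction I rule: finite_induct)
  case (insert i I)
  then show ?case using assms(3) by (subst M.finsum_insert) (auto simp: Pi_iff)
qed (simp add: assms)

lemma M_minus_comp: "x \<in> carrier M \<Longrightarrow> k \<in> carrier G \<Longrightarrow> (\<ominus>\<^bsub>M\<^esub> x) k = \<ominus>\<^bsub>A\<^esub> x k"
  by (simp flip: M.smult_minus_one A.smult_minus_one)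

lemma M_diff_comp: "x \<in> carrier M \<Longrightarrow> y \<in> carrier M \<Longrightarrow> k \<in> carrier G \<Longrightarrow> (x \<ominus>\<^bsub>M\<^esub> y) k = x k \<ominus>\<^bsub>A\<^esub> y k"
  by (simp add: a_minus_def M_minus_comp)

text \<open>Replacing g by its inverse turns the sum defining the product into the inner product of
  the first column with itself. Thus F of adj x x is a sum of elements adj a a of A, from which both
  positivity of F and the module norm are read off.\<close>

lemma adj_mult_one:
  assumes "x \<in> carrier M"
  shows "(adj M x \<otimes>\<^bsub>M\<^esub> x) \<one> = ip (col x) (col x)"
proof -
  have "(adj M x \<otimes>\<^bsub>M\<^esub> x) \<one> = (\<Oplus>\<^bsub>A\<^esub>g\<in>carrier G. (\<lambda>k. adj A (col x k) \<otimes>\<^bsub>A\<^esub> col x k) (inv g))"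
    unfolding M_mult_comp[OF one_closed] using assms
    by (intro A.finsum_cong') (auto simp: col_comp alpha_adj)
  also have "\<dots> = ip (col x) (col x)" unfolding ip_def using assms vecD[OF col_vec[OF assms]] by (intro sum_inv) auto
  finally show ?thesis .
qed

lemma Q_subset: "QQ \<subseteq> carrier M" by (auto simp: cp_base_def)

text \<open>Taking a coefficient is contractive, so coefficients away from the unit of G remain zero
  in the limit.\<close>

lemma Q_norm_closed: "norm_closed M QQ"
  unfolding norm_closed_def
proof (intro allI impI)
  fix f x assume *: "(\<forall>n. f n \<in> QQ) \<and> converges_to M f x"
  then have x: "x \<in> carrier M" and lim: "(\<lambda>n. nrm M (f n \<ominus>\<^bsub>M\<^esub> x)) \<longlonglongrightarrow> 0" by (auto simp: converges_to_def)
  have "x k = \<zero>\<^bsub>A\<^esub>" if k: "k \<in> carrier G" "k \<noteq> \<one>" for k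
  proof -
    have "nrm A (x k) \<le> nrm M (f n \<ominus>\<^bsub>M\<^esub> x)" for n
    proof -
      obtain a where "a \<in> carrier A" "f n = emb a" using * by (auto simp: cp_base_def)
      then have f: "f n \<in> carrier M" "f n k = \<zero>\<^bsub>A\<^esub>" using k by (auto simp: embed_comp)
      have "(f n \<ominus>\<^bsub>M\<^esub> x) k = \<ominus>\<^bsub>A\<^esub> x k" using f x k by (simp add: M_diff_comp) (simp add: a_minus_def)
      then show ?thesis using M_nrm_comp[of "f n \<ominus>\<^bsub>M\<^esub> x" k] f x k by simp
    qed
    then have "nrm A (x k) \<le> 0" using lim by (intro tendsto_lowerbound[OF lim]) auto
    then show ?thesis using definite[of "x k"] A.nrm_nonneg[OF M_comp[OF x k(1)]] x k by auto
  qed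
  then have "x = emb (x \<one>)" using x by (intro M_ext) (auto simp: embed_comp)
  then show "x \<in> QQ" using x by (auto simp: cp_base_def)
qed

lemma F_add: "x \<in> carrier M \<Longrightarrow> y \<in> carrier M \<Longrightarrow> F (x \<oplus>\<^bsub>M\<^esub> y) = F x \<oplus>\<^bsub>M\<^esub> F y" by (simp add: F_def embed_add M_comp)
lemma F_smult: "x \<in> carrier M \<Longrightarrow> F (c \<odot>\<^bsub>M\<^esub> x) = c \<odot>\<^bsub>M\<^esub> F x" by (simp add: F_def embed_smult M_comp)
lemma F_embed: "F (emb a) = emb a" by (simp add: F_def embed_comp)
lemma F_right: "x \<in> carrier M \<Longrightarrow> a \<in> carrier A \<Longrightarrow> F (x \<otimes>\<^bsub>M\<^esub> emb a) = F x \<otimes>\<^bsub>M\<^esub> emb a"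
  by (simp add: F_def embed_right embed_mult M_comp)
lemma F_left: "x \<in> carrier M \<Longrightarrow> a \<in> carrier A \<Longrightarrow> F (emb a \<otimes>\<^bsub>M\<^esub> x) = emb a \<otimes>\<^bsub>M\<^esub> F x"
  by (simp add: F_def embed_left embed_mult M_comp)

lemma F_conditional_expectation: "conditional_expectation M QQ F"
proof -
  have "subring QQ M"
    by (rule M.subringI) (auto simp: cp_base_def embed_add[symmetric] embed_mult[symmetric] embed_minus[symmetric] embed_one[symmetric])
  then have sub: "unital_cstar_subalgebra QQ M"
    using Q_norm_closed unfolding unital_cstar_subalgebra_def
    by (auto simp: cp_base_def embed_adj[symmetric] embed_smult[symmetric])
  have "positive M (F x)" if pos: "positive M x" for x
  proof -
    obtain y where y: "y \<in> carrier M" "x = adj M y \<otimes>\<^bsub>M\<^esub> y" using pos by (auto simp: positive_def)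
    \<comment> \<open>\<open>positive\<close> requires one element z; \<open>sum_positive\<close>
      provides it for the sum over G.\<close>
    have "positive A (ip (col y) (col y))" unfolding ip_def using col_vec[OF y(1)] by (intro sum_positive)
    then obtain z where z: "z \<in> carrier A" "ip (col y) (col y) = adj A z \<otimes>\<^bsub>A\<^esub> z" by (auto simp: positive_def)
    have "F x = adj M (emb z) \<otimes>\<^bsub>M\<^esub> emb z" using z y by (simp add: F_def adj_mult_one embed_mult embed_adj)
    then show ?thesis using z by (auto simp: positive_def)
  qed
  then show ?thesis using sub unfolding conditional_expectation_def
    by (auto simp: F_add F_smult cp_base_def F_embed F_left F_right) (auto simp: F_def)
qed

section \<open>The quasi-basis of canonical unitaries and the index\<close>

abbreviation "uu g \<equiv> mon \<one>\<^bsub>A\<^esub> g"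

text \<open>Quasi-bases are families over an initial segment of the naturals, so the unitaries have
  to be listed along an enumeration of G.\<close>

definition enum :: "nat \<Rightarrow> 'g" where "enum = (SOME f. bij_betw f {..<m} (carrier G))"

lemma enum: "bij_betw enum {..<m} (carrier G)"
  unfolding enum_def using ex_bij_betw_nat_finite[OF fin] unfolding atLeast0LessThan by (rule someI_ex)

lemma enum_closed: "j < m \<Longrightarrow> enum j \<in> carrier G" using enum by (auto simp: bij_betw_def)

lemma M_sum_enum:
  assumes "\<And>g. g \<in> carrier G \<Longrightarrow> f g \<in> carrier M"
  shows "(\<Oplus>\<^bsub>M\<^esub>j\<in>{..<m}. f (enum j)) = (\<Oplus>\<^bsub>M\<^esub>g\<in>carrier G. f g)"
  using M.finsum_reindex[of f enum "{..<m}"] enum assms enum_closed by (auto simp: bij_betw_def Pi_iff)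

lemma M_decomp:
  assumes "x \<in> carrier M"
  shows "(\<Oplus>\<^bsub>M\<^esub>g\<in>carrier G. mon (x g) g) = x"
proof (rule M_ext)
  fix k assume k: "k \<in> carrier G"
  have "(\<Oplus>\<^bsub>M\<^esub>g\<in>carrier G. mon (x g) g) k = (\<Oplus>\<^bsub>A\<^esub>g\<in>carrier G. if g = k then x k else \<zero>\<^bsub>A\<^esub>)"
    using assms k by (subst M_finsum_comp[OF fin]) (auto simp: mon_comp intro!: A.finsum_cong')
  then show "(\<Oplus>\<^bsub>M\<^esub>g\<in>carrier G. mon (x g) g) k = x k" using assms k fin by (simp add: A.finsum_single M_comp)
qed (use assms in \<open>auto intro!: M.finsum_closed\<close>)

text \<open>Translating by the inverse of g moves the g-th coefficient to the unit, where F reads it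
  off; translating back restores the g-th term of x. Summed over g this is half of the quasi-basis
  property.\<close>

lemma u_F_left: "x \<in> carrier M \<Longrightarrow> g \<in> carrier G \<Longrightarrow> uu g \<otimes>\<^bsub>M\<^esub> F (uu (inv g) \<otimes>\<^bsub>M\<^esub> x) = mon (x g) g"
proof (rule M_ext)
  fix k assume *: "x \<in> carrier M" "g \<in> carrier G" "k \<in> carrier G"
  have "inv g \<otimes> k = \<one> \<longleftrightarrow> k = g" using inv_mult_eq_iff[of g \<one> k] * by auto
  then show "(uu g \<otimes>\<^bsub>M\<^esub> F (uu (inv g) \<otimes>\<^bsub>M\<^esub> x)) k = mon (x g) g k"
    using * by (simp add: mon_left F_def M_comp) (simp add: embed_comp mon_comp mon_left M_comp)
qed auto

lemma u_F_right: "x \<in> carrier M \<Longrightarrow> g \<in> carrier G \<Longrightarrow> F (x \<otimes>\<^bsub>M\<^esub> uu g) \<otimes>\<^bsub>M\<^esub> uu (inv g) = mon (x (inv g)) (inv g)"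
proof (rule M_ext)
  fix k assume *: "x \<in> carrier M" "g \<in> carrier G" "k \<in> carrier G"
  have "k \<otimes> g = \<one> \<longleftrightarrow> k = inv g" using * by (metis inv_equality l_inv)
  then show "(F (x \<otimes>\<^bsub>M\<^esub> uu g) \<otimes>\<^bsub>M\<^esub> uu (inv g)) k = mon (x (inv g)) (inv g) k"
    using * by (simp add: mon_right F_def M_comp) (simp add: embed_comp mon_comp mon_right M_comp)
qed auto

lemma F_quasi_basis: "quasi_basis M F m (\<lambda>j. uu (enum j)) (\<lambda>j. uu (inv (enum j)))"
  unfolding quasi_basis_def
proof (intro conjI ballI allI impI)
  fix x assume x: "x \<in> carrier M"
  have "(\<Oplus>\<^bsub>M\<^esub>j\<in>{..<m}. uu (enum j) \<otimes>\<^bsub>M\<^esub> F (uu (inv (enum j)) \<otimes>\<^bsub>M\<^esub> x)) = (\<Oplus>\<^bsub>M\<^esub>g\<in>carrier G. uu g \<otimes>\<^bsub>M\<^esub> F (uu (inv g) \<otimes>\<^bsub>M\<^esub> x))"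
    using x by (intro M_sum_enum[of "\<lambda>g. uu g \<otimes>\<^bsub>M\<^esub> F (uu (inv g) \<otimes>\<^bsub>M\<^esub> x)"]) auto
  also have "\<dots> = (\<Oplus>\<^bsub>M\<^esub>g\<in>carrier G. mon (x g) g)" using x by (intro M.finsum_cong') (auto simp: u_F_left)
  finally show "x = (\<Oplus>\<^bsub>M\<^esub>j\<in>{..<m}. uu (enum j) \<otimes>\<^bsub>M\<^esub> F (uu (inv (enum j)) \<otimes>\<^bsub>M\<^esub> x))" using M_decomp[OF x] by simp
  have im: "(\<lambda>g. inv g) ` carrier G = carrier G" by (auto intro!: image_eqI[of _ _ "inv y" for y])
  have inj: "inj_on (\<lambda>g. inv g) (carrier G)" by (rule inj_onI) (metis inv_inv)
  have "(\<Oplus>\<^bsub>M\<^esub>j\<in>{..<m}. F (x \<otimes>\<^bsub>M\<^esub> uu (enum j)) \<otimes>\<^bsub>M\<^esub> uu (inv (enum j))) = (\<Oplus>\<^bsub>M\<^esub>g\<in>carrier G. F (x \<otimes>\<^bsub>M\<^esub> uu g) \<otimes>\<^bsub>M\<^esub> uu (inv g))"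
    using x by (intro M_sum_enum[of "\<lambda>g. F (x \<otimes>\<^bsub>M\<^esub> uu g) \<otimes>\<^bsub>M\<^esub> uu (inv g)"]) auto
  also have "\<dots> = (\<Oplus>\<^bsub>M\<^esub>g\<in>carrier G. mon (x (inv g)) (inv g))" using x by (intro M.finsum_cong') (auto simp: u_F_right)
  also have "\<dots> = (\<Oplus>\<^bsub>M\<^esub>g\<in>carrier G. mon (x g) g)"
    using M.finsum_reindex[of "\<lambda>g. mon (x g) g" "\<lambda>g. inv g" "carrier G"] im inj x by (auto simp: Pi_iff)
  finally show "x = (\<Oplus>\<^bsub>M\<^esub>j\<in>{..<m}. F (x \<otimes>\<^bsub>M\<^esub> uu (enum j)) \<otimes>\<^bsub>M\<^esub> uu (inv (enum j)))" using M_decomp[OF x] by simp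
qed (auto simp: enum_closed)

lemma F_index_finite: "index_finite M QQ F"
  unfolding index_finite_def using F_conditional_expectation F_quasi_basis by blast

text \<open>Expand v j in the second quasi-basis and fold the double sum back with the first: both
  sides equal the sum of all u j F(v j u' i) v' i. This justifies the definite description in
  \<open>Index\<close>.\<close>

lemma Index_unique:
  assumes "quasi_basis M F k u v" "quasi_basis M F l u' v'"
  shows "(\<Oplus>\<^bsub>M\<^esub>j\<in>{..<k}. u j \<otimes>\<^bsub>M\<^esub> v j) = (\<Oplus>\<^bsub>M\<^esub>j\<in>{..<l}. u' j \<otimes>\<^bsub>M\<^esub> v' j)"
proof -
  have c: "u j \<in> carrier M" "v j \<in> carrier M" if "j < k" for j using assms that by (auto simp: quasi_basis_def)
  have c': "u' j \<in> carrier M" "v' j \<in> carrier M" if "j < l" for j using assms that by (auto simp: quasi_basis_def)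
  let ?t = "\<lambda>j i. u j \<otimes>\<^bsub>M\<^esub> F (v j \<otimes>\<^bsub>M\<^esub> u' i) \<otimes>\<^bsub>M\<^esub> v' i"
  have "(\<Oplus>\<^bsub>M\<^esub>j\<in>{..<k}. u j \<otimes>\<^bsub>M\<^esub> v j) = (\<Oplus>\<^bsub>M\<^esub>j\<in>{..<k}. \<Oplus>\<^bsub>M\<^esub>i\<in>{..<l}. ?t j i)"
  proof (rule M.finsum_cong')
    fix j assume j: "j \<in> {..<k}"
    have "v j = (\<Oplus>\<^bsub>M\<^esub>i\<in>{..<l}. F (v j \<otimes>\<^bsub>M\<^esub> u' i) \<otimes>\<^bsub>M\<^esub> v' i)" using assms(2) c j by (auto simp: quasi_basis_def)
    then have "u j \<otimes>\<^bsub>M\<^esub> v j = u j \<otimes>\<^bsub>M\<^esub> (\<Oplus>\<^bsub>M\<^esub>i\<in>{..<l}. F (v j \<otimes>\<^bsub>M\<^esub> u' i) \<otimes>\<^bsub>M\<^esub> v' i)" by simp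
    also have "\<dots> = (\<Oplus>\<^bsub>M\<^esub>i\<in>{..<l}. u j \<otimes>\<^bsub>M\<^esub> (F (v j \<otimes>\<^bsub>M\<^esub> u' i) \<otimes>\<^bsub>M\<^esub> v' i))"
      using c c' j by (intro M.finsum_rdistr) auto
    also have "\<dots> = (\<Oplus>\<^bsub>M\<^esub>i\<in>{..<l}. ?t j i)" using c c' j by (intro M.finsum_cong') (auto simp: M.m_assoc)
    finally show "u j \<otimes>\<^bsub>M\<^esub> v j = (\<Oplus>\<^bsub>M\<^esub>i\<in>{..<l}. ?t j i)" .
  qed (use c c' in \<open>auto intro!: M.finsum_closed\<close>)
  also have "\<dots> = (\<Oplus>\<^bsub>M\<^esub>i\<in>{..<l}. \<Oplus>\<^bsub>M\<^esub>j\<in>{..<k}. ?t j i)" using c c' by (intro M.finsum_swap) auto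
  also have "\<dots> = (\<Oplus>\<^bsub>M\<^esub>i\<in>{..<l}. u' i \<otimes>\<^bsub>M\<^esub> v' i)"
  proof (rule M.finsum_cong')
    fix i assume i: "i \<in> {..<l}"
    have "u' i = (\<Oplus>\<^bsub>M\<^esub>j\<in>{..<k}. u j \<otimes>\<^bsub>M\<^esub> F (v j \<otimes>\<^bsub>M\<^esub> u' i))" using assms(1) c' i by (auto simp: quasi_basis_def)
    then have "u' i \<otimes>\<^bsub>M\<^esub> v' i = (\<Oplus>\<^bsub>M\<^esub>j\<in>{..<k}. u j \<otimes>\<^bsub>M\<^esub> F (v j \<otimes>\<^bsub>M\<^esub> u' i)) \<otimes>\<^bsub>M\<^esub> v' i" by simp
    also have "\<dots> = (\<Oplus>\<^bsub>M\<^esub>j\<in>{..<k}. ?t j i)" using c c' i by (intro M.finsum_ldistr) auto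
    finally show "(\<Oplus>\<^bsub>M\<^esub>j\<in>{..<k}. ?t j i) = u' i \<otimes>\<^bsub>M\<^esub> v' i" by simp
  qed (use c' in auto)
  finally show ?thesis .
qed

lemma Index_eq: "Index M F = of_nat m \<odot>\<^bsub>M\<^esub> \<one>\<^bsub>M\<^esub>"
proof -
  have one: "uu g \<otimes>\<^bsub>M\<^esub> uu (inv g) = \<one>\<^bsub>M\<^esub>" if g: "g \<in> carrier G" for g
  proof (rule M_ext)
    fix k assume k: "k \<in> carrier G"
    have "inv g \<otimes> k = inv g \<longleftrightarrow> k = \<one>" using g k by (simp add: inv_mult_eq_iff)
    then show "(uu g \<otimes>\<^bsub>M\<^esub> uu (inv g)) k = \<one>\<^bsub>M\<^esub> k" using g k by (simp add: mon_left mon_comp M_one_comp)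
  qed (auto simp: M_closed)
  have "(\<Oplus>\<^bsub>M\<^esub>j\<in>{..<m}. uu (enum j) \<otimes>\<^bsub>M\<^esub> uu (inv (enum j))) = (\<Oplus>\<^bsub>M\<^esub>j\<in>{..<m}. \<one>\<^bsub>M\<^esub>)"
    by (intro M.finsum_cong') (auto simp: one enum_closed)
  also have "\<dots> = of_nat m \<odot>\<^bsub>M\<^esub> \<one>\<^bsub>M\<^esub>" by (subst M.finsum_const_smult) auto
  finally have *: "of_nat m \<odot>\<^bsub>M\<^esub> \<one>\<^bsub>M\<^esub> = (\<Oplus>\<^bsub>M\<^esub>j\<in>{..<m}. uu (enum j) \<otimes>\<^bsub>M\<^esub> uu (inv (enum j)))" by simp
  show ?thesis unfolding Index_def
  proof (rule the_equality)
    show "\<exists>k u v. quasi_basis M F k u v \<and> of_nat m \<odot>\<^bsub>M\<^esub> \<one>\<^bsub>M\<^esub> = (\<Oplus>\<^bsub>M\<^esub>j\<in>{..<k}. u j \<otimes>\<^bsub>M\<^esub> v j)"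
      using F_quasi_basis * by blast
    fix z assume "\<exists>k u v. quasi_basis M F k u v \<and> z = (\<Oplus>\<^bsub>M\<^esub>j\<in>{..<k}. u j \<otimes>\<^bsub>M\<^esub> v j)"
    then obtain k u v where q: "quasi_basis M F k u v" "z = (\<Oplus>\<^bsub>M\<^esub>j\<in>{..<k}. u j \<otimes>\<^bsub>M\<^esub> v j)" by blast
    show "z = of_nat m \<odot>\<^bsub>M\<^esub> \<one>\<^bsub>M\<^esub>" unfolding q(2) * by (rule Index_unique[OF q(1) F_quasi_basis])
  qed
qed

section \<open>The Hilbert module of F and its bounded operators\<close>

abbreviation "H \<equiv> hilbert_pre M F"

lemma H_simps [simp]: "carrier H = carrier M" "mult H = mult M" "one H = one M" "zero H = zero M" "add H = add M" "smult H = smult M" "adj H = adj M"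
  by (simp_all add: hilbert_pre_def)

lemma H_minus [simp]: "a_inv H x = a_inv M x" "x \<ominus>\<^bsub>H\<^esub> y = x \<ominus>\<^bsub>M\<^esub> y"
  by (simp_all add: a_minus_def a_inv_def)

lemma H_nrm: "x \<in> carrier M \<Longrightarrow> nrm H x = l2 (col x)"
  by (simp add: hilbert_pre_def F_def embed_nrm adj_mult_one l2_def)

text \<open>The coefficients of x are bounded by the length of its first column, so the module norm
  controls the norm of M. With \<open>H_left_bound\<close> this bounds products in the module norm,
  as \<open>H_nring\<close> requires.\<close>

lemma M_le_H:
  assumes x: "x \<in> carrier M" shows "nrm M x \<le> real m * nrm H x"
proof -
  have "nrm M x \<le> (\<Sum>g\<in>carrier G. nrm A (x g))" by (rule M_nrm_sum[OF x])
  also have "\<dots> \<le> (\<Sum>g\<in>carrier G. nrm H x)"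
    using x l2_comp[OF col_vec[OF x]] by (intro sum_mono) (simp add: H_nrm col_comp alpha_nrm)
  finally show ?thesis by simp
qed

text \<open>The first column of x y is x, in the regular representation, applied to the first column
  of y.\<close>

lemma H_left_bound: "x \<in> carrier M \<Longrightarrow> y \<in> carrier M \<Longrightarrow> nrm H (x \<otimes>\<^bsub>M\<^esub> y) \<le> nrm M x * nrm H y"
proof -
  assume x: "x \<in> carrier M" and y: "y \<in> carrier M"
  have "col (x \<otimes>\<^bsub>M\<^esub> y) = rr x (col y)" unfolding col_def by (rule rr_mult[OF x y]) auto
  then show ?thesis using rr_l2[OF M_vec[OF x] col_vec[OF y]] H_nrm[OF M.m_closed[OF x y]] H_nrm[OF y] by simp
qed

text \<open>Regarding M under the module norm as a normed ring with constant m makes the completion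
  an instance of the inductive-limit construction.\<close>

lemma H_nring: "nring H (real m)"
proof (rule nring.intro)
  show "ring H"
  proof (rule ringI)
    show "abelian_group H"
    proof (rule abelian_groupI)
      fix x assume "x \<in> carrier H"
      then show "\<exists>y\<in>carrier H. y \<oplus>\<^bsub>H\<^esub> x = \<zero>\<^bsub>H\<^esub>" using M.l_neg[of x] by auto
    qed (auto simp: M.a_assoc intro: M.a_comm)
    show "monoid H" by (rule monoidI) (auto simp: M.m_assoc)
  qed (auto simp: M.l_distr M.r_distr)
  show "nring_axioms H (real m)"
  proof (rule nring_axioms.intro, simp_all only: H_simps, simp_all only: M.smult_closed M.smult_add M.add_smult M.smult_smult M.smult_one M.smult_mult_left M.smult_mult_right of_nat_0_le_iff)
    fix x y c assume x: "x \<in> carrier M"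
    have "l2 (col (c \<odot>\<^bsub>M\<^esub> x)) = l2 (\<lambda>k. c \<odot>\<^bsub>A\<^esub> col x k)"
      using x col_vec[of "c \<odot>\<^bsub>M\<^esub> x"] by (intro l2_cong) (auto simp: col_comp alpha_smult)
    then show "nrm H (c \<odot>\<^bsub>M\<^esub> x) = cmod c * nrm H x" using x by (simp add: H_nrm l2_smult col_vec)
    assume y: "y \<in> carrier M"
    have "l2 (col (x \<oplus>\<^bsub>M\<^esub> y)) = l2 (\<lambda>k. col x k \<oplus>\<^bsub>A\<^esub> col y k)"
      using x y col_vec[of "x \<oplus>\<^bsub>M\<^esub> y"] by (intro l2_cong) (auto simp: col_comp alpha_add)
    then show "nrm H (x \<oplus>\<^bsub>M\<^esub> y) \<le> nrm H x + nrm H y" using x y by (simp add: H_nrm l2_add col_vec)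
    show "nrm H (x \<otimes>\<^bsub>M\<^esub> y) \<le> real m * nrm H x * nrm H y"
      using x y by (intro order_trans[OF H_left_bound] mult_right_mono M_le_H) (auto simp: H_nrm)
  qed
qed

sublocale E: ind_sys "\<lambda>_. H" "\<lambda>_ _ x. x" "real m"
  by (rule nring.completion_ind_sys[OF H_nring])

abbreviation "EE \<equiv> hilbert_module M F"

lemma EE_def: "EE = E.Q" by (simp add: hilbert_module_def inductive_limit_def)

text \<open>A right A-linear map of M, bounded by K in the module norm. The operators of the basic
  construction are exactly the extensions of such maps (\<open>basic_span_eq\<close>), so identities
  between operators can be checked on M.\<close>

definition module_map :: "(('g \<Rightarrow> 'a) \<Rightarrow> ('g \<Rightarrow> 'a)) \<Rightarrow> real \<Rightarrow> bool" where
  "module_map \<tau> K \<longleftrightarrow> K \<ge> 0 \<and> (\<forall>x\<in>carrier M. \<tau> x \<in> carrier M \<and> nrm H (\<tau> x) \<le> K * nrm H x \<and>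
     (\<forall>c. \<tau> (c \<odot>\<^bsub>M\<^esub> x) = c \<odot>\<^bsub>M\<^esub> \<tau> x) \<and> (\<forall>y\<in>carrier M. \<tau> (x \<oplus>\<^bsub>M\<^esub> y) = \<tau> x \<oplus>\<^bsub>M\<^esub> \<tau> y) \<and>
     (\<forall>a\<in>carrier A. \<tau> (x \<otimes>\<^bsub>M\<^esub> emb a) = \<tau> x \<otimes>\<^bsub>M\<^esub> emb a))"

abbreviation "ext \<equiv> hilbert_ext M F"

lemma module_mapD:
  assumes "module_map \<tau> K"
  shows "K \<ge> 0" "x \<in> carrier M \<Longrightarrow> \<tau> x \<in> carrier M" "x \<in> carrier M \<Longrightarrow> nrm H (\<tau> x) \<le> K * nrm H x"
    "x \<in> carrier M \<Longrightarrow> \<tau> (c \<odot>\<^bsub>M\<^esub> x) = c \<odot>\<^bsub>M\<^esub> \<tau> x" "x \<in> carrier M \<Longrightarrow> y \<in> carrier M \<Longrightarrow> \<tau> (x \<oplus>\<^bsub>M\<^esub> y) = \<tau> x \<oplus>\<^bsub>M\<^esub> \<tau> y"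
    "x \<in> carrier M \<Longrightarrow> a \<in> carrier A \<Longrightarrow> \<tau> (x \<otimes>\<^bsub>M\<^esub> emb a) = \<tau> x \<otimes>\<^bsub>M\<^esub> emb a"
  using assms by (auto simp: module_map_def)

lemma module_map_diff: "module_map \<tau> K \<Longrightarrow> x \<in> carrier M \<Longrightarrow> y \<in> carrier M \<Longrightarrow> \<tau> (x \<ominus>\<^bsub>M\<^esub> y) = \<tau> x \<ominus>\<^bsub>M\<^esub> \<tau> y"
  by (simp add: a_minus_def module_mapD(2,4,5) M_closed flip: M.smult_minus_one)

lemma module_map_S:
  assumes g: "module_map \<tau> K" and x: "x \<in> E.S"
  shows "(\<lambda>n. \<tau> (x n)) \<in> E.S"
proof (rule E.cauchyI)
  have c: "x n \<in> carrier M" for n using E.cauchy_carrier[OF x] by simp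
  show "\<tau> (x n) \<in> carrier H" for n using c module_mapD(2)[OF g] by simp
  fix e :: real assume e: "e > 0"
  have K: "K \<ge> 0" by (rule module_mapD(1)[OF g])
  have "e / (K + 1) > 0" using e K by simp
  from E.cauchyD[OF x this] obtain N where N: "\<And>n. n \<ge> N \<Longrightarrow> nrm H (x n \<ominus>\<^bsub>M\<^esub> x N) < e / (K + 1)" by force
  have "nrm H (\<tau> (x n) \<ominus>\<^bsub>M\<^esub> \<tau> (x N)) < e" if "n \<ge> N" for n
  proof -
    have "nrm H (\<tau> (x n) \<ominus>\<^bsub>M\<^esub> \<tau> (x N)) \<le> K * nrm H (x n \<ominus>\<^bsub>M\<^esub> x N)"
      using c g by (simp add: module_map_diff[symmetric] module_mapD(3))
    also have "\<dots> \<le> K * (e / (K + 1))" using N[OF that] K by (intro mult_left_mono) auto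
    also have "\<dots> < e" using e K by (simp add: field_simps)
    finally show ?thesis .
  qed
  then show "\<exists>N. \<forall>n\<ge>N. nrm H (\<tau> (x n) \<ominus>\<^bsub>H\<^esub> \<tau> (x N)) < e" by auto
qed

lemma ext_cls:
  assumes g: "module_map \<tau> K" and x: "x \<in> E.S"
  shows "ext \<tau> (E.cls x) = E.cls (\<lambda>n. \<tau> (x n))"
  unfolding hilbert_ext_def EE_def restrict_apply'[OF E.cls_carrier[OF x]]
  by (rule seq_map_cls[OF E.seq_alg_axioms E.seq_alg_axioms x, where L = K])
    (use module_map_S[OF g] in \<open>auto simp: module_mapD(3)[OF g] module_map_diff[OF g, symmetric]\<close>)

lemma ext_extensional: "ext \<tau> \<in> extensional (carrier EE)" by (simp add: hilbert_ext_def)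

lemma op_eqI:
  assumes "S \<in> extensional (carrier EE)" "T \<in> extensional (carrier EE)" "\<And>x. x \<in> E.S \<Longrightarrow> S (E.cls x) = T (E.cls x)"
  shows "S = T"
  using assms by (intro extensionalityI[of S "carrier EE"]) (auto simp: EE_def E.carrier_Q)

lemma ext_eqI:
  assumes "module_map \<tau> K" "module_map \<sigma> L" "\<And>x. x \<in> carrier M \<Longrightarrow> \<tau> x = \<sigma> x"
  shows "ext \<tau> = ext \<sigma>"
proof (rule op_eqI[OF ext_extensional ext_extensional])
  fix x assume x: "x \<in> E.S"
  then show "ext \<tau> (E.cls x) = ext \<sigma> (E.cls x)" using assms E.cauchy_carrier[OF x] by (simp add: ext_cls)
qed

lemma ext_closed: "module_map \<tau> K \<Longrightarrow> X \<in> carrier EE \<Longrightarrow> ext \<tau> X \<in> carrier EE"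
  unfolding EE_def by (elim E.Q_cases) (simp add: ext_cls E.cls_carrier module_map_S)

lemma ext_comp:
  assumes s: "module_map \<sigma> L" and t: "module_map \<tau> K"
  shows "(\<lambda>X\<in>carrier EE. ext \<sigma> (ext \<tau> X)) = ext (\<lambda>x. \<sigma> (\<tau> x))" "module_map (\<lambda>x. \<sigma> (\<tau> x)) (L * K)"
proof -
  show g: "module_map (\<lambda>x. \<sigma> (\<tau> x)) (L * K)"
    unfolding module_map_def
  proof (intro conjI ballI allI)
    fix x assume x: "x \<in> carrier M"
    have "nrm H (\<sigma> (\<tau> x)) \<le> L * nrm H (\<tau> x)" using x by (intro module_mapD(3)[OF s] module_mapD(2)[OF t])
    also have "\<dots> \<le> L * (K * nrm H x)" using x by (intro mult_left_mono module_mapD(3)[OF t] module_mapD(1)[OF s])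
    finally show "nrm H (\<sigma> (\<tau> x)) \<le> L * K * nrm H x" by (simp add: mult.assoc)
  qed (use module_mapD[OF s] module_mapD[OF t] in \<open>simp_all add: M_closed\<close>)
  show "(\<lambda>X\<in>carrier EE. ext \<sigma> (ext \<tau> X)) = ext (\<lambda>x. \<sigma> (\<tau> x))"
  proof (rule op_eqI[OF _ ext_extensional])
    fix x assume x: "x \<in> E.S"
    then show "(\<lambda>X\<in>carrier EE. ext \<sigma> (ext \<tau> X)) (E.cls x) = ext (\<lambda>x. \<sigma> (\<tau> x)) (E.cls x)"
      using module_map_S[OF t x] s t g by (simp add: ext_cls E.cls_carrier EE_def)
  qed simp
qed

lemma ext_add:
  assumes s: "module_map \<sigma> L" and t: "module_map \<tau> K"
  shows "(\<lambda>X\<in>carrier EE. ext \<sigma> X \<oplus>\<^bsub>EE\<^esub> ext \<tau> X) = ext (\<lambda>x. \<sigma> x \<oplus>\<^bsub>M\<^esub> \<tau> x)" "module_map (\<lambda>x. \<sigma> x \<oplus>\<^bsub>M\<^esub> \<tau> x) (L + K)"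
proof -
  show g: "module_map (\<lambda>x. \<sigma> x \<oplus>\<^bsub>M\<^esub> \<tau> x) (L + K)"
    unfolding module_map_def
  proof (intro conjI ballI allI)
    fix x assume x: "x \<in> carrier M"
    have "nrm H (\<sigma> x \<oplus>\<^bsub>M\<^esub> \<tau> x) \<le> nrm H (\<sigma> x) + nrm H (\<tau> x)" using nring.nrm_add[OF H_nring] x module_mapD(2)[OF s] module_mapD(2)[OF t] by simp
    also have "\<dots> \<le> L * nrm H x + K * nrm H x" using x by (intro add_mono module_mapD(3)[OF s] module_mapD(3)[OF t])
    finally show "nrm H (\<sigma> x \<oplus>\<^bsub>M\<^esub> \<tau> x) \<le> (L + K) * nrm H x" by (simp add: distrib_right)
  qed (use module_mapD[OF s] module_mapD[OF t] in \<open>simp_all add: M_closed M.smult_add M.a_ac M.l_distr\<close>)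
  show "(\<lambda>X\<in>carrier EE. ext \<sigma> X \<oplus>\<^bsub>EE\<^esub> ext \<tau> X) = ext (\<lambda>x. \<sigma> x \<oplus>\<^bsub>M\<^esub> \<tau> x)"
  proof (rule op_eqI[OF _ ext_extensional])
    fix x assume x: "x \<in> E.S"
    then show "(\<lambda>X\<in>carrier EE. ext \<sigma> X \<oplus>\<^bsub>EE\<^esub> ext \<tau> X) (E.cls x) = ext (\<lambda>x. \<sigma> x \<oplus>\<^bsub>M\<^esub> \<tau> x) (E.cls x)"
      using module_map_S[OF t x] module_map_S[OF s x] s t g by (simp add: ext_cls E.cls_carrier EE_def E.Q_add)
  qed simp
qed

lemma ext_smult:
  assumes t: "module_map \<tau> K"
  shows "(\<lambda>X\<in>carrier EE. c \<odot>\<^bsub>EE\<^esub> ext \<tau> X) = ext (\<lambda>x. c \<odot>\<^bsub>M\<^esub> \<tau> x)" "module_map (\<lambda>x. c \<odot>\<^bsub>M\<^esub> \<tau> x) (cmod c * K)"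
proof -
  show g: "module_map (\<lambda>x. c \<odot>\<^bsub>M\<^esub> \<tau> x) (cmod c * K)"
    unfolding module_map_def
  proof (intro conjI ballI allI)
    fix x assume x: "x \<in> carrier M"
    have "nrm H (c \<odot>\<^bsub>M\<^esub> \<tau> x) = cmod c * nrm H (\<tau> x)" using nring.nrm_smult[OF H_nring] x module_mapD(2)[OF t] by simp
    also have "\<dots> \<le> cmod c * (K * nrm H x)" using x by (intro mult_left_mono module_mapD(3)[OF t]) auto
    finally show "nrm H (c \<odot>\<^bsub>M\<^esub> \<tau> x) \<le> cmod c * K * nrm H x" by (simp add: mult.assoc)
  qed (use module_mapD[OF t] in \<open>simp_all add: M_closed M.smult_add M.smult_smult mult.commute M.smult_mult_left\<close>)
  show "(\<lambda>X\<in>carrier EE. c \<odot>\<^bsub>EE\<^esub> ext \<tau> X) = ext (\<lambda>x. c \<odot>\<^bsub>M\<^esub> \<tau> x)"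
  proof (rule op_eqI[OF _ ext_extensional])
    fix x assume x: "x \<in> E.S"
    then show "(\<lambda>X\<in>carrier EE. c \<odot>\<^bsub>EE\<^esub> ext \<tau> X) (E.cls x) = ext (\<lambda>x. c \<odot>\<^bsub>M\<^esub> \<tau> x) (E.cls x)"
      using module_map_S[OF t x] t g by (simp add: ext_cls E.cls_carrier EE_def E.Q_smult)
  qed simp
qed

lemma module_map_zero: "module_map (\<lambda>x. \<zero>\<^bsub>M\<^esub>) 0"
  using nring.nrm_zero[OF H_nring] by (simp add: module_map_def M_closed M.l_null)

lemma ext_zero: "(\<lambda>X\<in>carrier EE. \<zero>\<^bsub>EE\<^esub>) = ext (\<lambda>x. \<zero>\<^bsub>M\<^esub>)"
proof (rule op_eqI[OF _ ext_extensional])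
  fix x assume x: "x \<in> E.S"
  then show "(\<lambda>X\<in>carrier EE. \<zero>\<^bsub>EE\<^esub>) (E.cls x) = ext (\<lambda>x. \<zero>\<^bsub>M\<^esub>) (E.cls x)"
    by (simp add: ext_cls[OF module_map_zero x] E.cls_carrier EE_def E.Q_zero)
qed simp

lemma module_map_id: "module_map (\<lambda>x. x) 1" by (simp add: module_map_def M_closed)

lemma ext_id: "(\<lambda>X\<in>carrier EE. X) = ext (\<lambda>x. x)"
proof (rule op_eqI[OF _ ext_extensional])
  fix x assume x: "x \<in> E.S"
  then show "(\<lambda>X\<in>carrier EE. X) (E.cls x) = ext (\<lambda>x. x) (E.cls x)"
    by (simp add: ext_cls[OF module_map_id x] E.cls_carrier EE_def)
qed simp

lemma module_map_left: "x \<in> carrier M \<Longrightarrow> module_map (\<lambda>y. x \<otimes>\<^bsub>M\<^esub> y) (nrm M x)"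
  by (simp add: module_map_def H_left_bound M_closed M_mult_closed M.smult_mult_right M.r_distr M.m_assoc)

text \<open>The first column of F x is that of x with every entry except the one at the unit
  replaced by zero.\<close>

lemma F_H_le:
  assumes x: "x \<in> carrier M" shows "nrm H (F x) \<le> nrm H x"
proof -
  have "l2 (col (F x)) = l2 (delta \<one> (x \<one>))"
    using x by (intro l2_cong) (auto simp: col_comp F_def embed_comp delta_def)
  then show ?thesis using l2_comp[OF col_vec[OF x] one_closed] x by (simp add: H_nrm l2_delta col_comp M_comp)
qed

lemma module_map_F: "module_map F 1"
  by (simp add: module_map_def F_H_le F_add F_smult F_right F_closed)

lemma left_mult_eq: "left_mult M F x = ext (\<lambda>y. x \<otimes>\<^bsub>M\<^esub> y)" by (simp add: left_mult_def)
lemma jones_eq: "jones_projection M F = ext F" by (simp add: jones_projection_def)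

lemma module_map_sum:
  assumes "finite I" "\<And>i. i \<in> I \<Longrightarrow> module_map (\<tau> i) (K i)"
  shows "module_map (\<lambda>w. \<Oplus>\<^bsub>M\<^esub>i\<in>I. \<tau> i w) (\<Sum>i\<in>I. K i)" "X \<in> carrier EE \<Longrightarrow> (\<Oplus>\<^bsub>EE\<^esub>i\<in>I. ext (\<tau> i) X) = ext (\<lambda>w. \<Oplus>\<^bsub>M\<^esub>i\<in>I. \<tau> i w) X"
proof -
  have "module_map (\<lambda>w. \<Oplus>\<^bsub>M\<^esub>i\<in>I. \<tau> i w) (\<Sum>i\<in>I. K i) \<and> (\<forall>X\<in>carrier EE. (\<Oplus>\<^bsub>EE\<^esub>i\<in>I. ext (\<tau> i) X) = ext (\<lambda>w. \<Oplus>\<^bsub>M\<^esub>i\<in>I. \<tau> i w) X)"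
    using assms
  proof (induction I rule: finite_induct)
    case empty
    have "\<zero>\<^bsub>EE\<^esub> = ext (\<lambda>x. \<zero>\<^bsub>M\<^esub>) X" if "X \<in> carrier EE" for X using fun_cong[OF ext_zero, of X] that by simp
    then show ?case using module_map_zero by (simp add: EE_def)
  next
    case (insert i I)
    then have IH: "module_map (\<lambda>w. \<Oplus>\<^bsub>M\<^esub>i\<in>I. \<tau> i w) (\<Sum>i\<in>I. K i)" "\<And>X. X \<in> carrier EE \<Longrightarrow> (\<Oplus>\<^bsub>EE\<^esub>i\<in>I. ext (\<tau> i) X) = ext (\<lambda>w. \<Oplus>\<^bsub>M\<^esub>i\<in>I. \<tau> i w) X"
      and gi: "module_map (\<tau> i) (K i)" by auto
    have eq: "(\<Oplus>\<^bsub>M\<^esub>j\<in>insert i I. \<tau> j w) = \<tau> i w \<oplus>\<^bsub>M\<^esub> (\<Oplus>\<^bsub>M\<^esub>j\<in>I. \<tau> j w)" if "w \<in> carrier M" for w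
      using insert that by (intro M.finsum_insert) (auto intro: module_mapD(2))
    have g: "module_map (\<lambda>w. \<tau> i w \<oplus>\<^bsub>M\<^esub> (\<Oplus>\<^bsub>M\<^esub>j\<in>I. \<tau> j w)) (\<Sum>i\<in>insert i I. K i)" using ext_add(2)[OF gi IH(1)] insert by simp
    have g': "module_map (\<lambda>w. \<Oplus>\<^bsub>M\<^esub>j\<in>insert i I. \<tau> j w) (\<Sum>i\<in>insert i I. K i)"
      using g unfolding module_map_def by (simp add: eq M_closed M_mult_closed)
    have "(\<Oplus>\<^bsub>EE\<^esub>j\<in>insert i I. ext (\<tau> j) X) = ext (\<lambda>w. \<Oplus>\<^bsub>M\<^esub>j\<in>insert i I. \<tau> j w) X" if X: "X \<in> carrier EE" for X
    proof -
      have "(\<Oplus>\<^bsub>EE\<^esub>j\<in>insert i I. ext (\<tau> j) X) = ext (\<tau> i) X \<oplus>\<^bsub>EE\<^esub> (\<Oplus>\<^bsub>EE\<^esub>j\<in>I. ext (\<tau> j) X)"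
        using insert X ext_closed unfolding EE_def by (intro E.Q.finsum_insert) (auto intro!: ext_closed[unfolded EE_def])
      also have "\<dots> = ext (\<lambda>w. \<tau> i w \<oplus>\<^bsub>M\<^esub> (\<Oplus>\<^bsub>M\<^esub>j\<in>I. \<tau> j w)) X"
        using fun_cong[OF ext_add(1)[OF gi IH(1)], of X] IH(2)[OF X] X by simp
      also have "\<dots> = ext (\<lambda>w. \<Oplus>\<^bsub>M\<^esub>j\<in>insert i I. \<tau> j w) X"
        using ext_eqI[OF g g'] eq by simp
      finally show ?thesis .
    qed
    then show ?case using g' by blast
  qed
  then show "module_map (\<lambda>w. \<Oplus>\<^bsub>M\<^esub>i\<in>I. \<tau> i w) (\<Sum>i\<in>I. K i)" "X \<in> carrier EE \<Longrightarrow> (\<Oplus>\<^bsub>EE\<^esub>i\<in>I. ext (\<tau> i) X) = ext (\<lambda>w. \<Oplus>\<^bsub>M\<^esub>i\<in>I. \<tau> i w) X" by auto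
qed

text \<open>Since \<open>F\<close> has a quasi-basis, the span of the \<open>x e\<^sub>Q y\<close> consists of all bounded right
  \<open>A\<close>-linear operators; this makes its closure under composition obvious.\<close>

lemma basic_span_eq: "basic_span M F = {ext \<tau> |\<tau>. \<exists>K. module_map \<tau> K}"
proof
  have left: "left_mult M F x (jones_projection M F (left_mult M F y X)) = ext (\<lambda>w. x \<otimes>\<^bsub>M\<^esub> F (y \<otimes>\<^bsub>M\<^esub> w)) X"
    "module_map (\<lambda>w. x \<otimes>\<^bsub>M\<^esub> F (y \<otimes>\<^bsub>M\<^esub> w)) (nrm M x * (1 * nrm M y))"
    if "x \<in> carrier M" "y \<in> carrier M" "X \<in> carrier EE" for x y X
  proof -
    note g = ext_comp[OF module_map_F module_map_left[OF that(2)]]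
    note g' = ext_comp[OF module_map_left[OF that(1)] g(2)]
    show "module_map (\<lambda>w. x \<otimes>\<^bsub>M\<^esub> F (y \<otimes>\<^bsub>M\<^esub> w)) (nrm M x * (1 * nrm M y))" by (rule g'(2))
    show "left_mult M F x (jones_projection M F (left_mult M F y X)) = ext (\<lambda>w. x \<otimes>\<^bsub>M\<^esub> F (y \<otimes>\<^bsub>M\<^esub> w)) X"
      using fun_cong[OF g(1), of X] fun_cong[OF g'(1), of X] that(3) by (simp add: left_mult_eq jones_eq)
  qed
  have X0: "E.cls (\<lambda>_. \<zero>\<^bsub>M\<^esub>) \<in> carrier EE" unfolding EE_def using E.S_zero by (intro E.cls_carrier) simp
  show "basic_span M F \<subseteq> {ext \<tau> |\<tau>. \<exists>K. module_map \<tau> K}"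
  proof
    fix T assume "T \<in> basic_span M F"
    then obtain k x y where xy: "\<And>j. j < (k::nat) \<Longrightarrow> x j \<in> carrier M" "\<And>j. j < k \<Longrightarrow> y j \<in> carrier M"
      "T = (\<lambda>X\<in>carrier EE. \<Oplus>\<^bsub>EE\<^esub>j\<in>{..<k}. left_mult M F (x j) (jones_projection M F (left_mult M F (y j) X)))"
      unfolding basic_span_def by blast
    let ?t = "\<lambda>j w. x j \<otimes>\<^bsub>M\<^esub> F (y j \<otimes>\<^bsub>M\<^esub> w)"
    show "T \<in> {ext \<tau> |\<tau>. \<exists>K. module_map \<tau> K}"
    proof -
      have gt: "module_map (?t j) (nrm M (x j) * (1 * nrm M (y j)))" if "j \<in> {..<k}" for j
        using left(2)[OF xy(1) xy(2) X0] that by blast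
      have gs: "module_map (\<lambda>w. \<Oplus>\<^bsub>M\<^esub>j\<in>{..<k}. ?t j w) (\<Sum>j\<in>{..<k}. nrm M (x j) * (1 * nrm M (y j)))"
        by (rule module_map_sum(1)[OF finite_lessThan gt])
      have gs2: "(\<Oplus>\<^bsub>EE\<^esub>j\<in>{..<k}. ext (?t j) X) = ext (\<lambda>w. \<Oplus>\<^bsub>M\<^esub>j\<in>{..<k}. ?t j w) X" if "X \<in> carrier EE" for X
        by (rule module_map_sum(2)[OF finite_lessThan gt that])
      have "T = ext (\<lambda>w. \<Oplus>\<^bsub>M\<^esub>j\<in>{..<k}. ?t j w)"
      proof (rule extensionalityI[OF _ ext_extensional])
        fix X assume X: "X \<in> carrier EE"
        have "T X = (\<Oplus>\<^bsub>EE\<^esub>j\<in>{..<k}. ext (?t j) X)"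
          unfolding xy(3) using X xy(1,2) ext_closed[OF gt X] unfolding restrict_apply'[OF X]
          by (intro abelian_monoid.finsum_cong'[OF E.Q.abelian_monoid_axioms, folded EE_def]) (auto simp: left(1))
        then show "T X = ext (\<lambda>w. \<Oplus>\<^bsub>M\<^esub>j\<in>{..<k}. ?t j w) X" using gs2[OF X] by simp
      qed (simp add: xy(3))
      then show ?thesis using gs by blast
    qed
  qed
  show "{ext \<tau> |\<tau>. \<exists>K. module_map \<tau> K} \<subseteq> basic_span M F"
  proof
    fix T assume "T \<in> {ext \<tau> |\<tau>. \<exists>K. module_map \<tau> K}"
    then obtain \<tau> K where t: "T = ext \<tau>" "module_map \<tau> K" by blast
    \<comment> \<open>Apply \<tau> to the quasi-basis expansion of w into terms u_g F(u_g^{-1} w).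
      By right A-linearity the factor F(u_g^{-1} w) comes out, leaving \<tau>(u_g) as left
      coefficient.\<close>
    let ?x = "\<lambda>j. \<tau> (uu (enum j))" and ?y = "\<lambda>j. uu (inv (enum j))"
    let ?t = "\<lambda>j w. ?x j \<otimes>\<^bsub>M\<^esub> F (?y j \<otimes>\<^bsub>M\<^esub> w)"
    have c: "?x j \<in> carrier M" "?y j \<in> carrier M" for j by (auto intro!: module_mapD(2)[OF t(2)])
    have gt: "module_map (?t j) (nrm M (?x j) * (1 * nrm M (?y j)))" for j
      using ext_comp(2)[OF module_map_left[OF c(1)] ext_comp(2)[OF module_map_F module_map_left[OF c(2)]]] .
    note gs = module_map_sum[OF finite_lessThan gt]
    have tau: "\<tau> w = (\<Oplus>\<^bsub>M\<^esub>j\<in>{..<m}. ?t j w)" if w: "w \<in> carrier M" for w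
    proof -
      let ?f = "\<lambda>j. uu (enum j) \<otimes>\<^bsub>M\<^esub> F (?y j \<otimes>\<^bsub>M\<^esub> w)"
      have sum: "\<tau> (\<Oplus>\<^bsub>M\<^esub>j\<in>I. f j) = (\<Oplus>\<^bsub>M\<^esub>j\<in>I. \<tau> (f j))" if "finite I" "f \<in> I \<rightarrow> carrier M" for f and I :: "nat set"
        using that
      proof (induction I rule: finite_induct)
        case empty
        have "\<tau> \<zero>\<^bsub>M\<^esub> = \<zero>\<^bsub>M\<^esub>" using module_mapD(4)[OF t(2), of "\<zero>\<^bsub>M\<^esub>" 0] module_mapD(2)[OF t(2), of "\<zero>\<^bsub>M\<^esub>"] by (simp add: M_closed)
        then show ?case by simp
      next
        case (insert i I)
        then show ?case using module_mapD(2,5)[OF t(2)] by (simp add: Pi_iff)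
      qed
      have f: "?f \<in> {..<m} \<rightarrow> carrier M" using w by auto
      have "w = (\<Oplus>\<^bsub>M\<^esub>j\<in>{..<m}. ?f j)" using F_quasi_basis w by (auto simp: quasi_basis_def)
      then have "\<tau> w = (\<Oplus>\<^bsub>M\<^esub>j\<in>{..<m}. \<tau> (?f j))" using sum[OF finite_lessThan f] by simp
      also have "\<dots> = (\<Oplus>\<^bsub>M\<^esub>j\<in>{..<m}. ?t j w)"
        using w c module_mapD(6)[OF t(2)] by (intro M.finsum_cong') (auto simp: F_def intro!: M_mult_closed M_comp)
      finally show ?thesis .
    qed
    have "T = (\<lambda>X\<in>carrier EE. \<Oplus>\<^bsub>EE\<^esub>j\<in>{..<m}. left_mult M F (?x j) (jones_projection M F (left_mult M F (?y j) X)))"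
    proof (rule extensionalityI[of _ "carrier EE"])
      fix X assume X: "X \<in> carrier EE"
      have "T X = ext (\<lambda>w. \<Oplus>\<^bsub>M\<^esub>j\<in>{..<m}. ?t j w) X" unfolding t(1) by (rule fun_cong[OF ext_eqI[OF t(2) gs(1)]]) (rule tau)
      also have "\<dots> = (\<Oplus>\<^bsub>EE\<^esub>j\<in>{..<m}. ext (?t j) X)" using gs(2)[OF X] by simp
      also have "\<dots> = (\<Oplus>\<^bsub>EE\<^esub>j\<in>{..<m}. left_mult M F (?x j) (jones_projection M F (left_mult M F (?y j) X)))"
        using left(1)[OF c X] by simp
      finally show "T X = (\<lambda>X\<in>carrier EE. \<Oplus>\<^bsub>EE\<^esub>j\<in>{..<m}. left_mult M F (?x j) (jones_projection M F (left_mult M F (?y j) X))) X"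
        using X by simp
    qed (auto simp: t(1) ext_extensional)
    moreover have "\<forall>j<m. ?x j \<in> carrier M \<and> ?y j \<in> carrier M" using c by blast
    ultimately show "T \<in> basic_span M F" unfolding basic_span_def
      by (intro CollectI exI[of _ m] exI[of _ ?x] exI[of _ ?y] conjI)
  qed
qed

end

section \<open>The Rokhlin projection\<close>

lemma norm_closedD: "norm_closed A S \<Longrightarrow> (\<And>n. f n \<in> S) \<Longrightarrow> converges_to A f x \<Longrightarrow> x \<in> S"
  unfolding norm_closed_def by blast

context crossed_pos
begin

section \<open>The basic construction as a normed algebra\<close>

abbreviation "BB \<equiv> basic_construction M F"

lemma BB_simps:
  "carrier BB = {ext \<tau> |\<tau>. \<exists>K. module_map \<tau> K}"
  "S \<otimes>\<^bsub>BB\<^esub> T = (\<lambda>X\<in>carrier EE. S (T X))"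
  "\<one>\<^bsub>BB\<^esub> = (\<lambda>X\<in>carrier EE. X)"
  "\<zero>\<^bsub>BB\<^esub> = (\<lambda>X\<in>carrier EE. \<zero>\<^bsub>EE\<^esub>)"
  "S \<oplus>\<^bsub>BB\<^esub> T = (\<lambda>X\<in>carrier EE. S X \<oplus>\<^bsub>EE\<^esub> T X)"
  "c \<odot>\<^bsub>BB\<^esub> T = (\<lambda>X\<in>carrier EE. c \<odot>\<^bsub>EE\<^esub> T X)"
  "nrm BB T = (SUP X \<in> {X \<in> carrier EE. nrm EE X \<le> 1}. nrm EE (T X))"
  by (simp_all add: basic_construction_def Let_def basic_span_eq)

lemma BB_cases: assumes "T \<in> carrier BB" obtains \<tau> K where "module_map \<tau> K" "T = ext \<tau>"
  using assms by (auto simp: BB_simps)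

lemma ext_BB: "module_map \<tau> K \<Longrightarrow> ext \<tau> \<in> carrier BB" by (auto simp: BB_simps)

lemma BB_ops:
  "module_map \<sigma> L \<Longrightarrow> module_map \<tau> K \<Longrightarrow> ext \<sigma> \<otimes>\<^bsub>BB\<^esub> ext \<tau> = ext (\<lambda>x. \<sigma> (\<tau> x))"
  "module_map \<sigma> L \<Longrightarrow> module_map \<tau> K \<Longrightarrow> ext \<sigma> \<oplus>\<^bsub>BB\<^esub> ext \<tau> = ext (\<lambda>x. \<sigma> x \<oplus>\<^bsub>M\<^esub> \<tau> x)"
  "module_map \<tau> K \<Longrightarrow> c \<odot>\<^bsub>BB\<^esub> ext \<tau> = ext (\<lambda>x. c \<odot>\<^bsub>M\<^esub> \<tau> x)"
  "\<one>\<^bsub>BB\<^esub> = ext (\<lambda>x. x)" "\<zero>\<^bsub>BB\<^esub> = ext (\<lambda>x. \<zero>\<^bsub>M\<^esub>)"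
  unfolding BB_simps by (rule ext_comp ext_add ext_smult ext_id ext_zero; assumption)+

lemma ext_bound:
  assumes t: "module_map \<tau> K" and X: "X \<in> carrier EE"
  shows "nrm EE (ext \<tau> X) \<le> K * nrm EE X"
proof -
  obtain x where x: "x \<in> E.S" "X = E.cls x" using X unfolding EE_def by (rule E.Q_cases)
  have c: "x n \<in> carrier M" for n using E.cauchy_carrier[OF x(1)] by simp
  show ?thesis unfolding x(2) ext_cls[OF t x(1)] unfolding EE_def
    by (rule tendsto_le[OF E.nontriv tendsto_mult[OF tendsto_const E.Q_nrm_lim[OF x(1)]] E.Q_nrm_lim[OF module_map_S[OF t x(1)]]])
      (use c module_mapD(3)[OF t] in \<open>auto intro!: always_eventually\<close>)
qed

lemma EE_nrm_nonneg: "X \<in> carrier EE \<Longrightarrow> 0 \<le> nrm EE X" unfolding EE_def by (rule E.Q.nrm_nonneg)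

lemma BB_bdd: "T \<in> carrier BB \<Longrightarrow> bdd_above ((\<lambda>X. nrm EE (T X)) ` {X \<in> carrier EE. nrm EE X \<le> 1})"
proof (elim BB_cases)
  fix \<tau> K assume t: "module_map \<tau> K" "T = ext \<tau>"
  show ?thesis
  proof (rule bdd_aboveI2)
    fix X assume X: "X \<in> {X \<in> carrier EE. nrm EE X \<le> 1}"
    then show "nrm EE (T X) \<le> K * 1" unfolding t(2) using module_mapD(1)[OF t(1)]
      by (intro order_trans[OF ext_bound[OF t(1)]] mult_left_mono) auto
  qed
qed

lemma ext_smult_arg:
  assumes t: "module_map \<tau> K" and X: "X \<in> carrier EE"
  shows "ext \<tau> (c \<odot>\<^bsub>EE\<^esub> X) = c \<odot>\<^bsub>EE\<^esub> ext \<tau> X"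
proof -
  obtain x where x: "x \<in> E.S" "X = E.cls x" using X unfolding EE_def by (rule E.Q_cases)
  have c: "x n \<in> carrier M" for n using E.cauchy_carrier[OF x(1)] by simp
  show ?thesis unfolding x(2) ext_cls[OF t x(1)] unfolding EE_def E.Q_smult[OF x(1)] E.Q_smult[OF module_map_S[OF t x(1)]]
    using ext_cls[OF t E.S_smult[OF x(1)]] c module_mapD(4)[OF t] by simp
qed

lemma BB_bound:
  assumes T: "T \<in> carrier BB" and X: "X \<in> carrier EE"
  shows "nrm EE (T X) \<le> nrm BB T * nrm EE X"
proof -
  obtain \<tau> K where t: "module_map \<tau> K" "T = ext \<tau>" using T by (rule BB_cases)
  show ?thesis
  proof (cases "nrm EE X = 0")
    case True
    then show ?thesis using ext_bound[OF t(1) X] t(2) by simp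
  next
    case False
    then have pos: "nrm EE X > 0" using EE_nrm_nonneg[OF X] by simp
    define c where "c = complex_of_real (1 / nrm EE X)"
    have "nrm EE (c \<odot>\<^bsub>EE\<^esub> X) = cmod c * nrm EE X" using X unfolding EE_def by (rule E.Q.nrm_smult)
    then have cX: "nrm EE (c \<odot>\<^bsub>EE\<^esub> X) = 1" using pos by (simp add: c_def norm_divide)
    have "c \<odot>\<^bsub>EE\<^esub> X \<in> carrier EE" using X unfolding EE_def by (rule E.Q.smult_closed)
    then have "nrm EE (T (c \<odot>\<^bsub>EE\<^esub> X)) \<le> nrm BB T" unfolding BB_simps(7)
      using cX by (intro cSUP_upper BB_bdd T) auto
    also have "T (c \<odot>\<^bsub>EE\<^esub> X) = c \<odot>\<^bsub>EE\<^esub> T X" unfolding t(2) by (rule ext_smult_arg[OF t(1) X])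
    also have "nrm EE (c \<odot>\<^bsub>EE\<^esub> T X) = cmod c * nrm EE (T X)"
      using ext_closed[OF t(1) X] unfolding t(2) EE_def by (rule E.Q.nrm_smult)
    finally show ?thesis using pos by (simp add: c_def norm_divide field_simps)
  qed
qed

lemma EE_zero: "\<zero>\<^bsub>EE\<^esub> \<in> carrier EE" "nrm EE \<zero>\<^bsub>EE\<^esub> = 0" unfolding EE_def by simp_all

lemma BB_nrm_le:
  assumes "\<And>X. X \<in> carrier EE \<Longrightarrow> nrm EE (T X) \<le> c * nrm EE X" "c \<ge> 0"
  shows "nrm BB T \<le> c"
  unfolding BB_simps(7)
proof (rule cSUP_least)
  show "{X \<in> carrier EE. nrm EE X \<le> 1} \<noteq> {}" using EE_zero by (metis (mono_tags, lifting) empty_iff mem_Collect_eq zero_le_one)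
  fix X assume "X \<in> {X \<in> carrier EE. nrm EE X \<le> 1}"
  then show "nrm EE (T X) \<le> c" using assms(1)[of X] mult_left_mono[of "nrm EE X" 1 c] assms(2) by auto
qed

lemma BB_nrm_nonneg: "T \<in> carrier BB \<Longrightarrow> 0 \<le> nrm BB T"
proof -
  assume T: "T \<in> carrier BB"
  then obtain \<tau> K where t: "module_map \<tau> K" "T = ext \<tau>" by (rule BB_cases)
  have "0 \<le> nrm EE (T \<zero>\<^bsub>EE\<^esub>)" unfolding t(2) by (intro EE_nrm_nonneg ext_closed[OF t(1)] EE_zero)
  also have "\<dots> \<le> nrm BB T" unfolding BB_simps(7) by (intro cSUP_upper BB_bdd T) (use EE_zero in auto)
  finally show ?thesis .
qed

lemma BB_ext_nrm: "module_map \<tau> K \<Longrightarrow> nrm BB (ext \<tau>) \<le> K"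
  by (intro BB_nrm_le ext_bound) (auto dest: module_mapD(1))

text \<open>\<open>BB_cases\<close> writes operators as extensions of module maps and
  \<open>BB_ops\<close> computes with them, so the algebraic axioms reduce to identities on M; the
  norm estimates are those of operators on the Hilbert module.\<close>

lemma BB_nring: "nring BB 1"
proof (rule nring.intro)
  note C = ext_comp(2) ext_add(2) ext_smult(2) module_map_id module_map_zero
  show "ring BB"
  proof (rule ringI)
    show "abelian_group BB"
    proof (rule abelian_groupI)
      fix S T assume "S \<in> carrier BB" "T \<in> carrier BB"
      then obtain \<sigma> L \<tau> K where st: "module_map \<sigma> L" "S = ext \<sigma>" "module_map \<tau> K" "T = ext \<tau>" by (elim BB_cases)
      show "S \<oplus>\<^bsub>BB\<^esub> T \<in> carrier BB" unfolding st BB_ops(2)[OF st(1,3)] by (rule ext_BB[OF ext_add(2)[OF st(1,3)]])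
      show "S \<oplus>\<^bsub>BB\<^esub> T = T \<oplus>\<^bsub>BB\<^esub> S" unfolding st BB_ops(2)[OF st(1,3)] BB_ops(2)[OF st(3,1)]
        by (rule ext_eqI[OF ext_add(2)[OF st(1,3)] ext_add(2)[OF st(3,1)]]) (auto intro!: M.a_comm module_mapD(2)[OF st(1)] module_mapD(2)[OF st(3)])
      fix R assume "R \<in> carrier BB"
      then obtain \<rho> J where r: "module_map \<rho> J" "R = ext \<rho>" by (rule BB_cases)
      show "S \<oplus>\<^bsub>BB\<^esub> T \<oplus>\<^bsub>BB\<^esub> R = S \<oplus>\<^bsub>BB\<^esub> (T \<oplus>\<^bsub>BB\<^esub> R)"
        unfolding st r BB_ops(2)[OF st(1,3)] BB_ops(2)[OF st(3) r(1)] BB_ops(2)[OF st(1) ext_add(2)[OF st(3) r(1)]] BB_ops(2)[OF ext_add(2)[OF st(1,3)] r(1)]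
        by (rule ext_eqI[OF ext_add(2)[OF ext_add(2)[OF st(1,3)] r(1)] ext_add(2)[OF st(1) ext_add(2)[OF st(3) r(1)]]])
          (auto intro!: M.a_assoc module_mapD(2)[OF st(1)] module_mapD(2)[OF st(3)] module_mapD(2)[OF r(1)])
    next
      show "\<zero>\<^bsub>BB\<^esub> \<in> carrier BB" unfolding BB_ops by (rule ext_BB[OF module_map_zero])
      fix S assume "S \<in> carrier BB"
      then obtain \<sigma> L where s: "module_map \<sigma> L" "S = ext \<sigma>" by (rule BB_cases)
      show "\<zero>\<^bsub>BB\<^esub> \<oplus>\<^bsub>BB\<^esub> S = S" unfolding s BB_ops(5) BB_ops(2)[OF module_map_zero s(1)]
        by (rule ext_eqI[OF ext_add(2)[OF module_map_zero s(1)] s(1)]) (auto intro!: M.l_zero module_mapD(2)[OF s(1)])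
      show "\<exists>y\<in>carrier BB. y \<oplus>\<^bsub>BB\<^esub> S = \<zero>\<^bsub>BB\<^esub>"
      proof (rule bexI)
        show "ext (\<lambda>x. (-1) \<odot>\<^bsub>M\<^esub> \<sigma> x) \<in> carrier BB" by (rule ext_BB[OF ext_smult(2)[OF s(1)]])
        show "ext (\<lambda>x. (-1) \<odot>\<^bsub>M\<^esub> \<sigma> x) \<oplus>\<^bsub>BB\<^esub> S = \<zero>\<^bsub>BB\<^esub>"
          unfolding s BB_ops(5) BB_ops(2)[OF ext_smult(2)[OF s(1)] s(1)]
          by (rule ext_eqI[OF ext_add(2)[OF ext_smult(2)[OF s(1)] s(1)] module_map_zero]) (simp add: M.smult_minus_one M.l_neg module_mapD(2)[OF s(1)])
      qed
    qed
    show "monoid BB"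
    proof (rule monoidI)
      fix S T assume "S \<in> carrier BB" "T \<in> carrier BB"
      then obtain \<sigma> L \<tau> K where st: "module_map \<sigma> L" "S = ext \<sigma>" "module_map \<tau> K" "T = ext \<tau>" by (elim BB_cases)
      show "S \<otimes>\<^bsub>BB\<^esub> T \<in> carrier BB" unfolding st BB_ops(1)[OF st(1,3)] by (rule ext_BB[OF ext_comp(2)[OF st(1,3)]])
      fix R assume "R \<in> carrier BB"
      then obtain \<rho> J where r: "module_map \<rho> J" "R = ext \<rho>" by (rule BB_cases)
      show "S \<otimes>\<^bsub>BB\<^esub> T \<otimes>\<^bsub>BB\<^esub> R = S \<otimes>\<^bsub>BB\<^esub> (T \<otimes>\<^bsub>BB\<^esub> R)"
        unfolding st r BB_ops(1)[OF st(1,3)] BB_ops(1)[OF st(3) r(1)] BB_ops(1)[OF st(1) ext_comp(2)[OF st(3) r(1)]] BB_ops(1)[OF ext_comp(2)[OF st(1,3)] r(1)] ..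
    next
      show "\<one>\<^bsub>BB\<^esub> \<in> carrier BB" unfolding BB_ops by (rule ext_BB[OF module_map_id])
      fix S assume "S \<in> carrier BB"
      then obtain \<sigma> L where s: "module_map \<sigma> L" "S = ext \<sigma>" by (rule BB_cases)
      show "\<one>\<^bsub>BB\<^esub> \<otimes>\<^bsub>BB\<^esub> S = S" unfolding s BB_ops(4) BB_ops(1)[OF module_map_id s(1)] ..
      show "S \<otimes>\<^bsub>BB\<^esub> \<one>\<^bsub>BB\<^esub> = S" unfolding s BB_ops(4) BB_ops(1)[OF s(1) module_map_id] ..
    qed
    fix S T R assume "S \<in> carrier BB" "T \<in> carrier BB" "R \<in> carrier BB"
    then obtain \<sigma> L \<tau> K \<rho> J where st: "module_map \<sigma> L" "S = ext \<sigma>" "module_map \<tau> K" "T = ext \<tau>" and r: "module_map \<rho> J" "R = ext \<rho>" by (elim BB_cases)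
    note st1 = ext_add(2)[OF st(1,3)] and sr = ext_comp(2)[OF st(1) r(1)] and tr = ext_comp(2)[OF st(3) r(1)]
      and rs = ext_comp(2)[OF r(1) st(1)] and rt = ext_comp(2)[OF r(1) st(3)]
    show "(S \<oplus>\<^bsub>BB\<^esub> T) \<otimes>\<^bsub>BB\<^esub> R = S \<otimes>\<^bsub>BB\<^esub> R \<oplus>\<^bsub>BB\<^esub> T \<otimes>\<^bsub>BB\<^esub> R"
      unfolding st r BB_ops(2)[OF st(1,3)] BB_ops(1)[OF st1 r(1)] BB_ops(1)[OF st(1) r(1)] BB_ops(1)[OF st(3) r(1)] BB_ops(2)[OF sr tr] ..
    show "R \<otimes>\<^bsub>BB\<^esub> (S \<oplus>\<^bsub>BB\<^esub> T) = R \<otimes>\<^bsub>BB\<^esub> S \<oplus>\<^bsub>BB\<^esub> R \<otimes>\<^bsub>BB\<^esub> T"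
      unfolding st r BB_ops(2)[OF st(1,3)] BB_ops(1)[OF r(1) st1] BB_ops(1)[OF r(1) st(1)] BB_ops(1)[OF r(1) st(3)] BB_ops(2)[OF rs rt]
      by (rule ext_eqI[OF ext_comp(2)[OF r(1) st1] ext_add(2)[OF rs rt]]) (auto intro!: module_mapD(5)[OF r(1)] module_mapD(2)[OF st(1)] module_mapD(2)[OF st(3)])
  qed
  have le: "nrm BB (c \<odot>\<^bsub>BB\<^esub> T) \<le> cmod c * nrm BB T" if T: "T \<in> carrier BB" for T c
  proof (rule BB_nrm_le)
    obtain \<tau> K where t: "module_map \<tau> K" "T = ext \<tau>" using T by (rule BB_cases)
    fix X assume X: "X \<in> carrier EE"
    have "nrm EE ((c \<odot>\<^bsub>BB\<^esub> T) X) = cmod c * nrm EE (T X)"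
      using ext_closed[OF t(1) X] X unfolding t(2) BB_simps by (simp add: EE_def E.Q.nrm_smult)
    then show "nrm EE ((c \<odot>\<^bsub>BB\<^esub> T) X) \<le> cmod c * nrm BB T * nrm EE X"
      using BB_bound[OF T X] by (simp add: mult.assoc mult_left_mono)
  qed (use BB_nrm_nonneg[OF T] in simp)
  show "nring_axioms BB 1"
  proof (rule nring_axioms.intro)
    fix S T c assume S: "S \<in> carrier BB" and T: "T \<in> carrier BB"
    then obtain \<sigma> L \<tau> K where st: "module_map \<sigma> L" "S = ext \<sigma>" "module_map \<tau> K" "T = ext \<tau>" by (elim BB_cases)
    note add = ext_add(2)[OF st(1,3)] and comp = ext_comp(2)[OF st(1,3)] and cs = ext_smult(2)[OF st(1), of c] and ct = ext_smult(2)[OF st(3), of c]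
    show "c \<odot>\<^bsub>BB\<^esub> (S \<oplus>\<^bsub>BB\<^esub> T) = c \<odot>\<^bsub>BB\<^esub> S \<oplus>\<^bsub>BB\<^esub> c \<odot>\<^bsub>BB\<^esub> T"
      unfolding st BB_ops(2)[OF st(1,3)] BB_ops(3)[OF add] BB_ops(3)[OF st(1)] BB_ops(3)[OF st(3)] BB_ops(2)[OF cs ct]
      by (rule ext_eqI[OF ext_smult(2)[OF add] ext_add(2)[OF cs ct]]) (auto intro!: M.smult_add module_mapD(2)[OF st(1)] module_mapD(2)[OF st(3)])
    show "(c \<odot>\<^bsub>BB\<^esub> S) \<otimes>\<^bsub>BB\<^esub> T = c \<odot>\<^bsub>BB\<^esub> (S \<otimes>\<^bsub>BB\<^esub> T)"
      unfolding st BB_ops(1)[OF st(1,3)] BB_ops(3)[OF comp] BB_ops(3)[OF st(1)] BB_ops(1)[OF cs st(3)] ..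
    show "S \<otimes>\<^bsub>BB\<^esub> (c \<odot>\<^bsub>BB\<^esub> T) = c \<odot>\<^bsub>BB\<^esub> (S \<otimes>\<^bsub>BB\<^esub> T)"
      unfolding st BB_ops(1)[OF st(1,3)] BB_ops(3)[OF comp] BB_ops(3)[OF st(3)] BB_ops(1)[OF st(1) ct]
      by (rule ext_eqI[OF ext_comp(2)[OF st(1) ct] ext_smult(2)[OF comp]]) (auto intro!: module_mapD(4)[OF st(1)] module_mapD(2)[OF st(3)])
    show "nrm BB (S \<oplus>\<^bsub>BB\<^esub> T) \<le> nrm BB S + nrm BB T"
    proof (rule BB_nrm_le)
      fix X assume X: "X \<in> carrier EE"
      have "nrm EE ((S \<oplus>\<^bsub>BB\<^esub> T) X) \<le> nrm EE (S X) + nrm EE (T X)"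
        using X ext_closed[OF st(1) X] ext_closed[OF st(3) X] E.Q.nrm_add unfolding st BB_simps by (simp add: EE_def)
      then show "nrm EE ((S \<oplus>\<^bsub>BB\<^esub> T) X) \<le> (nrm BB S + nrm BB T) * nrm EE X"
        using BB_bound[OF S X] BB_bound[OF T X] by (simp add: distrib_right)
    qed (use BB_nrm_nonneg S T in auto)
    show "nrm BB (S \<otimes>\<^bsub>BB\<^esub> T) \<le> 1 * nrm BB S * nrm BB T"
    proof (rule BB_nrm_le)
      fix X assume X: "X \<in> carrier EE"
      have TX: "T X \<in> carrier EE" unfolding st by (rule ext_closed[OF st(3) X])
      have "nrm EE ((S \<otimes>\<^bsub>BB\<^esub> T) X) = nrm EE (S (T X))" using X by (simp add: BB_simps)
      also have "\<dots> \<le> nrm BB S * nrm EE (T X)" by (rule BB_bound[OF S TX])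
      also have "\<dots> \<le> nrm BB S * (nrm BB T * nrm EE X)" by (intro mult_left_mono BB_bound T X BB_nrm_nonneg S)
      finally show "nrm EE ((S \<otimes>\<^bsub>BB\<^esub> T) X) \<le> 1 * nrm BB S * nrm BB T * nrm EE X" by (simp add: mult.assoc)
    qed (use BB_nrm_nonneg S T in auto)
  next
    fix T c d assume T: "T \<in> carrier BB"
    then obtain \<tau> K where t: "module_map \<tau> K" "T = ext \<tau>" by (rule BB_cases)
    note ct = ext_smult(2)[OF t(1), of c] and dt = ext_smult(2)[OF t(1), of d]
    show cT: "c \<odot>\<^bsub>BB\<^esub> T \<in> carrier BB" for c unfolding t(2) BB_ops(3)[OF t(1)] by (rule ext_BB[OF ext_smult(2)[OF t(1)]])
    show "(c + d) \<odot>\<^bsub>BB\<^esub> T = c \<odot>\<^bsub>BB\<^esub> T \<oplus>\<^bsub>BB\<^esub> d \<odot>\<^bsub>BB\<^esub> T"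
      unfolding t(2) BB_ops(3)[OF t(1)] BB_ops(2)[OF ct dt]
      by (rule ext_eqI[OF ext_smult(2)[OF t(1)] ext_add(2)[OF ct dt]]) (auto intro!: M.add_smult module_mapD(2)[OF t(1)])
    show *: "c \<odot>\<^bsub>BB\<^esub> (d \<odot>\<^bsub>BB\<^esub> T) = (c * d) \<odot>\<^bsub>BB\<^esub> T" for c d
      unfolding t(2) BB_ops(3)[OF t(1)] BB_ops(3)[OF ext_smult(2)[OF t(1)]]
      by (rule ext_eqI[OF ext_smult(2)[OF ext_smult(2)[OF t(1)]] ext_smult(2)[OF t(1)]]) (auto intro!: M.smult_smult module_mapD(2)[OF t(1)])
    show 1: "1 \<odot>\<^bsub>BB\<^esub> T = T" unfolding t(2) BB_ops(3)[OF t(1)]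
      by (rule ext_eqI[OF ext_smult(2)[OF t(1)] t(1)]) (auto intro!: M.smult_one module_mapD(2)[OF t(1)])
    show "nrm BB (c \<odot>\<^bsub>BB\<^esub> T) = cmod c * nrm BB T"
    proof (cases "c = 0")
      case True then show ?thesis using le[OF T, of c] BB_nrm_nonneg[OF cT[of c]] by simp
    next
      case False
      have "inverse c \<odot>\<^bsub>BB\<^esub> (c \<odot>\<^bsub>BB\<^esub> T) = T" using False by (simp add: * 1)
      with le[OF cT[of c], of "inverse c"] have "nrm BB T \<le> nrm BB (c \<odot>\<^bsub>BB\<^esub> T) / cmod c"
        by (simp add: norm_inverse divide_inverse mult.commute)
      then show ?thesis using le[OF T, of c] False by (simp add: field_simps)
    qed
  qed simp
qed

abbreviation "LL \<equiv> left_mult M F"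

lemma LL_closed: "x \<in> carrier M \<Longrightarrow> LL x \<in> carrier BB"
  unfolding left_mult_eq by (rule ext_BB[OF module_map_left])

lemma LL_nrm: "x \<in> carrier M \<Longrightarrow> nrm BB (LL x) \<le> nrm M x"
  unfolding left_mult_eq by (rule BB_ext_nrm[OF module_map_left])

text \<open>With \<open>LL_nrm\<close> this makes left multiplication Lipschitz, so that it induces
  a map between ultrapowers.\<close>

lemma LL_diff:
  assumes "x \<in> carrier M" "y \<in> carrier M"
  shows "LL x \<ominus>\<^bsub>BB\<^esub> LL y = LL (x \<ominus>\<^bsub>M\<^esub> y)"
proof -
  interpret B: nring BB 1 by (rule BB_nring)
  note gx = module_map_left[OF assms(1)] and gy = module_map_left[OF assms(2)] and gy' = ext_smult(2)[OF module_map_left[OF assms(2)], of "-1"]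
  have "LL x \<ominus>\<^bsub>BB\<^esub> LL y = LL x \<oplus>\<^bsub>BB\<^esub> (-1) \<odot>\<^bsub>BB\<^esub> LL y" using LL_closed[OF assms(2)] by (simp add: a_minus_def B.smult_minus_one)
  also have "\<dots> = ext (\<lambda>w. x \<otimes>\<^bsub>M\<^esub> w \<oplus>\<^bsub>M\<^esub> (-1) \<odot>\<^bsub>M\<^esub> (y \<otimes>\<^bsub>M\<^esub> w))"
    unfolding left_mult_eq BB_ops(3)[OF gy] BB_ops(2)[OF gx gy'] ..
  also have "\<dots> = LL (x \<ominus>\<^bsub>M\<^esub> y)"
    unfolding left_mult_eq using assms
    by (intro ext_eqI[OF ext_add(2)[OF gx gy'] module_map_left]) (auto simp: M.smult_minus_one a_minus_def M.l_distr M.l_minus)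
  finally show ?thesis .
qed

end

text \<open>Simplicity of A is assumed in the form delivered by \<open>Q_simple\<close>: a closed
  two-sided ideal, given as a set with its closure properties, contains 1 as soon as it contains a
  nonzero element.\<close>

locale rokhlin = crossed_pos G A \<alpha> for G :: "'g monoid" (structure) and A :: "'a cstar" and \<alpha> +
  fixes v p :: "nat \<Rightarrow> 'g \<Rightarrow> 'a"
  assumes v_closed [simp, intro]: "\<And>n g. g \<in> carrier G \<Longrightarrow> v n g \<in> carrier A"
    and v_mult: "\<And>n g h. g \<in> carrier G \<Longrightarrow> h \<in> carrier G \<Longrightarrow> v n g \<otimes>\<^bsub>A\<^esub> v n h = v n (g \<otimes> h)"
    and v_one: "\<And>n. v n \<one> = \<one>\<^bsub>A\<^esub>"
    and v_adj: "\<And>n g. g \<in> carrier G \<Longrightarrow> adj A (v n g) = v n (inv g)"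
    and alpha_v: "\<And>n g h. g \<in> carrier G \<Longrightarrow> h \<in> carrier G \<Longrightarrow> \<alpha> g (v n h) = v n (g \<otimes> h \<otimes> inv g)"
    and nrm_v: "\<And>n g. g \<in> carrier G \<Longrightarrow> nrm A (v n g) \<le> 1"
    and Ad_v: "\<And>g a. g \<in> carrier G \<Longrightarrow> a \<in> carrier A \<Longrightarrow>
       (\<lambda>n. nrm A (v n g \<otimes>\<^bsub>A\<^esub> a \<otimes>\<^bsub>A\<^esub> v n (inv g) \<ominus>\<^bsub>A\<^esub> \<alpha> g a)) \<longlonglongrightarrow> 0"
    and p_closed [simp, intro]: "\<And>n t. t \<in> carrier G \<Longrightarrow> p n t \<in> carrier A"
    and p_mult: "\<And>n s t. s \<in> carrier G \<Longrightarrow> t \<in> carrier G \<Longrightarrow> p n s \<otimes>\<^bsub>A\<^esub> p n t = (if s = t then p n s else \<zero>\<^bsub>A\<^esub>)"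
    and p_sum: "\<And>n. (\<Oplus>\<^bsub>A\<^esub>t\<in>carrier G. p n t) = \<one>\<^bsub>A\<^esub>"
    and alpha_p: "\<And>n g t. g \<in> carrier G \<Longrightarrow> t \<in> carrier G \<Longrightarrow> \<alpha> g (p n t) = p n (g \<otimes> t)"
    and nrm_p: "\<And>n t. t \<in> carrier G \<Longrightarrow> nrm A (p n t) \<le> 1"
    and p_central: "\<And>t a. t \<in> carrier G \<Longrightarrow> a \<in> carrier A \<Longrightarrow>
       (\<lambda>n. nrm A (a \<otimes>\<^bsub>A\<^esub> p n t \<ominus>\<^bsub>A\<^esub> p n t \<otimes>\<^bsub>A\<^esub> a)) \<longlonglongrightarrow> 0"
    and A_simple: "\<And>I a. I \<subseteq> carrier A \<Longrightarrow> norm_closed A I \<Longrightarrow>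
       (\<And>x y. x \<in> I \<Longrightarrow> y \<in> I \<Longrightarrow> x \<oplus>\<^bsub>A\<^esub> y \<in> I) \<Longrightarrow>
       (\<And>x y. x \<in> carrier A \<Longrightarrow> y \<in> I \<Longrightarrow> x \<otimes>\<^bsub>A\<^esub> y \<in> I) \<Longrightarrow>
       (\<And>x y. x \<in> carrier A \<Longrightarrow> y \<in> I \<Longrightarrow> y \<otimes>\<^bsub>A\<^esub> x \<in> I) \<Longrightarrow> a \<in> I \<Longrightarrow> a \<noteq> \<zero>\<^bsub>A\<^esub> \<Longrightarrow> \<one>\<^bsub>A\<^esub> \<in> I"
begin

text \<open>p_t and p_{kt} are orthogonal unless k = 1. So compressing a between them leaves, apart
  from the expected term for k = 1, only a commutator of a with p_t.\<close>

lemma p_commutator_mult: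
  assumes "a \<in> carrier A" "t \<in> carrier G" "k \<in> carrier G"
  shows "p n t \<otimes>\<^bsub>A\<^esub> a \<otimes>\<^bsub>A\<^esub> p n (k \<otimes> t) \<ominus>\<^bsub>A\<^esub> (if k = \<one> then a \<otimes>\<^bsub>A\<^esub> p n t else \<zero>\<^bsub>A\<^esub>) =
     (p n t \<otimes>\<^bsub>A\<^esub> a \<ominus>\<^bsub>A\<^esub> a \<otimes>\<^bsub>A\<^esub> p n t) \<otimes>\<^bsub>A\<^esub> p n (k \<otimes> t)"
    "nrm A ((p n t \<otimes>\<^bsub>A\<^esub> a \<ominus>\<^bsub>A\<^esub> a \<otimes>\<^bsub>A\<^esub> p n t) \<otimes>\<^bsub>A\<^esub> p n (k \<otimes> t)) \<le> nrm A (a \<otimes>\<^bsub>A\<^esub> p n t \<ominus>\<^bsub>A\<^esub> p n t \<otimes>\<^bsub>A\<^esub> a)"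
proof -
  have "k \<otimes> t = t \<longleftrightarrow> k = \<one>" using assms by simp
  then have "p n t \<otimes>\<^bsub>A\<^esub> p n (k \<otimes> t) = (if k = \<one> then p n t else \<zero>\<^bsub>A\<^esub>)" using assms p_mult[of t "k \<otimes> t" n] by auto
  then have "a \<otimes>\<^bsub>A\<^esub> p n t \<otimes>\<^bsub>A\<^esub> p n (k \<otimes> t) = (if k = \<one> then a \<otimes>\<^bsub>A\<^esub> p n t else \<zero>\<^bsub>A\<^esub>)"
    using assms by (simp add: A.m_assoc)
  then show "p n t \<otimes>\<^bsub>A\<^esub> a \<otimes>\<^bsub>A\<^esub> p n (k \<otimes> t) \<ominus>\<^bsub>A\<^esub> (if k = \<one> then a \<otimes>\<^bsub>A\<^esub> p n t else \<zero>\<^bsub>A\<^esub>) =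
     (p n t \<otimes>\<^bsub>A\<^esub> a \<ominus>\<^bsub>A\<^esub> a \<otimes>\<^bsub>A\<^esub> p n t) \<otimes>\<^bsub>A\<^esub> p n (k \<otimes> t)"
    using assms by (simp add: a_minus_def A.l_distr A.l_minus del: if_distrib)
  have "nrm A ((p n t \<otimes>\<^bsub>A\<^esub> a \<ominus>\<^bsub>A\<^esub> a \<otimes>\<^bsub>A\<^esub> p n t) \<otimes>\<^bsub>A\<^esub> p n (k \<otimes> t)) \<le> nrm A (p n t \<otimes>\<^bsub>A\<^esub> a \<ominus>\<^bsub>A\<^esub> a \<otimes>\<^bsub>A\<^esub> p n t) * nrm A (p n (k \<otimes> t))"
    using assms A.nrm_mult[of "p n t \<otimes>\<^bsub>A\<^esub> a \<ominus>\<^bsub>A\<^esub> a \<otimes>\<^bsub>A\<^esub> p n t" "p n (k \<otimes> t)"] by simp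
  also have "\<dots> \<le> nrm A (p n t \<otimes>\<^bsub>A\<^esub> a \<ominus>\<^bsub>A\<^esub> a \<otimes>\<^bsub>A\<^esub> p n t) * 1" using assms by (intro mult_left_mono nrm_p) auto
  also have "\<dots> = nrm A (a \<otimes>\<^bsub>A\<^esub> p n t \<ominus>\<^bsub>A\<^esub> p n t \<otimes>\<^bsub>A\<^esub> a)" using assms by (simp add: A.nrm_diff_commute)
  finally show "nrm A ((p n t \<otimes>\<^bsub>A\<^esub> a \<ominus>\<^bsub>A\<^esub> a \<otimes>\<^bsub>A\<^esub> p n t) \<otimes>\<^bsub>A\<^esub> p n (k \<otimes> t)) \<le> nrm A (a \<otimes>\<^bsub>A\<^esub> p n t \<ominus>\<^bsub>A\<^esub> p n t \<otimes>\<^bsub>A\<^esub> a)" .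
qed

text \<open>The k-th coefficient of p_t z p_t is p_t z_k p_{kt}, because the automorphism of k moves
  p_t to p_{kt}. Up to commutators this is z_k p_t for k = 1 and 0 otherwise, and the p_t sum to
  1.\<close>

lemma F_limit:
  assumes z: "z \<in> carrier M"
  shows "converges_to M (\<lambda>n. \<Oplus>\<^bsub>M\<^esub>t\<in>carrier G. emb (p n t) \<otimes>\<^bsub>M\<^esub> z \<otimes>\<^bsub>M\<^esub> emb (p n t)) (F z)"
proof -
  let ?w = "\<lambda>n. \<Oplus>\<^bsub>M\<^esub>t\<in>carrier G. emb (p n t) \<otimes>\<^bsub>M\<^esub> z \<otimes>\<^bsub>M\<^esub> emb (p n t)"
  let ?d = "\<lambda>n k t. nrm A (z k \<otimes>\<^bsub>A\<^esub> p n t \<ominus>\<^bsub>A\<^esub> p n t \<otimes>\<^bsub>A\<^esub> z k)"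
  have wc: "?w n \<in> carrier M" for n using z by (intro M.finsum_closed) auto
  have le: "nrm A ((?w n \<ominus>\<^bsub>M\<^esub> F z) k) \<le> (\<Sum>t\<in>carrier G. ?d n k t)" if k: "k \<in> carrier G" for n k
  proof -
    let ?c = "\<lambda>t. if k = \<one> then z k \<otimes>\<^bsub>A\<^esub> p n t else \<zero>\<^bsub>A\<^esub>"
    have "?w n k = (\<Oplus>\<^bsub>A\<^esub>t\<in>carrier G. p n t \<otimes>\<^bsub>A\<^esub> z k \<otimes>\<^bsub>A\<^esub> p n (k \<otimes> t))"
      using z k by (subst M_finsum_comp[OF fin]) (auto simp: embed_left embed_right alpha_p M_comp intro!: A.finsum_cong')
    moreover have "F z k = (\<Oplus>\<^bsub>A\<^esub>t\<in>carrier G. ?c t)"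
    proof (cases "k = \<one>")
      case True
      have "(\<Oplus>\<^bsub>A\<^esub>t\<in>carrier G. z k \<otimes>\<^bsub>A\<^esub> p n t) = z k \<otimes>\<^bsub>A\<^esub> (\<Oplus>\<^bsub>A\<^esub>t\<in>carrier G. p n t)"
        using z k by (intro A.finsum_rdistr[symmetric] fin) auto
      then show ?thesis using True z k by (simp add: F_def embed_comp p_sum M_comp)
    next
      case False then show ?thesis using k by (simp add: F_def embed_comp)
    qed
    ultimately have "(?w n \<ominus>\<^bsub>M\<^esub> F z) k = (\<Oplus>\<^bsub>A\<^esub>t\<in>carrier G. p n t \<otimes>\<^bsub>A\<^esub> z k \<otimes>\<^bsub>A\<^esub> p n (k \<otimes> t)) \<ominus>\<^bsub>A\<^esub> (\<Oplus>\<^bsub>A\<^esub>t\<in>carrier G. ?c t)"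
      using wc[of n] z k by (simp add: M_diff_comp F_closed)
    also have "\<dots> = (\<Oplus>\<^bsub>A\<^esub>t\<in>carrier G. p n t \<otimes>\<^bsub>A\<^esub> z k \<otimes>\<^bsub>A\<^esub> p n (k \<otimes> t) \<ominus>\<^bsub>A\<^esub> ?c t)"
      using z k by (intro A.finsum_diff fin) (auto simp: M_comp)
    also have "nrm A \<dots> \<le> (\<Sum>t\<in>carrier G. nrm A (p n t \<otimes>\<^bsub>A\<^esub> z k \<otimes>\<^bsub>A\<^esub> p n (k \<otimes> t) \<ominus>\<^bsub>A\<^esub> ?c t))"
      using z k by (intro A.nrm_finsum fin) (auto simp: M_comp)
    also have "\<dots> \<le> (\<Sum>t\<in>carrier G. ?d n k t)"
      using z k p_commutator_mult[OF M_comp[OF z k] _ k] by (intro sum_mono) simp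
    finally show ?thesis .
  qed
  have "(\<lambda>n. nrm M (?w n \<ominus>\<^bsub>M\<^esub> F z)) \<longlonglongrightarrow> 0"
  proof (rule tendsto_sandwich[OF _ _ tendsto_const])
    show "eventually (\<lambda>n. 0 \<le> nrm M (?w n \<ominus>\<^bsub>M\<^esub> F z)) sequentially" using wc z by (intro always_eventually allI M.nrm_nonneg) auto
    show "eventually (\<lambda>n. nrm M (?w n \<ominus>\<^bsub>M\<^esub> F z) \<le> (\<Sum>k\<in>carrier G. \<Sum>t\<in>carrier G. ?d n k t)) sequentially"
      using wc z le by (intro always_eventually allI order_trans[OF M_nrm_sum] sum_mono) auto
    show "(\<lambda>n. \<Sum>k\<in>carrier G. \<Sum>t\<in>carrier G. ?d n k t) \<longlonglongrightarrow> 0"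
      using z by (intro tendsto_null_sum p_central) (auto simp: M_comp)
  qed
  then show ?thesis using z by (simp add: converges_to_def F_closed)
qed

lemma M_simple: "simple_cstar M"
  unfolding simple_cstar_def
proof (intro conjI allI impI)
  show "carrier M \<noteq> {\<zero>\<^bsub>M\<^esub>}"
  proof
    assume "carrier M = {\<zero>\<^bsub>M\<^esub>}"
    then have "\<one>\<^bsub>M\<^esub> = \<zero>\<^bsub>M\<^esub>" using M_closed(4) by blast
    then have "\<one>\<^bsub>M\<^esub> \<one> = \<zero>\<^bsub>M\<^esub> \<one>" by simp
    then show False using nontrivial by (simp add: M_one_comp)
  qed
  fix I assume "ideal I M \<and> norm_closed M I"
  then interpret I: ideal I M by simp
  have cl: "norm_closed M I" using \<open>ideal I M \<and> norm_closed M I\<close> by simp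
  show "I = {\<zero>\<^bsub>M\<^esub>} \<or> I = carrier M"
  proof (cases "I = {\<zero>\<^bsub>M\<^esub>}")
    case False
    then obtain y where y: "y \<in> I" "y \<noteq> \<zero>\<^bsub>M\<^esub>" using I.zero_closed by blast
    have yc: "y \<in> carrier M" using y I.a_subset by blast
    have "\<exists>k\<in>carrier G. y k \<noteq> \<zero>\<^bsub>A\<^esub>"
    proof (rule ccontr)
      assume "\<not> ?thesis"
      then have "y = \<zero>\<^bsub>M\<^esub>" using yc by (intro M_ext) (auto simp: M_closed)
      then show False using y by simp
    qed
    then obtain k where k: "k \<in> carrier G" "y k \<noteq> \<zero>\<^bsub>A\<^esub>" by blast
    \<comment> \<open>Multiplying by a unitary moves the nonzero coefficient \<open>y k\<close> to
      the unit of G, where F sees it.\<close>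
    define z where "z = y \<otimes>\<^bsub>M\<^esub> uu (inv k)"
    have z: "z \<in> I" "z \<in> carrier M" using y yc by (auto simp: z_def intro!: I.I_r_closed)
    have z1: "z \<one> = y k" using yc k by (simp add: z_def mon_right M_comp)
    have sumI: "(\<Oplus>\<^bsub>M\<^esub>t\<in>T. f t) \<in> I" if "finite T" "\<And>t. t \<in> T \<Longrightarrow> f t \<in> I" for T and f :: "'g \<Rightarrow> _"
      using that
    proof (induction T rule: finite_induct)
      case (insert t T) then show ?case using I.a_subset by (subst M.finsum_insert) (auto intro!: I.a_closed)
    qed (simp add: I.zero_closed)
    have Fz: "F z \<in> I"
      by (rule norm_closedD[OF cl _ F_limit[OF z(2)]], rule sumI[OF fin], rule I.I_r_closed[OF I.I_l_closed[OF z(1)]]) auto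
    \<comment> \<open>The part of the ideal lying in A is a closed ideal of A. It contains
      \<open>y k\<close>, the coefficient of F z, so simplicity of A applies.\<close>
    define J where "J = {a \<in> carrier A. emb a \<in> I}"
    have "\<one>\<^bsub>A\<^esub> \<in> J"
    proof (rule A_simple[of J "y k"])
      show "J \<subseteq> carrier A" by (auto simp: J_def)
      show "norm_closed A J" unfolding norm_closed_def
      proof (intro allI impI)
        fix f a assume f: "(\<forall>n. f n \<in> J) \<and> converges_to A f a"
        then have a: "a \<in> carrier A" and fc: "\<And>n. f n \<in> carrier A" by (auto simp: converges_to_def J_def)
        have "emb (f n) \<ominus>\<^bsub>M\<^esub> emb a = emb (f n \<ominus>\<^bsub>A\<^esub> a)" for n using a fc by (simp add: a_minus_def embed_add embed_minus)
        then have "converges_to M (\<lambda>n. emb (f n)) (emb a)" using f a fc by (simp add: converges_to_def embed_nrm)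
        then have "emb a \<in> I" by (rule norm_closedD[OF cl, rotated]) (use f in \<open>auto simp: J_def\<close>)
        then show "a \<in> J" using a by (simp add: J_def)
      qed
      show "y k \<in> J" using Fz z1 yc k by (simp add: J_def F_def M_comp)
      show "y k \<noteq> \<zero>\<^bsub>A\<^esub>" by fact
    qed (auto simp: J_def embed_add embed_mult intro: I.I_l_closed I.I_r_closed)
    then have "\<one>\<^bsub>M\<^esub> \<in> I" by (simp add: J_def embed_one)
    then show ?thesis using I.one_imp_carrier by blast
  qed simp
qed

section \<open>The averaging projections and their asymptotic centrality\<close>

definition en :: "nat \<Rightarrow> 'g \<Rightarrow> 'a" where
  "en n = (\<lambda>k\<in>carrier G. complex_of_real (1 / real m) \<odot>\<^bsub>A\<^esub> v n (inv k))"

lemma en_closed [simp, intro]: "en n \<in> carrier M" by (auto simp: en_def M_simps)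

lemma en_comp: "k \<in> carrier G \<Longrightarrow> en n k = complex_of_real (1 / real m) \<odot>\<^bsub>A\<^esub> v n (inv k)" by (simp add: en_def)

lemma en_adj: "adj M (en n) = en n"
proof (rule M_ext)
  fix k assume k: "k \<in> carrier G"
  then show "adj M (en n) k = en n k"
    by (simp add: en_comp A.adj_smult v_adj alpha_smult alpha_v)
qed (auto simp: M_closed)

lemma en_left_one:
  assumes x: "x \<in> carrier M"
  shows "(en n \<otimes>\<^bsub>M\<^esub> x) \<one> = complex_of_real (1 / real m) \<odot>\<^bsub>A\<^esub> (\<Oplus>\<^bsub>A\<^esub>g\<in>carrier G. v n (inv g) \<otimes>\<^bsub>A\<^esub> \<alpha> g (x (inv g)))"
  using x by (subst A.smult_finsum[OF fin]) (auto simp: M_mult_comp en_comp A.smult_mult_left M_comp intro!: A.finsum_cong')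

text \<open>The identity behind the Rokhlin projection, valid for all \<open>x\<close> and not only asymptotically:
  both sides have \<open>k\<close>-th component \<open>1/m \<cdot> \<Sum>\<^sub>h v h\<^sup>-\<^sup>1 \<alpha>\<^sub>h (x (h\<^sup>-\<^sup>1 k))\<close>.\<close>

lemma en_F_en:
  assumes x: "x \<in> carrier M"
  shows "of_nat m \<odot>\<^bsub>M\<^esub> (en n \<otimes>\<^bsub>M\<^esub> F (en n \<otimes>\<^bsub>M\<^esub> x)) = en n \<otimes>\<^bsub>M\<^esub> x"
proof (rule M_ext)
  fix k assume k: "k \<in> carrier G"
  let ?c = "complex_of_real (1 / real m)"
  let ?f = "\<lambda>g. v n (inv g) \<otimes>\<^bsub>A\<^esub> \<alpha> g (x (inv g))"
  let ?h = "\<lambda>g. v n (inv g) \<otimes>\<^bsub>A\<^esub> \<alpha> g (x (inv g \<otimes> k))"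
  have f: "?f \<in> vec" and h: "?h \<in> vec" using x k by auto
  have fc: "(\<Oplus>\<^bsub>A\<^esub>g\<in>carrier G. ?f g) \<in> carrier A" using f by (intro A.finsum_closed)
  have m: "of_nat m * ?c = 1" using m_pos by simp
  have "(of_nat m \<odot>\<^bsub>M\<^esub> (en n \<otimes>\<^bsub>M\<^esub> F (en n \<otimes>\<^bsub>M\<^esub> x))) k = of_nat m \<odot>\<^bsub>A\<^esub> (en n k \<otimes>\<^bsub>A\<^esub> \<alpha> k (?c \<odot>\<^bsub>A\<^esub> (\<Oplus>\<^bsub>A\<^esub>g\<in>carrier G. ?f g)))"
    using x k fc by (simp add: F_def embed_right en_left_one M_comp M_mult_closed)
  also have "\<dots> = ?c \<odot>\<^bsub>A\<^esub> (v n (inv k) \<otimes>\<^bsub>A\<^esub> \<alpha> k (\<Oplus>\<^bsub>A\<^esub>g\<in>carrier G. ?f g))"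
    using k fc m by (simp add: en_comp alpha_smult A.smult_mult_left A.smult_mult_right A.smult_smult)
  also have "v n (inv k) \<otimes>\<^bsub>A\<^esub> \<alpha> k (\<Oplus>\<^bsub>A\<^esub>g\<in>carrier G. ?f g) = (\<Oplus>\<^bsub>A\<^esub>g\<in>carrier G. v n (inv k) \<otimes>\<^bsub>A\<^esub> \<alpha> k (?f g))"
    using k f by (subst alpha_sum[OF k fin f], intro A.finsum_rdistr fin) auto
  \<comment> \<open>The automorphism of k conjugates the argument of v by k, and v(k^{-1}) v(k
    g^{-1} k^{-1}) = v((k g)^{-1}). So the sum is the one for e x, shifted by k.\<close>
  also have "\<dots> = (\<Oplus>\<^bsub>A\<^esub>g\<in>carrier G. ?h (k \<otimes> g))"
  proof (rule A.finsum_cong')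
    fix g assume g: "g \<in> carrier G"
    have "inv k \<otimes> (k \<otimes> inv g \<otimes> inv k) = inv (k \<otimes> g)" using g k by (simp add: m_assoc[symmetric] inv_mult_group)
    then have 1: "v n (inv k) \<otimes>\<^bsub>A\<^esub> v n (k \<otimes> inv g \<otimes> inv k) = v n (inv (k \<otimes> g))" using g k by (simp add: v_mult)
    have 2: "inv (k \<otimes> g) \<otimes> k = inv g" using g k by (simp add: inv_mult_group m_assoc)
    show "v n (inv k) \<otimes>\<^bsub>A\<^esub> \<alpha> k (?f g) = ?h (k \<otimes> g)"
      unfolding 2 1[symmetric] using g k x by (simp add: alpha_mult alpha_v alpha_alpha A.m_assoc M_comp)
  qed (use h k in auto)
  also have "\<dots> = (\<Oplus>\<^bsub>A\<^esub>g\<in>carrier G. ?h g)" by (rule sum_left[OF k h])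
  also have "?c \<odot>\<^bsub>A\<^esub> \<dots> = (en n \<otimes>\<^bsub>M\<^esub> x) k"
    using x k h by (subst A.smult_finsum[OF fin h]) (auto simp: M_mult_comp en_comp A.smult_mult_left M_comp intro!: A.finsum_cong')
  finally show "(of_nat m \<odot>\<^bsub>M\<^esub> (en n \<otimes>\<^bsub>M\<^esub> F (en n \<otimes>\<^bsub>M\<^esub> x))) k = (en n \<otimes>\<^bsub>M\<^esub> x) k" .
qed (use x in \<open>auto intro!: M_mult_closed M_closed\<close>)

lemma F_en: "F (en n) = emb (complex_of_real (1 / real m) \<odot>\<^bsub>A\<^esub> \<one>\<^bsub>A\<^esub>)"
  by (simp add: F_def en_comp v_one)

text \<open>\<open>en_F_en\<close> with x = e gives e^2 = m e F(e^2). In the coefficient of e^2 at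
  the unit each v(g^{-1}) meets v(g), so F(e^2) is 1/m and the right-hand side is e.\<close>

lemma en_idem: "en n \<otimes>\<^bsub>M\<^esub> en n = en n"
proof -
  have "en n = en n \<otimes>\<^bsub>M\<^esub> \<one>\<^bsub>M\<^esub>" by (simp add: M_one_mult)
  also have "\<dots> = of_nat m \<odot>\<^bsub>M\<^esub> (en n \<otimes>\<^bsub>M\<^esub> F (en n))" using en_F_en[of "\<one>\<^bsub>M\<^esub>" n] by (simp add: M_closed M_one_mult)
  also have "\<dots> = en n" unfolding F_en using m_pos by (simp add: embed_smult embed_one M.smult_mult_right M.smult_smult M_closed M_one_mult)
  finally have "en n \<otimes>\<^bsub>M\<^esub> en n = of_nat m \<odot>\<^bsub>M\<^esub> (en n \<otimes>\<^bsub>M\<^esub> F (en n \<otimes>\<^bsub>M\<^esub> en n))" using en_F_en[of "en n" n] by simp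
  have one: "(en n \<otimes>\<^bsub>M\<^esub> en n) \<one> = complex_of_real (1 / real m) \<odot>\<^bsub>A\<^esub> \<one>\<^bsub>A\<^esub>"
  proof -
    have "(\<Oplus>\<^bsub>A\<^esub>g\<in>carrier G. v n (inv g) \<otimes>\<^bsub>A\<^esub> \<alpha> g (en n (inv g))) = (\<Oplus>\<^bsub>A\<^esub>g\<in>carrier G. complex_of_real (1 / real m) \<odot>\<^bsub>A\<^esub> \<one>\<^bsub>A\<^esub>)"
      by (intro A.finsum_cong') (auto simp: en_comp alpha_smult alpha_v A.smult_mult_right v_mult v_one m_assoc)
    also have "\<dots> = \<one>\<^bsub>A\<^esub>" using fin one_closed by (auto simp: A.finsum_const_smult A.smult_smult)
    finally show ?thesis by (simp add: en_left_one)
  qed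
  have "en n \<otimes>\<^bsub>M\<^esub> en n = of_nat m \<odot>\<^bsub>M\<^esub> (en n \<otimes>\<^bsub>M\<^esub> F (en n \<otimes>\<^bsub>M\<^esub> en n))" by fact
  also have "\<dots> = en n" unfolding F_def one using m_pos by (simp add: embed_smult embed_one M.smult_mult_right M.smult_smult M_closed M_one_mult)
  finally show ?thesis .
qed

text \<open>e is the average of m monomials v(g)^{-1} u_g, each of norm at most 1.\<close>

lemma en_nrm: "nrm M (en n) \<le> 1"
proof -
  have w: "nrm M (mon (v n (inv g)) g) \<le> 1" if g: "g \<in> carrier G" for g
  proof -
    have "nrm M (mon (v n (inv g)) g) \<le> (\<Sum>k\<in>carrier G. nrm A (mon (v n (inv g)) g k))" using g by (intro M_nrm_sum) auto
    also have "\<dots> = (\<Sum>k\<in>carrier G. if k = g then nrm A (v n (inv g)) else 0)" by (intro sum.cong) (auto simp: mon_comp)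
    also have "\<dots> = nrm A (v n (inv g))" using fin g by simp
    finally show ?thesis using nrm_v[of "inv g" n] g by simp
  qed
  have "en n = (\<Oplus>\<^bsub>M\<^esub>g\<in>carrier G. mon (en n g) g)" by (simp add: M_decomp)
  also have "\<dots> = (\<Oplus>\<^bsub>M\<^esub>g\<in>carrier G. complex_of_real (1 / real m) \<odot>\<^bsub>M\<^esub> mon (v n (inv g)) g)"
    by (intro M.finsum_cong') (auto intro!: M_ext simp: mon_comp en_comp)
  finally have "nrm M (en n) \<le> (\<Sum>g\<in>carrier G. nrm M (complex_of_real (1 / real m) \<odot>\<^bsub>M\<^esub> mon (v n (inv g)) g))"
    using M.nrm_finsum[OF fin, of "\<lambda>g. complex_of_real (1 / real m) \<odot>\<^bsub>M\<^esub> mon (v n (inv g)) g"] by auto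
  also have "\<dots> = (\<Sum>g\<in>carrier G. (1 / real m) * nrm M (mon (v n (inv g)) g))"
    by (intro sum.cong) (auto simp: M.nrm_smult norm_divide)
  also have "\<dots> \<le> (\<Sum>g\<in>carrier G. (1 / real m) * 1)" by (intro sum_mono mult_left_mono w) auto
  also have "\<dots> = 1" using m_pos by simp
  finally show ?thesis .
qed

text \<open>The coefficient at the unit of G is 1/m for every n. This keeps the class of the
  sequence in the ultrapower away from zero.\<close>

lemma en_nrm_ge: "1 / real m \<le> nrm M (en n)"
  using M_nrm_comp[of "en n" \<one>] by (simp add: en_comp v_one A.nrm_smult nrm_A_one norm_divide)

text \<open>Substituting g = k h^{-1} in e y makes the k-th coefficients of e y and y e sums over
  the same h. With q = k h^{-1} their terms differ, up to the factor 1/m, by v(q)^{-1} times the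
  defect between the automorphism of q and conjugation by v(q) at y_h. Coefficients and unitaries of
  y are thus treated together.\<close>

lemma en_central:
  assumes y: "y \<in> carrier M"
  shows "(\<lambda>n. nrm M (en n \<otimes>\<^bsub>M\<^esub> y \<ominus>\<^bsub>M\<^esub> y \<otimes>\<^bsub>M\<^esub> en n)) \<longlonglongrightarrow> 0"
proof -
  let ?c = "complex_of_real (1 / real m)"
  let ?q = "\<lambda>k h. k \<otimes> inv h"
  let ?d = "\<lambda>n k h. nrm A (v n (?q k h) \<otimes>\<^bsub>A\<^esub> y h \<otimes>\<^bsub>A\<^esub> v n (inv (?q k h)) \<ominus>\<^bsub>A\<^esub> \<alpha> (?q k h) (y h))"
  have le: "nrm A ((en n \<otimes>\<^bsub>M\<^esub> y \<ominus>\<^bsub>M\<^esub> y \<otimes>\<^bsub>M\<^esub> en n) k) \<le> (\<Sum>h\<in>carrier G. ?d n k h)" if k: "k \<in> carrier G" for n k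
  proof -
    let ?f = "\<lambda>g. en n g \<otimes>\<^bsub>A\<^esub> \<alpha> g (y (inv g \<otimes> k))"
    let ?a = "\<lambda>h. ?c \<odot>\<^bsub>A\<^esub> (v n (inv (?q k h)) \<otimes>\<^bsub>A\<^esub> \<alpha> (?q k h) (y h))"
    let ?b = "\<lambda>h. ?c \<odot>\<^bsub>A\<^esub> (y h \<otimes>\<^bsub>A\<^esub> v n (inv (?q k h)))"
    have f: "?f \<in> vec" using y k by auto
    have "(en n \<otimes>\<^bsub>M\<^esub> y) k = (\<Oplus>\<^bsub>A\<^esub>g\<in>carrier G. ?f (k \<otimes> g))" unfolding M_mult_comp[OF k] using sum_left[OF k f] by simp
    also have "\<dots> = (\<Oplus>\<^bsub>A\<^esub>h\<in>carrier G. ?f (?q k h))" using f k by (intro sum_inv[symmetric]) auto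
    also have "\<dots> = (\<Oplus>\<^bsub>A\<^esub>h\<in>carrier G. ?a h)"
    proof (rule A.finsum_cong')
      fix h assume h: "h \<in> carrier G"
      have "inv (?q k h) \<otimes> k = h" using h k by (simp add: inv_mult_group m_assoc)
      then show "?f (?q k h) = ?a h" using h k y by (simp add: en_comp A.smult_mult_left M_comp)
    qed (use y k in auto)
    finally have 1: "(en n \<otimes>\<^bsub>M\<^esub> y) k = (\<Oplus>\<^bsub>A\<^esub>h\<in>carrier G. ?a h)" .
    have 2: "(y \<otimes>\<^bsub>M\<^esub> en n) k = (\<Oplus>\<^bsub>A\<^esub>h\<in>carrier G. ?b h)"
      unfolding M_mult_comp[OF k]
    proof (rule A.finsum_cong')
      fix h assume h: "h \<in> carrier G"
      have "h \<otimes> inv (inv h \<otimes> k) \<otimes> inv h = inv (?q k h)" using h k by (simp add: inv_mult_group m_assoc)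
      then show "y h \<otimes>\<^bsub>A\<^esub> \<alpha> h (en n (inv h \<otimes> k)) = ?b h" using h k y
        by (simp add: en_comp alpha_smult alpha_v A.smult_mult_right M_comp)
    qed (use y k in auto)
    have "(en n \<otimes>\<^bsub>M\<^esub> y \<ominus>\<^bsub>M\<^esub> y \<otimes>\<^bsub>M\<^esub> en n) k = (\<Oplus>\<^bsub>A\<^esub>h\<in>carrier G. ?a h) \<ominus>\<^bsub>A\<^esub> (\<Oplus>\<^bsub>A\<^esub>h\<in>carrier G. ?b h)"
      using y k by (simp add: M_diff_comp 1 2 M_mult_closed)
    also have "\<dots> = (\<Oplus>\<^bsub>A\<^esub>h\<in>carrier G. ?a h \<ominus>\<^bsub>A\<^esub> ?b h)" using y k by (intro A.finsum_diff fin) auto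
    finally have "nrm A ((en n \<otimes>\<^bsub>M\<^esub> y \<ominus>\<^bsub>M\<^esub> y \<otimes>\<^bsub>M\<^esub> en n) k) = nrm A (\<Oplus>\<^bsub>A\<^esub>h\<in>carrier G. ?a h \<ominus>\<^bsub>A\<^esub> ?b h)"
      by (rule arg_cong)
    also have "\<dots> \<le> (\<Sum>h\<in>carrier G. nrm A (?a h \<ominus>\<^bsub>A\<^esub> ?b h))" using y k by (intro A.nrm_finsum fin) auto
    also have "\<dots> \<le> (\<Sum>h\<in>carrier G. ?d n k h)"
    proof (rule sum_mono)
      fix h assume h: "h \<in> carrier G"
      define Q where "Q = k \<otimes> inv h"
      have Q: "Q \<in> carrier G" using h k by (simp add: Q_def)
      have yh: "y h \<in> carrier A" using y h by auto
      \<comment> \<open>The term of y e is rewritten with v(q)^{-1} in front, so that this factor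
        can be taken out of the difference.\<close>
      have e: "v n (inv Q) \<otimes>\<^bsub>A\<^esub> (v n Q \<otimes>\<^bsub>A\<^esub> y h \<otimes>\<^bsub>A\<^esub> v n (inv Q)) = y h \<otimes>\<^bsub>A\<^esub> v n (inv Q)"
      proof -
        have "v n (inv Q) \<otimes>\<^bsub>A\<^esub> (v n Q \<otimes>\<^bsub>A\<^esub> x) = x" if x: "x \<in> carrier A" for x
        proof -
          have "v n (inv Q) \<otimes>\<^bsub>A\<^esub> (v n Q \<otimes>\<^bsub>A\<^esub> x) = (v n (inv Q) \<otimes>\<^bsub>A\<^esub> v n Q) \<otimes>\<^bsub>A\<^esub> x"
            using Q x by (intro A.m_assoc[symmetric]) auto
          then show ?thesis using Q x by (simp add: v_mult v_one)
        qed
        then show ?thesis using Q yh by (simp add: A.m_assoc)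
      qed
      have "?a h \<ominus>\<^bsub>A\<^esub> ?b h = ?c \<odot>\<^bsub>A\<^esub> (v n (inv Q) \<otimes>\<^bsub>A\<^esub> \<alpha> Q (y h) \<ominus>\<^bsub>A\<^esub> v n (inv Q) \<otimes>\<^bsub>A\<^esub> (v n Q \<otimes>\<^bsub>A\<^esub> y h \<otimes>\<^bsub>A\<^esub> v n (inv Q)))"
        unfolding e Q_def[symmetric] using Q yh by (intro A.smult_diff[symmetric]) auto
      also have "v n (inv Q) \<otimes>\<^bsub>A\<^esub> \<alpha> Q (y h) \<ominus>\<^bsub>A\<^esub> v n (inv Q) \<otimes>\<^bsub>A\<^esub> (v n Q \<otimes>\<^bsub>A\<^esub> y h \<otimes>\<^bsub>A\<^esub> v n (inv Q)) =
          v n (inv Q) \<otimes>\<^bsub>A\<^esub> (\<alpha> Q (y h) \<ominus>\<^bsub>A\<^esub> v n Q \<otimes>\<^bsub>A\<^esub> y h \<otimes>\<^bsub>A\<^esub> v n (inv Q))"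
        using Q yh by (simp add: a_minus_def A.r_distr A.r_minus)
      finally have "nrm A (?a h \<ominus>\<^bsub>A\<^esub> ?b h) = nrm A (?c \<odot>\<^bsub>A\<^esub> (v n (inv Q) \<otimes>\<^bsub>A\<^esub> (\<alpha> Q (y h) \<ominus>\<^bsub>A\<^esub> v n Q \<otimes>\<^bsub>A\<^esub> y h \<otimes>\<^bsub>A\<^esub> v n (inv Q))))"
        by (rule arg_cong)
      also have "\<dots> =
          (1 / real m) * nrm A (v n (inv Q) \<otimes>\<^bsub>A\<^esub> (\<alpha> Q (y h) \<ominus>\<^bsub>A\<^esub> v n Q \<otimes>\<^bsub>A\<^esub> y h \<otimes>\<^bsub>A\<^esub> v n (inv Q)))"
        using Q yh by (subst A.nrm_smult) (auto simp: norm_divide)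
      also have "\<dots> \<le> 1 * (1 * nrm A (v n (inv Q)) * nrm A (\<alpha> Q (y h) \<ominus>\<^bsub>A\<^esub> v n Q \<otimes>\<^bsub>A\<^esub> y h \<otimes>\<^bsub>A\<^esub> v n (inv Q)))"
        using Q yh m_pos by (intro mult_mono A.nrm_mult) (auto simp: divide_le_eq)
      also have "\<dots> \<le> 1 * (1 * 1 * nrm A (\<alpha> Q (y h) \<ominus>\<^bsub>A\<^esub> v n Q \<otimes>\<^bsub>A\<^esub> y h \<otimes>\<^bsub>A\<^esub> v n (inv Q)))"
        using Q yh by (intro mult_left_mono mult_right_mono nrm_v) auto
      also have "\<dots> = ?d n k h" unfolding Q_def[symmetric] using Q yh by (simp add: A.nrm_diff_commute[of "\<alpha> Q (y h)"])
      finally show "nrm A (?a h \<ominus>\<^bsub>A\<^esub> ?b h) \<le> ?d n k h" .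
    qed
    finally show ?thesis .
  qed
  show ?thesis
  proof (rule tendsto_sandwich[OF _ _ tendsto_const])
    show "eventually (\<lambda>n. 0 \<le> nrm M (en n \<otimes>\<^bsub>M\<^esub> y \<ominus>\<^bsub>M\<^esub> y \<otimes>\<^bsub>M\<^esub> en n)) sequentially"
      using y by (intro always_eventually allI M.nrm_nonneg) auto
    show "eventually (\<lambda>n. nrm M (en n \<otimes>\<^bsub>M\<^esub> y \<ominus>\<^bsub>M\<^esub> y \<otimes>\<^bsub>M\<^esub> en n) \<le> (\<Sum>k\<in>carrier G. \<Sum>h\<in>carrier G. ?d n k h)) sequentially"
      using y le by (intro always_eventually allI order_trans[OF M_nrm_sum] sum_mono) auto
    show "(\<lambda>n. \<Sum>k\<in>carrier G. \<Sum>h\<in>carrier G. ?d n k h) \<longlonglongrightarrow> 0"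
      using y by (intro tendsto_null_sum Ad_v) (auto simp: M_comp)
  qed
qed

end

section \<open>The Rokhlin property and the obstruction to fixed-point inclusions\<close>

context rokhlin
begin

lemma M_weak_tracial_rokhlin:
  assumes \<omega>: "free_ultrafilter \<omega>"
  shows "weak_tracial_rokhlin \<omega> M QQ F"
proof -
  interpret U: seq_star "\<lambda>_. M" "real m" "bounded_seqs M" \<omega> by (rule M.ultrapower_seq_star[OF \<omega>])
  interpret B: nring BB 1 by (rule BB_nring)
  interpret V: seq_alg "\<lambda>_. BB" 1 "bounded_seqs BB" \<omega> by (rule B.ultrapower_seq_alg[OF \<omega>])
  \<comment> \<open>A free ultrafilter refines the cofinite filter, so ordinary limits in n are
    limits along it.\<close>
  have le_seq: "\<omega> \<le> sequentially" using \<omega> by (simp add: free_ultrafilter_def cofinite_eq_sequentially)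
  have UQ: "ultrapower \<omega> M = U.Q" and VQ: "ultrapower \<omega> BB = V.Q" by (simp_all add: ultrapower_def)
  have constM: "up_const \<omega> M x = U.cls (\<lambda>_. x)" for x by (simp add: up_const_def U.cls_def)
  have constB: "up_const \<omega> BB T = V.cls (\<lambda>_. T)" for T by (simp add: up_const_def V.cls_def)
  have constS: "(\<lambda>_. x) \<in> bounded_seqs M" if "x \<in> carrier M" for x using that by (intro M.bounded_seqsI[of _ "nrm M x"]) auto
  have enS: "en \<in> bounded_seqs M" by (intro M.bounded_seqsI[of _ 1] en_closed en_nrm)
  define e where "e = U.cls en"
  have eQ: "e \<in> carrier U.Q" unfolding e_def by (rule U.cls_carrier[OF enS])
  have e_comm: "e \<in> relative_commutant \<omega> M"
  proof -
    have "e \<otimes>\<^bsub>U.Q\<^esub> U.cls (\<lambda>_. a) = U.cls (\<lambda>_. a) \<otimes>\<^bsub>U.Q\<^esub> e" if a: "a \<in> carrier M" for a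
    proof -
      have "((\<lambda>n. nrm M (en n \<otimes>\<^bsub>M\<^esub> a \<ominus>\<^bsub>M\<^esub> a \<otimes>\<^bsub>M\<^esub> en n)) \<longlongrightarrow> 0) \<omega>"
        using en_central[OF a] by (rule tendsto_mono[OF le_seq])
      then show ?thesis unfolding e_def U.Q_mult[OF enS constS[OF a]] U.Q_mult[OF constS[OF a] enS]
        by (subst U.cls_eq_iff[OF U.S_mult[OF enS constS[OF a]] U.S_mult[OF constS[OF a] enS]])
    qed
    then show ?thesis unfolding relative_commutant_def UQ constM using eQ by blast
  qed
  have e_adj: "adj U.Q e = e" unfolding e_def U.Q_adj[OF enS] by (simp add: en_adj)
  have e_idem: "e \<otimes>\<^bsub>U.Q\<^esub> e = e" unfolding e_def U.Q_mult[OF enS enS] by (simp add: en_idem)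
  have e_pos: "positive U.Q e" unfolding positive_def using eQ e_adj e_idem by (intro bexI[of _ e]) simp_all
  have e_nrm: "nrm U.Q e \<le> 1" unfolding e_def
    by (rule tendsto_upperbound[OF U.Q_nrm_lim[OF enS] _ U.nontriv]) (simp add: en_nrm)
  have "1 / real m \<le> nrm U.Q e" unfolding e_def
    by (rule tendsto_lowerbound[OF U.Q_nrm_lim[OF enS] _ U.nontriv]) (simp add: en_nrm_ge)
  then have "nrm U.Q e \<noteq> 0" using m_pos by auto
  then have e_nz: "e \<noteq> \<zero>\<^bsub>U.Q\<^esub>" by auto
  have LS: "(\<lambda>n. LL (x n)) \<in> bounded_seqs BB" if x: "x \<in> bounded_seqs M" for x
  proof -
    obtain K where K: "\<And>n. nrm M (x n) \<le> K" "\<And>n. x n \<in> carrier M" using M.bounded_seqsE[OF x] by blast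
    show ?thesis by (intro B.bounded_seqsI[of _ K] LL_closed K order_trans[OF LL_nrm])
  qed
  have Lcls: "up_map \<omega> BB LL (U.cls x) = V.cls (\<lambda>n. LL (x n))" if x: "x \<in> bounded_seqs M" for x
    unfolding up_map_def
    by (rule seq_map_cls[OF U.seq_alg_axioms V.seq_alg_axioms x, where L = 1]) (use LS in \<open>auto simp: LL_diff LL_nrm\<close>)
  have FS: "(\<lambda>n. F (x n)) \<in> bounded_seqs M" if x: "x \<in> bounded_seqs M" for x
  proof -
    obtain K where K: "\<And>n. nrm M (x n) \<le> K" "\<And>n. x n \<in> carrier M" using M.bounded_seqsE[OF x] by blast
    have "nrm M (F (x n)) \<le> K" for n
      using M_nrm_comp[OF K(2) one_closed, of n] K by (simp add: F_def embed_nrm M_comp) (meson order_trans)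
    then show ?thesis by (intro M.bounded_seqsI[of _ K] F_closed K)
  qed
  have Fcls: "up_map \<omega> M F (U.cls x) = U.cls (\<lambda>n. F (x n))" if x: "x \<in> bounded_seqs M" for x
    unfolding up_map_def
  proof (rule seq_map_cls[OF U.seq_alg_axioms U.seq_alg_axioms x, where L = 1])
    fix x y assume *: "x \<in> carrier M" "y \<in> carrier M"
    then have "F x \<ominus>\<^bsub>M\<^esub> F y = emb ((x \<ominus>\<^bsub>M\<^esub> y) \<one>)" by (simp add: F_def a_minus_def M_minus_comp embed_add embed_minus M_comp)
    then show "nrm M (F x \<ominus>\<^bsub>M\<^esub> F y) \<le> 1 * nrm M (x \<ominus>\<^bsub>M\<^esub> y)" using * M_nrm_comp[of "x \<ominus>\<^bsub>M\<^esub> y" \<one>]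
      by (simp add: embed_nrm M_comp)
  qed (rule FS)
  let ?I = "of_nat m \<odot>\<^bsub>M\<^esub> \<one>\<^bsub>M\<^esub>"
  have I: "?I \<in> carrier M" by (simp add: M_closed)
  have jB: "jones_projection M F \<in> carrier BB" unfolding jones_eq by (rule ext_BB[OF module_map_F])
  have constBS: "(\<lambda>_. T) \<in> bounded_seqs BB" if "T \<in> carrier BB" for T using that by (intro B.bounded_seqsI[of _ "nrm BB T"]) auto
  \<comment> \<open>On vectors of M this is \<open>en_F_en\<close>, so it holds for the extended
    operators. As it is exact for each n, the identity in the ultrapower follows without
    estimates.\<close>
  have op: "LL ?I \<otimes>\<^bsub>BB\<^esub> ((LL (en n) \<otimes>\<^bsub>BB\<^esub> jones_projection M F) \<otimes>\<^bsub>BB\<^esub> LL (en n)) = LL (en n)" for n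
  proof -
    note gE = module_map_left[OF en_closed[of n]] and gI = module_map_left[OF I]
    note g1 = ext_comp(2)[OF gE module_map_F] note g2 = ext_comp(2)[OF g1 gE] note g3 = ext_comp(2)[OF gI g2]
    show ?thesis
      unfolding left_mult_eq jones_eq BB_ops(1)[OF gE module_map_F] BB_ops(1)[OF g1 gE] BB_ops(1)[OF gI g2]
    proof (rule ext_eqI[OF g3 gE])
      fix x assume x: "x \<in> carrier M"
      have "en n \<otimes>\<^bsub>M\<^esub> F (en n \<otimes>\<^bsub>M\<^esub> x) \<in> carrier M" using x by (intro M_mult_closed F_closed) auto
      then show "?I \<otimes>\<^bsub>M\<^esub> (en n \<otimes>\<^bsub>M\<^esub> F (en n \<otimes>\<^bsub>M\<^esub> x)) = en n \<otimes>\<^bsub>M\<^esub> x"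
        using en_F_en[OF x, of n] by (simp add: M.smult_mult_left M_closed M_one_mult)
    qed
  qed
  have eq: "up_const \<omega> BB (LL ?I) \<otimes>\<^bsub>V.Q\<^esub> (up_map \<omega> BB LL e \<otimes>\<^bsub>V.Q\<^esub> up_const \<omega> BB (jones_projection M F) \<otimes>\<^bsub>V.Q\<^esub> up_map \<omega> BB LL e) = up_map \<omega> BB LL e"
    unfolding e_def Lcls[OF enS] constB V.Q_mult[OF LS[OF enS] constBS[OF jB]]
      V.Q_mult[OF V.S_mult[OF LS[OF enS] constBS[OF jB]] LS[OF enS]]
      V.Q_mult[OF constBS[OF LL_closed[OF I]] V.S_mult[OF V.S_mult[OF LS[OF enS] constBS[OF jB]] LS[OF enS]]]
    by (simp only: op)
  have "?I \<otimes>\<^bsub>M\<^esub> F (en n) = \<one>\<^bsub>M\<^esub>" for n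
    unfolding F_en using m_pos
    by (simp add: embed_smult embed_one M.smult_mult_left M.smult_mult_right M.smult_smult M_closed M_one_mult)
  then have "up_const \<omega> M ?I \<otimes>\<^bsub>U.Q\<^esub> up_map \<omega> M F e = \<one>\<^bsub>U.Q\<^esub>"
    unfolding e_def Fcls[OF enS] constM U.Q_mult[OF constS[OF I] FS[OF enS]] U.Q_one by simp
  then have zero: "\<one>\<^bsub>U.Q\<^esub> \<ominus>\<^bsub>U.Q\<^esub> up_const \<omega> M ?I \<otimes>\<^bsub>U.Q\<^esub> up_map \<omega> M F e = \<zero>\<^bsub>U.Q\<^esub>" by simp
  \<comment> \<open>The remainder is 0, for which the sequence of zeros is a witness of
    subequivalence.\<close>
  have sub: "subequivalent U.Q \<zero>\<^bsub>U.Q\<^esub> a" if "positive U.Q a" for a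
  proof -
    have "a \<in> carrier U.Q" using that by (auto simp: positive_def)
    then show ?thesis unfolding subequivalent_def converges_to_def by (intro exI[of _ "\<lambda>_. \<zero>\<^bsub>U.Q\<^esub>"]) simp
  qed
  \<comment> \<open>e is positive and idempotent, hence its own positive square root: both witnesses
    are e.\<close>
  show ?thesis
    unfolding weak_tracial_rokhlin_def Let_def UQ VQ Index_eq
    using M_simple F_index_finite e_comm e_pos e_nz e_nrm e_idem eq sub
    by (intro conjI allI impI exI[of _ e]) (simp_all add: zero)
qed

text \<open>Commuting with A means that a x_k is x_k times the image of a under k. For a = p_t this
  reads p_t x_k = x_k p_{kt}, whence p_t x_k = p_t x_k p_{kt}. For k other than the unit the latter
  is only a commutator error, and summing over t gives x_k = 0.\<close>

lemma A_relative_commutant: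
  assumes x: "x \<in> carrier M" and comm: "\<And>a. a \<in> carrier A \<Longrightarrow> emb a \<otimes>\<^bsub>M\<^esub> x = x \<otimes>\<^bsub>M\<^esub> emb a"
  shows "x = emb (x \<one>)" "\<And>a. a \<in> carrier A \<Longrightarrow> a \<otimes>\<^bsub>A\<^esub> x \<one> = x \<one> \<otimes>\<^bsub>A\<^esub> a"
proof -
  have eq: "a \<otimes>\<^bsub>A\<^esub> x k = x k \<otimes>\<^bsub>A\<^esub> \<alpha> k a" if "a \<in> carrier A" "k \<in> carrier G" for a k
    using fun_cong[OF comm[OF that(1)], of k] x that by (simp add: embed_left embed_right)
  show "a \<otimes>\<^bsub>A\<^esub> x \<one> = x \<one> \<otimes>\<^bsub>A\<^esub> a" if "a \<in> carrier A" for a using eq[OF that one_closed] that by simp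
  have "x k = \<zero>\<^bsub>A\<^esub>" if k: "k \<in> carrier G" "k \<noteq> \<one>" for k
  proof -
    let ?d = "\<lambda>n t. nrm A (x k \<otimes>\<^bsub>A\<^esub> p n t \<ominus>\<^bsub>A\<^esub> p n t \<otimes>\<^bsub>A\<^esub> x k)"
    have xk: "x k \<in> carrier A" using x k by auto
    have le: "nrm A (p n t \<otimes>\<^bsub>A\<^esub> x k) \<le> ?d n t" if t: "t \<in> carrier G" for n t
    proof -
      have E: "p n t \<otimes>\<^bsub>A\<^esub> x k = x k \<otimes>\<^bsub>A\<^esub> p n (k \<otimes> t)" using t k eq[of "p n t" k] by (simp add: alpha_p)
      have "p n t \<otimes>\<^bsub>A\<^esub> x k = p n t \<otimes>\<^bsub>A\<^esub> (x k \<otimes>\<^bsub>A\<^esub> p n (k \<otimes> t))"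
        unfolding E[symmetric] using t xk p_mult[OF t t, of n] by (simp flip: A.m_assoc)
      also have "\<dots> = p n t \<otimes>\<^bsub>A\<^esub> x k \<otimes>\<^bsub>A\<^esub> p n (k \<otimes> t)"
        using t xk k by (intro A.m_assoc[symmetric]) auto
      finally have "p n t \<otimes>\<^bsub>A\<^esub> x k = (p n t \<otimes>\<^bsub>A\<^esub> x k \<ominus>\<^bsub>A\<^esub> x k \<otimes>\<^bsub>A\<^esub> p n t) \<otimes>\<^bsub>A\<^esub> p n (k \<otimes> t)"
        using p_commutator_mult(1)[OF xk t k(1), of n] k t xk by simp
      then show ?thesis using p_commutator_mult(2)[OF xk t k(1), of n] by simp
    qed
    have "nrm A (x k) \<le> (\<Sum>t\<in>carrier G. ?d n t)" for n
    proof -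
      have "x k = (\<Oplus>\<^bsub>A\<^esub>t\<in>carrier G. p n t) \<otimes>\<^bsub>A\<^esub> x k" using xk by (simp add: p_sum)
      also have "\<dots> = (\<Oplus>\<^bsub>A\<^esub>t\<in>carrier G. p n t \<otimes>\<^bsub>A\<^esub> x k)" using xk by (intro A.finsum_ldistr fin) auto
      finally have "nrm A (x k) \<le> (\<Sum>t\<in>carrier G. nrm A (p n t \<otimes>\<^bsub>A\<^esub> x k))"
        using A.nrm_finsum[OF fin, of "\<lambda>t. p n t \<otimes>\<^bsub>A\<^esub> x k"] xk by auto
      also have "\<dots> \<le> (\<Sum>t\<in>carrier G. ?d n t)" by (intro sum_mono le)
      finally show ?thesis .
    qed
    moreover have "(\<lambda>n. \<Sum>t\<in>carrier G. ?d n t) \<longlonglongrightarrow> 0" using xk by (intro tendsto_null_sum p_central)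
    ultimately have "nrm A (x k) \<le> 0" by (intro tendsto_lowerbound[of "\<lambda>n. \<Sum>t\<in>carrier G. ?d n t"]) auto
    then show ?thesis using definite[OF xk] A.nrm_nonneg[OF xk] by simp
  qed
  then show "x = emb (x \<one>)" using x by (intro M_ext) (auto simp: embed_comp)
qed

text \<open>The action is approximately inner, hence trivial on the centre.\<close>

lemma alpha_central:
  assumes z: "z \<in> carrier A" "\<And>a. a \<in> carrier A \<Longrightarrow> a \<otimes>\<^bsub>A\<^esub> z = z \<otimes>\<^bsub>A\<^esub> a" and g: "g \<in> carrier G"
  shows "\<alpha> g z = z"
proof -
  have "v n g \<otimes>\<^bsub>A\<^esub> z \<otimes>\<^bsub>A\<^esub> v n (inv g) = z" for n using z g by (simp add: A.m_assoc v_mult v_one)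
  then have "(\<lambda>n. nrm A (z \<ominus>\<^bsub>A\<^esub> \<alpha> g z)) \<longlonglongrightarrow> 0" using Ad_v[OF g z(1)] by simp
  then have "nrm A (z \<ominus>\<^bsub>A\<^esub> \<alpha> g z) = 0" by (simp add: LIMSEQ_const_iff)
  then show ?thesis using definite[of "z \<ominus>\<^bsub>A\<^esub> \<alpha> g z"] z g by (simp add: A.diff_eq_zero_iff)
qed

lemma uu_mult: "g \<in> carrier G \<Longrightarrow> h \<in> carrier G \<Longrightarrow> uu g \<otimes>\<^bsub>M\<^esub> uu h = uu (g \<otimes> h)"
proof (rule M_ext)
  fix k assume *: "g \<in> carrier G" "h \<in> carrier G" "k \<in> carrier G"
  have "inv g \<otimes> k = h \<longleftrightarrow> k = g \<otimes> h" using * by (metis inv_closed inv_solve_left m_closed inv_inv)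
  then show "(uu g \<otimes>\<^bsub>M\<^esub> uu h) k = uu (g \<otimes> h) k" using * by (simp add: mon_left mon_comp)
qed (auto intro!: M_mult_closed)

lemma uu_one: "uu \<one> = \<one>\<^bsub>M\<^esub>" by (simp add: embed_mono[symmetric] embed_one)

lemma uu_emb: "g \<in> carrier G \<Longrightarrow> a \<in> carrier A \<Longrightarrow> uu g \<otimes>\<^bsub>M\<^esub> emb a = emb (\<alpha> g a) \<otimes>\<^bsub>M\<^esub> uu g"
  by (rule M_ext) (auto simp: embed_left embed_right mon_comp intro!: M_mult_closed)

text \<open>The commutator l is given by the equation l (k g) = g k because this is what the
  multiplicative map z is applied to: z(g) and z(k) commute, so z(l) z(k g) = z(k g), and z(k g) is
  invertible.\<close>

lemma endomorphism_fixes_commutators: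
  assumes c: "\<And>x. x \<in> carrier M \<Longrightarrow> \<gamma> x \<in> carrier M"
    and mult: "\<And>x y. x \<in> carrier M \<Longrightarrow> y \<in> carrier M \<Longrightarrow> \<gamma> (x \<otimes>\<^bsub>M\<^esub> y) = \<gamma> x \<otimes>\<^bsub>M\<^esub> \<gamma> y"
    and fixA: "\<And>a. a \<in> carrier A \<Longrightarrow> \<gamma> (emb a) = emb a"
    and g: "g \<in> carrier G" and k: "k \<in> carrier G" and l: "l \<in> carrier G" "l \<otimes> (k \<otimes> g) = g \<otimes> k"
  shows "\<gamma> (uu l) = uu l"
proof -
  define z where "z g = (uu (inv g) \<otimes>\<^bsub>M\<^esub> \<gamma> (uu g)) \<one>" for g
  have uc: "uu g \<in> carrier M" for g by auto
  have comm: "emb a \<otimes>\<^bsub>M\<^esub> (uu (inv g) \<otimes>\<^bsub>M\<^esub> \<gamma> (uu g)) = (uu (inv g) \<otimes>\<^bsub>M\<^esub> \<gamma> (uu g)) \<otimes>\<^bsub>M\<^esub> emb a"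
    if "a \<in> carrier A" "g \<in> carrier G" for a g
  proof -
    have "\<gamma> (uu g) \<otimes>\<^bsub>M\<^esub> emb a = \<gamma> (uu g \<otimes>\<^bsub>M\<^esub> emb a)" using that mult[OF uc embed_closed] fixA by simp
    also have "\<dots> = emb (\<alpha> g a) \<otimes>\<^bsub>M\<^esub> \<gamma> (uu g)" using that mult[OF embed_closed uc] fixA by (simp add: uu_emb)
    finally have 1: "\<gamma> (uu g) \<otimes>\<^bsub>M\<^esub> emb a = emb (\<alpha> g a) \<otimes>\<^bsub>M\<^esub> \<gamma> (uu g)" .
    have "(uu (inv g) \<otimes>\<^bsub>M\<^esub> \<gamma> (uu g)) \<otimes>\<^bsub>M\<^esub> emb a = uu (inv g) \<otimes>\<^bsub>M\<^esub> (emb (\<alpha> g a) \<otimes>\<^bsub>M\<^esub> \<gamma> (uu g))"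
      using that c[OF uc] by (simp add: M.m_assoc 1)
    also have "\<dots> = (uu (inv g) \<otimes>\<^bsub>M\<^esub> emb (\<alpha> g a)) \<otimes>\<^bsub>M\<^esub> \<gamma> (uu g)" using that c[OF uc] by (simp add: M.m_assoc)
    also have "\<dots> = emb a \<otimes>\<^bsub>M\<^esub> (uu (inv g) \<otimes>\<^bsub>M\<^esub> \<gamma> (uu g))" using that c[OF uc] by (simp add: uu_emb M.m_assoc)
    finally show ?thesis by simp
  qed
  have zc: "z g \<in> carrier A" if "g \<in> carrier G" for g using that c[OF uc] by (auto simp: z_def)
  have z_emb: "uu (inv g) \<otimes>\<^bsub>M\<^esub> \<gamma> (uu g) = emb (z g)" if "g \<in> carrier G" for g
    unfolding z_def using that c[OF uc] comm by (intro A_relative_commutant(1)) auto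
  have z_central: "a \<otimes>\<^bsub>A\<^esub> z g = z g \<otimes>\<^bsub>A\<^esub> a" if "g \<in> carrier G" "a \<in> carrier A" for g a
    unfolding z_def using that c[OF uc] comm by (intro A_relative_commutant(2)) auto
  have \<gamma>: "\<gamma> (uu g) = uu g \<otimes>\<^bsub>M\<^esub> emb (z g)" if "g \<in> carrier G" for g
    using that c[OF uc] by (simp add: z_emb[symmetric] M.m_assoc[symmetric] uu_mult uu_one)
  have z_mult: "z (g \<otimes> k) = z g \<otimes>\<^bsub>A\<^esub> z k" if "g \<in> carrier G" "k \<in> carrier G" for g k
  proof -
    have "\<gamma> (uu (g \<otimes> k)) = \<gamma> (uu g) \<otimes>\<^bsub>M\<^esub> \<gamma> (uu k)" using that mult[OF uc uc, of g k] by (simp add: uu_mult)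
    also have "\<dots> = uu g \<otimes>\<^bsub>M\<^esub> (emb (z g) \<otimes>\<^bsub>M\<^esub> uu k) \<otimes>\<^bsub>M\<^esub> emb (z k)" using that zc by (simp add: \<gamma> M.m_assoc)
    \<comment> \<open>z(g) is central in A, so by \<open>alpha_central\<close> it passes the unitary
      of k unchanged.\<close>
    also have "emb (z g) \<otimes>\<^bsub>M\<^esub> uu k = uu k \<otimes>\<^bsub>M\<^esub> emb (z g)"
      using that zc z_central by (subst uu_emb) (auto simp: alpha_central)
    also have "uu g \<otimes>\<^bsub>M\<^esub> (uu k \<otimes>\<^bsub>M\<^esub> emb (z g)) \<otimes>\<^bsub>M\<^esub> emb (z k) = uu (g \<otimes> k) \<otimes>\<^bsub>M\<^esub> emb (z g \<otimes>\<^bsub>A\<^esub> z k)"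
      using that zc by (simp add: embed_mult uu_mult[symmetric] M.m_assoc)
    finally have "uu (g \<otimes> k) \<otimes>\<^bsub>M\<^esub> emb (z (g \<otimes> k)) = uu (g \<otimes> k) \<otimes>\<^bsub>M\<^esub> emb (z g \<otimes>\<^bsub>A\<^esub> z k)" using that by (simp add: \<gamma>)
    \<comment> \<open>Cancelling the unitary and comparing coefficients at the unit of G gives the
      equation in A.\<close>
    then have "uu (inv (g \<otimes> k)) \<otimes>\<^bsub>M\<^esub> (uu (g \<otimes> k) \<otimes>\<^bsub>M\<^esub> emb (z (g \<otimes> k))) = uu (inv (g \<otimes> k)) \<otimes>\<^bsub>M\<^esub> (uu (g \<otimes> k) \<otimes>\<^bsub>M\<^esub> emb (z g \<otimes>\<^bsub>A\<^esub> z k))" by simp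
    then have "emb (z (g \<otimes> k)) = emb (z g \<otimes>\<^bsub>A\<^esub> z k)"
      using that zc by (simp add: M.m_assoc[symmetric] uu_mult uu_one del: inv_mult_group)
    then have "emb (z (g \<otimes> k)) \<one> = emb (z g \<otimes>\<^bsub>A\<^esub> z k) \<one>" by simp
    then show ?thesis by (simp add: embed_comp)
  qed
  have z_one: "z \<one> = \<one>\<^bsub>A\<^esub>"
  proof -
    have "\<gamma> (uu \<one>) = uu \<one>" using fixA[of "\<one>\<^bsub>A\<^esub>"] by (simp add: embed_mono)
    then show ?thesis unfolding z_def by (simp add: uu_one M_closed M_one_mult M_one_comp)
  qed
  have "z l \<otimes>\<^bsub>A\<^esub> z (k \<otimes> g) = z (k \<otimes> g)"
    using z_mult[of l "k \<otimes> g"] z_mult[of g k] z_mult[of k g] l g k z_central[of g "z k"] zc by simp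
  then have "(z l \<otimes>\<^bsub>A\<^esub> z (k \<otimes> g)) \<otimes>\<^bsub>A\<^esub> z (inv (k \<otimes> g)) = z (k \<otimes> g) \<otimes>\<^bsub>A\<^esub> z (inv (k \<otimes> g))" by simp
  moreover have "z (k \<otimes> g) \<otimes>\<^bsub>A\<^esub> z (inv (k \<otimes> g)) = \<one>\<^bsub>A\<^esub>"
    using z_mult[of "k \<otimes> g" "inv (k \<otimes> g)"] z_one g k by (simp del: inv_mult_group)
  ultimately have "z l = \<one>\<^bsub>A\<^esub>" using g k l zc by (simp add: A.m_assoc del: inv_mult_group)
  then show ?thesis using \<gamma>[OF l(1)] by (simp add: embed_one M_one_mult)
qed

text \<open>Transported along \<Phi>, each automorphism \<beta> h becomes a map of M fixing A, hence
  fixing u_l for every commutator l. So u_l lies in the fixed-point algebra, which is A; but its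
  only coefficient sits at l, which forces l = 1.\<close>

lemma fixed_point_inclusion_comm_group:
  assumes "iso_to_fixed_point_inclusion M QQ F H' D \<beta> \<Phi>"
  shows "comm_group G"
proof (rule group_comm_groupI)
  fix g k assume g: "g \<in> carrier G" and k: "k \<in> carrier G"
  have act: "group_action_on H' D \<beta>" and \<Phi>: "\<Phi> \<in> star_iso M D" and im: "\<Phi> ` QQ = fixed_points H' D \<beta>"
    using assms by (auto simp: iso_to_fixed_point_inclusion_def)
  have bij: "bij_betw \<Phi> (carrier M) (carrier D)" and hom: "\<Phi> \<in> ring_hom M D" using \<Phi> by (auto simp: star_iso_def)
  let ?\<Psi> = "inv_into (carrier M) \<Phi>"
  have \<Psi>: "?\<Psi> y \<in> carrier M" "\<Phi> (?\<Psi> y) = y" if "y \<in> carrier D" for y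
    using that bij by (auto simp: bij_betw_def inv_into_into f_inv_into_f)
  have \<Psi>\<Phi>: "?\<Psi> (\<Phi> x) = x" if "x \<in> carrier M" for x using that bij by (simp add: bij_betw_def)
  have \<Phi>c: "\<Phi> x \<in> carrier D" if "x \<in> carrier M" for x using ring_hom_closed[OF hom that] .
  define l where "l = g \<otimes> k \<otimes> inv (k \<otimes> g)"
  have l: "l \<in> carrier G" "l \<otimes> (k \<otimes> g) = g \<otimes> k" using g k by (simp_all add: l_def m_assoc del: inv_mult_group)
  have uc: "uu l \<in> carrier M" by auto
  have "\<beta> h (\<Phi> (uu l)) = \<Phi> (uu l)" if h: "h \<in> carrier H'" for h
  proof -
    have \<beta>: "\<beta> h \<in> ring_hom D D" using act h by (auto simp: group_action_on_def star_iso_def)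
    let ?\<gamma> = "\<lambda>x. ?\<Psi> (\<beta> h (\<Phi> x))"
    have bc: "\<beta> h (\<Phi> x) \<in> carrier D" if "x \<in> carrier M" for x using ring_hom_closed[OF \<beta> \<Phi>c[OF that]] .
    have "?\<gamma> (uu l) = uu l"
    proof (rule endomorphism_fixes_commutators[where \<gamma> = ?\<gamma>, OF _ _ _ g k l])
      fix x assume x: "x \<in> carrier M"
      show "?\<gamma> x \<in> carrier M" using \<Psi>(1)[OF bc[OF x]] .
      fix y assume y: "y \<in> carrier M"
      have "\<Phi> (?\<gamma> x \<otimes>\<^bsub>M\<^esub> ?\<gamma> y) = \<beta> h (\<Phi> x) \<otimes>\<^bsub>D\<^esub> \<beta> h (\<Phi> y)"
        using ring_hom_mult[OF hom \<Psi>(1)[OF bc[OF x]] \<Psi>(1)[OF bc[OF y]]] \<Psi>(2)[OF bc[OF x]] \<Psi>(2)[OF bc[OF y]] by simp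
      also have "\<dots> = \<beta> h (\<Phi> (x \<otimes>\<^bsub>M\<^esub> y))" using ring_hom_mult[OF \<beta> \<Phi>c[OF x] \<Phi>c[OF y]] ring_hom_mult[OF hom x y] by simp
      finally have "\<beta> h (\<Phi> (x \<otimes>\<^bsub>M\<^esub> y)) = \<Phi> (?\<gamma> x \<otimes>\<^bsub>M\<^esub> ?\<gamma> y)" by simp
      then show "?\<gamma> (x \<otimes>\<^bsub>M\<^esub> y) = ?\<gamma> x \<otimes>\<^bsub>M\<^esub> ?\<gamma> y"
        using \<Psi>\<Phi>[OF M_mult_closed[OF \<Psi>(1)[OF bc[OF x]] \<Psi>(1)[OF bc[OF y]]]] by simp
    next
      fix a assume a: "a \<in> carrier A"
      then have "\<Phi> (emb a) \<in> fixed_points H' D \<beta>" using im by (auto simp: cp_base_def)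
      then have "\<beta> h (\<Phi> (emb a)) = \<Phi> (emb a)" using h by (auto simp: fixed_points_def)
      then show "?\<gamma> (emb a) = emb a" using \<Psi>\<Phi>[OF embed_closed[OF a]] by simp
    qed
    then show ?thesis using \<Psi>(2)[OF bc[OF uc]] by simp
  qed
  then have "\<Phi> (uu l) \<in> \<Phi> ` QQ" unfolding im using \<Phi>c[OF uc] by (auto simp: fixed_points_def)
  then have "uu l \<in> QQ" using bij Q_subset uc by (auto simp: bij_betw_def dest: inj_onD)
  then obtain a where "uu l = emb a" by (auto simp: cp_base_def)
  then have "uu l l = emb a l" by simp
  then have "l = \<one>" using l(1) nontrivial by (auto simp: mon_comp embed_comp split: if_splits)
  then show "g \<otimes> k = k \<otimes> g" using l(2) g k by simp
qed

end

section \<open>The regular product action as an instance\<close>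

context regular_uhf
begin

text \<open>Level 0 has the empty word as its only index. It is a copy of the complex numbers, its
  unit has norm at least 1, and the embedding into the limit is isometric.\<close>

lemma Q_nontrivial: "\<one>\<^bsub>Q\<^esub> \<noteq> \<zero>\<^bsub>Q\<^esub>"
proof
  assume *: "\<one>\<^bsub>Q\<^esub> = \<zero>\<^bsub>Q\<^esub>"
  have W0: "W 0 = {[]}" by (auto simp: words_def)
  have "vnorm (W 0) (mv (W 0) \<one>\<^bsub>T 0\<^esub> (\<lambda>_. 1)) \<le> nrm (T 0) \<one>\<^bsub>T 0\<^esub> * vnorm (W 0) (\<lambda>_. 1)"
    unfolding T_def by (rule vnorm_mv[OF fW])
  then have "1 \<le> nrm (T 0) \<one>\<^bsub>T 0\<^esub>" by (simp add: vnorm_def L2_set_def mv_def T_simps W0)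
  also have "\<dots> = nrm Q \<one>\<^bsub>Q\<^esub>" using level_nrm[of "\<one>\<^bsub>T 0\<^esub>" 0] by (simp add: level_one)
  finally show False using * by simp
qed

lemma rokhlin_regular: "rokhlin G (uhf (carrier G)) \<alpha> vv pp"
  unfolding uhf_eq
proof (intro rokhlin.intro crossed_pos.intro crossed.intro group_axioms Q_nstar)
  show "crossed_axioms G Q \<alpha>"
    by (rule crossed_axioms.intro)
      (simp_all add: fin Q_cstar Q_nontrivial Q_cs Q_lb alpha_closed alpha_add alpha_mult alpha_smult alpha_adj alpha_alpha alpha_one alpha_nrm Q_nrm_eq_0)
  show "crossed_pos_axioms G Q" by (rule crossed_pos_axioms.intro) (rule Q_positive[OF fin])
  show "rokhlin_axioms G Q \<alpha> vv pp"
  proof (rule rokhlin_axioms.intro)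
    fix I a
    assume "I \<subseteq> carrier Q" "norm_closed Q I" "\<And>x y. x \<in> I \<Longrightarrow> y \<in> I \<Longrightarrow> x \<oplus>\<^bsub>Q\<^esub> y \<in> I"
      "\<And>x y. x \<in> carrier Q \<Longrightarrow> y \<in> I \<Longrightarrow> x \<otimes>\<^bsub>Q\<^esub> y \<in> I" "\<And>x y. x \<in> carrier Q \<Longrightarrow> y \<in> I \<Longrightarrow> y \<otimes>\<^bsub>Q\<^esub> x \<in> I"
      "a \<in> I" "a \<noteq> \<zero>\<^bsub>Q\<^esub>"
    then show "\<one>\<^bsub>Q\<^esub> \<in> I" by (rule Q_simple)
  qed (simp_all add: vv_mult vv_one vv_adj alpha_vv nrm_vv Ad_vv_tendsto pp_mult pp_sum alpha_pp nrm_pp pp_central vv_closed pp_closed)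
qed

end

theorem corollary5p10:
  fixes G :: "'g monoid" and \<omega> :: "nat filter"
  defines "A \<equiv> uhf (carrier G)"
  defines "M \<equiv> crossed_product G A (regular_product_action G)"
  defines "Q \<equiv> cp_base G A"
  defines "F \<equiv> cp_expectation G A"
  assumes "group G" and "finite (carrier G)" and "\<not> comm_group G"
    and "free_ultrafilter \<omega>"
  shows "weak_tracial_rokhlin \<omega> M Q F \<and>
         \<not> (\<exists>(H :: 'h monoid) (D :: 'd cstar) \<beta> \<Phi>. iso_to_fixed_point_inclusion M Q F H D \<beta> \<Phi>)"
proof -
  have "regular_uhf G" using assms(5,6) by (simp add: regular_uhf_def regular_uhf_axioms_def)
  then interpret R: rokhlin G A "regular_product_action G" "regular_uhf.vv G" "regular_uhf.pp G"
    unfolding A_def by (rule regular_uhf.rokhlin_regular)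
  show ?thesis
    unfolding M_def Q_def F_def
    using R.M_weak_tracial_rokhlin[OF assms(8)] R.fixed_point_inclusion_comm_group assms(7) by blast
qed

end
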